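(* For each fixed integer $d\ge1$, the memoized evaluation of the aggregated recurrence for $\Phi$ together with the integer form of Burnside's formula (both given in the context) is an exact algorithm for $U_d(n)$ with running time $\exp(O_d(\sqrt n))$ and storage $\exp(O_d(\sqrt n))$, measured in bit operations and bits respectively. With a common cache over all partitions of $n$, the number of stored fixed-point values $\Phi(H)$ is at most $$|\mathcal{H}_d(n)|=\sum_{m=0}^{n}[x^m]\prod_{a\ge1}(1-x^a)^{-d}\le\exp\left(\pi\sqrt{\frac{2dn}{3}}\right)\qquad(n\ge1).$$
   Context: All graphs are finite, simple and undirected. $U_d(n)$ is the number of isomorphism classes of $d$-regular graphs on $n$ vertices (not necessarily connected). $O_d$ means that the implied constant may depend on $d$. For a partition $\lambda=(1^{m_1}2^{m_2}\cdots n^{m_n})$ of $n$, put $z_\lambda=\prod_{a=1}^n a^{m_a}m_a!$, and let $F_d(\lambda)$ be the number of $d$-regular graphs on the vertex set $\{1,\dots,n\}$ fixed by one permutation of cycle type $\lambda$. Integer form of Burnside's formula: $$U_d(n)=\frac{1}{n!}\sum_{\lambda\vdash n}\frac{n!}{z_\lambda}F_d(\lambda).$$ A normalized state is a finitely supported array $H=(H_{a,r})_{a\ge1,\,1\le r\le d}$ of nonnegative integers; $N(H)=\sum_{a,r}aH_{a,r}$; $\mathcal{H}_d(n)$ is the set of normalized states with $N(H)\le n$. A labeled realization of $H$ is a finite set $V$ with a permutation $\sigma$ and a function $\rho:V\to\{1,\dots,d\}$ constant on cycles of $\sigma$, with exactly $H_{a,r}$ cycles of length $a$ and value $r$. $\Phi(H)$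 is the number of $\sigma$-invariant sets $E$ of unordered pairs of distinct elements of $V$ such that each $v\in V$ lies in exactly $\rho(v)$ pairs of $E$ (this depends only on $H$); $\Phi(0)=1$. One has $F_d(\lambda)=\Phi(H^{\lambda,d})$, where $H^{\lambda,d}_{a,r}=m_a$ if $r=d$ and $0$ otherwise. Aggregated recurrence. For $H\ne0$ choose a pair $(a,r)$ with $H_{a,r}>0$ by a deterministic rule depending only on $H$ (for instance the lexicographically largest such pair). Let $P_a(x)=(1+x^2)^{\lfloor(a-1)/2\rfloor}(1+x)^{\varepsilon_a}$ with $\varepsilon_a=1$ for $a$ even and $0$ for $a$ odd, and $I_a(u)=[x^u]P_a(x)$. Let $h_{b,s}=H_{b,s}-1$ if $(b,s)=(a,r)$ and $h_{b,s}=H_{b,s}$ otherwise; $g_{ab}=\gcd(a,b)$, $\alpha_{ab}=b/g_{ab}$, $\beta_{ab}=a/g_{ab}$, $K_{a,r;b,s}=\min\{g_{ab},\lfloor r/\alpha_{ab}\rfloor,\lfloor s/\beta_{ab}\rfloor\}$. $\mathcal{A}(H,a,r,u)$ is the set of families $\nu=(\nu_{b,s,k})_{b\ge1,1\le s\le d,0\le k\le K_{a,r;b,s}}$ of nonnegative integers with $\sum_k\nu_{b,s,k}=h_{b,s}$ for all $(b,s)$ and $u+\sum_{b,s,k}k\alpha_{ab}\nu_{b,s,k}=r$. Let $W_{b,s}(\nu)=\frac{h_{b,s}!}{\prod_k\nu_{b,s,k}!}\prod_k\binom{g_{ab}}{k}^{\nu_{b,s,k}}$, and let $H^\nu_{b,t}$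 ($1\le t\le d$) be the sum of $\nu_{b,s,k}$ over all $(s,k)$ with $s-k\beta_{ab}=t$. Then $$\Phi(H)=\sum_{u=0}^{r}I_a(u)\sum_{\nu\in\mathcal{A}(H,a,r,u)}\Bigl(\prod_{b,s}W_{b,s}(\nu)\Bigr)\Phi(H^\nu).$$ The algorithm evaluates $\Phi(H^{\lambda,d})$ for every partition $\lambda$ of $n$ by this recurrence using exact integer arithmetic, storing each computed value $\Phi(H)$ in a cache (the common cache is shared by all partitions) and reusing it whenever the same $H$ recurs, and then evaluates the integer form of Burnside's formula. *)

theory Defs
  imports
    "HOL-Analysis.Analysis"
    "HOL-Combinatorics.Combinatorics"
    "HOL-Computational_Algebra.Formal_Power_Series"
    "HOL-Library.Log_Nat"
    "HOL-Library.Monad_Syntax"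
begin

section \<open>Regular graphs up to isomorphism\<close>

text \<open>A simple graph on the vertex set \<open>V\<close> is given by its set of edges.\<close>

definition all_pairs :: "'v set \<Rightarrow> 'v set set" where
  "all_pairs V = {e. e \<subseteq> V \<and> card e = 2}"

definition degree_in :: "'v set set \<Rightarrow> 'v \<Rightarrow> nat" where
  "degree_in E v = card {e \<in> E. v \<in> e}"

definition regular_graphs :: "nat \<Rightarrow> 'v set \<Rightarrow> 'v set set set" where
  "regular_graphs d V = {E. E \<subseteq> all_pairs V \<and> (\<forall>v\<in>V. degree_in E v = d)}"

definition graph_iso :: "'v set \<Rightarrow> 'v set set \<Rightarrow> 'v set set \<Rightarrow> bool" where
  "graph_iso V E E' \<longleftrightarrow> (\<exists>p. bij_betw p V V \<and> E' = (\<lambda>e. p ` e) ` E)"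

definition num_regular :: "nat \<Rightarrow> nat \<Rightarrow> nat" where
  "num_regular d n =
     card (regular_graphs d {1..n} //
       {(E, E'). E \<in> regular_graphs d {1..n} \<and> E' \<in> regular_graphs d {1..n}
                 \<and> graph_iso {1..n} E E'})"


section \<open>Normalized states and their fixed-point numbers\<close>

text \<open>A state \<open>H\<close> is a function of the pair \<open>(a, r)\<close>; a normalized state vanishes outside
  \<open>a \<ge> 1\<close>, \<open>1 \<le> r \<le> d\<close>.\<close>

type_synonym state = "nat \<times> nat \<Rightarrow> nat"

definition normalized :: "nat \<Rightarrow> state \<Rightarrow> bool" where
  "normalized d H \<longleftrightarrow>
     finite {p. H p \<noteq> 0} \<and> (\<forall>a r. H (a, r) \<noteq> 0 \<longrightarrow> 1 \<le> a \<and> 1 \<le> r \<and> r \<le> d)"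

definition state_size :: "state \<Rightarrow> nat" where
  "state_size H = (\<Sum>(a, r) \<in> {p. H p \<noteq> 0}. a * H (a, r))"

definition states :: "nat \<Rightarrow> nat \<Rightarrow> state set" where
  "states d n = {H. normalized d H \<and> state_size H \<le> n}"

definition realization ::
    "nat \<Rightarrow> state \<Rightarrow> 'v set \<Rightarrow> ('v \<Rightarrow> 'v) \<Rightarrow> ('v \<Rightarrow> nat) \<Rightarrow> bool" where
  "realization d H V \<sigma> \<rho> \<longleftrightarrow>
     finite V \<and> \<sigma> permutes V \<and> (\<forall>v\<in>V. 1 \<le> \<rho> v \<and> \<rho> v \<le> d) \<and>
     (\<forall>v\<in>V. \<forall>w\<in>orbit \<sigma> v. \<rho> w = \<rho> v) \<and>
     (\<forall>a r. card {C \<in> orbit \<sigma> ` V. card C = a \<and> (\<forall>v\<in>C. \<rho> v = r)} = H (a, r))"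

definition fixed_graphs :: "'v set \<Rightarrow> ('v \<Rightarrow> 'v) \<Rightarrow> ('v \<Rightarrow> nat) \<Rightarrow> 'v set set set" where
  "fixed_graphs V \<sigma> \<rho> =
     {E. E \<subseteq> all_pairs V \<and> (\<lambda>e. \<sigma> ` e) ` E = E \<and> (\<forall>v\<in>V. degree_in E v = \<rho> v)}"

text \<open>The number of fixed graphs is the same for all realizations of \<open>H\<close>, whence the definite
  description. Every finite set is in bijection with a set of natural numbers, so realizations on
  sets of naturals suffice.\<close>

definition Phi :: "nat \<Rightarrow> state \<Rightarrow> nat" where
  "Phi d H = (THE k. \<exists>(V :: nat set) \<sigma> \<rho>. realization d H V \<sigma> \<rho> \<and> k = card (fixed_graphs V \<sigma> \<rho>))"


section \<open>Bit complexity\<close>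

text \<open>\<open>bits x\<close> is the length of a prefix-free binary encoding of \<open>x\<close>. A number is
  written with a 1 in front of each of its binary digits and a final 0; a list with a 1 in front of
  each of its elements and a final 0; an optional value with a leading 0 or 1; a pair by
  concatenation.\<close>

class encodable =
  fixes bits :: "'a \<Rightarrow> nat"

instantiation nat :: encodable
begin
definition bits_nat :: "nat \<Rightarrow> nat" where
  "bits_nat x = 2 * floorlog 2 x + 1"
instance ..
end

instantiation bool :: encodable
begin
definition bits_bool :: "bool \<Rightarrow> nat" where
  "bits_bool x = 1"
instance ..
end

instantiation prod :: (encodable, encodable) encodable
begin
definition bits_prod :: "'a \<times> 'b \<Rightarrow> nat" where
  "bits_prod p = bits (fst p) + bits (snd p)"
instance ..
end

instantiation option :: (encodable) encodable
begin
definition bits_option :: "'a option \<Rightarrow> nat" where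
  "bits_option x = (case x of None \<Rightarrow> 1 | Some y \<Rightarrow> 1 + bits y)"
instance ..
end

instantiation list :: (encodable) encodable
begin
definition bits_list :: "'a list \<Rightarrow> nat" where
  "bits_list xs = 1 + (\<Sum>x\<leftarrow>xs. 1 + bits x)"
instance ..
end

text \<open>
  A computation consists of its result, the number of bit operations spent, and the number of
  bits of storage taken up. Storage is never released or overwritten: every value produced
  is written to fresh cells, so that \<open>storage\<close> counts all intermediate results and all cached data
  and bounds from above the number of cells in use at any moment.

  There are no pointers and no sharing. A basic operation reads its operands and writes its
  result bit by bit; multiplication and division are charged the product of the operand lengths
  (school methods). Taking apart the head of a list or decrementing a counter amounts to
  copying it (\<open>inspect\<close>), and \<open>ret\<close>, which assembles tuples, lists and optional values from
  values already computed, is charged for reading and writing all of the assembled value. Every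
  step costs at least one, which pays for branching and for passing on control.

  In the programs below, every arithmetic operation and every comparison is one of the operations
  ending in \<open>C\<close>; \<open>ret\<close> is applied to constructor terms over variables and literals only.
\<close>

datatype 'a cost = Cost (val: 'a) (bit_ops: nat) (storage: nat)

definition bind_cost :: "'a cost \<Rightarrow> ('a \<Rightarrow> 'b cost) \<Rightarrow> 'b cost" where
  "bind_cost m f =
     (case m of Cost x t s \<Rightarrow> (case f x of Cost y t' s' \<Rightarrow> Cost y (t + t') (s + s')))"

adhoc_overloading Monad_Syntax.bind \<rightleftharpoons> bind_cost

lemma bind_cost_cong [fundef_cong]:
  assumes "m = m'" and "f (val m') = f' (val m')"
  shows "bind_cost m f = bind_cost m' f'"
  using assms by (cases m') (simp add: bind_cost_def)

definition emit :: "nat \<Rightarrow> 'a::encodable \<Rightarrow> 'a cost" where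
  "emit t x = Cost x (1 + t + bits x) (bits x)"

definition ret :: "'a::encodable \<Rightarrow> 'a cost" where
  "ret x = emit (bits x) x"

definition inspect :: "'a::encodable \<Rightarrow> unit cost" where
  "inspect x = Cost () (1 + 2 * bits x) (bits x)"

definition addC :: "nat \<Rightarrow> nat \<Rightarrow> nat cost" where
  "addC x y = emit (bits x + bits y) (x + y)"

definition subC :: "nat \<Rightarrow> nat \<Rightarrow> nat cost" where
  "subC x y = emit (bits x + bits y) (x - y)"

definition mulC :: "nat \<Rightarrow> nat \<Rightarrow> nat cost" where
  "mulC x y = emit (bits x * bits y) (x * y)"

definition divC :: "nat \<Rightarrow> nat \<Rightarrow> nat cost" where
  "divC x y = emit (bits x * bits y) (x div y)"

definition modC :: "nat \<Rightarrow> nat \<Rightarrow> nat cost" where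
  "modC x y = emit (bits x * bits y) (x mod y)"

definition leC :: "nat \<Rightarrow> nat \<Rightarrow> bool cost" where
  "leC x y = emit (bits x + bits y) (x \<le> y)"

definition eqC :: "'a::encodable \<Rightarrow> 'a \<Rightarrow> bool cost" where
  "eqC x y = emit (bits x + bits y) (x = y)"

definition appC :: "'a::encodable list \<Rightarrow> 'a list \<Rightarrow> 'a list cost" where
  "appC xs ys = emit (bits xs + bits ys) (xs @ ys)"

primrec mapC :: "('a::encodable \<Rightarrow> 'b::encodable cost) \<Rightarrow> 'a list \<Rightarrow> 'b list cost" where
  "mapC f [] = ret []"
| "mapC f (x # xs) = do {
     inspect (x # xs);
     y \<leftarrow> f x;
     ys \<leftarrow> mapC f xs;
     ret (y # ys) }"

primrec foldC ::
    "('a::encodable \<Rightarrow> 'b::encodable \<Rightarrow> 'b cost) \<Rightarrow> 'a list \<Rightarrow> 'b \<Rightarrow> 'b cost" where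
  "foldC f [] s = ret s"
| "foldC f (x # xs) s = do {
     inspect (x # xs);
     s' \<leftarrow> f x s;
     foldC f xs s' }"


section \<open>The algorithm\<close>

text \<open>\<open>countC i m\<close> lists the \<open>m\<close> numbers \<open>i, i + 1, \<dots>, i + m - 1\<close>.\<close>

primrec countC' :: "nat \<Rightarrow> nat \<Rightarrow> nat list cost" where
  "countC' 0 i = ret []"
| "countC' (Suc m) i = do {
     inspect (Suc m);
     j \<leftarrow> addC i 1;
     js \<leftarrow> countC' m j;
     ret (i # js) }"

definition countC :: "nat \<Rightarrow> nat \<Rightarrow> nat list cost" where
  "countC i m = countC' m i"

text \<open>The list \<open>0, \<dots>, m\<close>.\<close>

definition uptoC :: "nat \<Rightarrow> nat list cost" where
  "uptoC m = do { m1 \<leftarrow> addC m 1; countC 0 m1 }"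

definition sumC :: "nat list \<Rightarrow> nat cost" where
  "sumC xs = foldC addC xs 0"

definition prodC :: "nat list \<Rightarrow> nat cost" where
  "prodC xs = foldC mulC xs 1"

definition minC :: "nat \<Rightarrow> nat \<Rightarrow> nat cost" where
  "minC x y = do { c \<leftarrow> leC x y; if c then ret x else ret y }"

definition factC :: "nat \<Rightarrow> nat cost" where
  "factC m = do { ks \<leftarrow> countC 1 m; prodC ks }"

definition powC :: "nat \<Rightarrow> nat \<Rightarrow> nat cost" where
  "powC x e = do { ks \<leftarrow> countC 1 e; foldC (\<lambda>_ acc. mulC x acc) ks 1 }"

definition binomC :: "nat \<Rightarrow> nat \<Rightarrow> nat cost" where
  "binomC m k = do {
     c \<leftarrow> leC k m;
     if c then do {
       l \<leftarrow> subC m k;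
       mf \<leftarrow> factC m;
       kf \<leftarrow> factC k;
       lf \<leftarrow> factC l;
       q \<leftarrow> mulC kf lf;
       divC mf q }
     else ret 0 }"

function gcdC :: "nat \<Rightarrow> nat \<Rightarrow> nat cost" where
  "gcdC x y = do {
     c \<leftarrow> eqC y 0;
     if c then ret x else do { z \<leftarrow> modC x y; gcdC y z } }"
  by pat_completeness auto
termination
  by (relation "Wellfounded.measure snd") (auto simp: eqC_def modC_def emit_def)

declare gcdC.simps [simp del]

definition alphaC :: "nat \<Rightarrow> nat \<Rightarrow> nat cost" where
  "alphaC a b = do { g \<leftarrow> gcdC a b; divC b g }"

definition betaC :: "nat \<Rightarrow> nat \<Rightarrow> nat cost" where
  "betaC a b = do { g \<leftarrow> gcdC a b; divC a g }"

definition maxkC :: "nat \<Rightarrow> nat \<Rightarrow> nat \<Rightarrow> nat \<Rightarrow> nat cost" where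
  "maxkC a r b s = do {
     g \<leftarrow> gcdC a b;
     \<alpha> \<leftarrow> alphaC a b;
     \<beta> \<leftarrow> betaC a b;
     x \<leftarrow> divC r \<alpha>;
     y \<leftarrow> divC s \<beta>;
     m \<leftarrow> minC x y;
     minC g m }"

text \<open>\<open>innerC a u\<close> is \<open>I\<^sub>a(u)\<close>, the coefficient of \<open>x\<^sup>u\<close> in \<open>(1 + x\<^sup>2)\<^sup>m\<close> for odd \<open>a\<close> and in
  \<open>(1 + x\<^sup>2)\<^sup>m (1 + x)\<close> for even \<open>a\<close>, where \<open>m = (a - 1) div 2\<close>: it is \<open>m choose (u div 2)\<close>, except
  that it vanishes when \<open>a\<close> and \<open>u\<close> are both odd.\<close>

definition innerC :: "nat \<Rightarrow> nat \<Rightarrow> nat cost" where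
  "innerC a u = do {
     a1 \<leftarrow> subC a 1;
     m \<leftarrow> divC a1 2;
     v \<leftarrow> divC u 2;
     i \<leftarrow> modC a 2;
     j \<leftarrow> modC u 2;
     p \<leftarrow> mulC i j;
     c \<leftarrow> eqC p 1;
     if c then ret 0 else binomC m v }"

text \<open>Inside the algorithm, a state is the list of all entries \<open>((b, s), h)\<close> with
  \<open>1 \<le> b \<le> n\<close>, \<open>1 \<le> s \<le> d\<close>, zero entries included, in increasing lexicographic order of \<open>(b, s)\<close>.
  A family \<open>\<nu>\<close> is the list, in the same order, of the entries
  \<open>((b, s), [(0, \<nu>\<^sub>b\<^sub>s\<^sub>0), (1, \<nu>\<^sub>b\<^sub>s\<^sub>1), \<dots>])\<close>. The cache is an association list.\<close>

type_synonym table = "((nat \<times> nat) \<times> nat) list"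
type_synonym family = "((nat \<times> nat) \<times> (nat \<times> nat) list) list"
type_synonym cache = "(table \<times> nat) list"

definition state_of :: "table \<Rightarrow> state" where
  "state_of T p = (case map_of T p of None \<Rightarrow> 0 | Some h \<Rightarrow> h)"

text \<open>The lexicographically largest \<open>(a, r)\<close> with a nonzero entry, \<open>None\<close> for the zero state.\<close>

definition pickC :: "table \<Rightarrow> (nat \<times> nat) option cost" where
  "pickC T = foldC (\<lambda>(p, h) acc. do {
     c \<leftarrow> eqC h 0;
     if c then ret acc else ret (Some p) }) T None"

text \<open>The table of the numbers \<open>h\<^sub>b\<^sub>s\<close>.\<close>

definition removeC :: "nat \<times> nat \<Rightarrow> table \<Rightarrow> table cost" where
  "removeC q T = mapC (\<lambda>(p, h). do {
     c \<leftarrow> eqC p q;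
     if c then do { h' \<leftarrow> subC h 1; ret (p, h') } else ret (p, h) }) T"

text \<open>All ways to choose \<open>\<nu>\<^sub>k\<close> for \<open>k\<close> in the list such that \<open>\<Sum> \<nu>\<^sub>k = h\<close> and
  \<open>\<Sum> k \<alpha> \<nu>\<^sub>k \<le> B\<close>, each together with \<open>B - \<Sum> k \<alpha> \<nu>\<^sub>k\<close>.\<close>

primrec splitsC ::
    "nat list \<Rightarrow> nat \<Rightarrow> nat \<Rightarrow> nat \<Rightarrow> ((nat \<times> nat) list \<times> nat) list cost" where
  "splitsC [] \<alpha> h B = do {
     c \<leftarrow> eqC h 0;
     if c then ret [([], B)] else ret [] }"
| "splitsC (k # ks) \<alpha> h B = do {
     inspect (k # ks);
     js \<leftarrow> uptoC h;
     foldC (\<lambda>j acc. do {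
       w \<leftarrow> mulC k \<alpha>;
       x \<leftarrow> mulC w j;
       c \<leftarrow> leC x B;
       if c then do {
         h' \<leftarrow> subC h j;
         B' \<leftarrow> subC B x;
         sols \<leftarrow> splitsC ks \<alpha> h' B';
         ext \<leftarrow> mapC (\<lambda>(f, B''). ret ((k, j) # f, B'')) sols;
         appC acc ext }
       else ret acc }) js [] }"

text \<open>The families in \<open>\<A>(H, a, r, r - B)\<close>, where the table lists the \<open>h\<^sub>b\<^sub>s\<close>.\<close>

primrec familiesC :: "table \<Rightarrow> nat \<Rightarrow> nat \<Rightarrow> nat \<Rightarrow> family list cost" where
  "familiesC [] a r B = do {
     c \<leftarrow> eqC B 0;
     if c then ret [[]] else ret [] }"
| "familiesC (e # T) a r B = do {
     inspect (e # T);
     (case e of ((b, s), h) \<Rightarrow> do {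
       \<alpha> \<leftarrow> alphaC a b;
       K \<leftarrow> maxkC a r b s;
       ks \<leftarrow> uptoC K;
       sols \<leftarrow> splitsC ks \<alpha> h B;
       foldC (\<lambda>(f, B') acc. do {
         \<nu>s \<leftarrow> familiesC T a r B';
         ext \<leftarrow> mapC (\<lambda>\<nu>. ret (((b, s), f) # \<nu>)) \<nu>s;
         appC acc ext }) sols [] }) }"

text \<open>The weight \<open>\<Prod>\<^sub>b\<^sub>s W\<^sub>b\<^sub>s(\<nu>)\<close>, with \<open>h\<^sub>b\<^sub>s\<close> recovered as \<open>\<Sum>\<^sub>k \<nu>\<^sub>b\<^sub>s\<^sub>k\<close>.\<close>

definition weightC :: "nat \<Rightarrow> family \<Rightarrow> nat cost" where
  "weightC a \<nu> = foldC (\<lambda>((b, s), f) acc. do {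
     js \<leftarrow> mapC (\<lambda>(k, j). ret j) f;
     h \<leftarrow> sumC js;
     hf \<leftarrow> factC h;
     jfs \<leftarrow> mapC factC js;
     den \<leftarrow> prodC jfs;
     q \<leftarrow> divC hf den;
     g \<leftarrow> gcdC a b;
     xs \<leftarrow> mapC (\<lambda>(k, j). do { x \<leftarrow> binomC g k; powC x j }) f;
     x \<leftarrow> prodC xs;
     W \<leftarrow> mulC q x;
     mulC acc W }) \<nu> 1"

text \<open>The state \<open>H\<^sup>\<nu>\<close>: the entry at \<open>(b, t)\<close> is the sum of all \<open>\<nu>\<^sub>b\<^sub>s\<^sub>k\<close> with
  \<open>s = t + k \<beta>\<^sub>a\<^sub>b\<close>.\<close>

definition nextC :: "nat \<Rightarrow> family \<Rightarrow> table cost" where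
  "nextC a \<nu> = mapC (\<lambda>((b, t), _). do {
     \<beta> \<leftarrow> betaC a b;
     x \<leftarrow> foldC (\<lambda>((b', s), f) acc.
       foldC (\<lambda>(k, j) acc. do {
         kb \<leftarrow> mulC k \<beta>;
         s' \<leftarrow> addC t kb;
         c \<leftarrow> eqC (b', s) (b, s');
         if c then addC acc j else ret acc }) f acc) \<nu> 0;
     ret ((b, t), x) }) \<nu>"

text \<open>The right-hand side of the recurrence: all pairs of a coefficient \<open>I\<^sub>a(u) \<Prod> W\<^sub>b\<^sub>s(\<nu>)\<close> and
  a state \<open>H\<^sup>\<nu>\<close>, for \<open>0 \<le> u \<le> r\<close> and \<open>\<nu> \<in> \<A>(H, a, r, u)\<close>.\<close>

definition termsC :: "table \<Rightarrow> nat \<Rightarrow> nat \<Rightarrow> (nat \<times> table) list cost" where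
  "termsC T a r = do {
     T' \<leftarrow> removeC (a, r) T;
     us \<leftarrow> uptoC r;
     foldC (\<lambda>u acc. do {
       i \<leftarrow> innerC a u;
       B \<leftarrow> subC r u;
       \<nu>s \<leftarrow> familiesC T' a r B;
       ext \<leftarrow> mapC (\<lambda>\<nu>. do {
         w \<leftarrow> weightC a \<nu>;
         c \<leftarrow> mulC i w;
         H \<leftarrow> nextC a \<nu>;
         ret (c, H) }) \<nu>s;
       appC acc ext }) us [] }"

primrec lookupC :: "cache \<Rightarrow> table \<Rightarrow> nat option cost" where
  "lookupC [] T = ret None"
| "lookupC (e # C) T = do {
     inspect (e # C);
     (case e of (T', v) \<Rightarrow> do {
       c \<leftarrow> eqC T' T;
       if c then ret (Some v) else lookupC C T }) }"

text \<open>Memoized evaluation of the recurrence, returning the value and the updated cache. The first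
  argument bounds the depth of the recursion. Each recursive call is made on a state with at
  least one cycle less, so depth \<open>n + 1\<close> suffices for all states of size at most \<open>n\<close> and the first
  equation is never reached in \<open>regular_countC\<close>.\<close>

primrec phiC :: "nat \<Rightarrow> table \<Rightarrow> cache \<Rightarrow> (nat \<times> cache) cost" where
  "phiC 0 T C = ret (0, C)"
| "phiC (Suc l) T C = do {
     inspect (Suc l);
     known \<leftarrow> lookupC C T;
     (case known of
        Some v \<Rightarrow> ret (v, C)
      | None \<Rightarrow> do {
          p \<leftarrow> pickC T;
          (case p of
             None \<Rightarrow> ret (1, (T, 1) # C)
           | Some (a, r) \<Rightarrow> do {
               ts \<leftarrow> termsC T a r;
               (v, C') \<leftarrow> foldC (\<lambda>(c, T') (acc, C). do {
                 (v, C') \<leftarrow> phiC l T' C;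
                 x \<leftarrow> mulC c v;
                 acc' \<leftarrow> addC acc x;
                 ret (acc', C') }) ts (0, C);
               ret (v, (T, v) # C') }) }) }"

text \<open>All lists \<open>[(a, m\<^sub>a), \<dots>]\<close>, \<open>a\<close> running through the given list, with \<open>\<Sum> a m\<^sub>a = B\<close>.\<close>

primrec partitionsC :: "nat list \<Rightarrow> nat \<Rightarrow> (nat \<times> nat) list list cost" where
  "partitionsC [] B = do {
     c \<leftarrow> eqC B 0;
     if c then ret [[]] else ret [] }"
| "partitionsC (a # as) B = do {
     inspect (a # as);
     q \<leftarrow> divC B a;
     ms \<leftarrow> uptoC q;
     foldC (\<lambda>m acc. do {
       x \<leftarrow> mulC a m;
       B' \<leftarrow> subC B x;
       \<mu>s \<leftarrow> partitionsC as B';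
       ext \<leftarrow> mapC (\<lambda>\<mu>. ret ((a, m) # \<mu>)) \<mu>s;
       appC acc ext }) ms [] }"

definition zC :: "(nat \<times> nat) list \<Rightarrow> nat cost" where
  "zC \<mu> = foldC (\<lambda>(a, m) acc. do {
     x \<leftarrow> powC a m;
     y \<leftarrow> factC m;
     z \<leftarrow> mulC x y;
     mulC acc z }) \<mu> 1"

text \<open>The state \<open>H\<^sup>\<lambda>\<^sup>,\<^sup>d\<close>.\<close>

definition initC :: "nat \<Rightarrow> (nat \<times> nat) list \<Rightarrow> table cost" where
  "initC d \<mu> = do {
     rs \<leftarrow> countC 1 d;
     foldC (\<lambda>(a, m) acc. do {
       row \<leftarrow> mapC (\<lambda>r. do {
         c \<leftarrow> eqC r d;
         if c then ret ((a, r), m) else ret ((a, r), 0) }) rs;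
       appC acc row }) \<mu> [] }"

text \<open>The integer form of Burnside's formula. The result contains the final contents of the cache,
  which is shared by all partitions and never loses an entry.\<close>

definition regular_countC :: "nat \<Rightarrow> nat \<Rightarrow> (nat \<times> cache) cost" where
  "regular_countC d n = do {
     as \<leftarrow> countC 1 n;
     \<mu>s \<leftarrow> partitionsC as n;
     nf \<leftarrow> factC n;
     l \<leftarrow> addC n 1;
     (S, C) \<leftarrow> foldC (\<lambda>\<mu> (acc, C). do {
       z \<leftarrow> zC \<mu>;
       q \<leftarrow> divC nf z;
       H \<leftarrow> initC d \<mu>;
       (v, C') \<leftarrow> phiC l H C;
       x \<leftarrow> mulC q v;
       acc' \<leftarrow> addC acc x;
       ret (acc', C') }) \<mu>s (0, []);
     U \<leftarrow> divC S nf;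
     ret (U, C) }"

end

theory Submission
  imports Defs
begin

text \<open>
  Proof idea. Fix a realization \<open>(V, \<sigma>, \<rho>)\<close> of \<open>H\<close> and delete one cycle \<open>O\<close> of length \<open>a\<close> and
  degree \<open>r\<close>. A \<open>\<sigma>\<close>-invariant edge set decomposes into the pairs inside \<open>O\<close>, the pairs between
  \<open>O\<close> and each other cycle, and the rest; each of these families of pairs splits into \<open>\<sigma>\<close>-orbits of
  known degree contribution. Grouping the other cycles by length, degree and number of chosen
  orbits gives the aggregated recurrence, hence correctness of the memoized evaluation, and
  Burnside's lemma turns the fixed-point numbers into \<open>U\<^sub>d(n)\<close>.

  Every cached key is a state of size at most \<open>n\<close>, and the number of states is estimated by
  its generating function at \<open>x = e\<^sup>-\<^sup>t\<close>. For the running time let \<open>z = n + d + 100 + |\<H>\<^sub>d(n)|\<close>.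
  A family of \<open>\<A>(H, a, r, u)\<close> picks at most \<open>d + 1\<close> numbers between \<open>0\<close> and \<open>h\<^sub>b\<^sub>s\<close> for each
  \<open>(b, s)\<close>, and \<open>\<Prod> (h\<^sub>b\<^sub>s + 1)\<close> counts states below \<open>H\<close>, so there are at most \<open>z\<^sup>d\<^sup>+\<^sup>1\<close> families.
  Thus each new cache entry costs \<open>z\<^bsup>O(d)\<^esup>\<close> bit operations and there are at most \<open>z\<close> of them;
  since \<open>z\<close> is \<open>exp (O(\<surd>n))\<close>, so is the total.
\<close>

section \<open>Values and storage of the programs\<close>

text \<open>Four obstacles shape the proof. \<open>Phi\<close> is a definite description, so it has
  no usable value before its independence of the realization is known, and that independence comes
  from the recurrence itself. The recurrence is therefore proved for an arbitrary function
  \<open>G\<close> that is correct on smaller realizations. Next, deleting a cycle leaves vertices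
  whose residual degree may be 0, whereas states forbid degree 0; the induction over the other
  cycles works with unrestricted residual degrees and discards the zeros only at its end. Then,
  bounding every call of the memoized evaluation separately would count the work below a state once
  per visit; a potential proportional to the length of the cache charges it once. Finally, a table
  has \<open>n * d\<close> entries, so an estimate that raises the exponent of \<open>z\<close> at
  each entry would be useless; the cost of an enumeration is kept linear in a multiplicative bound
  for the number of enumerated objects. Storage needs no estimate of its own, because every step is
  charged at least for what it writes.\<close>

lemma bind_cost_sel [simp]:
  "val (bind_cost m f) = val (f (val m))"
  "bit_ops (bind_cost m f) = bit_ops m + bit_ops (f (val m))"
  "storage (bind_cost m f) = storage m + storage (f (val m))"
  by (cases m; cases "f (val m)"; simp add: bind_cost_def)+

lemma emit_sel [simp]:
  "val (emit t x) = x" "bit_ops (emit t x) = 1 + t + bits x" "storage (emit t x) = bits x"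
  by (simp_all add: emit_def)

lemma ret_sel [simp]:
  "val (ret x) = x" "bit_ops (ret x) = 1 + 2 * bits x" "storage (ret x) = bits x"
  by (simp_all add: ret_def)

lemma inspect_sel [simp]:
  "val (inspect x) = ()" "bit_ops (inspect x) = 1 + 2 * bits x" "storage (inspect x) = bits x"
  by (simp_all add: inspect_def)

lemma val_case_prod [simp]: "val (case p of (a, b) \<Rightarrow> f a b) = (case p of (a, b) \<Rightarrow> val (f a b))"
  by (cases p) simp

lemma val_if [simp]: "val (if c then x else y) = (if c then val x else val y)"
  by simp

lemma val_arith [simp]:
  "val (addC x y) = x + y" "val (subC x y) = x - y" "val (mulC x y) = x * y"
  "val (divC x y) = x div y" "val (modC x y) = x mod y" "val (leC x y) = (x \<le> y)"
  by (simp_all add: addC_def subC_def mulC_def divC_def modC_def leC_def)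

lemma val_eqC [simp]: "val (eqC u v) = (u = v)"
  by (simp add: eqC_def)

lemma val_appC [simp]: "val (appC xs ys) = xs @ ys"
  by (simp add: appC_def)

lemma val_mapC [simp]: "val (mapC f xs) = map (\<lambda>x. val (f x)) xs"
  by (induction xs) auto

lemma val_foldC [simp]: "val (foldC f xs s) = fold (\<lambda>x s. val (f x s)) xs s"
  by (induction xs arbitrary: s) auto

lemma val_countC' : "val (countC' m i) = [i..<i + m]"
  by (induction m arbitrary: i) (auto simp: upt_rec)

lemma val_countC [simp]: "val (countC i m) = [i..<i + m]"
  by (simp add: countC_def val_countC')

lemma val_uptoC [simp]: "val (uptoC m) = [0..<Suc m]"
  by (simp add: uptoC_def)

lemma fold_plus_sum_list: "fold (\<lambda>x s. x + s) xs s = sum_list xs + (s :: nat)"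
  by (induction xs arbitrary: s) auto

lemma fold_times_prod_list: "fold (\<lambda>x s. x * s) xs s = prod_list xs * (s :: nat)"
  by (induction xs arbitrary: s) auto

lemma val_sumC [simp]: "val (sumC xs) = sum_list xs"
  by (simp add: sumC_def fold_plus_sum_list)

lemma val_prodC [simp]: "val (prodC xs) = prod_list xs"
  by (simp add: prodC_def fold_times_prod_list)

lemma val_minC [simp]: "val (minC x y) = min x y"
  by (simp add: minC_def min_def)

lemma val_factC [simp]: "val (factC m) = fact m"
proof -
  have "prod_list [1..<Suc m] = fact m"
    by (induction m) auto
  then show ?thesis
    by (simp add: factC_def)
qed

lemma val_powC [simp]: "val (powC x e) = x ^ e"
proof -
  have "fold (\<lambda>_ acc. x * acc) ks s = x ^ length ks * s" for ks :: "nat list" and s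
    by (induction ks arbitrary: s) auto
  then show ?thesis
    by (simp add: powC_def del: upt_Suc)
qed

lemma val_binomC [simp]: "val (binomC m k) = m choose k"
  by (simp add: binomC_def binomial_fact' binomial_eq_0)

lemma val_gcdC [simp]: "val (gcdC x y) = gcd x y"
  by (induction x y rule: gcdC.induct) (subst gcdC.simps, simp add: gcd_red_nat[symmetric])

lemma val_alphaC [simp]: "val (alphaC a b) = b div gcd a b"
  by (simp add: alphaC_def)

lemma val_betaC [simp]: "val (betaC a b) = a div gcd a b"
  by (simp add: betaC_def)

lemma val_maxkC [simp]:
  "val (maxkC a r b s) = min (gcd a b) (min (r div (b div gcd a b)) (s div (a div gcd a b)))"
  by (simp add: maxkC_def)

lemma val_innerC [simp]:
  "val (innerC a u) = (if odd a \<and> odd u then 0 else (a - 1) div 2 choose (u div 2))"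
  by (auto simp: innerC_def odd_iff_mod_2_eq_one)

text \<open>Writing a result is part of the charge for producing it, so no primitive stores more
  bits than it spends operations. The inequality survives sequencing and branching; hence the bound
  on the running time is also the bound on storage.\<close>

lemma storage_le_emit_ops [simp]:
  "storage (addC x y) \<le> bit_ops (addC x y)" "storage (subC x y) \<le> bit_ops (subC x y)"
  "storage (mulC x y) \<le> bit_ops (mulC x y)" "storage (divC x y) \<le> bit_ops (divC x y)"
  "storage (modC x y) \<le> bit_ops (modC x y)" "storage (leC x y) \<le> bit_ops (leC x y)"
  "storage (eqC u v) \<le> bit_ops (eqC u v)" "storage (appC xs ys) \<le> bit_ops (appC xs ys)"
  "storage (ret w) \<le> bit_ops (ret w)" "storage (inspect w) \<le> bit_ops (inspect w)"
  by (simp_all add: addC_def subC_def mulC_def divC_def modC_def leC_def eqC_def appC_def)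

lemma storage_le_bind [intro]:
  assumes "storage m \<le> bit_ops m" "\<And>x. storage (f x) \<le> bit_ops (f x)"
  shows "storage (bind_cost m f) \<le> bit_ops (bind_cost m f)"
  using assms by (simp add: add_mono)

lemma storage_le_if:
  assumes "storage x \<le> bit_ops x" "storage y \<le> bit_ops y"
  shows "storage (if c then x else y) \<le> bit_ops (if c then x else y)"
  using assms by simp

lemma storage_le_case_prod:
  assumes "\<And>a b. storage (f a b) \<le> bit_ops (f a b)"
  shows "storage (case p of (a, b) \<Rightarrow> f a b) \<le> bit_ops (case p of (a, b) \<Rightarrow> f a b)"
  using assms by (cases p) simp

text \<open>Loop bodies take their element apart and are then applied to the accumulator. A nested
  pattern leaves the inner case distinction with two further arguments, which is the next
  variant.\<close>

lemma storage_le_case_prod2: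
  assumes "\<And>a b. storage (f a b c) \<le> bit_ops (f a b c)"
  shows "storage ((case p of (a, b) \<Rightarrow> f a b) c) \<le> bit_ops ((case p of (a, b) \<Rightarrow> f a b) c)"
  using assms by (cases p) simp

lemma storage_le_case_prod3:
  assumes "\<And>a b. storage (f a b c e) \<le> bit_ops (f a b c e)"
  shows "storage ((case p of (a, b) \<Rightarrow> f a b) c e) \<le> bit_ops ((case p of (a, b) \<Rightarrow> f a b) c e)"
  using assms by (cases p) simp

lemma storage_le_case_option:
  assumes "storage x \<le> bit_ops x" "\<And>a. storage (f a) \<le> bit_ops (f a)"
  shows "storage (case p of None \<Rightarrow> x | Some a \<Rightarrow> f a) \<le> bit_ops (case p of None \<Rightarrow> x | Some a \<Rightarrow> f a)"
  using assms by (cases p) auto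

lemma storage_le_mapC:
  assumes "\<And>x. storage (f x) \<le> bit_ops (f x)"
  shows "storage (mapC f xs) \<le> bit_ops (mapC f xs)"
proof (induction xs)
  case Nil
  show ?case by simp
next
  case (Cons x xs)
  show ?case unfolding mapC.simps by (intro storage_le_bind Cons assms storage_le_emit_ops)
qed

lemma storage_le_foldC:
  assumes "\<And>x s. storage (f x s) \<le> bit_ops (f x s)"
  shows "storage (foldC f xs s) \<le> bit_ops (foldC f xs s)"
proof (induction xs arbitrary: s)
  case Nil
  show ?case by simp
next
  case (Cons x xs)
  show ?case unfolding foldC.simps by (intro storage_le_bind Cons assms storage_le_emit_ops)
qed

lemmas storage_le_intros = storage_le_bind storage_le_if storage_le_case_prod
  storage_le_case_prod2 storage_le_case_prod3 storage_le_case_option storage_le_mapC storage_le_foldC storage_le_emit_ops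

lemma storage_le_countC: "storage (countC i m) \<le> bit_ops (countC i m)"
proof -
  have "storage (countC' m i) \<le> bit_ops (countC' m i)"
  proof (induction m arbitrary: i)
    case 0
    show ?case by simp
  next
    case (Suc m)
    show ?case unfolding countC'.simps by (intro storage_le_intros Suc)
  qed
  then show ?thesis by (simp add: countC_def)
qed

lemma storage_le_gcdC: "storage (gcdC x y) \<le> bit_ops (gcdC x y)"
proof (induction x y rule: gcdC.induct)
  case (1 x y)
  then show ?case
    by (subst (1 2) gcdC.simps) (auto simp: eqC_def modC_def intro!: add_mono)
qed

lemma storage_le_arith:
  "storage (uptoC m) \<le> bit_ops (uptoC m)" "storage (sumC xs) \<le> bit_ops (sumC xs)"
  "storage (prodC xs) \<le> bit_ops (prodC xs)" "storage (minC m k) \<le> bit_ops (minC m k)"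
  "storage (factC m) \<le> bit_ops (factC m)" "storage (powC m k) \<le> bit_ops (powC m k)"
  unfolding uptoC_def sumC_def prodC_def minC_def factC_def powC_def
  by (intro storage_le_intros storage_le_countC)+

lemma storage_le_arith2:
  "storage (binomC m k) \<le> bit_ops (binomC m k)"
  "storage (alphaC a b) \<le> bit_ops (alphaC a b)" "storage (betaC a b) \<le> bit_ops (betaC a b)"
  unfolding binomC_def alphaC_def betaC_def
  by (intro storage_le_intros storage_le_gcdC storage_le_arith)+

lemma storage_le_arith3:
  "storage (maxkC a r b s) \<le> bit_ops (maxkC a r b s)"
  "storage (innerC a u) \<le> bit_ops (innerC a u)"
  unfolding maxkC_def innerC_def
  by (intro storage_le_intros storage_le_gcdC storage_le_arith storage_le_arith2)+

lemma storage_le_splitsC: "storage (splitsC ks \<alpha> h B) \<le> bit_ops (splitsC ks \<alpha> h B)"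
proof (induction ks arbitrary: h B)
  case Nil
  show ?case unfolding splitsC.simps by (intro storage_le_intros)
next
  case (Cons k ks)
  show ?case unfolding splitsC.simps by (intro storage_le_intros Cons storage_le_arith)
qed

lemma storage_le_familiesC: "storage (familiesC T a r B) \<le> bit_ops (familiesC T a r B)"
proof (induction T arbitrary: B)
  case Nil
  show ?case unfolding familiesC.simps by (intro storage_le_intros)
next
  case (Cons e T)
  show ?case unfolding familiesC.simps
    by (intro storage_le_intros Cons storage_le_arith storage_le_arith2 storage_le_arith3
        storage_le_splitsC)
qed

lemma storage_le_termsC: "storage (termsC T a r) \<le> bit_ops (termsC T a r)"
  unfolding termsC_def removeC_def weightC_def nextC_def
  by (intro storage_le_intros storage_le_arith storage_le_arith2 storage_le_arith3
      storage_le_familiesC storage_le_gcdC)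

lemma storage_le_lookupC: "storage (lookupC C T) \<le> bit_ops (lookupC C T)"
proof (induction C)
  case Nil
  show ?case unfolding lookupC.simps by (intro storage_le_intros)
next
  case (Cons e C)
  show ?case unfolding lookupC.simps by (intro storage_le_intros Cons)
qed

lemma storage_le_phiC: "storage (phiC l T C) \<le> bit_ops (phiC l T C)"
proof (induction l arbitrary: T C)
  case 0
  show ?case unfolding phiC.simps by (intro storage_le_intros)
next
  case (Suc l)
  show ?case unfolding phiC.simps pickC_def
    by (intro storage_le_intros Suc storage_le_lookupC storage_le_termsC)
qed

lemma storage_le_partitionsC: "storage (partitionsC as B) \<le> bit_ops (partitionsC as B)"
proof (induction as arbitrary: B)
  case Nil
  show ?case unfolding partitionsC.simps by (intro storage_le_intros)
next
  case (Cons a as)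
  show ?case unfolding partitionsC.simps by (intro storage_le_intros Cons storage_le_arith)
qed

theorem storage_le_regular_countC: "storage (regular_countC d n) \<le> bit_ops (regular_countC d n)"
  unfolding regular_countC_def zC_def initC_def
  by (intro storage_le_intros storage_le_countC storage_le_partitionsC storage_le_arith
      storage_le_phiC)

section \<open>Invariant edge sets and the aggregated recurrence\<close>

text \<open>Used with a set of orbits for \<open>Q\<close>: a choice of orbits matters only through
  how many are chosen, and this is where the binomial coefficients of the recurrence come
  from.\<close>

lemma sum_Pow_card:
  fixes f :: "nat \<Rightarrow> nat"
  assumes "finite Q"
  shows "(\<Sum>Q'\<in>Pow Q. f (card Q')) = (\<Sum>k\<le>card Q. (card Q choose k) * f k)"
proof -
  have "(\<Sum>Q'\<in>Pow Q. f (card Q')) = (\<Sum>k\<le>card Q. \<Sum>Q'\<in>{Q'\<in>Pow Q. card Q' = k}. f (card Q'))"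
    by (rule sum.group[symmetric]) (use assms in \<open>auto intro: card_mono\<close>)
  also have "\<dots> = (\<Sum>k\<le>card Q. (card Q choose k) * f k)"
  proof (rule sum.cong[OF refl])
    fix k
    have "(\<Sum>Q'\<in>{Q'\<in>Pow Q. card Q' = k}. f (card Q')) = card {Q'. Q' \<subseteq> Q \<and> card Q' = k} * f k"
      by simp
    then show "(\<Sum>Q'\<in>{Q'\<in>Pow Q. card Q' = k}. f (card Q')) = (card Q choose k) * f k"
      using n_subsets[OF assms] by simp
  qed
  finally show ?thesis .
qed

text \<open>With \<open>p\<close> the least positive period, a coincidence of the iterates
  \<open>i < j < p\<close> carried on for \<open>p - j\<close> steps would give the smaller period
  \<open>p - j + i\<close>. The map is arbitrary so that the lemma serves both points under \<sigma>
  and pairs of points under its image map.\<close>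

lemma period:
  assumes "(f ^^ N) x = x" "N > 0"
  obtains p where "p > 0" "\<And>i. (f ^^ i) x = x \<longleftrightarrow> p dvd i"
    "\<And>i j. (f ^^ i) x = (f ^^ j) x \<longleftrightarrow> i mod p = j mod p"
    "card (range (\<lambda>i. (f ^^ i) x)) = p"
proof -
  define p where "p = (LEAST p. p > 0 \<and> (f ^^ p) x = x)"
  have p: "p > 0" "(f ^^ p) x = x"
    using LeastI[of "\<lambda>p. p > 0 \<and> (f ^^ p) x = x" N] assms by (auto simp: p_def)
  have least: "p \<le> q" if "q > 0" "(f ^^ q) x = x" for q
    unfolding p_def using that by (intro Least_le) auto
  have m: "(f ^^ (i mod p)) x = (f ^^ i) x" for i
    using funpow_mod_eq p(2) by metis
  have lt: "False" if "i < j" "j < p" "(f ^^ i) x = (f ^^ j) x" for i j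
  proof -
    have "(f ^^ (p - j + i)) x = (f ^^ (p - j)) ((f ^^ j) x)"
      using that(3) by (simp add: funpow_add)
    also have "\<dots> = (f ^^ (p - j + j)) x"
      by (simp only: funpow_add comp_apply)
    also have "\<dots> = x"
      using that p by simp
    finally show False
      using least[of "p - j + i"] that by linarith
  qed
  have iff: "(f ^^ i) x = (f ^^ j) x \<longleftrightarrow> i mod p = j mod p" for i j
  proof
    assume "(f ^^ i) x = (f ^^ j) x"
    then have "(f ^^ (i mod p)) x = (f ^^ (j mod p)) x"
      by (simp add: m)
    moreover have "i mod p < p" "j mod p < p"
      using p by auto
    ultimately show "i mod p = j mod p"
      using lt by (metis nat_neq_iff)
  next
    assume "i mod p = j mod p"
    then show "(f ^^ i) x = (f ^^ j) x"
      using m by metis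
  qed
  have "range (\<lambda>i. (f ^^ i) x) = (\<lambda>i. (f ^^ i) x) ` {..<p}"
  proof (intro equalityI subsetI)
    fix y assume "y \<in> range (\<lambda>i. (f ^^ i) x)"
    then obtain i where "y = (f ^^ i) x" by blast
    then have "y = (f ^^ (i mod p)) x" "i mod p < p"
      using m p by auto
    then show "y \<in> (\<lambda>i. (f ^^ i) x) ` {..<p}" by blast
  qed auto
  moreover have "inj_on (\<lambda>i. (f ^^ i) x) {..<p}"
    using iff by (auto simp: inj_on_def)
  ultimately have "card (range (\<lambda>i. (f ^^ i) x)) = p"
    by (simp add: card_image)
  moreover have "(f ^^ i) x = x \<longleftrightarrow> p dvd i" for i
    using iff[of i 0] by auto
  ultimately show ?thesis
    using that p(1) iff by blast
qed

section \<open>Invariant sets of pairs as unions of orbits\<close>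

lemma funpow_image: "((`) f ^^ i) e = (f ^^ i) ` e" for f :: "'a \<Rightarrow> 'a"
  by (induction i) (simp_all add: image_image)

definition inv_sets :: "('v \<Rightarrow> 'v) \<Rightarrow> 'v set set \<Rightarrow> 'v set set set" where
  "inv_sets \<sigma> A = {E. E \<subseteq> A \<and> (`) \<sigma> ` E = E}"

text \<open>The admissible pairs \<open>A\<close> are a parameter because they are split into
  invariant blocks that are dealt with one at a time. Meanwhile \<rho> holds the degrees still to be
  met, which may drop to 0.\<close>

definition graph_count :: "'v set \<Rightarrow> ('v \<Rightarrow> 'v) \<Rightarrow> 'v set set \<Rightarrow> ('v \<Rightarrow> nat) \<Rightarrow> nat" where
  "graph_count V \<sigma> A \<rho> = card {E \<in> inv_sets \<sigma> A. \<forall>v\<in>V. degree_in E v = \<rho> v}"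

text \<open>For a permutation of finite order the nonnegative powers already give the whole
  orbit.\<close>

definition pair_orbit :: "('v \<Rightarrow> 'v) \<Rightarrow> 'v set \<Rightarrow> 'v set set" where
  "pair_orbit \<sigma> e = range (\<lambda>i. (\<sigma> ^^ i) ` e)"

definition join_pairs :: "'v set \<Rightarrow> 'v set \<Rightarrow> 'v set set" where
  "join_pairs C D = (\<lambda>(x, y). {x, y}) ` (C \<times> D)"

lemma card_fixed_graphs: "card (fixed_graphs V \<sigma> \<rho>) = graph_count V \<sigma> (all_pairs V) \<rho>"
  unfolding fixed_graphs_def graph_count_def inv_sets_def by (rule arg_cong[where f=card]) auto

lemma graph_count_cong:
  assumes "\<And>v. v \<in> V \<Longrightarrow> \<rho> v = \<rho>' v"
  shows "graph_count V \<sigma> A \<rho> = graph_count V \<sigma> A \<rho>'"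
  using assms unfolding graph_count_def by (intro arg_cong[where f=card]) auto

lemma degree_in_Un:
  assumes "finite E" "finite E'" "E \<inter> E' = {}"
  shows "degree_in (E \<union> E') v = degree_in E v + degree_in E' v"
proof -
  have "{e \<in> E \<union> E'. v \<in> e} = {e \<in> E. v \<in> e} \<union> {e \<in> E'. v \<in> e}" by auto
  then show ?thesis
    unfolding degree_in_def using assms by (simp add: card_Un_disjoint disjoint_iff)
qed

lemma finite_all_pairs [simp]: "finite V \<Longrightarrow> finite (all_pairs V)"
  by (rule finite_subset[of _ "Pow V"]) (auto simp: all_pairs_def)

lemma card_all_pairs: "finite V \<Longrightarrow> card (all_pairs V) = card V choose 2"
  unfolding all_pairs_def by (rule n_subsets)

locale finite_perm =
  fixes V :: "'v set" and \<sigma> :: "'v \<Rightarrow> 'v"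
  assumes fin: "finite V" and perm: "\<sigma> permutes V"
begin

lemma inj_image_perm: "inj ((`) \<sigma>)"
  using permutes_inj[OF perm] by (simp add: inj_image_eq_iff inj_def)

lemma permutation: "permutation \<sigma>"
  by (rule permutes_imp_permutation[OF fin perm])

lemma nilpotent: obtains N where "N > 0" "\<sigma> ^^ N = id"
  using permutation_is_nilpotent[OF permutation] by blast

text \<open>An invariant edge set restricts to an invariant set on each block, since the blocks are
  invariant and \<sigma> acts injectively on sets. Degrees add because the blocks are disjoint. The
  filter on the first part makes the truncated subtraction of degrees faithful.\<close>

lemma graph_count_split:
  assumes fin': "finite A1" "finite A2" and disj: "A1 \<inter> A2 = {}"
    and inv: "(`) \<sigma> ` A1 = A1" "(`) \<sigma> ` A2 = A2"
  shows "graph_count V \<sigma> (A1 \<union> A2) \<rho> =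
    (\<Sum>E\<in>{E \<in> inv_sets \<sigma> A1. \<forall>v\<in>V. degree_in E v \<le> \<rho> v}.
       graph_count V \<sigma> A2 (\<lambda>v. \<rho> v - degree_in E v))"
proof -
  let ?S = "{E \<in> inv_sets \<sigma> (A1 \<union> A2). \<forall>v\<in>V. degree_in E v = \<rho> v}"
  let ?X = "{E \<in> inv_sets \<sigma> A1. \<forall>v\<in>V. degree_in E v \<le> \<rho> v}"
  let ?Y = "\<lambda>E. {E' \<in> inv_sets \<sigma> A2. \<forall>v\<in>V. degree_in E' v = \<rho> v - degree_in E v}"
  have fs: "finite E" if "E \<subseteq> A1 \<union> A2" for E
    using that fin' finite_subset by blast
  have restr: "(`) \<sigma> ` (E \<inter> A) = E \<inter> A" if "(`) \<sigma> ` E = E" "(`) \<sigma> ` A = A" for E A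
    using that image_Int[OF inj_image_perm, of E A] by simp
  have deg: "degree_in E v = degree_in (E \<inter> A1) v + degree_in (E \<inter> A2) v"
    if "E \<subseteq> A1 \<union> A2" for E v
  proof -
    have "E = (E \<inter> A1) \<union> (E \<inter> A2)" using that by auto
    moreover have "(E \<inter> A1) \<inter> (E \<inter> A2) = {}" using disj by auto
    ultimately show ?thesis
      using degree_in_Un[of "E \<inter> A1" "E \<inter> A2" v] fin' by simp
  qed
  have "bij_betw (\<lambda>E. (E \<inter> A1, E \<inter> A2)) ?S (Sigma ?X ?Y)"
  proof (rule bij_betw_byWitness[where f' = "\<lambda>(E, E'). E \<union> E'"])
    show "\<forall>E\<in>?S. (case (E \<inter> A1, E \<inter> A2) of (E, E') \<Rightarrow> E \<union> E') = E"
      by (auto simp: inv_sets_def)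
    show "\<forall>p\<in>Sigma ?X ?Y. ((case p of (E, E') \<Rightarrow> E \<union> E') \<inter> A1, (case p of (E, E') \<Rightarrow> E \<union> E') \<inter> A2) = p"
      using disj by (auto simp: inv_sets_def)
    show "(\<lambda>E. (E \<inter> A1, E \<inter> A2)) ` ?S \<subseteq> Sigma ?X ?Y"
    proof (rule image_subsetI)
      fix E assume E: "E \<in> ?S"
      then have "E \<subseteq> A1 \<union> A2" by (auto simp: inv_sets_def)
      from E deg[OF this] show "(E \<inter> A1, E \<inter> A2) \<in> Sigma ?X ?Y"
        using inv restr by (auto simp: inv_sets_def)
    qed
    show "(\<lambda>(E, E'). E \<union> E') ` Sigma ?X ?Y \<subseteq> ?S"
    proof (rule image_subsetI, clarify, intro conjI)
      fix E E' assume *: "E \<in> inv_sets \<sigma> A1" "\<forall>v\<in>V. degree_in E v \<le> \<rho> v" "E' \<in> inv_sets \<sigma> A2"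
        "\<forall>v\<in>V. degree_in E' v = \<rho> v - degree_in E v"
      then show "E \<union> E' \<in> inv_sets \<sigma> (A1 \<union> A2)"
        by (auto simp: inv_sets_def image_Un)
      have "degree_in (E \<union> E') v = degree_in E v + degree_in E' v" for v
        using * disj fin' by (intro degree_in_Un) (auto simp: inv_sets_def intro: finite_subset)
      then show "\<forall>v\<in>V. degree_in (E \<union> E') v = \<rho> v"
        using * by auto
    qed
  qed
  then have "card ?S = card (Sigma ?X ?Y)"
    by (rule bij_betw_same_card)
  also have "\<dots> = (\<Sum>E\<in>?X. card (?Y E))"
    by (rule card_SigmaI) (use fin' in \<open>auto simp: inv_sets_def intro: finite_subset[of _ "Pow A1"] finite_subset[of _ "Pow A2"]\<close>)
  finally show ?thesis
    by (simp add: graph_count_def)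
qed

lemma pair_orbit_refl: "e \<in> pair_orbit \<sigma> e"
  unfolding pair_orbit_def by (rule range_eqI[of _ _ 0]) simp

lemma image_pair_orbit: "(`) \<sigma> ` pair_orbit \<sigma> e = pair_orbit \<sigma> e"
proof -
  obtain N where N: "N > 0" "\<sigma> ^^ N = id" by (rule nilpotent)
  show ?thesis
  proof (intro equalityI subsetI)
    fix x assume "x \<in> (`) \<sigma> ` pair_orbit \<sigma> e"
    then obtain i where "x = (\<sigma> ^^ Suc i) ` e"
      by (auto simp: pair_orbit_def image_comp)
    then show "x \<in> pair_orbit \<sigma> e" unfolding pair_orbit_def by blast
  next
    fix x assume "x \<in> pair_orbit \<sigma> e"
    then obtain i where "x = (\<sigma> ^^ i) ` e" by (auto simp: pair_orbit_def)
    \<comment> \<open>One step back is \<open>N - 1\<close> steps forward.\<close>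
    moreover have "(\<sigma> ^^ i) = \<sigma> \<circ> (\<sigma> ^^ (i + (N - 1)))"
    proof -
      have "\<sigma> \<circ> (\<sigma> ^^ (i + (N - 1))) = \<sigma> ^^ (i + N)"
        using N by (metis One_nat_def Suc_pred add_Suc_right funpow.simps(2))
      then show ?thesis using N by (simp add: funpow_add)
    qed
    ultimately have "x = \<sigma> ` ((\<sigma> ^^ (i + (N - 1))) ` e)"
      by (metis image_comp)
    then show "x \<in> (`) \<sigma> ` pair_orbit \<sigma> e"
      unfolding pair_orbit_def by blast
  qed
qed

lemma pair_orbit_subset:
  assumes "(`) \<sigma> ` E = E" "e \<in> E"
  shows "pair_orbit \<sigma> e \<subseteq> E"
proof -
  have "(\<sigma> ^^ i) ` e \<in> E" for i
  proof (induction i)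
    case (Suc i)
    have "(\<sigma> ^^ Suc i) ` e = \<sigma> ` ((\<sigma> ^^ i) ` e)" by (simp add: image_image)
    then show ?case using Suc assms by blast
  qed (use assms in simp)
  then show ?thesis by (auto simp: pair_orbit_def)
qed

lemma pair_orbit_sym:
  assumes "f \<in> pair_orbit \<sigma> e"
  shows "e \<in> pair_orbit \<sigma> f"
proof -
  obtain N where N: "N > 0" "\<sigma> ^^ N = id" by (rule nilpotent)
  obtain i where i: "f = (\<sigma> ^^ i) ` e" using assms by (auto simp: pair_orbit_def)
  \<comment> \<open>The remaining \<open>N * i - i\<close> steps complete a multiple of
    \<open>N\<close> and so lead back to \<open>e\<close>.\<close>
  have "(\<sigma> ^^ (N * i - i)) ` f = (\<sigma> ^^ (N * i)) ` e"
    unfolding i image_comp funpow_add[symmetric] using N by simp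
  also have "\<sigma> ^^ (N * i) = id"
    using N by (simp add: funpow_mult[symmetric])
  finally show ?thesis unfolding pair_orbit_def by auto
qed

lemma pair_orbit_eq:
  assumes "f \<in> pair_orbit \<sigma> e"
  shows "pair_orbit \<sigma> f = pair_orbit \<sigma> e"
  by (intro equalityI pair_orbit_subset[OF image_pair_orbit] assms pair_orbit_sym[OF assms])

text \<open>An invariant subset of \<open>A1\<close> is a union of orbits of pairs. All
  \<open>g\<close> orbits have the same size and the same degree function \<delta>, so the rest of
  the count sees only the number \<open>k\<close> of chosen orbits. The lemma is applied three
  times: to the pairs between two cycles, to the chords of a cycle and to its diameters.\<close>

lemma graph_count_block:
  assumes fin': "finite A1" "finite A2" and disj: "A1 \<inter> A2 = {}"
    and inv: "(`) \<sigma> ` A1 = A1" "(`) \<sigma> ` A2 = A2"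
    and card_orb: "\<And>e. e \<in> A1 \<Longrightarrow> card (pair_orbit \<sigma> e) = p" and "p > 0"
    and card_A1: "card A1 = g * p"
    and deg: "\<And>e v. e \<in> A1 \<Longrightarrow> v \<in> V \<Longrightarrow> degree_in (pair_orbit \<sigma> e) v = \<delta> v"
  shows "graph_count V \<sigma> (A1 \<union> A2) \<rho> =
    (\<Sum>k\<le>g. (g choose k) * (if \<forall>v\<in>V. k * \<delta> v \<le> \<rho> v
        then graph_count V \<sigma> A2 (\<lambda>v. \<rho> v - k * \<delta> v) else 0))"
proof -
  let ?Q = "pair_orbit \<sigma> ` A1"
  have sub: "pair_orbit \<sigma> e \<subseteq> A1" if "e \<in> A1" for e
    using pair_orbit_subset[OF inv(1) that] .
  have Un: "\<Union>?Q = A1"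
    using sub pair_orbit_refl by blast
  have dj: "X \<inter> Y = {}" if XY: "X \<in> ?Q" "Y \<in> ?Q" "X \<noteq> Y" for X Y
  proof -
    obtain e f where "X = pair_orbit \<sigma> e" "Y = pair_orbit \<sigma> f" using XY(1,2) by blast
    then show ?thesis using XY(3) pair_orbit_eq by (metis disjoint_iff)
  qed
  have finQ: "finite ?Q" using fin' by simp
  have "p * card ?Q = card (\<Union>?Q)"
  proof (rule card_partition)
    show "finite (\<Union>?Q)" using Un fin' by simp
    show "card c = p" if "c \<in> ?Q" for c using that card_orb by blast
  qed (use finQ dj in blast)+
  then have g: "card ?Q = g"
    using card_A1 \<open>p > 0\<close> Un by simp
  \<comment> \<open>A union of orbits determines its orbits: they are the orbits of its
    elements.\<close>
  have inj: "inj_on Union (Pow ?Q)"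
  proof (rule inj_on_inverseI[where g = "\<lambda>E. pair_orbit \<sigma> ` E"])
    fix Q' assume Q': "Q' \<in> Pow ?Q"
    show "pair_orbit \<sigma> ` (\<Union>Q') = Q'"
    proof (intro equalityI subsetI)
      fix X assume "X \<in> pair_orbit \<sigma> ` \<Union>Q'"
      then obtain Y e where "Y \<in> Q'" "e \<in> Y" "X = pair_orbit \<sigma> e" by blast
      then show "X \<in> Q'" using Q' pair_orbit_eq by auto
    next
      fix X assume X: "X \<in> Q'"
      then obtain e where "X = pair_orbit \<sigma> e" using Q' by auto
      then show "X \<in> pair_orbit \<sigma> ` \<Union>Q'"
        using X pair_orbit_refl by blast
    qed
  qed
  have img: "Union ` Pow ?Q = inv_sets \<sigma> A1"
  proof (intro equalityI subsetI)
    fix E assume "E \<in> Union ` Pow ?Q"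
    then obtain Q' where Q': "Q' \<subseteq> ?Q" "E = \<Union>Q'" by auto
    have "(`) \<sigma> ` \<Union>Q' = (\<Union>X\<in>Q'. (`) \<sigma> ` X)" by blast
    also have "\<dots> = (\<Union>X\<in>Q'. X)"
    proof (rule SUP_cong[OF refl])
      fix X assume "X \<in> Q'"
      then obtain e where "X = pair_orbit \<sigma> e" using Q'(1) by blast
      then show "(`) \<sigma> ` X = X" using image_pair_orbit by simp
    qed
    finally have "(`) \<sigma> ` \<Union>Q' = \<Union>Q'" by (simp only: image_ident)
    moreover have "\<Union>Q' \<subseteq> A1" by (rule order_trans[OF Union_mono[OF Q'(1)] eq_refl[OF Un]])
    ultimately show "E \<in> inv_sets \<sigma> A1"
      unfolding inv_sets_def Q'(2) by (intro CollectI conjI)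
  next
    fix E assume E: "E \<in> inv_sets \<sigma> A1"
    then have "pair_orbit \<sigma> e \<subseteq> E" if "e \<in> E" for e
      using pair_orbit_subset[of E e] that by (simp add: inv_sets_def)
    then have "E = \<Union>(pair_orbit \<sigma> ` E)"
      using pair_orbit_refl by blast
    moreover have "pair_orbit \<sigma> ` E \<in> Pow ?Q" using E by (auto simp: inv_sets_def)
    ultimately show "E \<in> Union ` Pow ?Q" by blast
  qed
  have degQ: "degree_in (\<Union>Q') v = card Q' * \<delta> v" if Q'v: "Q' \<subseteq> ?Q" "v \<in> V" for Q' v
  proof -
    have "{e \<in> \<Union>Q'. v \<in> e} = (\<Union>X\<in>Q'. {e \<in> X. v \<in> e})" by blast
    also have "card \<dots> = (\<Sum>X\<in>Q'. card {e \<in> X. v \<in> e})"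
    proof (rule card_UN_disjoint)
      show "finite Q'" using that finQ finite_subset by blast
      show "\<forall>X\<in>Q'. finite {e \<in> X. v \<in> e}"
      proof
        fix X assume "X \<in> Q'"
        then have "X \<subseteq> A1" using that Un by blast
        then show "finite {e \<in> X. v \<in> e}"
          by (intro finite_subset[OF _ fin'(1)]) auto
      qed
      show "\<forall>X\<in>Q'. \<forall>Y\<in>Q'. X \<noteq> Y \<longrightarrow> {e \<in> X. v \<in> e} \<inter> {e \<in> Y. v \<in> e} = {}"
      proof (intro ballI impI)
        fix X Y assume XY: "X \<in> Q'" "Y \<in> Q'" "X \<noteq> Y"
        then have "X \<inter> Y = {}" using dj[of X Y] that(1) by (simp add: subset_iff)
        then show "{e \<in> X. v \<in> e} \<inter> {e \<in> Y. v \<in> e} = {}" by auto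
      qed
    qed
    also have "\<dots> = (\<Sum>X\<in>Q'. \<delta> v)"
    proof (rule sum.cong[OF refl])
      fix X assume "X \<in> Q'"
      then obtain e where "e \<in> A1" "X = pair_orbit \<sigma> e" using Q'v(1) by blast
      then show "card {e \<in> X. v \<in> e} = \<delta> v"
        using deg[of e v] Q'v(2) by (simp add: degree_in_def)
    qed
    finally show ?thesis by (simp add: degree_in_def)
  qed
  have "graph_count V \<sigma> (A1 \<union> A2) \<rho> =
    (\<Sum>E\<in>{E \<in> inv_sets \<sigma> A1. \<forall>v\<in>V. degree_in E v \<le> \<rho> v}.
       graph_count V \<sigma> A2 (\<lambda>v. \<rho> v - degree_in E v))"
    by (rule graph_count_split) (use assms in auto)
  also have "\<dots> = (\<Sum>E\<in>inv_sets \<sigma> A1. if \<forall>v\<in>V. degree_in E v \<le> \<rho> v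
       then graph_count V \<sigma> A2 (\<lambda>v. \<rho> v - degree_in E v) else 0)"
    by (rule sum.inter_filter) (use fin' in \<open>auto simp: inv_sets_def intro: finite_subset[of _ "Pow A1"]\<close>)
  also have "\<dots> = (\<Sum>Q'\<in>Pow ?Q. if \<forall>v\<in>V. degree_in (\<Union>Q') v \<le> \<rho> v
       then graph_count V \<sigma> A2 (\<lambda>v. \<rho> v - degree_in (\<Union>Q') v) else 0)"
    unfolding img[symmetric] sum.reindex[OF inj] comp_def ..
  also have "\<dots> = (\<Sum>Q'\<in>Pow ?Q. if \<forall>v\<in>V. card Q' * \<delta> v \<le> \<rho> v
       then graph_count V \<sigma> A2 (\<lambda>v. \<rho> v - card Q' * \<delta> v) else 0)"
  proof (rule sum.cong[OF refl])
    fix Q' assume "Q' \<in> Pow ?Q"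
    then have *: "degree_in (\<Union>Q') v = card Q' * \<delta> v" if "v \<in> V" for v
      using degQ that by blast
    have "graph_count V \<sigma> A2 (\<lambda>v. \<rho> v - degree_in (\<Union>Q') v) =
      graph_count V \<sigma> A2 (\<lambda>v. \<rho> v - card Q' * \<delta> v)"
      by (rule graph_count_cong) (simp add: *)
    with * show "(if \<forall>v\<in>V. degree_in (\<Union>Q') v \<le> \<rho> v
       then graph_count V \<sigma> A2 (\<lambda>v. \<rho> v - degree_in (\<Union>Q') v) else 0) =
      (if \<forall>v\<in>V. card Q' * \<delta> v \<le> \<rho> v
       then graph_count V \<sigma> A2 (\<lambda>v. \<rho> v - card Q' * \<delta> v) else 0)"
      by simp
  qed
  also have "\<dots> = (\<Sum>k\<le>g. (g choose k) * (if \<forall>v\<in>V. k * \<delta> v \<le> \<rho> v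
        then graph_count V \<sigma> A2 (\<lambda>v. \<rho> v - k * \<delta> v) else 0))"
    using sum_Pow_card[OF finQ, of "\<lambda>k. if \<forall>v\<in>V. k * \<delta> v \<le> \<rho> v
        then graph_count V \<sigma> A2 (\<lambda>v. \<rho> v - k * \<delta> v) else 0"] g by simp
  finally show ?thesis .
qed

lemma orbit_range: "orbit \<sigma> x = range (\<lambda>i. (\<sigma> ^^ i) x)"
  using orbit_altdef_permutation[OF permutation, of x] by auto

lemma orbit_eq: "y \<in> orbit \<sigma> x \<Longrightarrow> orbit \<sigma> y = orbit \<sigma> x"
  by (rule orbit_cyclic_eq3[OF cyclic_on_orbit[OF perm fin]])

lemma self_orbit: "x \<in> orbit \<sigma> x"
  by (rule permutation_self_in_orbit[OF permutation])

lemma orbit_in: "C \<in> orbit \<sigma> ` V \<Longrightarrow> x \<in> C \<Longrightarrow> C = orbit \<sigma> x"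
  by (metis imageE orbit_eq)

lemma orbit_subset: "C \<in> orbit \<sigma> ` V \<Longrightarrow> C \<subseteq> V"
  by (auto dest: subsetD[OF permutes_orbit_subset[OF perm]])

lemma finite_in: "C \<in> orbit \<sigma> ` V \<Longrightarrow> finite C"
  by (rule finite_subset[OF orbit_subset fin])

lemma orbit_ne: "C \<in> orbit \<sigma> ` V \<Longrightarrow> C \<noteq> {}"
  using self_orbit by fastforce

lemma card_pos: "C \<in> orbit \<sigma> ` V \<Longrightarrow> card C > 0"
  using finite_in orbit_ne by (simp add: card_gt_0_iff)

lemma orbits_disjoint: "C \<in> orbit \<sigma> ` V \<Longrightarrow> D \<in> orbit \<sigma> ` V \<Longrightarrow> C \<noteq> D \<Longrightarrow> C \<inter> D = {}"
  by (metis disjoint_iff orbit_in)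

lemma image_orbit: "C \<in> orbit \<sigma> ` V \<Longrightarrow> \<sigma> ` C = C"
proof -
  assume C: "C \<in> orbit \<sigma> ` V"
  have "\<sigma> ` C \<subseteq> C" using C by (auto intro: orbit.step)
  then show ?thesis
    using finite_in[OF C] permutes_inj[OF perm]
    by (meson card_image card_subset_eq inj_on_subset subset_UNIV)
qed

lemma funpow_orbit: "C \<in> orbit \<sigma> ` V \<Longrightarrow> x \<in> C \<Longrightarrow> (\<sigma> ^^ i) x \<in> C"
  by (metis orbit_in orbit_range rangeI)

lemma orbit_period:
  assumes "C \<in> orbit \<sigma> ` V" "x \<in> C"
  shows "(\<sigma> ^^ i) x = (\<sigma> ^^ j) x \<longleftrightarrow> i mod card C = j mod card C"
    and "(\<sigma> ^^ i) x = x \<longleftrightarrow> card C dvd i"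
proof -
  obtain N where N: "N > 0" "\<sigma> ^^ N = id" by (rule nilpotent)
  obtain p where "p > 0" "\<And>i. (\<sigma> ^^ i) x = x \<longleftrightarrow> p dvd i"
    "\<And>i j. (\<sigma> ^^ i) x = (\<sigma> ^^ j) x \<longleftrightarrow> i mod p = j mod p"
    "card (range (\<lambda>i. (\<sigma> ^^ i) x)) = p"
    using period[of N \<sigma> x] N by auto
  then show "(\<sigma> ^^ i) x = (\<sigma> ^^ j) x \<longleftrightarrow> i mod card C = j mod card C"
    "(\<sigma> ^^ i) x = x \<longleftrightarrow> card C dvd i"
    using orbit_in[OF assms] orbit_range by auto
qed

text \<open>Numbers with the same multiples are equal, so the exponents that fix a pair determine
  the size of its orbit.\<close>

lemma card_pair_orbit:
  assumes "\<And>i. (\<sigma> ^^ i) ` e = e \<longleftrightarrow> p dvd i"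
  shows "card (pair_orbit \<sigma> e) = p"
proof -
  obtain N where N: "N > 0" "\<sigma> ^^ N = id" by (rule nilpotent)
  have "((`) \<sigma> ^^ N) e = e" using N by (simp add: funpow_image)
  then obtain q where q: "\<And>i. ((`) \<sigma> ^^ i) e = e \<longleftrightarrow> q dvd i"
    "card (range (\<lambda>i. ((`) \<sigma> ^^ i) e)) = q"
    by (rule period[OF _ N(1)]) blast
  have iff: "q dvd i \<longleftrightarrow> p dvd i" for i
    using assms[of i] q(1)[of i] by (simp add: funpow_image)
  have "q = p" using iff[of p] iff[of q] by (intro dvd_antisym) simp_all
  then show ?thesis
    using q(2) by (simp add: pair_orbit_def funpow_image)
qed

lemma degree_in_inv:
  assumes "(`) \<sigma> ` X = X"
  shows "degree_in X (\<sigma> v) = degree_in X v"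
proof -
  have "{e \<in> X. \<sigma> v \<in> e} = (`) \<sigma> ` {e \<in> X. v \<in> e}"
  proof (intro equalityI subsetI)
    fix e assume e: "e \<in> {e \<in> X. \<sigma> v \<in> e}"
    then obtain f where "f \<in> X" "e = \<sigma> ` f" using assms by blast
    moreover from this e have "v \<in> f" using permutes_inj[OF perm] by (auto simp: inj_def)
    ultimately show "e \<in> (`) \<sigma> ` {e \<in> X. v \<in> e}" by blast
  next
    fix e assume "e \<in> (`) \<sigma> ` {e \<in> X. v \<in> e}"
    then show "e \<in> {e \<in> X. \<sigma> v \<in> e}" using assms by blast
  qed
  then show ?thesis
    unfolding degree_in_def using inj_image_perm by (simp add: card_image inj_on_subset[of _ UNIV])
qed

text \<open>Double counting of the incidences between \<open>C\<close> and \<open>X\<close>. The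
  degree is constant along the cycle because \<open>X\<close> is invariant, and each edge meets the
  cycle in \<open>c\<close> points.\<close>

lemma degree_pair_orbit:
  assumes C: "C \<in> orbit \<sigma> ` V" and "finite X" and inv: "(`) \<sigma> ` X = X"
    and c: "\<And>e. e \<in> X \<Longrightarrow> card (e \<inter> C) = c" and v: "v \<in> C"
  shows "card C * degree_in X v = c * card X"
proof -
  have "degree_in X w = degree_in X v" if "w \<in> C" for w
  proof -
    have "w \<in> orbit \<sigma> v" using orbit_in[OF C v] that by simp
    then show ?thesis by induction (simp_all add: degree_in_inv[OF inv])
  qed
  then have "card C * degree_in X v = (\<Sum>w\<in>C. degree_in X w)" by simp
  also have "\<dots> = (\<Sum>w\<in>C. card {e\<in>X. w \<in> e})" by (simp add: degree_in_def)
  also have "\<dots> = (\<Sum>e\<in>X. c)"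
  proof (rule sum_multicount_gen)
    show "\<forall>e\<in>X. card {w \<in> C. w \<in> e} = c"
      using c by (metis (no_types, lifting) Collect_cong Int_def inf_commute)
  qed (use assms finite_in in auto)
  finally show ?thesis by simp
qed

lemma degree_zero: "(\<And>e. e \<in> X \<Longrightarrow> v \<notin> e) \<Longrightarrow> degree_in X v = 0"
proof -
  assume "\<And>e. e \<in> X \<Longrightarrow> v \<notin> e"
  then have "{e \<in> X. v \<in> e} = {}" by auto
  then show ?thesis unfolding degree_in_def by (simp only: card.empty)
qed

lemma image_all_pairs:
  assumes "\<sigma> ` A = A"
  shows "(`) \<sigma> ` all_pairs A = all_pairs A"
proof (intro equalityI subsetI)
  fix e assume "e \<in> (`) \<sigma> ` all_pairs A"
  then show "e \<in> all_pairs A"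
    using assms permutes_inj[OF perm]
    by (auto simp: all_pairs_def card_image inj_on_subset[of _ UNIV])
next
  fix e assume e: "e \<in> all_pairs A"
  then obtain f where "f \<subseteq> A" "e = \<sigma> ` f"
    using assms by (metis (no_types, lifting) all_pairs_def mem_Collect_eq subset_imageE)
  moreover from this e have "card f = 2"
    using permutes_inj[OF perm] by (auto simp: all_pairs_def card_image inj_on_subset[of _ UNIV])
  ultimately show "e \<in> (`) \<sigma> ` all_pairs A" by (auto simp: all_pairs_def)
qed

lemma image_join_pairs:
  assumes "\<sigma> ` C = C" "\<sigma> ` D = D"
  shows "(`) \<sigma> ` join_pairs C D = join_pairs C D"
proof -
  have "(`) \<sigma> ` join_pairs C D = (\<lambda>(x, y). {x, y}) ` (map_prod \<sigma> \<sigma> ` (C \<times> D))"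
    unfolding join_pairs_def image_comp by (intro image_cong) auto
  also have "map_prod \<sigma> \<sigma> ` (C \<times> D) = C \<times> D"
    using assms by (auto simp: map_prod_surj_on)
  finally show ?thesis by (simp add: join_pairs_def)
qed

end

section \<open>Orbits of pairs between two cycles and inside one cycle\<close>

context finite_perm
begin

lemma degree_pair_orbit_in:
  assumes C: "C \<in> orbit \<sigma> ` V" and e: "card (pair_orbit \<sigma> e) = p" "p > 0" and c: "card (e \<inter> C) = c"
    and v: "v \<in> C"
  shows "card C * degree_in (pair_orbit \<sigma> e) v = c * p"
proof -
  have "finite (pair_orbit \<sigma> e)" by (rule card_ge_0_finite) (use e in simp)
  moreover have "card (f \<inter> C) = c" if "f \<in> pair_orbit \<sigma> e" for f
  proof -
    obtain i where i: "f = (\<sigma> ^^ i) ` e" using \<open>f \<in> _\<close> by (auto simp: pair_orbit_def)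
    have inj: "inj (\<sigma> ^^ i)" using permutes_inj[OF perm] by (rule inj_fn)
    have "(\<sigma> ^^ i) ` C = C"
    proof (induction i)
      case (Suc i)
      have "(\<sigma> ^^ Suc i) ` C = \<sigma> ` ((\<sigma> ^^ i) ` C)" by (simp add: image_image)
      then show ?case using Suc image_orbit[OF C] by simp
    qed simp
    then have "f \<inter> C = (\<sigma> ^^ i) ` (e \<inter> C)"
      unfolding i using image_Int[OF inj, of e C] by simp
    then show ?thesis using c inj by (simp add: card_image inj_on_subset[OF inj])
  qed
  ultimately show ?thesis
    using degree_pair_orbit[OF C _ image_pair_orbit _ v, of e c] e by auto
qed

lemma degree_pair_orbit_out:
  assumes inv: "\<sigma> ` A = A" and "e \<subseteq> A" "v \<notin> A"
  shows "degree_in (pair_orbit \<sigma> e) v = 0"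
proof (rule degree_zero)
  fix f assume "f \<in> pair_orbit \<sigma> e"
  then obtain i where i: "f = (\<sigma> ^^ i) ` e" by (auto simp: pair_orbit_def)
  have "(\<sigma> ^^ i) ` e \<subseteq> A"
  proof (induction i)
    case (Suc i)
    have "(\<sigma> ^^ Suc i) ` e = \<sigma> ` ((\<sigma> ^^ i) ` e)" by (simp add: image_image)
    then show ?case using Suc inv by blast
  qed (use assms in simp)
  then show "v \<notin> f" using assms i by auto
qed

text \<open>A pair with one point in each cycle returns exactly when both cycles close up. Its orbit
  thus has lcm many elements, and there are gcd many orbits. Each orbit adds the lcm divided by the
  length of the cycle to the degrees on that cycle; these quotients are \<alpha> on \<open>C\<close>
  and \<beta> on \<open>D\<close>.\<close>

lemma join_block:
  assumes C: "C \<in> orbit \<sigma> ` V" and D: "D \<in> orbit \<sigma> ` V" and "C \<noteq> D"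
    and A: "finite A" "(`) \<sigma> ` A = A" "join_pairs C D \<inter> A = {}"
    and rho: "\<And>v. v \<in> C \<Longrightarrow> \<rho> v = B" "\<And>v. v \<in> D \<Longrightarrow> \<rho> v = s"
  defines "g \<equiv> gcd (card C) (card D)"
  shows "graph_count V \<sigma> (join_pairs C D \<union> A) \<rho> =
    (\<Sum>k\<le>g. (g choose k) * (if k * (card D div g) \<le> B \<and> k * (card C div g) \<le> s
        then graph_count V \<sigma> A (\<lambda>v. \<rho> v - k * (if v \<in> C then card D div g
           else if v \<in> D then card C div g else 0)) else 0))"
proof -
  let ?\<delta> = "\<lambda>v. if v \<in> C then card D div g else if v \<in> D then card C div g else 0"
  have dj: "C \<inter> D = {}" using orbits_disjoint assms by blast
  have finCD: "finite C" "finite D" using C D finite_in by auto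
  have pos: "card C > 0" "card D > 0" using C D card_pos by auto
  have pd: "card (pair_orbit \<sigma> e) = lcm (card C) (card D) \<and>
      (\<forall>v\<in>V. degree_in (pair_orbit \<sigma> e) v = ?\<delta> v)" if e: "e \<in> join_pairs C D" for e
  proof -
    obtain x y where xy: "x \<in> C" "y \<in> D" "e = {x, y}"
      using e by (auto simp: join_pairs_def)
    have "(\<sigma> ^^ i) ` e = e \<longleftrightarrow> lcm (card C) (card D) dvd i" for i
    proof -
      \<comment> \<open>The two points cannot be swapped, as they lie in disjoint cycles.\<close>
      have "(\<sigma> ^^ i) x \<in> C" "(\<sigma> ^^ i) y \<in> D" using funpow_orbit C D xy by auto
      then have "(\<sigma> ^^ i) ` e = e \<longleftrightarrow> (\<sigma> ^^ i) x = x \<and> (\<sigma> ^^ i) y = y"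
        using xy dj by (auto simp: doubleton_eq_iff)
      then show ?thesis using orbit_period(2)[OF C] orbit_period(2)[OF D] xy by simp
    qed
    then have cp: "card (pair_orbit \<sigma> e) = lcm (card C) (card D)" by (rule card_pair_orbit)
    have lpos: "lcm (card C) (card D) > 0" using pos by (simp add: lcm_pos_nat)
    have "e \<inter> C = {x}" "e \<inter> D = {y}" using xy dj by auto
    then have c1: "card (e \<inter> C) = 1" "card (e \<inter> D) = 1" by auto
    have l: "lcm (card C) (card D) = card C * (card D div g)"
      "lcm (card C) (card D) = card D * (card C div g)"
      unfolding g_def lcm_nat_def by (simp_all add: div_mult_swap mult.commute)
    have "degree_in (pair_orbit \<sigma> e) v = ?\<delta> v" if "v \<in> V" for v
    proof -
      consider "v \<in> C" | "v \<in> D" "v \<notin> C" | "v \<notin> C \<union> D" by auto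
      then show ?thesis
      proof cases
        case 1
        then show ?thesis
          using degree_pair_orbit_in[OF C cp lpos c1(1) 1] l(1) pos by simp
      next
        case 2
        then show ?thesis
          using degree_pair_orbit_in[OF D cp lpos c1(2) 2(1)] l(2) pos by simp
      next
        case 3
        have "\<sigma> ` (C \<union> D) = C \<union> D" using image_orbit C D by (simp add: image_Un)
        then show ?thesis
          using degree_pair_orbit_out[of "C \<union> D" e v] 3 xy by simp
      qed
    qed
    then show ?thesis using cp by blast
  qed
  have inj: "inj_on (\<lambda>(x, y). {x, y}) (C \<times> D)"
    using dj by (auto simp: inj_on_def doubleton_eq_iff)
  have cardJ: "card (join_pairs C D) = g * lcm (card C) (card D)"
    unfolding join_pairs_def using inj by (simp add: card_image g_def prod_gcd_lcm_nat[symmetric] card_cartesian_product)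
  have finJ: "finite (join_pairs C D)" using finCD by (simp add: join_pairs_def)
  have "graph_count V \<sigma> (join_pairs C D \<union> A) \<rho> =
    (\<Sum>k\<le>g. (g choose k) * (if \<forall>v\<in>V. k * ?\<delta> v \<le> \<rho> v
        then graph_count V \<sigma> A (\<lambda>v. \<rho> v - k * ?\<delta> v) else 0))"
    by (rule graph_count_block[where p = "lcm (card C) (card D)"])
      (use finJ A cardJ pd pos image_join_pairs image_orbit C D in \<open>auto simp: lcm_pos_nat\<close>)
  also have "\<dots> = (\<Sum>k\<le>g. (g choose k) * (if k * (card D div g) \<le> B \<and> k * (card C div g) \<le> s
        then graph_count V \<sigma> A (\<lambda>v. \<rho> v - k * ?\<delta> v) else 0))"
  proof (rule sum.cong[OF refl])
    fix k
    obtain x y where "x \<in> C" "y \<in> D" using orbit_ne[OF C] orbit_ne[OF D] by blast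
    moreover from this have "x \<in> V" "y \<in> V" "y \<notin> C" using orbit_subset C D dj by auto
    ultimately have "(\<forall>v\<in>V. k * ?\<delta> v \<le> \<rho> v) \<longleftrightarrow> k * (card D div g) \<le> B \<and> k * (card C div g) \<le> s"
      using rho dj by auto
    then show "(g choose k) * (if \<forall>v\<in>V. k * ?\<delta> v \<le> \<rho> v
        then graph_count V \<sigma> A (\<lambda>v. \<rho> v - k * ?\<delta> v) else 0) =
      (g choose k) * (if k * (card D div g) \<le> B \<and> k * (card C div g) \<le> s
        then graph_count V \<sigma> A (\<lambda>v. \<rho> v - k * ?\<delta> v) else 0)" by simp
  qed
  finally show ?thesis .
qed

text \<open>For even \<open>a\<close> the pairs of opposite points form the one orbit of pairs inside a cycle that
  contributes 1 rather than 2 to each degree. It is the source of the factor \<open>1 + x\<close> of \<open>P\<^sub>a\<close>.\<close>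

definition diameters :: "'v set \<Rightarrow> 'v set set" where
  "diameters C = (if even (card C) then (\<lambda>x. {x, (\<sigma> ^^ (card C div 2)) x}) ` C else {})"

text \<open>Half a turn exchanges a point with its opposite point and hence fixes the diameter
  through them. So the orbit of a diameter closes after half the length of the cycle, and this one
  orbit contains all diameters.\<close>

lemma diameter_orbit:
  assumes C: "C \<in> orbit \<sigma> ` V" and ev: "even (card C)" and x: "x \<in> C"
  shows "pair_orbit \<sigma> {x, (\<sigma> ^^ (card C div 2)) x} = diameters C"
    and "card (diameters C) = card C div 2"
    and "diameters C \<subseteq> all_pairs C"
proof -
  let ?h = "card C div 2"
  have pos: "card C > 0" using C card_pos by auto
  have h: "card C = 2 * ?h" "?h > 0" using ev pos by auto
  have ne: "(\<sigma> ^^ ?h) y \<noteq> y" if "y \<in> C" for y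
    using orbit_period(2)[OF C that] h by (metis dvd_imp_le mult_2 less_add_same_cancel1 not_le)
  show "diameters C \<subseteq> all_pairs C"
    using ev funpow_orbit[OF C] ne ne[symmetric] by (auto simp: diameters_def all_pairs_def card_insert_if)
  have img: "(\<sigma> ^^ i) ` {x, (\<sigma> ^^ ?h) x} = {(\<sigma> ^^ i) x, (\<sigma> ^^ ?h) ((\<sigma> ^^ i) x)}" for i
    by (simp add: funpow_add[symmetric] comp_def[symmetric] add.commute flip: comp_apply[of "\<sigma> ^^ _" "\<sigma> ^^ _" x])
  have "C = range (\<lambda>i. (\<sigma> ^^ i) x)" using orbit_in[OF C x] orbit_range by simp
  then show po: "pair_orbit \<sigma> {x, (\<sigma> ^^ ?h) x} = diameters C"
    using ev unfolding pair_orbit_def img diameters_def by auto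
  \<comment> \<open>The pair is fixed when both points are fixed or when they are swapped, that is,
    for \<open>i\<close> congruent to 0 or to \<open>?h\<close> modulo \<open>2 * ?h\<close>.
    Together these are the multiples of \<open>?h\<close>.\<close>
  have "(\<sigma> ^^ i) ` {x, (\<sigma> ^^ ?h) x} = {x, (\<sigma> ^^ ?h) x} \<longleftrightarrow> ?h dvd i" for i
  proof -
    have "(\<sigma> ^^ i) ` {x, (\<sigma> ^^ ?h) x} = {x, (\<sigma> ^^ ?h) x} \<longleftrightarrow>
      (\<sigma> ^^ i) x = x \<or> (\<sigma> ^^ i) x = (\<sigma> ^^ ?h) x \<and> (\<sigma> ^^ (?h + i)) x = x"
      unfolding img by (auto simp: doubleton_eq_iff funpow_add)
    also have "\<dots> \<longleftrightarrow> card C dvd i \<or> i mod card C = ?h mod card C \<and> card C dvd (?h + i)"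
      using orbit_period[OF C x] by simp
    also have "\<dots> \<longleftrightarrow> ?h dvd i"
    proof
      assume "card C dvd i \<or> i mod card C = ?h mod card C \<and> card C dvd (?h + i)"
      then show "?h dvd i"
      proof
        assume "card C dvd i"
        then show ?thesis using h(1) by (metis dvd_mult_right)
      next
        assume "i mod card C = ?h mod card C \<and> card C dvd (?h + i)"
        then have "?h dvd ?h + i" using h(1) by (metis dvd_mult_right)
        then show ?thesis by simp
      qed
    next
      assume "?h dvd i"
      then obtain q where q: "i = ?h * q" by auto
      show "card C dvd i \<or> i mod card C = ?h mod card C \<and> card C dvd (?h + i)"
      proof (cases "even q")
        case True
        then show ?thesis using q h(1) by (metis mult.commute mult_dvd_mono dvd_refl)
      next
        case False
        then obtain t where "q = 2 * t + 1" by (auto elim: oddE)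
        then have "i = card C * t + ?h" using q h(1) by (simp add: algebra_simps)
        moreover from this have "?h + i = card C * (t + 1)" using h(1) by (simp add: algebra_simps)
        ultimately show ?thesis by (metis dvd_triv_left mod_mult_self4)
      qed
    qed
    finally show ?thesis .
  qed
  then show "card (diameters C) = ?h"
    using card_pair_orbit po by metis
qed

lemma all_pairs_elim:
  assumes "e \<in> all_pairs C"
  obtains x y where "e = {x, y}" "x \<noteq> y" "x \<in> C" "y \<in> C"
  using assms by (auto simp: all_pairs_def card_2_iff)

text \<open>An iterate that fixes the pair but not its points swaps them. Its square then fixes
  \<open>x\<close>, which forces the length of the cycle to be even and the iterate to act as half a
  turn, so the pair is a diameter. Every other pair has an orbit of full length.\<close>

lemma chord_orbit:
  assumes C: "C \<in> orbit \<sigma> ` V" and e: "e \<in> all_pairs C - diameters C"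
  shows "card (pair_orbit \<sigma> e) = card C"
proof (rule card_pair_orbit)
  fix i
  obtain x y where xy: "e = {x, y}" "x \<noteq> y" "x \<in> C" "y \<in> C"
    using e all_pairs_elim by blast
  show "(\<sigma> ^^ i) ` e = e \<longleftrightarrow> card C dvd i"
  proof
    assume "card C dvd i"
    then show "(\<sigma> ^^ i) ` e = e"
      using xy orbit_period(2)[OF C xy(3), of i] orbit_period(2)[OF C xy(4), of i] by simp
  next
    assume *: "(\<sigma> ^^ i) ` e = e"
    show "card C dvd i"
    proof (rule ccontr)
      assume nd: "\<not> card C dvd i"
      then have "(\<sigma> ^^ i) x = y" "(\<sigma> ^^ i) y = x"
        using * xy orbit_period(2)[OF C] by (auto simp: doubleton_eq_iff)
      then have "(\<sigma> ^^ (i + i)) x = x" by (simp add: funpow_add)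
      then have d: "card C dvd 2 * i" using orbit_period(2)[OF C xy(3)] by (simp add: mult_2)
      have ev: "even (card C)"
      proof (rule ccontr)
        assume "odd (card C)"
        then have "coprime (card C) 2" by simp
        then show False using d nd coprime_dvd_mult_right_iff by blast
      qed
      then obtain h where h: "card C = 2 * h" by blast
      then have "h dvd i" using d by simp
      then obtain q where q: "i = h * q" by blast
      have "odd q" using nd q h by auto
      then obtain t where "q = 2 * t + 1" by (auto elim: oddE)
      then have "i = h + card C * t" using q h by (simp add: algebra_simps)
      then have "i mod card C = (card C div 2) mod card C" using h by simp
      then have "(\<sigma> ^^ i) x = (\<sigma> ^^ (card C div 2)) x" by (simp only: orbit_period(1)[OF C xy(3)])
      then have "e \<in> diameters C"
        using xy ev \<open>(\<sigma> ^^ i) x = y\<close> by (auto simp: diameters_def)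
      then show False using e by blast
    qed
  qed
qed

lemma image_diameters:
  assumes C: "C \<in> orbit \<sigma> ` V"
  shows "(`) \<sigma> ` diameters C = diameters C"
proof (cases "even (card C)")
  case True
  obtain x where "x \<in> C" using orbit_ne[OF C] by blast
  then show ?thesis
    using diameter_orbit(1)[OF C True] image_pair_orbit by metis
qed (simp add: diameters_def)

lemma sum_half:
  fixes f :: "nat \<Rightarrow> nat"
  shows "(\<Sum>u<2 * n. f u) = (\<Sum>k<n. f (2 * k) + f (2 * k + 1))"
  by (induction n) auto

text \<open>This is the factorization of \<open>P\<^sub>a\<close>: each of the
  \<open>(card C - 1) div 2\<close> orbits of chords raises all degrees on the cycle by 2, and for
  even length the single orbit of diameters raises them by 1. The parity of \<open>u\<close> tells
  whether the diameters are taken, so the two choices merge into one coefficient.\<close>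

lemma inner_block:
  assumes C: "C \<in> orbit \<sigma> ` V"
    and A: "finite A" "(`) \<sigma> ` A = A" "all_pairs C \<inter> A = {}"
    and rho: "\<And>v. v \<in> C \<Longrightarrow> \<rho> v = r"
  shows "graph_count V \<sigma> (all_pairs C \<union> A) \<rho> =
    (\<Sum>u\<le>r. (if odd (card C) \<and> odd u then 0 else (card C - 1) div 2 choose (u div 2)) *
        graph_count V \<sigma> A (\<lambda>v. if v \<in> C then r - u else \<rho> v))"
proof -
  let ?a = "card C"
  let ?m = "(?a - 1) div 2"
  let ?N = "all_pairs C - diameters C"
  define G where "G u = graph_count V \<sigma> A (\<lambda>v. if v \<in> C then r - u else \<rho> v)" for u
  obtain x where x: "x \<in> C" using orbit_ne[OF C] by blast
  have pos: "?a > 0" using C card_pos by auto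
  have finC: "finite C" using C finite_in by auto
  have CV: "C \<subseteq> V" using C orbit_subset by auto
  have dsub: "diameters C \<subseteq> all_pairs C"
    using diameter_orbit(3)[OF C _ x] by (auto simp: diameters_def)
  have finD: "finite (diameters C)" using finC by (simp add: diameters_def)
  have invP: "(`) \<sigma> ` all_pairs C = all_pairs C" using image_all_pairs image_orbit[OF C] by blast
  have invN: "(`) \<sigma> ` ?N = ?N"
    using image_set_diff[OF inj_image_perm, of "all_pairs C" "diameters C"] invP image_diameters[OF C] by simp
  have deg2: "degree_in (pair_orbit \<sigma> e) v = (if v \<in> C then 2 * p div ?a else 0)"
    if e: "e \<in> all_pairs C" and p: "card (pair_orbit \<sigma> e) = p" "p > 0" for e v p
  proof (cases "v \<in> C")
    case True
    have "e \<inter> C = e" "card e = 2" using e by (auto simp: all_pairs_def)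
    then have "?a * degree_in (pair_orbit \<sigma> e) v = 2 * p"
      using degree_pair_orbit_in[OF C p _ True, of 2] by simp
    then show ?thesis using True pos by (metis nonzero_mult_div_cancel_left not_gr_zero)
  next
    case False
    then show ?thesis using degree_pair_orbit_out[OF image_orbit[OF C], of e v] e by (auto simp: all_pairs_def)
  qed
  have cardD: "card (diameters C) = (if even ?a then ?a div 2 else 0)"
    using diameter_orbit(2)[OF C _ x] by (auto simp: diameters_def)
  \<comment> \<open>Removing the \<open>?a div 2\<close> diameters of an even cycle from all
    \<open>?a choose 2\<close> pairs leaves a multiple of \<open>?a\<close>; for odd length there is
    nothing to remove.\<close>
  have cardN: "card ?N = ?m * ?a"
  proof -
    have "card ?N = (?a choose 2) - card (diameters C)"
      using card_Diff_subset[OF finD dsub] card_all_pairs[OF finC] by simp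
    also have "\<dots> = ?m * ?a"
    proof (cases "even ?a")
      case True
      then obtain h where h: "?a = 2 * h" by blast
      have "h > 0" using h pos by simp
      then obtain j where j: "h = Suc j" by (cases h) auto
      show ?thesis unfolding cardD using h j by (simp add: choose_two algebra_simps)
    next
      case False
      then obtain h where h: "?a = 2 * h + 1" by (auto elim: oddE)
      show ?thesis unfolding cardD using h False by (simp add: choose_two algebra_simps)
    qed
    finally show ?thesis .
  qed
  have *: "graph_count V \<sigma> (?N \<union> (diameters C \<union> A)) \<rho> =
    (\<Sum>k\<le>?m. (?m choose k) * (if \<forall>v\<in>V. k * (if v \<in> C then 2 else 0) \<le> \<rho> v
        then graph_count V \<sigma> (diameters C \<union> A) (\<lambda>v. \<rho> v - k * (if v \<in> C then 2 else 0)) else 0))"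
  proof (rule graph_count_block[where p = "?a"])
    show "degree_in (pair_orbit \<sigma> e) v = (if v \<in> C then 2 else 0)" if "e \<in> ?N" "v \<in> V" for e v
      using deg2[OF _ chord_orbit[OF C] pos, of e v] that pos by simp
    show "(`) \<sigma> ` (diameters C \<union> A) = diameters C \<union> A"
      using image_diameters[OF C] A by (simp add: image_Un)
    show "?N \<inter> (diameters C \<union> A) = {}" using A(3) by auto
  qed (use finC finD A cardN invN pos chord_orbit[OF C] in auto)
  \<comment> \<open>After the chords have used up \<open>2 * k\<close>, the diameters of an even
    cycle are all taken or all left, since they form a single orbit.\<close>
  have Dm: "graph_count V \<sigma> (diameters C \<union> A) (\<lambda>v. \<rho> v - k * (if v \<in> C then 2 else 0)) =
      G (2 * k) + (if odd ?a \<or> 2 * k + 1 > r then 0 else G (2 * k + 1))" for k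
  proof (cases "odd ?a")
    case True
    then show ?thesis
      unfolding G_def by (simp add: diameters_def) (rule graph_count_cong, use rho in auto)
  next
    case ev: False
    let ?\<rho> = "\<lambda>v. \<rho> v - k * (if v \<in> C then 2 else 0)"
    have h: "?a div 2 > 0" "2 * (?a div 2) = ?a" using ev pos by auto
    have "graph_count V \<sigma> (diameters C \<union> A) ?\<rho> =
      (\<Sum>j\<le>1. (1 choose j) * (if \<forall>v\<in>V. j * (if v \<in> C then 1 else 0) \<le> ?\<rho> v
        then graph_count V \<sigma> A (\<lambda>v. ?\<rho> v - j * (if v \<in> C then 1 else 0)) else 0))"
    proof (rule graph_count_block[where p = "?a div 2"])
      show cp: "card (pair_orbit \<sigma> e) = ?a div 2" if "e \<in> diameters C" for e
        using that ev diameter_orbit(1,2)[OF C] by (auto simp: diameters_def)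
      show "degree_in (pair_orbit \<sigma> e) v = (if v \<in> C then 1 else 0)"
        if "e \<in> diameters C" "v \<in> V" for e v
      proof -
        have "e \<in> all_pairs C" using that dsub by blast
        then have "degree_in (pair_orbit \<sigma> e) v = (if v \<in> C then 2 * (?a div 2) div ?a else 0)"
          by (rule deg2[OF _ cp[OF that(1)] h(1)])
        then show ?thesis using h pos by simp
      qed
      show "diameters C \<inter> A = {}" using A dsub by auto
    qed (use finD A cardD ev h image_diameters[OF C] in auto)
    also have "\<dots> = G (2 * k) + (if \<forall>v\<in>V. (if v \<in> C then 1 else 0) \<le> ?\<rho> v then G (2 * k + 1) else 0)"
    proof -
      have "graph_count V \<sigma> A ?\<rho> = G (2 * k)"
        unfolding G_def by (rule graph_count_cong) (use rho in auto)
      moreover have "graph_count V \<sigma> A (\<lambda>v. ?\<rho> v - (if v \<in> C then 1 else 0)) = G (2 * k + 1)"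
        unfolding G_def by (rule graph_count_cong) (use rho in auto)
      ultimately show ?thesis by (simp add: numeral_eq_Suc cong: if_cong)
    qed
    also have "(\<forall>v\<in>V. (if v \<in> C then 1 else 0) \<le> ?\<rho> v) \<longleftrightarrow> 2 * k + 1 \<le> r"
      using rho CV x by auto
    finally show ?thesis using ev by auto
  qed
  define c where "c u = (if odd ?a \<and> odd u then 0 else ?m choose (u div 2))" for u
  have eq: "all_pairs C \<union> A = ?N \<union> (diameters C \<union> A)" using dsub by auto
  have cond: "(\<forall>v\<in>V. k * (if v \<in> C then 2 else 0) \<le> \<rho> v) \<longleftrightarrow> 2 * k \<le> r" for k
    using rho CV x by auto
  have "graph_count V \<sigma> (all_pairs C \<union> A) \<rho> =
    (\<Sum>k\<le>?m. (?m choose k) * (if 2 * k \<le> r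
        then G (2 * k) + (if odd ?a \<or> 2 * k + 1 > r then 0 else G (2 * k + 1)) else 0))"
    (is "_ = (\<Sum>k\<le>?m. ?f k)")
    unfolding eq * Dm cond ..
  \<comment> \<open>The range is enlarged beyond both \<open>?m\<close> and \<open>r\<close>, where
    all terms vanish, so that even and odd \<open>u\<close> can be paired up without boundary
    cases.\<close>
  also have "\<dots> = (\<Sum>k<?m + r + 1. ?f k)"
    by (rule sum.mono_neutral_left) auto
  also have "\<dots> = (\<Sum>k<?m + r + 1. (if 2 * k \<le> r then c (2 * k) * G (2 * k) else 0) +
      (if 2 * k + 1 \<le> r then c (2 * k + 1) * G (2 * k + 1) else 0))"
    by (rule sum.cong) (auto simp: c_def algebra_simps)
  also have "\<dots> = (\<Sum>u<2 * (?m + r + 1). if u \<le> r then c u * G u else 0)"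
    by (rule sum_half[symmetric])
  also have "\<dots> = (\<Sum>u\<in>{u\<in>{..<2 * (?m + r + 1)}. u \<le> r}. c u * G u)"
    by (rule sum.inter_filter[symmetric]) simp
  also have "{u\<in>{..<2 * (?m + r + 1)}. u \<le> r} = {..r}" by auto
  finally show ?thesis by (simp add: c_def G_def)
qed

end

section \<open>The recurrence, one cycle after another\<close>

definition bump :: "state \<Rightarrow> nat \<times> nat \<Rightarrow> state" where
  "bump M q = M(q := Suc (M q))"

text \<open>A cycle of residual degree 0 meets no further edge, and normalized states have no entry
  for it.\<close>

definition drop_zero :: "state \<Rightarrow> state" where
  "drop_zero M = (\<lambda>(b, t). if t = 0 then 0 else M (b, t))"

text \<open>The recurrence before aggregation. The other cycles are processed along a list of their
  types; \<open>B\<close> is the degree that the deleted cycle still lacks, and \<open>M\<close>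
  collects the types of the processed cycles with their residual degrees.\<close>

primrec orbit_sum :: "(state \<Rightarrow> nat) \<Rightarrow> nat \<Rightarrow> (nat \<times> nat) list \<Rightarrow> nat \<Rightarrow> state \<Rightarrow> nat" where
  "orbit_sum G a [] B M = (if B = 0 then G (drop_zero M) else 0)"
| "orbit_sum G a (p # L) B M = (case p of (b, s) \<Rightarrow>
     \<Sum>k\<le>gcd a b. (gcd a b choose k) *
       (if k * (b div gcd a b) \<le> B \<and> k * (a div gcd a b) \<le> s
        then orbit_sum G a L (B - k * (b div gcd a b)) (bump M (b, s - k * (a div gcd a b))) else 0))"

text \<open>The choice of a point is harmless wherever \<rho> is constant on cycles.\<close>

definition orbit_type :: "('v \<Rightarrow> nat) \<Rightarrow> 'v set \<Rightarrow> nat \<times> nat" where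
  "orbit_type \<rho> D = (card D, \<rho> (SOME v. v \<in> D))"

definition profile :: "('v \<Rightarrow> nat) \<Rightarrow> 'v set set \<Rightarrow> state" where
  "profile \<rho> R = (\<lambda>q. card {D \<in> R. orbit_type \<rho> D = q})"

lemma orbit_type_eq: "v \<in> D \<Longrightarrow> (\<And>w. w \<in> D \<Longrightarrow> \<rho> w = s) \<Longrightarrow> orbit_type \<rho> D = (card D, s)"
  using someI[of "\<lambda>v. v \<in> D" v] by (simp add: orbit_type_def)

lemma orbit_type_cong: "v \<in> D \<Longrightarrow> (\<And>w. w \<in> D \<Longrightarrow> \<rho> w = \<rho>' w) \<Longrightarrow> orbit_type \<rho> D = orbit_type \<rho>' D"
  using someI[of "\<lambda>v. v \<in> D" v] by (simp add: orbit_type_def)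

context finite_perm
begin

text \<open>The end of the traversal. No admissible pair touches \<open>C\<close> any more, so the
  residual degree of \<open>C\<close> must be 0. What remains is a realization on fewer points once
  all points of degree 0 are removed, and there \<open>G\<close> is known to be correct.\<close>

lemma graph_count_rest:
  assumes C: "C \<in> orbit \<sigma> ` V" and B: "\<And>v. v \<in> C \<Longrightarrow> \<rho> v = B"
    and const: "\<And>v w. v \<in> V \<Longrightarrow> w \<in> orbit \<sigma> v \<Longrightarrow> \<rho> w = \<rho> v"
    and le: "\<And>v. v \<in> V \<Longrightarrow> \<rho> v \<le> d"
    and IH: "\<And>V' \<sigma>' \<rho>' H. realization d H (V' :: 'v set) \<sigma>' \<rho>' \<Longrightarrow> card V' < card V
        \<Longrightarrow> card (fixed_graphs V' \<sigma>' \<rho>') = G H"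
  shows "graph_count V \<sigma> (all_pairs (V - C)) \<rho> =
    (if B = 0 then G (drop_zero (profile \<rho> (orbit \<sigma> ` V - {C}))) else 0)"
proof -
  obtain x where x: "x \<in> C" "x \<in> V" using orbit_ne[OF C] orbit_subset[OF C] by blast
  have out: "degree_in E v = 0" if "E \<subseteq> all_pairs A" "v \<notin> A" for E v and A :: "'v set"
    by (rule degree_zero) (use that in \<open>auto simp: all_pairs_def\<close>)
  show ?thesis
  proof (cases "B = 0")
    case False
    have empty: "{E \<in> inv_sets \<sigma> (all_pairs (V - C)). \<forall>v\<in>V. degree_in E v = \<rho> v} = {}"
    proof -
      have "degree_in E x = 0" if "E \<in> inv_sets \<sigma> (all_pairs (V - C))" for E
        using that out[of E "V - C" x] x by (auto simp: inv_sets_def)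
      then show ?thesis using B[OF x(1)] x False by force
    qed
    show ?thesis unfolding graph_count_def empty using False by simp
  next
    case True
    \<comment> \<open>Points of residual degree 0 are isolated in the remaining graph; they have to
      go because a realization requires degrees of at least 1.\<close>
    define V' where "V' = {v \<in> V - C. \<rho> v \<noteq> 0}"
    define \<sigma>' where "\<sigma>' = perm_restrict \<sigma> V'"
    have V'V: "V' \<subseteq> V" by (auto simp: V'_def)
    have rC: "\<rho> v = 0" if "v \<in> C" for v using B True that by simp
    have mem: "w \<in> V' \<longleftrightarrow> v \<in> V'" if "v \<in> V" "w \<in> orbit \<sigma> v" for v w
    proof -
      have "w \<in> V" using that permutes_orbit_subset[OF perm] by blast
      moreover have "\<rho> w = \<rho> v" using const that by blast
      moreover have "w \<in> C \<longleftrightarrow> v \<in> C"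
        using orbit_in[OF C] orbit_eq[OF that(2)] that(2) self_orbit by metis
      ultimately show ?thesis using that by (auto simp: V'_def)
    qed
    have closed: "\<sigma> v \<in> V'" if "v \<in> V'" for v
      using mem[of v "\<sigma> v"] that V'V by (auto intro: orbit.base)
    have sig: "\<sigma>' v = \<sigma> v" if "v \<in> V'" for v using that by (simp add: \<sigma>'_def perm_restrict_def)
    have "\<sigma> ` V' = V'"
    proof (rule card_subset_eq)
      show "finite V'" using V'V fin finite_subset by blast
      show "\<sigma> ` V' \<subseteq> V'" using closed by blast
      show "card (\<sigma> ` V') = card V'"
        using permutes_inj[OF perm] by (simp add: card_image inj_on_subset[of _ UNIV])
    qed
    then have bij: "bij_betw \<sigma>' V' V'"
      using sig permutes_inj[OF perm] unfolding bij_betw_def inj_on_def inj_def by force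
    have perm': "\<sigma>' permutes V'"
      by (rule bij_imp_permutes[OF bij]) (simp add: \<sigma>'_def perm_restrict_def)
    have orb': "orbit \<sigma>' v = orbit \<sigma> v" if "v \<in> V'" for v
      by (rule orbit_cong[OF self_orbit])
        (use mem[of v] that V'V sig in blast)
    let ?Os = "orbit \<sigma> ` V - {C}"
    have otyp: "orbit_type \<rho> (orbit \<sigma> v) = (card (orbit \<sigma> v), \<rho> v)" if "v \<in> V" for v
      by (rule orbit_type_eq[OF self_orbit]) (use const that in blast)
    have "card {D \<in> orbit \<sigma>' ` V'. card D = a \<and> (\<forall>v\<in>D. \<rho> v = r)} =
        drop_zero (profile \<rho> ?Os) (a, r)" for a r
    proof (cases "r = 0")
      case True
      have empty: "{D \<in> orbit \<sigma>' ` V'. card D = a \<and> (\<forall>v\<in>D. \<rho> v = r)} = {}"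
        using orb' self_orbit True by (fastforce simp: V'_def)
      show ?thesis unfolding empty using True by (simp add: drop_zero_def)
    next
      case False
      have "{D \<in> orbit \<sigma>' ` V'. card D = a \<and> (\<forall>v\<in>D. \<rho> v = r)} = {D \<in> ?Os. orbit_type \<rho> D = (a, r)}"
      proof (intro equalityI subsetI)
        fix D assume "D \<in> {D \<in> orbit \<sigma>' ` V'. card D = a \<and> (\<forall>v\<in>D. \<rho> v = r)}"
        then obtain v where v: "v \<in> V'" "D = orbit \<sigma> v" "card D = a" "\<forall>v\<in>D. \<rho> v = r"
          using orb' by auto
        moreover have "D \<noteq> C" using v self_orbit by (auto simp: V'_def)
        moreover have "orbit_type \<rho> D = (a, r)" using otyp[of v] v V'V self_orbit by auto
        ultimately show "D \<in> {D \<in> ?Os. orbit_type \<rho> D = (a, r)}" using V'V by auto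
      next
        fix D assume "D \<in> {D \<in> ?Os. orbit_type \<rho> D = (a, r)}"
        then obtain v where v: "v \<in> V" "D = orbit \<sigma> v" "D \<noteq> C" "orbit_type \<rho> D = (a, r)" by auto
        then have "\<rho> v = r" "card D = a" using otyp by auto
        moreover have "v \<notin> C" using v orbit_in[OF C] by metis
        ultimately have "v \<in> V'" using v False by (simp add: V'_def)
        moreover have "\<forall>w\<in>D. \<rho> w = r" using const v \<open>\<rho> v = r\<close> by auto
        ultimately show "D \<in> {D \<in> orbit \<sigma>' ` V'. card D = a \<and> (\<forall>v\<in>D. \<rho> v = r)}"
          using orb' v \<open>card D = a\<close> by auto
      qed
      then show ?thesis using False by (simp add: drop_zero_def profile_def)
    qed
    moreover have "finite V'" by (rule finite_subset[OF V'V fin])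
    ultimately have real: "realization d (drop_zero (profile \<rho> ?Os)) V' \<sigma>' \<rho>"
      unfolding realization_def using perm' le const orb' V'V by (auto simp: V'_def)
    have "card V' < card V"
      by (rule psubset_card_mono[OF fin]) (use V'V x in \<open>auto simp: V'_def\<close>)
    then have "card (fixed_graphs V' \<sigma>' \<rho>) = G (drop_zero (profile \<rho> ?Os))" by (rule IH[OF real])
    moreover have "{E \<in> inv_sets \<sigma> (all_pairs (V - C)). \<forall>v\<in>V. degree_in E v = \<rho> v} = fixed_graphs V' \<sigma>' \<rho>"
    proof -
      have img: "(`) \<sigma> ` E = (`) \<sigma>' ` E" if "E \<subseteq> all_pairs V'" for E
      proof (rule image_cong[OF refl])
        fix e assume "e \<in> E"
        then have "e \<subseteq> V'" using that by (auto simp: all_pairs_def)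
        then show "\<sigma> ` e = \<sigma>' ` e" using sig by (intro image_cong) auto
      qed
      have sub: "E \<subseteq> all_pairs V'" if E: "E \<subseteq> all_pairs (V - C)" and "\<forall>v\<in>V. degree_in E v = \<rho> v" for E
      proof
        fix e assume e: "e \<in> E"
        have "v \<in> V'" if "v \<in> e" for v
        proof -
          have v: "v \<in> V - C" using E e that by (auto simp: all_pairs_def)
          have "finite E" by (rule finite_subset[OF E]) (use fin in simp)
          then have "finite {e \<in> E. v \<in> e}" by simp
          moreover have "e \<in> {e \<in> E. v \<in> e}" using e that by blast
          ultimately have "degree_in E v > 0" unfolding degree_in_def using card_gt_0_iff by blast
          then show ?thesis using v assms(2) \<open>\<forall>v\<in>V. degree_in E v = \<rho> v\<close> by (auto simp: V'_def)
        qed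
        moreover have "card e = 2" using E e by (auto simp: all_pairs_def)
        ultimately show "e \<in> all_pairs V'" by (auto simp: all_pairs_def)
      qed
      show ?thesis
      proof (intro equalityI subsetI)
        fix E assume "E \<in> {E \<in> inv_sets \<sigma> (all_pairs (V - C)). \<forall>v\<in>V. degree_in E v = \<rho> v}"
        then have E: "E \<subseteq> all_pairs (V - C)" "(`) \<sigma> ` E = E" "\<forall>v\<in>V. degree_in E v = \<rho> v"
          by (auto simp: inv_sets_def)
        note s = sub[OF E(1,3)]
        show "E \<in> fixed_graphs V' \<sigma>' \<rho>"
          unfolding fixed_graphs_def using s img[OF s] E V'V by auto
      next
        fix E assume "E \<in> fixed_graphs V' \<sigma>' \<rho>"
        then have E: "E \<subseteq> all_pairs V'" "(`) \<sigma>' ` E = E" "\<forall>v\<in>V'. degree_in E v = \<rho> v"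
          by (auto simp: fixed_graphs_def)
        have "all_pairs V' \<subseteq> all_pairs (V - C)" by (auto simp: all_pairs_def V'_def)
        moreover have "degree_in E v = \<rho> v" if "v \<in> V" for v
        proof (cases "v \<in> V'")
          case False
          then have "\<rho> v = 0" using rC that by (auto simp: V'_def)
          then show ?thesis using out[OF E(1) False] by simp
        qed (use E in auto)
        ultimately show "E \<in> {E \<in> inv_sets \<sigma> (all_pairs (V - C)). \<forall>v\<in>V. degree_in E v = \<rho> v}"
          using E img[OF E(1)] by (auto simp: inv_sets_def)
      qed
    qed
    ultimately show ?thesis using True by (simp add: graph_count_def)
  qed
qed

text \<open>Induction over the cycles not yet joined to \<open>C\<close>, with \<rho> and
  \<open>B\<close> generalized because \<open>join_block\<close> lowers both. The current cycle
  \<open>D\<close> moves from the list into the profile with its new type, while all other types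
  stay the same because cycles are disjoint.\<close>

lemma graph_count_orbits:
  assumes C: "C \<in> orbit \<sigma> ` V"
    and IH: "\<And>V' \<sigma>' \<rho>' H. realization d H (V' :: 'v set) \<sigma>' \<rho>' \<Longrightarrow> card V' < card V
        \<Longrightarrow> card (fixed_graphs V' \<sigma>' \<rho>') = G H"
  shows "distinct Ds \<Longrightarrow> set Ds \<subseteq> orbit \<sigma> ` V - {C} \<Longrightarrow> (\<And>v. v \<in> C \<Longrightarrow> \<rho> v = B) \<Longrightarrow>
    (\<And>v w. v \<in> V \<Longrightarrow> w \<in> orbit \<sigma> v \<Longrightarrow> \<rho> w = \<rho> v) \<Longrightarrow> (\<And>v. v \<in> V \<Longrightarrow> \<rho> v \<le> d) \<Longrightarrow>
    graph_count V \<sigma> ((\<Union>D\<in>set Ds. join_pairs C D) \<union> all_pairs (V - C)) \<rho> =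
      orbit_sum G (card C) (map (orbit_type \<rho>) Ds) B (profile \<rho> (orbit \<sigma> ` V - {C} - set Ds))"
proof (induction Ds arbitrary: \<rho> B)
  case Nil
  show ?case using graph_count_rest[OF C Nil(3) Nil(4) Nil(5) IH] by simp
next
  case (Cons D Ds)
  let ?a = "card C" and ?b = "card D"
  let ?g = "gcd ?a ?b"
  let ?A = "(\<Union>D\<in>set Ds. join_pairs C D) \<union> all_pairs (V - C)"
  have D: "D \<in> orbit \<sigma> ` V" "D \<noteq> C" "D \<notin> set Ds" using Cons.prems by auto
  obtain y where y: "y \<in> D" using orbit_ne[OF D(1)] by blast
  define s where "s = \<rho> y"
  have dj: "D' \<inter> D = {}" if "D' \<in> orbit \<sigma> ` V" "D' \<noteq> D" for D'
    using orbits_disjoint[OF that(1) D(1) that(2)] .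
  have djC: "D' \<inter> C = {}" if "D' \<in> orbit \<sigma> ` V" "D' \<noteq> C" for D'
    using orbits_disjoint[OF that(1) C that(2)] .
  have rD: "\<rho> v = s" if "v \<in> D" for v
    using Cons.prems(4)[of y v] that y orbit_in[OF D(1) y] orbit_subset[OF D(1)] by (auto simp: s_def)
  have typD: "orbit_type \<rho> D = (?b, s)" by (rule orbit_type_eq[OF y rD])
  have inv: "(`) \<sigma> ` ?A = ?A"
  proof -
    have "(`) \<sigma> ` (\<Union>D\<in>set Ds. join_pairs C D) = (\<Union>D\<in>set Ds. (`) \<sigma> ` join_pairs C D)"
      by (rule image_UN)
    also have "\<dots> = (\<Union>D\<in>set Ds. join_pairs C D)"
    proof (rule SUP_cong[OF refl])
      fix D' assume "D' \<in> set Ds"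
      then have "D' \<in> orbit \<sigma> ` V" using Cons.prems(2) by auto
      then show "(`) \<sigma> ` join_pairs C D' = join_pairs C D'"
        by (intro image_join_pairs image_orbit C)
    qed
    moreover have "\<sigma> ` (V - C) = V - C"
      using image_set_diff[OF permutes_inj[OF perm], of V C] permutes_image[OF perm] image_orbit[OF C] by simp
    ultimately show ?thesis using image_all_pairs[of "V - C"] by (simp add: image_Un)
  qed
  have finA: "finite ?A"
  proof -
    have "finite (join_pairs C D')" if "D' \<in> set Ds" for D'
    proof -
      have "D' \<in> orbit \<sigma> ` V" using that Cons.prems(2) by auto
      then show ?thesis using finite_in C by (simp add: join_pairs_def)
    qed
    then show ?thesis using fin by simp
  qed
  have disj: "join_pairs C D \<inter> ?A = {}"
  proof -
    have "join_pairs C D \<inter> join_pairs C D' = {}" if "D' \<in> set Ds" for D'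
    proof -
      have D': "D' \<in> orbit \<sigma> ` V" "D' \<noteq> C" "D' \<noteq> D" using that Cons.prems D by auto
      show ?thesis
        using dj[OF D'(1,3)] djC[OF D'(1,2)] djC[OF D(1,2)]
        by (auto simp: join_pairs_def doubleton_eq_iff)
    qed
    moreover have "join_pairs C D \<inter> all_pairs (V - C) = {}"
      by (auto simp: join_pairs_def all_pairs_def)
    ultimately show ?thesis by blast
  qed
  have "graph_count V \<sigma> ((\<Union>D\<in>set (D # Ds). join_pairs C D) \<union> all_pairs (V - C)) \<rho> =
    graph_count V \<sigma> (join_pairs C D \<union> ?A) \<rho>"
    by (simp add: Un_assoc)
  also have "\<dots> = (\<Sum>k\<le>?g. (?g choose k) * (if k * (?b div ?g) \<le> B \<and> k * (?a div ?g) \<le> s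
        then graph_count V \<sigma> ?A (\<lambda>v. \<rho> v - k * (if v \<in> C then ?b div ?g
           else if v \<in> D then ?a div ?g else 0)) else 0))"
    by (rule join_block[OF C D(1) _ finA inv disj]) (use D Cons.prems rD in auto)
  also have "\<dots> = (\<Sum>k\<le>?g. (?g choose k) * (if k * (?b div ?g) \<le> B \<and> k * (?a div ?g) \<le> s
        then orbit_sum G ?a (map (orbit_type \<rho>) Ds) (B - k * (?b div ?g))
          (bump (profile \<rho> (orbit \<sigma> ` V - {C} - set (D # Ds))) (?b, s - k * (?a div ?g))) else 0))"
  proof (rule sum.cong[OF refl])
    fix k
    let ?\<rho> = "\<lambda>v. \<rho> v - k * (if v \<in> C then ?b div ?g else if v \<in> D then ?a div ?g else 0)"
    have same: "orbit_type ?\<rho> D' = orbit_type \<rho> D'" if D': "D' \<in> orbit \<sigma> ` V" "D' \<noteq> C" "D' \<noteq> D" for D'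
    proof -
      obtain z where "z \<in> D'" using orbit_ne[OF D'(1)] by blast
      then show ?thesis
        by (rule orbit_type_cong) (use dj[OF D'(1,3)] djC[OF D'(1,2)] in auto)
    qed
    have typD': "orbit_type ?\<rho> D = (?b, s - k * (?a div ?g))"
      by (rule orbit_type_eq[OF y]) (use rD djC[OF D(1,2)] in auto)
    have "graph_count V \<sigma> ?A ?\<rho> =
      orbit_sum G ?a (map (orbit_type ?\<rho>) Ds) (B - k * (?b div ?g))
        (profile ?\<rho> (orbit \<sigma> ` V - {C} - set Ds))"
    proof (rule Cons.IH)
      show "distinct Ds" "set Ds \<subseteq> orbit \<sigma> ` V - {C}" using Cons.prems by auto
      show "?\<rho> v = B - k * (?b div ?g)" if "v \<in> C" for v using that Cons.prems(3) by simp
      show "?\<rho> v \<le> d" if "v \<in> V" for v using Cons.prems(5)[OF that] by simp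
      show "?\<rho> w = ?\<rho> v" if "v \<in> V" "w \<in> orbit \<sigma> v" for v w
      proof -
        have "w \<in> C \<longleftrightarrow> v \<in> C" "w \<in> D \<longleftrightarrow> v \<in> D"
          using orbit_in[OF C] orbit_in[OF D(1)] orbit_eq[OF that(2)] that(2) self_orbit by metis+
        then show ?thesis using Cons.prems(4)[OF that] by simp
      qed
    qed
    also have "map (orbit_type ?\<rho>) Ds = map (orbit_type \<rho>) Ds"
    proof (rule map_cong[OF refl])
      fix X assume "X \<in> set Ds"
      then show "orbit_type ?\<rho> X = orbit_type \<rho> X"
        using Cons.prems(2) D(3) by (intro same) auto
    qed
    also have "profile ?\<rho> (orbit \<sigma> ` V - {C} - set Ds) =
      bump (profile \<rho> (orbit \<sigma> ` V - {C} - set (D # Ds))) (?b, s - k * (?a div ?g))"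
    proof
      fix q
      let ?R = "orbit \<sigma> ` V - {C} - set (D # Ds)"
      have R: "orbit \<sigma> ` V - {C} - set Ds = insert D ?R" using D by auto
      have eq: "{X \<in> insert D ?R. orbit_type ?\<rho> X = q} =
          (if q = (?b, s - k * (?a div ?g)) then {D} else {}) \<union> {X \<in> ?R. orbit_type \<rho> X = q}"
      proof -
        have sameR: "orbit_type ?\<rho> X = orbit_type \<rho> X" if "X \<in> ?R" for X
          using that by (intro same) auto
        show ?thesis
        proof (intro equalityI subsetI)
          fix X assume "X \<in> {X \<in> insert D ?R. orbit_type ?\<rho> X = q}"
          then consider "X = D" "orbit_type ?\<rho> D = q" | "X \<in> ?R" "orbit_type ?\<rho> X = q" by blast
          then show "X \<in> (if q = (?b, s - k * (?a div ?g)) then {D} else {}) \<union> {X \<in> ?R. orbit_type \<rho> X = q}"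
          proof cases
            case 1
            then show ?thesis unfolding typD' by simp
          next
            case 2
            then show ?thesis using sameR[OF 2(1)] by simp
          qed
        next
          fix X assume "X \<in> (if q = (?b, s - k * (?a div ?g)) then {D} else {}) \<union> {X \<in> ?R. orbit_type \<rho> X = q}"
          then consider "X = D" "q = (?b, s - k * (?a div ?g))" | "X \<in> ?R" "orbit_type \<rho> X = q"
            by (auto split: if_splits)
          then show "X \<in> {X \<in> insert D ?R. orbit_type ?\<rho> X = q}"
          proof cases
            case 1
            then show ?thesis using typD' by blast
          next
            case 2
            then show ?thesis using sameR[OF 2(1)] by simp
          qed
        qed
      qed
      have "finite ?R" using fin by simp
      then show "profile ?\<rho> (orbit \<sigma> ` V - {C} - set Ds) q =
          bump (profile \<rho> ?R) (?b, s - k * (?a div ?g)) q"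
        unfolding profile_def R eq bump_def by simp
    qed
    finally show "(?g choose k) * (if k * (?b div ?g) \<le> B \<and> k * (?a div ?g) \<le> s
        then graph_count V \<sigma> ?A ?\<rho> else 0) = (?g choose k) * (if k * (?b div ?g) \<le> B \<and> k * (?a div ?g) \<le> s
        then orbit_sum G ?a (map (orbit_type \<rho>) Ds) (B - k * (?b div ?g))
          (bump (profile \<rho> (orbit \<sigma> ` V - {C} - set (D # Ds))) (?b, s - k * (?a div ?g))) else 0)"
      by simp
  qed
  finally show ?case by (simp only: list.map orbit_sum.simps typD prod.case)
qed

text \<open>\<open>G\<close> stands for any function that gives the right count on realizations with
  fewer points. In this form the recurrence can be used inside the induction that shows the count to
  be independent of the realization, before \<open>Phi\<close> has a meaning.\<close>

lemma fixed_graphs_recurrence: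
  assumes R: "realization d H V \<sigma> \<rho>" and C: "C \<in> orbit \<sigma> ` V" and r: "\<And>v. v \<in> C \<Longrightarrow> \<rho> v = r"
    and IH: "\<And>V' \<sigma>' \<rho>' H. realization d H (V' :: 'v set) \<sigma>' \<rho>' \<Longrightarrow> card V' < card V
        \<Longrightarrow> card (fixed_graphs V' \<sigma>' \<rho>') = G H"
    and Ds: "distinct Ds" "set Ds = orbit \<sigma> ` V - {C}"
  shows "card (fixed_graphs V \<sigma> \<rho>) =
    (\<Sum>u\<le>r. (if odd (card C) \<and> odd u then 0 else (card C - 1) div 2 choose (u div 2)) *
        orbit_sum G (card C) (map (orbit_type \<rho>) Ds) (r - u) (\<lambda>_. 0))"
proof -
  let ?A = "(\<Union>D\<in>set Ds. join_pairs C D) \<union> all_pairs (V - C)"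
  have const: "\<And>v w. v \<in> V \<Longrightarrow> w \<in> orbit \<sigma> v \<Longrightarrow> \<rho> w = \<rho> v" and le: "\<And>v. v \<in> V \<Longrightarrow> \<rho> v \<le> d"
    using R by (auto simp: realization_def)
  obtain x where x: "x \<in> C" "x \<in> V" using orbit_ne[OF C] orbit_subset[OF C] by blast
  have rd: "r \<le> d" using le[OF x(2)] r[OF x(1)] by simp
  have djC: "D' \<inter> C = {}" if "D' \<in> orbit \<sigma> ` V" "D' \<noteq> C" for D'
    using orbits_disjoint[OF that(1) C that(2)] .
  have V: "V = C \<union> (\<Union>D\<in>set Ds. D)"
  proof (intro equalityI subsetI)
    fix v assume "v \<in> V"
    then have "orbit \<sigma> v \<in> insert C (set Ds)" unfolding Ds(2) by simp
    then show "v \<in> C \<union> (\<Union>D\<in>set Ds. D)" using self_orbit[of v] by auto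
  next
    fix v assume "v \<in> C \<union> (\<Union>D\<in>set Ds. D)"
    then obtain D where "D \<in> orbit \<sigma> ` V" "v \<in> D" using C Ds by auto
    then show "v \<in> V" using orbit_subset by auto
  qed
  have eq: "all_pairs V = all_pairs C \<union> ?A"
  proof (intro equalityI subsetI)
    fix e assume "e \<in> all_pairs V"
    then obtain x y where xy: "e = {x, y}" "x \<noteq> y" "x \<in> V" "y \<in> V" by (rule all_pairs_elim)
    have j: "{u, v} \<in> (\<Union>D\<in>set Ds. join_pairs C D)" if uv: "u \<in> C" "v \<in> V" "v \<notin> C" for u v
    proof -
      obtain D where "D \<in> set Ds" "v \<in> D" using V uv by blast
      then show ?thesis using uv by (auto simp: join_pairs_def)
    qed
    consider "x \<in> C" "y \<in> C" | "x \<in> C" "y \<notin> C" | "x \<notin> C" "y \<in> C" | "x \<notin> C" "y \<notin> C" by blast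
    then show "e \<in> all_pairs C \<union> ?A"
    proof cases
      case 1
      then show ?thesis using xy by (simp add: all_pairs_def)
    next
      case 2
      then show ?thesis using j[of x y] xy by blast
    next
      case 3
      then show ?thesis using j[of y x] xy by (simp add: insert_commute)
    next
      case 4
      then show ?thesis using xy by (simp add: all_pairs_def)
    qed
  next
    fix e assume "e \<in> all_pairs C \<union> ?A"
    moreover have "join_pairs C D \<subseteq> all_pairs V" if "D \<in> set Ds" for D
    proof -
      have "D \<in> orbit \<sigma> ` V" "D \<noteq> C" using that Ds by auto
      then have "D \<subseteq> V" "D \<inter> C = {}" using orbit_subset djC by auto
      then show ?thesis using orbit_subset[OF C] by (auto simp: join_pairs_def all_pairs_def card_insert_if)
    qed
    moreover have "all_pairs C \<subseteq> all_pairs V" "all_pairs (V - C) \<subseteq> all_pairs V"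
      using orbit_subset[OF C] by (auto simp: all_pairs_def)
    ultimately show "e \<in> all_pairs V" by blast
  qed
  have inv: "(`) \<sigma> ` ?A = ?A"
  proof -
    have "(`) \<sigma> ` (\<Union>D\<in>set Ds. join_pairs C D) = (\<Union>D\<in>set Ds. (`) \<sigma> ` join_pairs C D)"
      by (rule image_UN)
    also have "\<dots> = (\<Union>D\<in>set Ds. join_pairs C D)"
    proof (rule SUP_cong[OF refl])
      fix D' assume "D' \<in> set Ds"
      then have "D' \<in> orbit \<sigma> ` V" using Ds by auto
      then show "(`) \<sigma> ` join_pairs C D' = join_pairs C D'"
        by (intro image_join_pairs image_orbit C)
    qed
    moreover have "\<sigma> ` (V - C) = V - C"
      using image_set_diff[OF permutes_inj[OF perm], of V C] permutes_image[OF perm] image_orbit[OF C] by simp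
    ultimately show ?thesis using image_all_pairs[of "V - C"] by (simp add: image_Un)
  qed
  have finA: "finite ?A"
    by (rule finite_subset[OF _ finite_all_pairs[OF fin]]) (simp only: eq Un_upper2)
  have disj: "all_pairs C \<inter> ?A = {}"
  proof -
    have "all_pairs C \<inter> join_pairs C D = {}" if "D \<in> set Ds" for D
    proof -
      have "D \<in> orbit \<sigma> ` V" "D \<noteq> C" using that Ds by auto
      then show ?thesis using djC by (auto simp: join_pairs_def all_pairs_def)
    qed
    moreover have "all_pairs C \<inter> all_pairs (V - C) = {}"
    proof (rule equals0I)
      fix e assume "e \<in> all_pairs C \<inter> all_pairs (V - C)"
      then have "e \<in> all_pairs C" "e \<subseteq> V - C" by (auto simp: all_pairs_def)
      then show False using all_pairs_elim[of e C] by blast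
    qed
    ultimately show ?thesis by blast
  qed
  have "card (fixed_graphs V \<sigma> \<rho>) = graph_count V \<sigma> (all_pairs C \<union> ?A) \<rho>"
    unfolding card_fixed_graphs eq ..
  also have "\<dots> = (\<Sum>u\<le>r. (if odd (card C) \<and> odd u then 0 else (card C - 1) div 2 choose (u div 2)) *
        graph_count V \<sigma> ?A (\<lambda>v. if v \<in> C then r - u else \<rho> v))"
    by (rule inner_block[OF C finA inv disj r])
  also have "\<dots> = (\<Sum>u\<le>r. (if odd (card C) \<and> odd u then 0 else (card C - 1) div 2 choose (u div 2)) *
        orbit_sum G (card C) (map (orbit_type \<rho>) Ds) (r - u) (\<lambda>_. 0))"
  proof (rule sum.cong[OF refl])
    fix u
    let ?\<rho> = "\<lambda>v. if v \<in> C then r - u else \<rho> v"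
    have "graph_count V \<sigma> ?A ?\<rho> = orbit_sum G (card C) (map (orbit_type ?\<rho>) Ds) (r - u)
      (profile ?\<rho> (orbit \<sigma> ` V - {C} - set Ds))"
    proof (rule graph_count_orbits[OF C IH])
      show "distinct Ds" "set Ds \<subseteq> orbit \<sigma> ` V - {C}" using Ds by auto
      show "?\<rho> v = r - u" if "v \<in> C" for v using that by simp
      show "?\<rho> v \<le> d" if "v \<in> V" for v using le[OF that] rd by auto
      show "?\<rho> w = ?\<rho> v" if "v \<in> V" "w \<in> orbit \<sigma> v" for v w
      proof -
        have "w \<in> C \<longleftrightarrow> v \<in> C"
          using orbit_in[OF C] orbit_eq[OF that(2)] that(2) self_orbit by metis
        then show ?thesis using const[OF that] by simp
      qed
    qed
    also have "map (orbit_type ?\<rho>) Ds = map (orbit_type \<rho>) Ds"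
    proof (rule map_cong[OF refl])
      fix D assume "D \<in> set Ds"
      then have D: "D \<in> orbit \<sigma> ` V" "D \<noteq> C" using Ds by auto
      obtain z where "z \<in> D" using orbit_ne[OF D(1)] by blast
      then show "orbit_type ?\<rho> D = orbit_type \<rho> D"
        by (rule orbit_type_cong) (use djC[OF D] in auto)
    qed
    also have "profile ?\<rho> (orbit \<sigma> ` V - {C} - set Ds) = (\<lambda>_. 0)"
      using Ds by (simp add: profile_def)
    finally show "(if odd (card C) \<and> odd u then 0 else (card C - 1) div 2 choose (u div 2)) *
        graph_count V \<sigma> ?A ?\<rho> = (if odd (card C) \<and> odd u then 0 else (card C - 1) div 2 choose (u div 2)) *
        orbit_sum G (card C) (map (orbit_type \<rho>) Ds) (r - u) (\<lambda>_. 0)" by simp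
  qed
  finally show ?thesis .
qed

end

text \<open>Lifts a prescribed list of types to an ordering of the cycles themselves. The recurrence
  thus holds for every order of the types, in particular for the order of the table.\<close>

lemma map_eq_mset:
  assumes "mset (map f xs) = mset ys"
  obtains xs' where "mset xs' = mset xs" "map f xs' = ys"
proof -
  have "\<exists>xs'. mset xs' = mset xs \<and> map f xs' = ys"
    using assms
  proof (induction ys arbitrary: xs)
    case (Cons y ys)
    then have "y \<in> set (map f xs)" by (metis list.set_intros(1) set_mset_mset)
    then obtain x where x: "x \<in> set xs" "f x = y" by auto
    then obtain us vs where xs: "xs = us @ x # vs" by (meson split_list)
    then have "mset (map f (us @ vs)) = mset ys" using Cons.prems x by simp
    then obtain xs' where "mset xs' = mset (us @ vs)" "map f xs' = ys" using Cons.IH by blast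
    then have "mset (x # xs') = mset xs \<and> map f (x # xs') = y # ys" using xs x by simp
    then show ?case by (rule exI)
  qed simp
  then show ?thesis by (elim exE conjE) (rule that)
qed

lemma count_map_distinct:
  "distinct xs \<Longrightarrow> count (mset (map f xs)) q = card {x \<in> set xs. f x = q}"
proof (induction xs)
  case (Cons x xs)
  have "{y \<in> set (x # xs). f y = q} = (if f x = q then {x} else {}) \<union> {y \<in> set xs. f y = q}" by auto
  then show ?case using Cons by (simp add: card_insert_if)
qed simp

section \<open>Realizations of a state and well-definedness of its fixed-point number\<close>

lemma realizationD:
  assumes "realization d H V \<sigma> \<rho>"
  shows "finite V" and "\<sigma> permutes V" and "v \<in> V \<Longrightarrow> 1 \<le> \<rho> v" and "v \<in> V \<Longrightarrow> \<rho> v \<le> d"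
    and "v \<in> V \<Longrightarrow> w \<in> orbit \<sigma> v \<Longrightarrow> \<rho> w = \<rho> v"
    and "card {C \<in> orbit \<sigma> ` V. card C = a \<and> (\<forall>v\<in>C. \<rho> v = r)} = H (a, r)"
  using assms unfolding realization_def by blast+

lemma realization_finite_perm: "realization d H V \<sigma> \<rho> \<Longrightarrow> finite_perm V \<sigma>"
  by (intro finite_perm.intro realizationD)

context
  fixes d :: nat and H :: state and V :: "'v set" and \<sigma> \<rho>
  assumes R: "realization d H V \<sigma> \<rho>"
begin

interpretation finite_perm V \<sigma> by (rule realization_finite_perm[OF R])

lemma realization_orbit_type:
  assumes "D \<in> orbit \<sigma> ` V" "v \<in> D"
  shows "orbit_type \<rho> D = (card D, \<rho> v)"
proof (rule orbit_type_eq[OF assms(2)])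
  fix w assume "w \<in> D"
  moreover have "D = orbit \<sigma> v" by (rule orbit_in[OF assms])
  moreover have "v \<in> V" using orbit_subset assms by blast
  ultimately show "\<rho> w = \<rho> v" using realizationD(5)[OF R] by simp
qed

lemma realization_card: "card {D \<in> orbit \<sigma> ` V. orbit_type \<rho> D = q} = H q"
proof -
  obtain a r where q: "q = (a, r)" by (cases q)
  have "{D \<in> orbit \<sigma> ` V. orbit_type \<rho> D = q} = {C \<in> orbit \<sigma> ` V. card C = a \<and> (\<forall>v\<in>C. \<rho> v = r)}"
  proof (rule Collect_cong, rule conj_cong[OF refl])
    fix D assume D: "D \<in> orbit \<sigma> ` V"
    then obtain v where v: "v \<in> D" using orbit_ne by blast
    have "\<forall>w\<in>D. orbit_type \<rho> D = (card D, \<rho> w)" using realization_orbit_type[OF D] by blast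
    then show "orbit_type \<rho> D = q \<longleftrightarrow> card D = a \<and> (\<forall>v\<in>D. \<rho> v = r)"
      using q v by (metis prod.inject)
  qed
  then show ?thesis using realizationD(6)[OF R] q by simp
qed

lemma realization_support: "{p. H p \<noteq> 0} = orbit_type \<rho> ` orbit \<sigma> ` V"
proof -
  have "H p \<noteq> 0 \<longleftrightarrow> p \<in> orbit_type \<rho> ` orbit \<sigma> ` V" for p
  proof -
    let ?S = "{D \<in> orbit \<sigma> ` V. orbit_type \<rho> D = p}"
    have "finite ?S" using fin by simp
    then have "H p \<noteq> 0 \<longleftrightarrow> ?S \<noteq> {}"
      using realization_card[of p] card_0_eq[of ?S] by metis
    also have "\<dots> \<longleftrightarrow> p \<in> orbit_type \<rho> ` orbit \<sigma> ` V" by auto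
    finally show ?thesis .
  qed
  then show ?thesis by (simp add: set_eq_iff)
qed

lemma realization_normalized: "normalized d H"
proof -
  have "1 \<le> a \<and> 1 \<le> r \<and> r \<le> d" if H: "H (a, r) \<noteq> 0" for a r
  proof -
    have "(a, r) \<in> orbit_type \<rho> ` orbit \<sigma> ` V" using H realization_support by blast
    then obtain D where D: "D \<in> orbit \<sigma> ` V" "orbit_type \<rho> D = (a, r)" by (metis imageE)
    obtain v where v: "v \<in> D" using orbit_ne[OF D(1)] by blast
    then have "v \<in> V" using orbit_subset[OF D(1)] by blast
    then show ?thesis
      using realization_orbit_type[OF D(1) v] D card_pos[OF D(1)]
        realizationD(3,4)[OF R, of v] by auto
  qed
  moreover have "finite {p. H p \<noteq> 0}" using realization_support fin by simp
  ultimately show ?thesis by (simp add: normalized_def)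
qed

lemma realization_size: "state_size H = card V"
proof -
  have "card V = card (\<Union>(orbit \<sigma> ` V))"
  proof (rule arg_cong[where f = card], intro equalityI subsetI)
    fix v assume "v \<in> V"
    then show "v \<in> \<Union>(orbit \<sigma> ` V)" using self_orbit by blast
  next
    fix v assume "v \<in> \<Union>(orbit \<sigma> ` V)"
    then show "v \<in> V" using orbit_subset by blast
  qed
  also have "\<dots> = (\<Sum>D\<in>orbit \<sigma> ` V. card D)"
    by (rule card_Union_disjoint) (use orbits_disjoint finite_in in \<open>auto simp: pairwise_def disjnt_def\<close>)
  also have "\<dots> = (\<Sum>p\<in>{p. H p \<noteq> 0}. \<Sum>D\<in>{D \<in> orbit \<sigma> ` V. orbit_type \<rho> D = p}. card D)"
    by (rule sum.group[symmetric]) (use fin realization_support in auto)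
  also have "\<dots> = (\<Sum>p\<in>{p. H p \<noteq> 0}. fst p * H p)"
  proof (rule sum.cong[OF refl])
    fix p
    have "(\<Sum>D\<in>{D \<in> orbit \<sigma> ` V. orbit_type \<rho> D = p}. card D) =
      (\<Sum>D\<in>{D \<in> orbit \<sigma> ` V. orbit_type \<rho> D = p}. fst p)"
      by (rule sum.cong) (auto simp: orbit_type_def)
    then show "(\<Sum>D\<in>{D \<in> orbit \<sigma> ` V. orbit_type \<rho> D = p}. card D) = fst p * H p"
      by (simp add: realization_card mult.commute)
  qed
  also have "\<dots> = state_size H"
    unfolding state_size_def by (rule sum.cong) auto
  finally show ?thesis by simp
qed

text \<open>Nothing on the right-hand side refers to the realization any more: only the multiset of
  types enters, and \<open>H\<close> determines it. This is what makes two realizations of the same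
  state comparable.\<close>

lemma fixed_graphs_recurrence_list:
  assumes H: "H (a, r) > 0"
    and L: "\<And>q. count_list L q = (H((a, r) := H (a, r) - 1)) q"
    and IH: "\<And>V' \<sigma>' \<rho>' H. realization d H (V' :: 'v set) \<sigma>' \<rho>' \<Longrightarrow> card V' < card V
        \<Longrightarrow> card (fixed_graphs V' \<sigma>' \<rho>') = G H"
  shows "card (fixed_graphs V \<sigma> \<rho>) =
    (\<Sum>u\<le>r. (if odd a \<and> odd u then 0 else (a - 1) div 2 choose (u div 2)) *
        orbit_sum G a L (r - u) (\<lambda>_. 0))"
proof -
  have "(a, r) \<in> orbit_type \<rho> ` orbit \<sigma> ` V" using H realization_support by (metis (mono_tags) mem_Collect_eq not_gr_zero)
  then obtain C where C: "C \<in> orbit \<sigma> ` V" "orbit_type \<rho> C = (a, r)" by (metis imageE)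
  let ?Os = "orbit \<sigma> ` V - {C}"
  have finO: "finite ?Os" using fin by simp
  then obtain xs where xs: "set xs = ?Os" "distinct xs" using finite_distinct_list by blast
  have "count (mset (map (orbit_type \<rho>) xs)) q = count (mset L) q" for q
  proof -
    have "count (mset (map (orbit_type \<rho>) xs)) q = card {D \<in> ?Os. orbit_type \<rho> D = q}"
      using count_map_distinct[OF xs(2), of "orbit_type \<rho>" q] xs(1) by simp
    also have "\<dots> = (H((a, r) := H (a, r) - 1)) q"
    proof (cases "q = (a, r)")
      case True
      have "{D \<in> ?Os. orbit_type \<rho> D = q} = {D \<in> orbit \<sigma> ` V. orbit_type \<rho> D = q} - {C}" by auto
      also have "card \<dots> = card {D \<in> orbit \<sigma> ` V. orbit_type \<rho> D = q} - 1"
        by (rule card_Diff_singleton) (use C True in auto)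
      finally show ?thesis using True realization_card by simp
    next
      case False
      then have "{D \<in> ?Os. orbit_type \<rho> D = q} = {D \<in> orbit \<sigma> ` V. orbit_type \<rho> D = q}"
        using C by auto
      then show ?thesis using False realization_card by simp
    qed
    finally show ?thesis using L by (simp add: count_mset)
  qed
  then have "mset (map (orbit_type \<rho>) xs) = mset L" by (rule multiset_eqI)
  then obtain Ds where Ds: "mset Ds = mset xs" "map (orbit_type \<rho>) Ds = L" by (rule map_eq_mset)
  have "set Ds = ?Os" "distinct Ds"
    using Ds(1) xs by (metis set_mset_mset, metis mset_eq_imp_distinct_iff)
  have r: "\<rho> v = r" if "v \<in> C" for v
    using realization_orbit_type[OF C(1) that] C(2) by simp
  have a: "card C = a" using C by (simp add: orbit_type_def)
  have "card (fixed_graphs V \<sigma> \<rho>) =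
    (\<Sum>u\<le>r. (if odd (card C) \<and> odd u then 0 else (card C - 1) div 2 choose (u div 2)) *
        orbit_sum G (card C) (map (orbit_type \<rho>) Ds) (r - u) (\<lambda>_. 0))"
    by (rule fixed_graphs_recurrence[OF R C(1) r IH \<open>distinct Ds\<close> \<open>set Ds = ?Os\<close>])
  then show ?thesis unfolding a Ds(2) .
qed

end

text \<open>Induction on the number of points. Two realizations of \<open>H\<close> have equally
  many points, and the recurrence gives both the same right-hand side, whose values belong to
  smaller realizations. So the count is unique and the definite description denotes it.\<close>

theorem Phi_eq:
  assumes "realization d H (V :: nat set) \<sigma> \<rho>"
  shows "Phi d H = card (fixed_graphs V \<sigma> \<rho>)"
  using assms
proof (induction "card V" arbitrary: H V \<sigma> \<rho> rule: less_induct)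
  case less
  have IH: "card (fixed_graphs V' \<sigma>' \<rho>') = Phi d H'"
    if "realization d H' (V' :: nat set) \<sigma>' \<rho>'" "card V' < card V" for V' \<sigma>' \<rho>' H'
    using less.hyps[OF that(2,1)] by simp
  have same: "card (fixed_graphs V' \<sigma>' \<rho>') = card (fixed_graphs V \<sigma> \<rho>)"
    if R': "realization d H (V' :: nat set) \<sigma>' \<rho>'" for V' \<sigma>' \<rho>'
  proof (cases "V = {}")
    case True
    have "card V' = 0" using realization_size[OF R'] realization_size[OF less.prems] True by simp
    then have "V' = {}" using realizationD(1)[OF R'] by simp
    moreover have "fixed_graphs {} \<tau> \<rho>'' = {{}}" for \<tau> :: "nat \<Rightarrow> nat" and \<rho>''
      by (auto simp: fixed_graphs_def all_pairs_def)
    ultimately show ?thesis using True by simp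
  next
    case False
    interpret finite_perm V \<sigma> by (rule realization_finite_perm[OF less.prems])
    obtain x where x: "x \<in> V" using False by blast
    let ?C = "orbit \<sigma> x"
    obtain a r where ar: "orbit_type \<rho> ?C = (a, r)" by (cases "orbit_type \<rho> ?C")
    have "(a, r) \<in> {p. H p \<noteq> 0}"
      unfolding realization_support[OF less.prems] using x ar by (metis image_eqI)
    then have H: "H (a, r) > 0" by simp
    have "finite {p. H p \<noteq> 0}" using realization_normalized[OF less.prems] by (simp add: normalized_def)
    then have "finite {q. (H((a, r) := H (a, r) - 1)) q > 0}"
      by (rule rev_finite_subset) (auto split: if_splits)
    \<comment> \<open>Finite support turns the state with one cycle removed into a multiset, and any
      listing of it can serve as \<open>L\<close>.\<close>
    then obtain M where M: "count M = H((a, r) := H (a, r) - 1)"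
      using count_Abs_multiset by blast
    obtain L where "mset L = M" using ex_mset by blast
    then have L: "count_list L q = (H((a, r) := H (a, r) - 1)) q" for q
      using M by (metis count_mset)
    have "card V' = card V" using realization_size[OF R'] realization_size[OF less.prems] by simp
    then show ?thesis
      using fixed_graphs_recurrence_list[OF R' H L IH] fixed_graphs_recurrence_list[OF less.prems H L IH]
      by simp
  qed
  then show ?case
    unfolding Phi_def
  proof (intro the_equality)
    show "\<exists>(V' :: nat set) \<sigma>' \<rho>'. realization d H V' \<sigma>' \<rho>' \<and>
        card (fixed_graphs V \<sigma> \<rho>) = card (fixed_graphs V' \<sigma>' \<rho>')"
      using less.prems by blast
    show "k = card (fixed_graphs V \<sigma> \<rho>)"
      if "\<exists>(V' :: nat set) \<sigma>' \<rho>'. realization d H V' \<sigma>' \<rho>' \<and> k = card (fixed_graphs V' \<sigma>' \<rho>')" for k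
      using that same by auto
  qed
qed

corollary Phi_recurrence:
  assumes R: "realization d H (V :: nat set) \<sigma> \<rho>" and H: "H (a, r) > 0"
    and L: "\<And>q. count_list L q = (H((a, r) := H (a, r) - 1)) q"
  shows "Phi d H =
    (\<Sum>u\<le>r. (if odd a \<and> odd u then 0 else (a - 1) div 2 choose (u div 2)) *
        orbit_sum (Phi d) a L (r - u) (\<lambda>_. 0))"
  unfolding Phi_eq[OF R]
proof (rule fixed_graphs_recurrence_list[OF R H L])
  fix V' \<sigma>' \<rho>' H' assume "realization d H' (V' :: nat set) \<sigma>' \<rho>'"
  then show "card (fixed_graphs V' \<sigma>' \<rho>') = Phi d H'" by (rule Phi_eq[symmetric])
qed

text \<open>A new cycle is put on a block of consecutive naturals above \<open>V\<close> and rotated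
  cyclically. Repeating this builds a realization of every normalized state, so that
  \<open>Phi\<close> denotes on all of them.\<close>

lemma realization_extend:
  assumes R: "realization d H (V :: nat set) \<sigma> \<rho>" and a: "a \<ge> 1" and r: "1 \<le> r" "r \<le> d"
  obtains V' \<sigma>' \<rho>' where "realization d (H((a, r) := Suc (H (a, r)))) (V' :: nat set) \<sigma>' \<rho>'"
proof -
  interpret finite_perm V \<sigma> by (rule realization_finite_perm[OF R])
  \<comment> \<open>Inserting 0 keeps \<open>Max\<close> meaningful when \<open>V\<close> is
    empty.\<close>
  define m where "m = Suc (Max (insert 0 V))"
  have ltm: "v < m" if "v \<in> V" for v using that fin by (simp add: m_def less_Suc_eq_le)
  define W where "W = {m..<m + a}"
  have dj: "V \<inter> W = {}" using ltm by (fastforce simp: W_def)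
  define c where "c x = (if x \<in> W then if Suc x = m + a then m else Suc x else x)" for x
  have mW: "m \<in> W" using a by (simp add: W_def)
  have cW: "c x \<in> W" if "x \<in> W" for x using that a by (auto simp: c_def W_def)
  have "c permutes W"
  proof (rule bij_imp_permutes)
    have "inj_on c W" by (auto simp: inj_on_def c_def W_def)
    moreover have "c ` W \<subseteq> W" using cW by blast
    ultimately show "bij_betw c W W"
      by (simp add: bij_betw_def W_def endo_inj_surj)
  qed (simp add: c_def)
  define \<sigma>' where "\<sigma>' = \<sigma> \<circ> c"
  have sW: "\<sigma>' x = c x" if "x \<in> W" for x
    using cW[OF that] dj permutes_not_in[OF perm] by (auto simp: \<sigma>'_def)
  have sV: "\<sigma>' x = \<sigma> x" if "x \<notin> W" for x using that by (simp add: \<sigma>'_def c_def)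
  have perm': "\<sigma>' permutes (V \<union> W)"
    unfolding \<sigma>'_def using permutes_subset[OF \<open>c permutes W\<close>] permutes_subset[OF perm]
    by (intro permutes_compose) auto
  have fin': "finite (V \<union> W)" using fin by (simp add: W_def)
  interpret P: finite_perm "V \<union> W" \<sigma>' using perm' fin' by unfold_locales
  have orbV: "orbit \<sigma>' v = orbit \<sigma> v" if "v \<in> V" for v
  proof (rule orbit_cong[OF self_orbit])
    fix s assume "s \<in> orbit \<sigma> v"
    then have "s \<in> V" using that permutes_orbit_subset[OF perm] by blast
    then show "\<sigma>' s = \<sigma> s" using sV dj by blast
  qed
  have pow: "(\<sigma>' ^^ i) m = m + i" if "i < a" for i
    using that
  proof (induction i)
    case (Suc i)
    then have "(\<sigma>' ^^ i) m = m + i" by simp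
    moreover have "m + i \<in> W" using Suc by (simp add: W_def)
    ultimately show ?case using sW[of "m + i"] Suc by (simp add: c_def)
  qed simp
  have orbm: "orbit \<sigma>' m = W"
  proof (intro equalityI subsetI)
    fix x assume "x \<in> orbit \<sigma>' m"
    then show "x \<in> W" by induction (use cW sW mW in auto)
  next
    fix x assume "x \<in> W"
    then obtain i where "i < a" "x = m + i" by (metis W_def atLeastLessThan_iff le_Suc_ex nat_add_left_cancel_less)
    then have "x = (\<sigma>' ^^ i) m" using pow by simp
    then show "x \<in> orbit \<sigma>' m" unfolding P.orbit_range by blast
  qed
  have orbW: "orbit \<sigma>' v = W" if "v \<in> W" for v
    using P.orbit_eq[of v m] that orbm by simp
  have img: "orbit \<sigma>' ` (V \<union> W) = insert W (orbit \<sigma> ` V)"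
  proof -
    have "orbit \<sigma>' ` V = orbit \<sigma> ` V" using orbV by (intro image_cong) auto
    moreover have "orbit \<sigma>' ` W = {W}" using orbW mW by auto
    ultimately show ?thesis by (simp add: image_Un)
  qed
  define \<rho>' where "\<rho>' v = (if v \<in> W then r else \<rho> v)" for v
  have Wnot: "W \<notin> orbit \<sigma> ` V"
  proof
    assume "W \<in> orbit \<sigma> ` V"
    then have "W \<subseteq> V" by (rule orbit_subset)
    then show False using mW dj by blast
  qed
  have "card {C \<in> orbit \<sigma>' ` (V \<union> W). card C = a' \<and> (\<forall>v\<in>C. \<rho>' v = r')} =
      (H((a, r) := Suc (H (a, r)))) (a', r')" for a' r'
  proof -
    let ?X = "{C \<in> orbit \<sigma> ` V. card C = a' \<and> (\<forall>v\<in>C. \<rho> v = r')}"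
    have cX: "card ?X = H (a', r')" by (rule realizationD(6)[OF R])
    have same: "(\<forall>v\<in>C. \<rho>' v = r') \<longleftrightarrow> (\<forall>v\<in>C. \<rho> v = r')" if "C \<in> orbit \<sigma> ` V" for C
    proof -
      have "v \<notin> W" if "v \<in> C" for v using orbit_subset[OF \<open>C \<in> _\<close>] that dj by blast
      then show ?thesis by (simp add: \<rho>'_def)
    qed
    have W: "card W = a' \<and> (\<forall>v\<in>W. \<rho>' v = r') \<longleftrightarrow> (a', r') = (a, r)"
      using mW by (auto simp: W_def \<rho>'_def)
    have eq: "{C \<in> orbit \<sigma>' ` (V \<union> W). card C = a' \<and> (\<forall>v\<in>C. \<rho>' v = r')} =
      (if (a', r') = (a, r) then insert W ?X else ?X)"
    proof (intro set_eqI)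
      fix C
      consider "C = W" | "C \<noteq> W" "C \<in> orbit \<sigma> ` V" | "C \<noteq> W" "C \<notin> orbit \<sigma> ` V" by blast
      then show "C \<in> {C \<in> orbit \<sigma>' ` (V \<union> W). card C = a' \<and> (\<forall>v\<in>C. \<rho>' v = r')} \<longleftrightarrow>
        C \<in> (if (a', r') = (a, r) then insert W ?X else ?X)"
      proof cases
        case 1
        then show ?thesis unfolding img using W Wnot by simp
      next
        case 2
        then show ?thesis unfolding img using same[OF 2(2)] by simp
      next
        case 3
        then show ?thesis unfolding img by simp
      qed
    qed
    have "finite ?X" "W \<notin> ?X" using fin Wnot by auto
    show ?thesis
    proof (cases "(a', r') = (a, r)")
      case True
      then show ?thesis
        unfolding eq if_P[OF True] card_insert_disjoint[OF \<open>finite ?X\<close> \<open>W \<notin> ?X\<close>] cX by simp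
    next
      case False
      then show ?thesis unfolding eq if_not_P[OF False] cX by auto
    qed
  qed
  moreover have "\<forall>v\<in>V \<union> W. \<forall>w\<in>orbit \<sigma>' v. \<rho>' w = \<rho>' v"
  proof (intro ballI)
    fix v w assume v: "v \<in> V \<union> W" and w: "w \<in> orbit \<sigma>' v"
    show "\<rho>' w = \<rho>' v"
    proof (cases "v \<in> W")
      case True
      then show ?thesis using w orbW by (simp add: \<rho>'_def)
    next
      case False
      then have "v \<in> V" using v by simp
      have "w \<in> orbit \<sigma> v" using w orbV[OF \<open>v \<in> V\<close>] by simp
      then have "w \<in> V" "\<rho> w = \<rho> v"
        using permutes_orbit_subset[OF perm \<open>v \<in> V\<close>] realizationD(5)[OF R \<open>v \<in> V\<close>] by auto
      moreover have "w \<notin> W" using \<open>w \<in> V\<close> dj by blast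
      ultimately show ?thesis using False by (simp add: \<rho>'_def)
    qed
  qed
  moreover have "1 \<le> \<rho>' v \<and> \<rho>' v \<le> d" if "v \<in> V \<union> W" for v
  proof (cases "v \<in> W")
    case False
    then have "v \<in> V" using that by simp
    then have "1 \<le> \<rho> v \<and> \<rho> v \<le> d" using realizationD(3,4)[OF R] by blast
    then show ?thesis using False by (simp add: \<rho>'_def)
  qed (use r in \<open>simp add: \<rho>'_def\<close>)
  ultimately have "realization d (H((a, r) := Suc (H (a, r)))) (V \<union> W) \<sigma>' \<rho>'"
    using perm' fin' unfolding realization_def by blast
  then show ?thesis by (rule that)
qed

lemma realization_exists:
  assumes "normalized d H"
  obtains V \<sigma> \<rho> where "realization d H (V :: nat set) \<sigma> \<rho>"
proof -
  have "\<exists>V \<sigma> \<rho>. realization d H (V :: nat set) \<sigma> \<rho>"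
    using assms
  proof (induction "\<Sum>p\<in>{p. H p \<noteq> 0}. H p" arbitrary: H rule: less_induct)
    case less
    have fin: "finite {p. H p \<noteq> 0}" using less.prems by (simp add: normalized_def)
    show ?case
    proof (cases "\<exists>p. H p \<noteq> 0")
      case False
      then have "realization d H ({} :: nat set) id (\<lambda>_. 0)"
        by (simp add: realization_def)
      then show ?thesis by blast
    next
      case True
      then obtain a r where ar: "H (a, r) \<noteq> 0" by auto
      define H' where "H' = H((a, r) := H (a, r) - 1)"
      have sub: "{p. H' p \<noteq> 0} \<subseteq> {p. H p \<noteq> 0}" by (auto simp: H'_def split: if_splits)
      have "(\<Sum>p\<in>{p. H' p \<noteq> 0}. H' p) \<le> (\<Sum>p\<in>{p. H p \<noteq> 0}. H' p)"
        using sub fin by (intro sum_mono2) auto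
      also have "\<dots> < (\<Sum>p\<in>{p. H p \<noteq> 0}. H p)"
        by (rule sum_strict_mono_ex1) (use fin ar in \<open>auto simp: H'_def\<close>)
      finally have lt: "(\<Sum>p\<in>{p. H' p \<noteq> 0}. H' p) < (\<Sum>p\<in>{p. H p \<noteq> 0}. H p)" .
      have "\<forall>p. H' p \<noteq> 0 \<longrightarrow> H p \<noteq> 0" using sub by blast
      then have "normalized d H'"
        using less.prems finite_subset[OF sub] unfolding normalized_def by blast
      from less.hyps[OF lt this] obtain V \<sigma> \<rho> where R: "realization d H' (V :: nat set) \<sigma> \<rho>" by blast
      have "1 \<le> a" "1 \<le> r" "r \<le> d" using less.prems ar by (auto simp: normalized_def)
      then obtain V' \<sigma>' \<rho>' where "realization d (H'((a, r) := Suc (H' (a, r)))) (V' :: nat set) \<sigma>' \<rho>'"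
        using realization_extend[OF R] by metis
      moreover have "H'((a, r) := Suc (H' (a, r))) = H" using ar by (auto simp: H'_def)
      ultimately show ?thesis by auto
    qed
  qed
  then show ?thesis using that by blast
qed

text \<open>The recurrence is first obtained by treating the \<open>h\<close> cycles of one kind one after another, that
  is, as a sum over words of length \<open>h\<close>. Collecting the words with equal letter counts yields the
  multinomial coefficients in \<open>W\<^sub>b\<^sub>s\<close>.\<close>

primrec word_sum :: "nat list \<Rightarrow> (nat \<Rightarrow> nat) \<Rightarrow> nat \<Rightarrow> ((nat \<Rightarrow> nat) \<Rightarrow> nat) \<Rightarrow> nat" where
  "word_sum ks c 0 F = F (\<lambda>_. 0)"
| "word_sum ks c (Suc h) F = (\<Sum>k\<leftarrow>ks. c k * word_sum ks c h (\<lambda>\<nu>. F (\<nu>(k := Suc (\<nu> k)))))"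

lemma word_sum_zero: "word_sum ks c h (\<lambda>_. 0) = 0"
  by (induction h) (simp_all add: sum_list_0)

lemma sum_list_sum_swap:
  fixes f :: "'a \<Rightarrow> 'b \<Rightarrow> nat"
  shows "(\<Sum>x\<leftarrow>xs. \<Sum>y\<in>A. f x y) = (\<Sum>y\<in>A. \<Sum>x\<leftarrow>xs. f x y)"
  by (induction xs) (simp_all add: sum.distrib)

text \<open>Sorts the words by the number \<open>j\<close> of occurrences of the letter
  \<open>k\<close>: the positions are chosen in \<open>h choose j\<close> ways, and what is left is
  a word in the other letters. In the induction the first letter is either \<open>k\<close> or not,
  which is Pascal's rule.\<close>

lemma word_sum_Cons:
  assumes "k \<notin> set ks"
  shows "word_sum (k # ks) c h F =
    (\<Sum>j\<le>h. (h choose j) * c k ^ j * word_sum ks c (h - j) (\<lambda>\<nu>. F (\<nu>(k := j))))"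
proof (induction h arbitrary: F)
  case 0
  show ?case by (simp add: fun_upd_idem)
next
  case (Suc h)
  define T where "T j = c k ^ j * word_sum ks c (Suc h - j) (\<lambda>\<nu>. F (\<nu>(k := j)))" for j
  \<comment> \<open>Words that begin with \<open>k\<close>: one occurrence is used up already, which
    shifts \<open>j\<close> to \<open>Suc j\<close>.\<close>
  have 1: "c k * word_sum (k # ks) c h (\<lambda>\<nu>. F (\<nu>(k := Suc (\<nu> k)))) =
      (\<Sum>j\<le>h. (h choose j) * T (Suc j))"
    by (simp add: Suc T_def sum_distrib_left algebra_simps fun_upd_same del: fun_upd_apply)
  have comm: "(\<nu>(k := j))(k' := Suc (\<nu> k')) = (\<nu>(k' := Suc (\<nu> k')))(k := j)"
    if "k' \<in> set ks" for k' j and \<nu> :: "nat \<Rightarrow> nat"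
    using that assms by (intro fun_upd_twist) auto
  have "(\<Sum>k'\<leftarrow>ks. c k' * word_sum (k # ks) c h (\<lambda>\<nu>. F (\<nu>(k' := Suc (\<nu> k'))))) =
    (\<Sum>k'\<leftarrow>ks. \<Sum>j\<le>h. (h choose j) * c k ^ j *
       (c k' * word_sum ks c (h - j) (\<lambda>\<nu>. F ((\<nu>(k' := Suc (\<nu> k')))(k := j)))))"
  proof (rule arg_cong[where f = sum_list], rule map_cong[OF refl])
    fix k' assume k': "k' \<in> set ks"
    then have "k' \<noteq> k" using assms by auto
    then show "c k' * word_sum (k # ks) c h (\<lambda>\<nu>. F (\<nu>(k' := Suc (\<nu> k')))) =
      (\<Sum>j\<le>h. (h choose j) * c k ^ j *
       (c k' * word_sum ks c (h - j) (\<lambda>\<nu>. F ((\<nu>(k' := Suc (\<nu> k')))(k := j)))))"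
      by (simp add: Suc comm[OF k'] sum_distrib_left algebra_simps fun_upd_other del: fun_upd_apply)
  qed
  also have "\<dots> = (\<Sum>j\<le>h. (h choose j) * c k ^ j *
      (\<Sum>k'\<leftarrow>ks. c k' * word_sum ks c (h - j) (\<lambda>\<nu>. F ((\<nu>(k' := Suc (\<nu> k')))(k := j)))))"
    by (simp add: sum_list_sum_swap sum_list_const_mult)
  also have "\<dots> = (\<Sum>j\<le>h. (h choose j) * T j)"
    by (rule sum.cong[OF refl]) (simp add: T_def Suc_diff_le)
  finally have 2: "(\<Sum>k'\<leftarrow>ks. c k' * word_sum (k # ks) c h (\<lambda>\<nu>. F (\<nu>(k' := Suc (\<nu> k'))))) =
    (\<Sum>j\<le>h. (h choose j) * T j)" .
  have "(\<Sum>j\<le>Suc h. (Suc h choose j) * T j) = T 0 + (\<Sum>j\<le>h. (Suc h choose Suc j) * T (Suc j))"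
    by (subst sum.atMost_Suc_shift) simp
  also have "\<dots> = (\<Sum>j\<le>h. (h choose j) * T (Suc j)) + (T 0 + (\<Sum>j\<le>h. (h choose Suc j) * T (Suc j)))"
    by (simp add: algebra_simps sum.distrib)
  also have "T 0 + (\<Sum>j\<le>h. (h choose Suc j) * T (Suc j)) = (\<Sum>j\<le>Suc h. (h choose j) * T j)"
    by (subst sum.atMost_Suc_shift) simp
  also have "\<dots> = (\<Sum>j\<le>h. (h choose j) * T j)" by simp
  finally show ?case using 1 2 by (simp add: T_def mult.assoc del: fun_upd_apply)
qed

definition multinomial :: "nat list \<Rightarrow> nat" where
  "multinomial js = fact (sum_list js) div prod_list (map fact js)"

text \<open>Both facts come from one induction: the quotient for \<open>j # js\<close> can be
  evaluated only when the division in \<open>multinomial js\<close> is known to be exact.\<close>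

lemma multinomial_fact: "fact (sum_list js) = prod_list (map fact js) * multinomial js"
  and multinomial_Cons: "multinomial (j # js) = (j + sum_list js choose j) * multinomial js"
proof (induction js arbitrary: j)
  case Nil
  {
    case 1
    show ?case by (simp add: multinomial_def)
  next
    case (2 j)
    show ?case by (simp add: multinomial_def)
  }
next
  case (Cons i js)
  have step: "multinomial (j # js) = (j + sum_list js choose j) * multinomial js \<and>
      fact (sum_list (j # js)) = prod_list (map fact (j # js)) * multinomial (j # js)"
    if "fact (sum_list js) = prod_list (map fact js) * multinomial js" for j and js :: "nat list"
  proof -
    have "fact (sum_list (j # js)) = (j + sum_list js choose j) * fact j * (fact (sum_list js) :: nat)"
      using binomial_fact_lemma[of j "j + sum_list js"] by (simp add: algebra_simps)
    also have "\<dots> = prod_list (map fact (j # js)) * ((j + sum_list js choose j) * multinomial js)"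
      using that by (simp add: algebra_simps)
    finally have *: "fact (sum_list (j # js)) =
      prod_list (map fact (j # js)) * ((j + sum_list js choose j) * multinomial js)" .
    moreover have "prod_list (map fact (j # js)) > (0 :: nat)"
      by (induction js) auto
    ultimately have "multinomial (j # js) = (j + sum_list js choose j) * multinomial js"
      unfolding multinomial_def[of "j # js"] by simp
    then show ?thesis using * by simp
  qed
  {
    case 1
    show ?case using step[OF Cons(1)] by simp
  next
    case (2 j)
    show ?case using step[of "i # js" j] step[OF Cons(1), of i] by simp
  }
qed

section \<open>The enumerated families and the aggregated sum\<close>

lemma fold_append_concat: "fold (\<lambda>x acc. acc @ g x) xs s = s @ concat (map g xs)"
  by (induction xs arbitrary: s) auto

lemma val_splitsC_Cons:
  "val (splitsC (k # ks) \<alpha> h B) = concat (map (\<lambda>j. if k * \<alpha> * j \<le> B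
      then map (\<lambda>(f, B''). ((k, j) # f, B'')) (val (splitsC ks \<alpha> (h - j) (B - k * \<alpha> * j))) else [])
    [0..<Suc h])"
proof -
  have "val (splitsC (k # ks) \<alpha> h B) = fold (\<lambda>j acc. acc @ (if k * \<alpha> * j \<le> B
      then map (\<lambda>(f, B''). ((k, j) # f, B'')) (val (splitsC ks \<alpha> (h - j) (B - k * \<alpha> * j))) else []))
    [0..<Suc h] []"
    by (simp add: if_distrib cong: if_cong del: upt_Suc)
  then show ?thesis by (simp only: fold_append_concat append_Nil)
qed

declare splitsC.simps(2) [simp del]

lemma splitsC_elem:
  "(f, B') \<in> set (val (splitsC ks \<alpha> h B)) \<Longrightarrow>
    map fst f = ks \<and> sum_list (map snd f) = h \<and> B' + (\<Sum>(k, j)\<leftarrow>f. k * \<alpha> * j) = B"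
proof (induction ks arbitrary: h B f)
  case Nil
  then show ?case by (auto split: if_splits)
next
  case (Cons k ks)
  from Cons.prems obtain j f' where j: "j \<le> h" "k * \<alpha> * j \<le> B" "f = (k, j) # f'"
    "(f', B') \<in> set (val (splitsC ks \<alpha> (h - j) (B - k * \<alpha> * j)))"
    unfolding val_splitsC_Cons by (auto split: if_splits)
  let ?S = "\<Sum>(k, j)\<leftarrow>f'. k * \<alpha> * j"
  have IH: "map fst f' = ks" "sum_list (map snd f') = h - j" "B' + ?S = B - k * \<alpha> * j"
    using Cons.IH[OF j(4)] by auto
  have "B' + (k * \<alpha> * j + ?S) = B" using IH(3) j(2) by linarith
  then show ?case using IH(1,2) j(1,3) by simp
qed

lemma sum_list_concat_map: "sum_list (map f (concat (map g xs))) = (\<Sum>x\<leftarrow>xs. sum_list (map f (g x)))"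
  by (induction xs) auto

lemma sum_list_upt: "(\<Sum>j\<leftarrow>[0..<Suc h]. f j) = (\<Sum>j\<le>h. f j)"
  by (simp add: interv_sum_list_conv_sum_set_nat atLeast0LessThan lessThan_Suc_atMost del: upt_Suc)

text \<open>The program enumerates letter counts, while the recurrence so far sums over words. A
  count vector arises from multinomially many words, all of the same weight. The function
  \<open>G\<close> is generalized since the induction prepends an entry to \<open>f\<close>; later
  it carries the sum over the rest of the table.\<close>

lemma sum_splitsC:
  assumes "distinct ks"
  shows "(\<Sum>(f, B')\<leftarrow>val (splitsC ks \<alpha> h B).
      multinomial (map snd f) * (\<Prod>(k, j)\<leftarrow>f. c k ^ j) * G f B') =
    word_sum ks c h (\<lambda>\<nu>. if (\<Sum>k\<leftarrow>ks. k * \<alpha> * \<nu> k) \<le> B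
      then G (map (\<lambda>k. (k, \<nu> k)) ks) (B - (\<Sum>k\<leftarrow>ks. k * \<alpha> * \<nu> k)) else 0)"
  using assms
proof (induction ks arbitrary: h B G)
  case Nil
  show ?case by (cases h) (simp_all add: multinomial_def)
next
  case (Cons k ks)
  then have k: "k \<notin> set ks" and ks: "distinct ks" by auto
  let ?S = "\<lambda>\<nu>. \<Sum>k\<leftarrow>ks. k * \<alpha> * \<nu> k"
  have "(\<Sum>(f, B')\<leftarrow>val (splitsC (k # ks) \<alpha> h B).
      multinomial (map snd f) * (\<Prod>(k, j)\<leftarrow>f. c k ^ j) * G f B') =
    (\<Sum>j\<leftarrow>[0..<Suc h]. if k * \<alpha> * j \<le> B then
      (\<Sum>(f, B')\<leftarrow>val (splitsC ks \<alpha> (h - j) (B - k * \<alpha> * j)).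
         multinomial (map snd ((k, j) # f)) * (\<Prod>(k, j)\<leftarrow>(k, j) # f. c k ^ j) * G ((k, j) # f) B') else 0)"
    unfolding val_splitsC_Cons sum_list_concat_map
    by (rule arg_cong[where f = sum_list], rule map_cong[OF refl])
      (auto simp: comp_def case_prod_beta')
  also have "\<dots> = (\<Sum>j\<le>h. if k * \<alpha> * j \<le> B then
      (\<Sum>(f, B')\<leftarrow>val (splitsC ks \<alpha> (h - j) (B - k * \<alpha> * j)).
         multinomial (map snd ((k, j) # f)) * (\<Prod>(k, j)\<leftarrow>(k, j) # f. c k ^ j) * G ((k, j) # f) B') else 0)"
    by (rule sum_list_upt)
  also have "\<dots> = (\<Sum>j\<le>h. (h choose j) * c k ^ j * word_sum ks c (h - j)
      (\<lambda>\<nu>. if k * \<alpha> * j + ?S \<nu> \<le> B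
        then G ((k, j) # map (\<lambda>k. (k, \<nu> k)) ks) (B - (k * \<alpha> * j + ?S \<nu>)) else 0))"
  proof (rule sum.cong[OF refl])
    fix j assume j: "j \<in> {..h}"
    show "(if k * \<alpha> * j \<le> B then
      (\<Sum>(f, B')\<leftarrow>val (splitsC ks \<alpha> (h - j) (B - k * \<alpha> * j)).
         multinomial (map snd ((k, j) # f)) * (\<Prod>(k, j)\<leftarrow>(k, j) # f. c k ^ j) * G ((k, j) # f) B') else 0) =
      (h choose j) * c k ^ j * word_sum ks c (h - j)
      (\<lambda>\<nu>. if k * \<alpha> * j + ?S \<nu> \<le> B
        then G ((k, j) # map (\<lambda>k. (k, \<nu> k)) ks) (B - (k * \<alpha> * j + ?S \<nu>)) else 0)"
    proof (cases "k * \<alpha> * j \<le> B")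
      case False
      then have "(\<lambda>\<nu>. if k * \<alpha> * j + ?S \<nu> \<le> B
        then G ((k, j) # map (\<lambda>k. (k, \<nu> k)) ks) (B - (k * \<alpha> * j + ?S \<nu>)) else 0) = (\<lambda>_. 0)"
        by auto
      then show ?thesis using False by (simp only: word_sum_zero if_False mult_0_right)
    next
      case True
      have "(\<Sum>(f, B')\<leftarrow>val (splitsC ks \<alpha> (h - j) (B - k * \<alpha> * j)).
         multinomial (map snd ((k, j) # f)) * (\<Prod>(k, j)\<leftarrow>(k, j) # f. c k ^ j) * G ((k, j) # f) B') =
        (\<Sum>(f, B')\<leftarrow>val (splitsC ks \<alpha> (h - j) (B - k * \<alpha> * j)). (h choose j) * c k ^ j *
         (multinomial (map snd f) * (\<Prod>(k, j)\<leftarrow>f. c k ^ j) * G ((k, j) # f) B'))"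
      proof (rule arg_cong[where f = sum_list], rule map_cong[OF refl])
        fix p assume p: "p \<in> set (val (splitsC ks \<alpha> (h - j) (B - k * \<alpha> * j)))"
        obtain f B' where fB: "p = (f, B')" by (cases p)
        have "sum_list (map snd f) = h - j" using splitsC_elem[OF p[unfolded fB]] by simp
        then have "multinomial (map snd ((k, j) # f)) = (h choose j) * multinomial (map snd f)"
          using multinomial_Cons[of j "map snd f"] j by simp
        then show "(case p of (f, B') \<Rightarrow> multinomial (map snd ((k, j) # f)) * (\<Prod>(k, j)\<leftarrow>(k, j) # f. c k ^ j) * G ((k, j) # f) B') =
          (case p of (f, B') \<Rightarrow> (h choose j) * c k ^ j *
           (multinomial (map snd f) * (\<Prod>(k, j)\<leftarrow>f. c k ^ j) * G ((k, j) # f) B'))"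
          using fB by simp
      qed
      also have "\<dots> = (h choose j) * c k ^ j * (\<Sum>(f, B')\<leftarrow>val (splitsC ks \<alpha> (h - j) (B - k * \<alpha> * j)).
         multinomial (map snd f) * (\<Prod>(k, j)\<leftarrow>f. c k ^ j) * G ((k, j) # f) B')"
        by (subst sum_list_const_mult[symmetric]) (simp add: case_prod_beta')
      also have "(\<Sum>(f, B')\<leftarrow>val (splitsC ks \<alpha> (h - j) (B - k * \<alpha> * j)).
         multinomial (map snd f) * (\<Prod>(k, j)\<leftarrow>f. c k ^ j) * G ((k, j) # f) B') =
        word_sum ks c (h - j) (\<lambda>\<nu>. if ?S \<nu> \<le> B - k * \<alpha> * j
          then G ((k, j) # map (\<lambda>k. (k, \<nu> k)) ks) (B - k * \<alpha> * j - ?S \<nu>) else 0)"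
        by (rule Cons.IH[OF ks])
      also have "(\<lambda>\<nu>. if ?S \<nu> \<le> B - k * \<alpha> * j
          then G ((k, j) # map (\<lambda>k. (k, \<nu> k)) ks) (B - k * \<alpha> * j - ?S \<nu>) else 0) =
        (\<lambda>\<nu>. if k * \<alpha> * j + ?S \<nu> \<le> B
        then G ((k, j) # map (\<lambda>k. (k, \<nu> k)) ks) (B - (k * \<alpha> * j + ?S \<nu>)) else 0)"
        using True by (auto simp: fun_eq_iff)
      finally show ?thesis using True by simp
    qed
  qed
  also have "\<dots> = word_sum (k # ks) c h (\<lambda>\<nu>. if (\<Sum>k\<leftarrow>k # ks. k * \<alpha> * \<nu> k) \<le> B
      then G (map (\<lambda>k. (k, \<nu> k)) (k # ks)) (B - (\<Sum>k\<leftarrow>k # ks. k * \<alpha> * \<nu> k)) else 0)"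
  proof -
    have eqs: "(\<Sum>k'\<leftarrow>ks. k' * \<alpha> * (\<nu>(k := j)) k') = ?S \<nu>"
      "map (\<lambda>k'. (k', (\<nu>(k := j)) k')) ks = map (\<lambda>k. (k, \<nu> k)) ks" for \<nu> j
      using k by (auto intro!: arg_cong[where f = sum_list] map_cong)
    show ?thesis unfolding word_sum_Cons[OF k] by (simp only: list.map sum_list.Cons fun_upd_same eqs)
  qed
  finally show ?case .
qed

text \<open>A cycle \<open>(b, s)\<close> joined by \<open>k\<close> orbits ends at degree
  \<open>s - k * \<beta>\<close>. The condition is written as an addition at the target, as in the
  program, so that truncated subtraction cannot produce false hits at degree 0.\<close>

definition contribution :: "nat \<Rightarrow> (nat \<times> nat) \<times> (nat \<times> nat) list \<Rightarrow> state" where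
  "contribution a e q = (\<Sum>(k, j)\<leftarrow>snd e.
     if fst e = (fst q, snd q + k * (a div gcd a (fst q))) then j else 0)"

definition next_count :: "nat \<Rightarrow> family \<Rightarrow> state" where
  "next_count a \<nu> q = (\<Sum>e\<leftarrow>\<nu>. contribution a e q)"

definition max_mult :: "nat \<Rightarrow> nat \<Rightarrow> nat \<Rightarrow> nat \<Rightarrow> nat" where
  "max_mult a r b s = min (gcd a b) (min (r div (b div gcd a b)) (s div (a div gcd a b)))"

lemma le_max_mult_iff:
  assumes "a > 0" "b > 0"
  shows "k \<le> max_mult a r b s \<longleftrightarrow>
    k \<le> gcd a b \<and> k * (b div gcd a b) \<le> r \<and> k * (a div gcd a b) \<le> s"
proof -
  have "b div gcd a b > 0" "a div gcd a b > 0"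
    using assms by (simp_all add: div_greater_zero_iff dvd_imp_le)
  then show ?thesis
    by (simp add: max_mult_def less_eq_div_iff_mult_less_eq)
qed

lemma bump_apply: "bump M p q = M q + (if q = p then 1 else 0)"
  by (simp add: bump_def)

text \<open>Matches the two ways of bookkeeping: processing one more cycle with letter
  \<open>k\<close> bumps the type to which it moves, and this is the effect of raising the count of
  \<open>k\<close> by one.\<close>

lemma contribution_bump:
  assumes "distinct ks" "k \<in> set ks" "k * (a div gcd a b) \<le> s"
  shows "(\<lambda>q. M q + contribution a ((b, s), map (\<lambda>i. (i, (\<nu>(k := Suc (\<nu> k))) i)) ks) q) =
    (\<lambda>q. bump M (b, s - k * (a div gcd a b)) q + contribution a ((b, s), map (\<lambda>i. (i, \<nu> i)) ks) q)"
proof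
  fix q :: "nat \<times> nat"
  obtain b' t where q: "q = (b', t)" by (cases q)
  let ?P = "\<lambda>i. (b, s) = (b', t + i * (a div gcd a b'))"
  have "(\<Sum>i\<leftarrow>ks. if ?P i then (\<nu>(k := Suc (\<nu> k))) i else 0) =
    (\<Sum>i\<leftarrow>ks. if ?P i then \<nu> i else 0) + (if ?P k then 1 else 0)"
    using assms(1,2)
  proof (induction ks)
    case (Cons i ks)
    show ?case
    proof (cases "i = k")
      case True
      then have "k \<notin> set ks" using Cons.prems by auto
      then have "(\<Sum>i\<leftarrow>ks. if ?P i then (\<nu>(k := Suc (\<nu> k))) i else 0) = (\<Sum>i\<leftarrow>ks. if ?P i then \<nu> i else 0)"
        by (intro arg_cong[where f = sum_list] map_cong) auto
      then show ?thesis using True by (simp only: list.map sum_list.Cons) auto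
    next
      case False
      then show ?thesis using Cons by simp
    qed
  qed simp
  \<comment> \<open>The assumption that \<open>k * \<beta>\<close> is at most \<open>s\<close> makes
    the subtraction exact here.\<close>
  moreover have "?P k \<longleftrightarrow> q = (b, s - k * (a div gcd a b))"
    using assms(3) q by auto
  ultimately show "M q + contribution a ((b, s), map (\<lambda>i. (i, (\<nu>(k := Suc (\<nu> k))) i)) ks) q =
    bump M (b, s - k * (a div gcd a b)) q + contribution a ((b, s), map (\<lambda>i. (i, \<nu> i)) ks) q"
    by (simp add: contribution_def bump_apply comp_def q del: fun_upd_apply)
qed

text \<open>A run of \<open>h\<close> cycles of one kind chooses a letter for each of them, and the
  outcome depends on the word only through its letter counts. The letters are limited by
  \<open>r\<close> instead of the current budget \<open>B\<close>, so that the same list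
  \<open>ks\<close> serves throughout the induction; letters too large for \<open>B\<close>
  contribute 0.\<close>

lemma orbit_sum_replicate:
  fixes a b r s B :: nat
  assumes ab: "a > 0" "b > 0" and "B \<le> r"
  defines "\<alpha> \<equiv> b div gcd a b" and "ks \<equiv> [0..<Suc (max_mult a r b s)]"
  shows "orbit_sum G a (replicate h (b, s) @ L) B M =
    word_sum ks (\<lambda>k. gcd a b choose k) h (\<lambda>\<nu>. if (\<Sum>k\<leftarrow>ks. k * \<alpha> * \<nu> k) \<le> B
      then orbit_sum G a L (B - (\<Sum>k\<leftarrow>ks. k * \<alpha> * \<nu> k))
        (\<lambda>q. M q + contribution a ((b, s), map (\<lambda>k. (k, \<nu> k)) ks) q) else 0)"
  using \<open>B \<le> r\<close>
proof (induction h arbitrary: B M)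
  case 0
  have "contribution a ((b, s), map (\<lambda>k. (k, 0)) ks) q = 0" for q
    by (auto simp: contribution_def comp_def intro!: sum_list_0)
  then show ?case by (simp add: sum_list_0)
next
  case (Suc h)
  let ?S = "\<lambda>\<nu>. \<Sum>k\<leftarrow>ks. k * \<alpha> * \<nu> k"
  let ?F = "\<lambda>B M \<nu>. if ?S \<nu> \<le> B then orbit_sum G a L (B - ?S \<nu>)
        (\<lambda>q. M q + contribution a ((b, s), map (\<lambda>k. (k, \<nu> k)) ks) q) else 0"
  let ?\<beta> = "a div gcd a b" and ?c = "\<lambda>k. gcd a b choose k"
  have dks: "distinct ks" by (simp add: ks_def)
  have S: "?S (\<nu>(k := Suc (\<nu> k))) = k * \<alpha> + ?S \<nu>" if "k \<in> set ks" for \<nu> k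
    using dks that
  proof (induction ks)
    case (Cons i ks)
    show ?case
    proof (cases "i = k")
      case True
      then have "k \<notin> set ks" using Cons.prems by auto
      then have "(\<Sum>i\<leftarrow>ks. i * \<alpha> * (\<nu>(k := Suc (\<nu> k))) i) = (\<Sum>i\<leftarrow>ks. i * \<alpha> * \<nu> i)"
        by (intro arg_cong[where f = sum_list] map_cong) auto
      then show ?thesis using True by (simp only: list.map sum_list.Cons) simp
    next
      case False
      then show ?thesis using Cons by simp
    qed
  qed simp
  have F: "?F B M (\<nu>(k := Suc (\<nu> k))) =
      (if k * \<alpha> \<le> B then ?F (B - k * \<alpha>) (bump M (b, s - k * ?\<beta>)) \<nu> else 0)" if k: "k \<in> set ks" for \<nu> k
  proof -
    have "k \<le> max_mult a r b s" using k unfolding ks_def by auto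
    then have "k * ?\<beta> \<le> s" using le_max_mult_iff[OF ab] by blast
    note C = contribution_bump[OF dks k this, of M \<nu>]
    show ?thesis unfolding S[OF k] C by auto
  qed
  have "orbit_sum G a (replicate (Suc h) (b, s) @ L) B M =
    (\<Sum>k\<le>gcd a b. ?c k * (if k * \<alpha> \<le> B \<and> k * ?\<beta> \<le> s
        then orbit_sum G a (replicate h (b, s) @ L) (B - k * \<alpha>) (bump M (b, s - k * ?\<beta>)) else 0))"
    unfolding \<alpha>_def by simp
  also have "\<dots> = (\<Sum>k\<le>gcd a b. if k \<in> set ks then ?c k * word_sum ks ?c h (\<lambda>\<nu>. ?F B M (\<nu>(k := Suc (\<nu> k)))) else 0)"
  proof (rule sum.cong[OF refl])
    fix k assume "k \<in> {..gcd a b}"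
    then have ks: "k \<in> set ks \<longleftrightarrow> k * \<alpha> \<le> r \<and> k * ?\<beta> \<le> s"
      using le_max_mult_iff[OF ab, of k r s] by (auto simp: ks_def less_Suc_eq_le \<alpha>_def)
    show "?c k * (if k * \<alpha> \<le> B \<and> k * ?\<beta> \<le> s
        then orbit_sum G a (replicate h (b, s) @ L) (B - k * \<alpha>) (bump M (b, s - k * ?\<beta>)) else 0) =
      (if k \<in> set ks then ?c k * word_sum ks ?c h (\<lambda>\<nu>. ?F B M (\<nu>(k := Suc (\<nu> k)))) else 0)"
    proof (cases "k \<in> set ks")
      case True
      show ?thesis
      proof (cases "k * \<alpha> \<le> B")
        case le: True
        have "orbit_sum G a (replicate h (b, s) @ L) (B - k * \<alpha>) (bump M (b, s - k * ?\<beta>)) =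
          word_sum ks ?c h (?F (B - k * \<alpha>) (bump M (b, s - k * ?\<beta>)))"
          by (rule Suc.IH) (use Suc.prems in simp)
        then show ?thesis using True le ks by (simp only: F[OF True] if_True simp_thms)
      next
        case False
        have "(\<lambda>\<nu>. ?F B M (\<nu>(k := Suc (\<nu> k)))) = (\<lambda>_. 0)"
          unfolding F[OF True] using False by simp
        then show ?thesis using False by (simp only: word_sum_zero) simp
      qed
    next
      case False
      then have n: "\<not> (k * \<alpha> \<le> B \<and> k * ?\<beta> \<le> s)" using ks Suc.prems by auto
      show ?thesis unfolding if_not_P[OF n] if_not_P[OF False] by simp
    qed
  qed
  also have "\<dots> = (\<Sum>k\<in>set ks. ?c k * word_sum ks ?c h (\<lambda>\<nu>. ?F B M (\<nu>(k := Suc (\<nu> k)))))"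
  proof -
    have "set ks \<subseteq> {..gcd a b}" by (auto simp: ks_def max_mult_def)
    then have "{k \<in> {..gcd a b}. k \<in> set ks} = set ks" by blast
    then show ?thesis by (simp add: sum.inter_filter[symmetric] del: mem_Collect_eq)
  qed
  also have "\<dots> = (\<Sum>k\<leftarrow>ks. ?c k * word_sum ks ?c h (\<lambda>\<nu>. ?F B M (\<nu>(k := Suc (\<nu> k)))))"
    by (rule sum_list_distinct_conv_sum_set[OF dks, symmetric])
  also have "\<dots> = word_sum ks ?c (Suc h) (?F B M)"
    by (simp only: word_sum.simps)
  finally show ?case .
qed

lemma val_familiesC_Cons:
  "val (familiesC (((b, s), h) # T) a r B) = concat (map (\<lambda>(f, B').
      map (\<lambda>\<nu>. ((b, s), f) # \<nu>) (val (familiesC T a r B')))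
    (val (splitsC [0..<Suc (max_mult a r b s)] (b div gcd a b) h B)))"
proof -
  have "val (familiesC (((b, s), h) # T) a r B) = fold (\<lambda>p acc. acc @ (case p of (f, B') \<Rightarrow>
      map (\<lambda>\<nu>. ((b, s), f) # \<nu>) (val (familiesC T a r B'))))
    (val (splitsC [0..<Suc (max_mult a r b s)] (b div gcd a b) h B)) []"
    by (simp add: max_mult_def case_prod_beta' del: upt_Suc)
  then show ?thesis by (simp only: fold_append_concat append_Nil)
qed

declare familiesC.simps(2) [simp del]

definition family_weight :: "nat \<Rightarrow> family \<Rightarrow> nat" where
  "family_weight a \<nu> = (\<Prod>((b, s), f)\<leftarrow>\<nu>. multinomial (map snd f) * (\<Prod>(k, j)\<leftarrow>f. (gcd a b choose k) ^ j))"

lemma fold_times_prod_list': "fold (\<lambda>x s. s * x) xs s = s * prod_list xs" for s :: nat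
  by (induction xs arbitrary: s) (auto simp: mult.assoc)

lemma val_weightC: "val (weightC a \<nu>) = family_weight a \<nu>"
proof -
  have "val (weightC a \<nu>) = fold (\<lambda>x acc. acc * x)
    (map (\<lambda>((b, s), f). multinomial (map snd f) * (\<Prod>(k, j)\<leftarrow>f. (gcd a b choose k) ^ j)) \<nu>) 1"
    unfolding weightC_def
    by (simp add: fold_map comp_def case_prod_beta' multinomial_def)
  then show ?thesis by (simp add: fold_times_prod_list' family_weight_def)
qed

text \<open>A table is a list of runs of equal types. For each entry \<open>sum_splitsC\<close>
  turns the enumeration of the program into a sum over words, and \<open>orbit_sum_replicate\<close>
  recognizes that sum as one run of the traversal. The budget and the partial state \<open>M\<close>
  vary in the induction.\<close>

lemma sum_familiesC:
  assumes a: "a > 0" and T: "\<And>b s h. ((b, s), h) \<in> set T \<Longrightarrow> b > 0" and B: "B \<le> r"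
  shows "(\<Sum>\<nu>\<leftarrow>val (familiesC T a r B). family_weight a \<nu> * G (drop_zero (\<lambda>q. M q + next_count a \<nu> q))) =
    orbit_sum G a (concat (map (\<lambda>(p, h). replicate h p) T)) B M"
  using T B
proof (induction T arbitrary: B M)
  case Nil
  show ?case by (simp add: family_weight_def next_count_def)
next
  case (Cons e T)
  obtain b s h where e: "e = ((b, s), h)" by (metis prod.exhaust)
  have b: "b > 0" using Cons.prems(1) e by auto
  let ?ks = "[0..<Suc (max_mult a r b s)]" and ?\<alpha> = "b div gcd a b" and ?c = "\<lambda>k. gcd a b choose k"
  let ?L = "concat (map (\<lambda>(p, h). replicate h p) T)"
  let ?sp = "val (splitsC ?ks ?\<alpha> h B)"
  let ?w = "\<lambda>f. multinomial (map snd f) * (\<Prod>(k, j)\<leftarrow>f. ?c k ^ j)"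
  have "(\<Sum>\<nu>\<leftarrow>val (familiesC (e # T) a r B). family_weight a \<nu> * G (drop_zero (\<lambda>q. M q + next_count a \<nu> q))) =
    (\<Sum>(f, B')\<leftarrow>?sp. \<Sum>\<nu>\<leftarrow>val (familiesC T a r B').
       family_weight a (((b, s), f) # \<nu>) * G (drop_zero (\<lambda>q. M q + next_count a (((b, s), f) # \<nu>) q)))"
    unfolding e val_familiesC_Cons sum_list_concat_map by (simp add: case_prod_beta' comp_def)
  also have "\<dots> = (\<Sum>(f, B')\<leftarrow>?sp. ?w f * orbit_sum G a ?L B' (\<lambda>q. M q + contribution a ((b, s), f) q))"
  proof (rule arg_cong[where f = sum_list], rule map_cong[OF refl])
    fix p assume p: "p \<in> set ?sp"
    obtain f B' where fB: "p = (f, B')" by (cases p)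
    have "B' \<le> r" using splitsC_elem[OF p[unfolded fB]] Cons.prems(2) by linarith
    have "(\<Sum>\<nu>\<leftarrow>val (familiesC T a r B').
       family_weight a (((b, s), f) # \<nu>) * G (drop_zero (\<lambda>q. M q + next_count a (((b, s), f) # \<nu>) q))) =
      (\<Sum>\<nu>\<leftarrow>val (familiesC T a r B'). ?w f * (family_weight a \<nu> *
        G (drop_zero (\<lambda>q. (M q + contribution a ((b, s), f) q) + next_count a \<nu> q))))"
      by (simp add: family_weight_def next_count_def algebra_simps)
    also have "\<dots> = ?w f * (\<Sum>\<nu>\<leftarrow>val (familiesC T a r B'). family_weight a \<nu> *
        G (drop_zero (\<lambda>q. (M q + contribution a ((b, s), f) q) + next_count a \<nu> q)))"
      by (rule sum_list_const_mult)
    also have "(\<Sum>\<nu>\<leftarrow>val (familiesC T a r B'). family_weight a \<nu> *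
        G (drop_zero (\<lambda>q. (M q + contribution a ((b, s), f) q) + next_count a \<nu> q))) =
      orbit_sum G a ?L B' (\<lambda>q. M q + contribution a ((b, s), f) q)"
      by (rule Cons.IH) (use Cons.prems \<open>B' \<le> r\<close> in auto)
    finally show "(case p of (f, B') \<Rightarrow> \<Sum>\<nu>\<leftarrow>val (familiesC T a r B').
       family_weight a (((b, s), f) # \<nu>) * G (drop_zero (\<lambda>q. M q + next_count a (((b, s), f) # \<nu>) q))) =
      (case p of (f, B') \<Rightarrow> ?w f * orbit_sum G a ?L B' (\<lambda>q. M q + contribution a ((b, s), f) q))"
      by (simp add: fB)
  qed
  also have "\<dots> = word_sum ?ks ?c h (\<lambda>\<nu>. if (\<Sum>k\<leftarrow>?ks. k * ?\<alpha> * \<nu> k) \<le> B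
      then orbit_sum G a ?L (B - (\<Sum>k\<leftarrow>?ks. k * ?\<alpha> * \<nu> k))
        (\<lambda>q. M q + contribution a ((b, s), map (\<lambda>k. (k, \<nu> k)) ?ks) q) else 0)"
    by (rule sum_splitsC) simp
  also have "\<dots> = orbit_sum G a (replicate h (b, s) @ ?L) B M"
    by (rule orbit_sum_replicate[OF a b Cons.prems(2), symmetric])
  finally show ?case by (simp add: e)
qed

lemma familiesC_elem:
  "\<nu> \<in> set (val (familiesC T a r B)) \<Longrightarrow> map fst \<nu> = map fst T \<and>
    list_all2 (\<lambda>e x. map fst (snd e) = [0..<Suc (max_mult a r (fst (fst x)) (snd (fst x)))] \<and>
      sum_list (map snd (snd e)) = snd x) \<nu> T"
proof (induction T arbitrary: B \<nu>)
  case Nil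
  then show ?case by (auto split: if_splits)
next
  case (Cons e T)
  obtain b s h where e: "e = ((b, s), h)" by (metis prod.exhaust)
  from Cons.prems obtain f B' \<nu>' where *: "(f, B') \<in> set (val (splitsC [0..<Suc (max_mult a r b s)] (b div gcd a b) h B))"
    "\<nu>' \<in> set (val (familiesC T a r B'))" "\<nu> = ((b, s), f) # \<nu>'"
    unfolding e val_familiesC_Cons by (auto simp del: upt_Suc)
  show ?case using Cons.IH[OF *(2)] splitsC_elem[OF *(1)] by (simp add: *(3) e del: upt_Suc)
qed

section \<open>Tables as canonical forms of states\<close>

definition table_keys :: "nat \<Rightarrow> nat \<Rightarrow> (nat \<times> nat) list" where
  "table_keys d n = List.product [1..<Suc n] [1..<Suc d]"

lemma distinct_table_keys: "distinct (table_keys d n)"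
  by (simp add: table_keys_def distinct_product del: upt_Suc)

lemma set_table_keys: "set (table_keys d n) = {1..n} \<times> {1..d}"
  by (auto simp: table_keys_def)

lemma length_table_keys: "length (table_keys d n) = n * d"
  by (simp add: table_keys_def length_product del: upt_Suc)

text \<open>Fixing the keys and their order makes the table of a state unique. Hence comparing
  tables decides equality of states in the cache, and keys can be counted as states.\<close>

definition is_table :: "nat \<Rightarrow> nat \<Rightarrow> table \<Rightarrow> bool" where
  "is_table d n T \<longleftrightarrow> map fst T = table_keys d n"

lemma state_of_in: "distinct (map fst T) \<Longrightarrow> (p, h) \<in> set T \<Longrightarrow> state_of T p = h"
  by (simp add: state_of_def)

lemma state_of_notin: "p \<notin> set (map fst T) \<Longrightarrow> state_of T p = 0"
  by (auto simp: state_of_def split: option.split dest: map_of_SomeD intro: rev_image_eqI)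

lemma state_of_map:
  assumes "map fst T = ks" "distinct ks"
  shows "T = map (\<lambda>p. (p, state_of T p)) ks"
proof -
  have "map (\<lambda>p. (p, state_of T p)) ks = map (\<lambda>e. (fst e, state_of T (fst e))) T"
    using assms(1) by (auto simp: comp_def)
  also have "\<dots> = map (\<lambda>e. e) T"
    by (rule map_cong[OF refl]) (use assms in \<open>auto simp: state_of_in\<close>)
  finally show ?thesis by simp
qed

lemma state_of_map_keys: "distinct ks \<Longrightarrow> state_of (map (\<lambda>p. (p, g p)) ks) p = (if p \<in> set ks then g p else 0)"
  by (auto simp: state_of_def map_of_map_restrict restrict_map_def)

lemma is_table_eqI:
  assumes "is_table d n T" "is_table d n T'" "state_of T = state_of T'"
  shows "T = T'"
  using state_of_map[of T] state_of_map[of T'] assms distinct_table_keys unfolding is_table_def by metis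

lemma state_of_support: "is_table d n T \<Longrightarrow> state_of T p \<noteq> 0 \<Longrightarrow> p \<in> {1..n} \<times> {1..d}"
  unfolding set_table_keys[symmetric] is_table_def using state_of_notin by metis

lemma normalized_state_of: "is_table d n T \<Longrightarrow> normalized d (state_of T)"
proof -
  assume T: "is_table d n T"
  have "{p. state_of T p \<noteq> 0} \<subseteq> {1..n} \<times> {1..d}" using state_of_support[OF T] by blast
  moreover from this have "finite {p. state_of T p \<noteq> 0}" by (rule finite_subset) simp
  ultimately show ?thesis by (auto simp: normalized_def subset_iff)
qed

lemma state_size_keys:
  assumes "finite A" "{p. H p \<noteq> 0} \<subseteq> A"
  shows "state_size H = (\<Sum>p\<in>A. fst p * H p)"
proof -
  have "state_size H = (\<Sum>p\<in>{p. H p \<noteq> 0}. fst p * H p)"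
    unfolding state_size_def by (rule sum.cong) auto
  also have "\<dots> = (\<Sum>p\<in>A. fst p * H p)"
    by (rule sum.mono_neutral_left) (use assms in auto)
  finally show ?thesis .
qed

lemma state_size_table:
  assumes "is_table d n T"
  shows "state_size (state_of T) = (\<Sum>(p, h)\<leftarrow>T. fst p * h)"
proof -
  have "state_size (state_of T) = (\<Sum>p\<in>set (table_keys d n). fst p * state_of T p)"
    by (rule state_size_keys) (use state_of_support[OF assms] set_table_keys in auto)
  also have "\<dots> = (\<Sum>p\<leftarrow>table_keys d n. fst p * state_of T p)"
    by (rule sum_list_distinct_conv_sum_set[OF distinct_table_keys, symmetric])
  also have "\<dots> = (\<Sum>(p, h)\<leftarrow>map (\<lambda>p. (p, state_of T p)) (table_keys d n). fst p * h)"
    by (simp add: comp_def)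
  also have "map (\<lambda>p. (p, state_of T p)) (table_keys d n) = T"
    using state_of_map[of T, OF _ distinct_table_keys] assms by (simp add: is_table_def)
  finally show ?thesis .
qed

lemma val_removeC:
  assumes T: "is_table d n T"
  shows "val (removeC q T) = map (\<lambda>p. (p, ((state_of T)(q := state_of T q - 1)) p)) (table_keys d n)"
proof -
  have "val (removeC q T) = map (\<lambda>(p, h). if p = q then (p, h - 1) else (p, h)) T"
    by (simp add: removeC_def case_prod_beta' cong: if_cong)
  also have "\<dots> = map (\<lambda>(p, h). if p = q then (p, h - 1) else (p, h))
      (map (\<lambda>p. (p, state_of T p)) (table_keys d n))"
    by (rule arg_cong[where f = "map _"], rule state_of_map[OF _ distinct_table_keys])
      (use T in \<open>simp add: is_table_def\<close>)
  also have "\<dots> = map (\<lambda>p. (p, ((state_of T)(q := state_of T q - 1)) p)) (table_keys d n)"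
    by auto
  finally show ?thesis .
qed

text \<open>The recurrence holds for the removal of a cycle at any nonzero entry; so all that has to
  be known of the chosen pair is that its entry is nonzero, and of \<open>None\<close> that the
  state is zero.\<close>

lemma val_pickC: "val (pickC T) = None \<Longrightarrow> (p, h) \<in> set T \<Longrightarrow> h = 0"
  and val_pickC_Some: "val (pickC T) = Some p \<Longrightarrow> \<exists>h. (p, h) \<in> set T \<and> h \<noteq> 0"
proof -
  have *: "val (pickC T) = fold (\<lambda>(p, h) acc. if h = 0 then acc else Some p) T None"
    by (simp add: pickC_def case_prod_beta' cong: if_cong)
  have "fold (\<lambda>(p, h) acc. if h = 0 then acc else Some p) T acc = None \<longleftrightarrow>
      acc = None \<and> (\<forall>(p, h)\<in>set T. h = 0)" for acc
    by (induction T arbitrary: acc) (auto split: if_splits)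
  then show "val (pickC T) = None \<Longrightarrow> (p, h) \<in> set T \<Longrightarrow> h = 0" by (auto simp: *)
  have "fold (\<lambda>(p, h) acc. if h = 0 then acc else Some p) T acc = Some p \<Longrightarrow>
      acc = Some p \<or> (\<exists>h. (p, h) \<in> set T \<and> h \<noteq> 0)" for acc
  proof (induction T arbitrary: acc)
    case (Cons e T)
    obtain q h where e: "e = (q, h)" by (cases e)
    have "(if h = 0 then acc else Some q) = Some p \<or> (\<exists>h. (p, h) \<in> set T \<and> h \<noteq> 0)"
      by (rule Cons.IH) (use Cons.prems e in simp)
    then show ?case by (cases "h = 0") (auto simp: e)
  qed simp
  then show "val (pickC T) = Some p \<Longrightarrow> \<exists>h. (p, h) \<in> set T \<and> h \<noteq> 0" by (fastforce simp: *)
qed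

lemma val_nextC: "val (nextC a \<nu>) = map (\<lambda>e. (fst e, next_count a \<nu> (fst e))) \<nu>"
proof -
  have inner: "fold (\<lambda>(k, j) acc. if (b', s) = (b, t + k * \<beta>) then acc + j else acc) f acc =
      (\<Sum>(k, j)\<leftarrow>f. if (b', s) = (b, t + k * \<beta>) then j else 0) + acc" for f :: "(nat \<times> nat) list" and b' s b t \<beta> acc :: nat
    by (induction f arbitrary: acc) auto
  have outer: "fold (\<lambda>((b', s), f) acc. fold (\<lambda>(k, j) acc. if (b', s) = (b, t + k * \<beta>) then acc + j else acc) f acc) \<mu> acc =
      (\<Sum>((b', s), f)\<leftarrow>\<mu>. \<Sum>(k, j)\<leftarrow>f. if (b', s) = (b, t + k * \<beta>) then j else 0) + acc"
    for \<mu> :: family and b t \<beta> acc :: nat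
    by (induction \<mu> arbitrary: acc) (simp, simp add: case_prod_beta' inner[unfolded prod.inject case_prod_beta'])
  have "val (nextC a \<nu>) = map (\<lambda>((b, t), _). ((b, t), fold (\<lambda>((b', s), f) acc.
      fold (\<lambda>(k, j) acc. if (b', s) = (b, t + k * (a div gcd a b)) then acc + j else acc) f acc) \<nu> 0)) \<nu>"
    unfolding nextC_def by (simp add: case_prod_beta' prod_eq_iff cong: if_cong)
  also have "\<dots> = map (\<lambda>e. (fst e, next_count a \<nu> (fst e))) \<nu>"
    unfolding outer next_count_def contribution_def by (simp add: case_prod_beta' prod_eq_iff)
  finally show ?thesis .
qed

lemma val_termsC:
  "val (termsC T a r) = concat (map (\<lambda>u. map (\<lambda>\<nu>.
      ((if odd a \<and> odd u then 0 else (a - 1) div 2 choose (u div 2)) * family_weight a \<nu>, val (nextC a \<nu>)))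
      (val (familiesC (val (removeC (a, r) T)) a r (r - u)))) [0..<Suc r])"
proof -
  have "val (termsC T a r) = fold (\<lambda>u acc. acc @ map (\<lambda>\<nu>.
      ((if odd a \<and> odd u then 0 else (a - 1) div 2 choose (u div 2)) * family_weight a \<nu>, val (nextC a \<nu>)))
      (val (familiesC (val (removeC (a, r) T)) a r (r - u)))) [0..<Suc r] []"
    unfolding termsC_def by (simp add: val_weightC del: upt_Suc)
  then show ?thesis by (simp only: fold_append_concat append_Nil)
qed

lemma count_list_replicate_concat:
  "distinct (map fst T) \<Longrightarrow> count_list (concat (map (\<lambda>(p, h). replicate h p) T)) q = state_of T q"
proof (induction T)
  case (Cons e T)
  obtain p h where e: "e = (p, h)" by (cases e)
  have "count_list (replicate h p) q = (if p = q then h else 0)" by (induction h) auto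
  moreover have "state_of T p = 0" using Cons.prems e by (intro state_of_notin) auto
  ultimately show ?case using Cons by (auto simp: e state_of_def)
qed (simp add: state_of_def)

lemma contribution_zero:
  assumes "fst e \<in> {1..n} \<times> {1..d}" "p \<notin> {1..n} \<times> {1..d}" "snd p \<noteq> 0"
  shows "contribution a e p = 0"
proof -
  have "fst e \<noteq> (fst p, snd p + k * (a div gcd a (fst p)))" for k
  proof
    assume "fst e = (fst p, snd p + k * (a div gcd a (fst p)))"
    then show False using assms by (cases p) auto
  qed
  then show ?thesis by (auto simp: contribution_def intro!: sum_list_0)
qed

text \<open>Joining changes degrees but never the length of a cycle, so each count of the entry
  reaches at most one key, with the same \<open>b\<close>. The inequality may be strict, since
  cycles whose degree is used up have no key.\<close>

lemma sum_contribution_le: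
  assumes "finite A"
  shows "(\<Sum>p\<in>A. fst p * contribution a e p) \<le> fst (fst e) * sum_list (map snd (snd e))"
proof -
  obtain b s f where e: "e = ((b, s), f)" by (metis prod.exhaust)
  let ?t = "\<lambda>k p. (b, s) = (fst p, snd p + k * (a div gcd a (fst p)))"
  have one: "(\<Sum>p\<in>A. fst p * (if ?t k p then j else 0)) \<le> b * j" for k j
  proof -
    have "(\<Sum>p\<in>A. fst p * (if ?t k p then j else 0)) \<le>
      (\<Sum>p\<in>A. if p = (b, s - k * (a div gcd a b)) then b * j else 0)"
      by (rule sum_mono) (auto simp: prod_eq_iff)
    also have "\<dots> \<le> b * j" using assms by (simp add: sum.delta)
    finally show ?thesis .
  qed
  have "(\<Sum>p\<in>A. fst p * contribution a e p) =
    (\<Sum>p\<in>A. \<Sum>(k, j)\<leftarrow>f. fst p * (if ?t k p then j else 0))"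
    by (simp add: contribution_def e sum_list_const_mult[symmetric] case_prod_beta')
  also have "\<dots> = (\<Sum>(k, j)\<leftarrow>f. \<Sum>p\<in>A. fst p * (if ?t k p then j else 0))"
    using sum_list_sum_swap[of "\<lambda>x p. fst p * (if ?t (fst x) p then snd x else 0)" A f]
    by (simp add: case_prod_beta')
  also have "\<dots> \<le> (\<Sum>(k, j)\<leftarrow>f. b * j)"
    by (rule sum_list_mono) (use one in \<open>simp add: case_prod_beta'\<close>)
  also have "\<dots> = b * sum_list (map snd f)"
    by (simp add: sum_list_const_mult case_prod_beta')
  finally show ?thesis by (simp add: e)
qed

context
  fixes d n :: nat and T :: table and a r :: nat
  assumes T: "is_table d n T" and H: "state_of T (a, r) > 0"
begin

lemma pos_a: "a > 0" and le_r: "r \<le> d" and ar_in: "(a, r) \<in> set (table_keys d n)"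
  using state_of_support[OF T, of "(a, r)"] H by (auto simp: set_table_keys)

lemma removeC_keys: "is_table d n (val (removeC (a, r) T))"
  by (simp add: is_table_def val_removeC[OF T] comp_def)

lemma state_of_removeC: "state_of (val (removeC (a, r) T)) = (state_of T)((a, r) := state_of T (a, r) - 1)"
proof
  fix q
  show "state_of (val (removeC (a, r) T)) q = ((state_of T)((a, r) := state_of T (a, r) - 1)) q"
  proof (cases "q \<in> set (table_keys d n)")
    case True
    then show ?thesis
      unfolding val_removeC[OF T] state_of_map_keys[OF distinct_table_keys] by simp
  next
    case False
    then have "state_of T q = 0" "q \<noteq> (a, r)"
      using state_of_support[OF T, of q] ar_in by (auto simp: set_table_keys)
    then show ?thesis
      unfolding val_removeC[OF T] state_of_map_keys[OF distinct_table_keys] using False by simp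
  qed
qed

lemma size_removeC: "state_size (state_of T) = state_size (state_of (val (removeC (a, r) T))) + a"
proof -
  let ?A = "set (table_keys d n)"
  have "state_size (state_of T) = (\<Sum>p\<in>?A. fst p * state_of T p)"
    by (rule state_size_keys) (use state_of_support[OF T] set_table_keys in auto)
  moreover have "state_size (state_of (val (removeC (a, r) T))) =
      (\<Sum>p\<in>?A. fst p * ((state_of T)((a, r) := state_of T (a, r) - 1)) p)"
    unfolding state_of_removeC[symmetric]
    by (rule state_size_keys) (use state_of_support[OF removeC_keys] set_table_keys in auto)
  moreover have "(\<Sum>p\<in>?A. fst p * state_of T p) =
      fst (a, r) * state_of T (a, r) + (\<Sum>p\<in>?A - {(a, r)}. fst p * state_of T p)"
    using ar_in by (intro sum.remove) auto
  moreover have "(\<Sum>p\<in>?A. fst p * ((state_of T)((a, r) := state_of T (a, r) - 1)) p) =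
      fst (a, r) * (state_of T (a, r) - 1) + (\<Sum>p\<in>?A - {(a, r)}. fst p * state_of T p)"
    using ar_in by (subst sum.remove[of _ "(a, r)"]) (auto intro!: sum.cong)
  moreover obtain m where "state_of T (a, r) = Suc m" using H by (cases "state_of T (a, r)") auto
  ultimately show ?thesis by simp
qed

text \<open>Degree 0 is not among the keys, so the program discards finished cycles in agreement
  with \<open>drop_zero\<close>. The drop in size by \<open>a\<close> drives the recursion: it
  bounds the depth and keeps the current state out of the cache until its value is known.\<close>

lemma nextC_table:
  assumes \<nu>: "\<nu> \<in> set (val (familiesC (val (removeC (a, r) T)) a r' B))"
  shows "val (nextC a \<nu>) = map (\<lambda>p. (p, next_count a \<nu> p)) (table_keys d n)"
    and "is_table d n (val (nextC a \<nu>))"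
    and "state_of (val (nextC a \<nu>)) = drop_zero (next_count a \<nu>)"
    and "state_size (state_of (val (nextC a \<nu>))) + a \<le> state_size (state_of T)"
proof -
  let ?T' = "val (removeC (a, r) T)"
  have keys: "map fst \<nu> = table_keys d n"
    using familiesC_elem[OF \<nu>] removeC_keys by (simp add: is_table_def)
  show eq: "val (nextC a \<nu>) = map (\<lambda>p. (p, next_count a \<nu> p)) (table_keys d n)"
    unfolding val_nextC keys[symmetric] by simp
  show tab: "is_table d n (val (nextC a \<nu>))"
    by (simp add: eq is_table_def comp_def)
  have kin: "fst e \<in> {1..n} \<times> {1..d}" if "e \<in> set \<nu>" for e
    using that keys set_table_keys by (metis image_eqI list.set_map)
  show st: "state_of (val (nextC a \<nu>)) = drop_zero (next_count a \<nu>)"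
  proof
    fix p :: "nat \<times> nat"
    obtain b t where p: "p = (b, t)" by (cases p)
    show "state_of (val (nextC a \<nu>)) p = drop_zero (next_count a \<nu>) p"
    proof (cases "p \<in> set (table_keys d n)")
      case True
      then show ?thesis
        unfolding eq state_of_map_keys[OF distinct_table_keys]
        by (auto simp: drop_zero_def p set_table_keys)
    next
      case False
      have "next_count a \<nu> p = 0" if "t \<noteq> 0"
      proof -
        have "contribution a e p = 0" if "e \<in> set \<nu>" for e
          by (rule contribution_zero[OF kin[OF that]])
            (use False \<open>t \<noteq> 0\<close> p set_table_keys in auto)
        then show ?thesis by (auto simp: next_count_def intro!: sum_list_0)
      qed
      then show ?thesis
        unfolding eq state_of_map_keys[OF distinct_table_keys] using False
        by (auto simp: drop_zero_def p)
    qed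
  qed
  let ?A = "set (table_keys d n)"
  have "state_size (state_of (val (nextC a \<nu>))) = (\<Sum>p\<in>?A. fst p * state_of (val (nextC a \<nu>)) p)"
    by (rule state_size_keys) (use state_of_support[OF tab] set_table_keys in auto)
  also have "\<dots> = (\<Sum>p\<in>?A. fst p * next_count a \<nu> p)"
    by (rule sum.cong[OF refl]) (simp add: eq state_of_map_keys[OF distinct_table_keys])
  also have "\<dots> = (\<Sum>p\<in>?A. \<Sum>e\<leftarrow>\<nu>. fst p * contribution a e p)"
    by (simp add: next_count_def sum_list_const_mult)
  also have "\<dots> = (\<Sum>e\<leftarrow>\<nu>. \<Sum>p\<in>?A. fst p * contribution a e p)"
    by (rule sum_list_sum_swap[symmetric])
  also have "\<dots> \<le> (\<Sum>e\<leftarrow>\<nu>. fst (fst e) * sum_list (map snd (snd e)))"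
    by (rule sum_list_mono) (rule sum_contribution_le, simp)
  also have "\<dots> = (\<Sum>(p, h)\<leftarrow>?T'. fst p * h)"
  proof -
    have "list_all2 (\<lambda>e x. sum_list (map snd (snd e)) = snd x) \<nu> ?T'"
      using familiesC_elem[OF \<nu>] by (auto elim: list_all2_mono)
    then have "list_all2 (\<lambda>e x. fst e = fst x \<and> sum_list (map snd (snd e)) = snd x) \<nu> ?T'"
      using familiesC_elem[OF \<nu>] by (auto simp: list_all2_conv_all_nth) (metis nth_map)
    then show ?thesis by (induction rule: list_all2_induct) (auto simp: case_prod_beta')
  qed
  also have "\<dots> = state_size (state_of ?T')" by (rule state_size_table[OF removeC_keys, symmetric])
  finally show "state_size (state_of (val (nextC a \<nu>))) + a \<le> state_size (state_of T)"
    using size_removeC by simp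
qed

lemma termsC_table:
  assumes "(c, T') \<in> set (val (termsC T a r))"
  shows "is_table d n T'" "state_size (state_of T') < state_size (state_of T)"
proof -
  obtain u \<nu> where "\<nu> \<in> set (val (familiesC (val (removeC (a, r) T)) a r (r - u)))" "T' = val (nextC a \<nu>)"
    using assms unfolding val_termsC by (auto simp del: upt_Suc)
  then show "is_table d n T'" "state_size (state_of T') < state_size (state_of T)"
    using nextC_table(2,4) pos_a by fastforce+
qed

text \<open>Started with the zero state, \<open>sum_familiesC\<close> turns the families back into a
  traversal of the table read as a list of types. The multiplicities in this list are those of the
  state with one cycle removed, so the recurrence for \<open>Phi\<close> applies.\<close>

lemma sum_termsC: "(\<Sum>(c, T')\<leftarrow>val (termsC T a r). c * Phi d (state_of T')) = Phi d (state_of T)"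
proof -
  let ?T' = "val (removeC (a, r) T)"
  let ?L = "concat (map (\<lambda>(p, h). replicate h p) ?T')"
  let ?I = "\<lambda>u. if odd a \<and> odd u then 0 else (a - 1) div 2 choose (u div 2)"
  have dis: "distinct (map fst ?T')"
    using removeC_keys distinct_table_keys by (simp add: is_table_def)
  have "(\<Sum>(c, T')\<leftarrow>val (termsC T a r). c * Phi d (state_of T')) =
    (\<Sum>u\<leftarrow>[0..<Suc r]. \<Sum>\<nu>\<leftarrow>val (familiesC ?T' a r (r - u)).
       ?I u * family_weight a \<nu> * Phi d (state_of (val (nextC a \<nu>))))"
    unfolding val_termsC sum_list_concat_map by (simp add: comp_def del: upt_Suc)
  also have "\<dots> = (\<Sum>u\<le>r. \<Sum>\<nu>\<leftarrow>val (familiesC ?T' a r (r - u)).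
       ?I u * family_weight a \<nu> * Phi d (state_of (val (nextC a \<nu>))))"
    by (rule sum_list_upt)
  also have "\<dots> = (\<Sum>u\<le>r. ?I u * orbit_sum (Phi d) a ?L (r - u) (\<lambda>_. 0))"
  proof (rule sum.cong[OF refl])
    fix u
    have "(\<Sum>\<nu>\<leftarrow>val (familiesC ?T' a r (r - u)).
       ?I u * family_weight a \<nu> * Phi d (state_of (val (nextC a \<nu>)))) =
      (\<Sum>\<nu>\<leftarrow>val (familiesC ?T' a r (r - u)).
       ?I u * (family_weight a \<nu> * Phi d (drop_zero (\<lambda>q. 0 + next_count a \<nu> q))))"
      by (rule arg_cong[where f = sum_list], rule map_cong[OF refl])
        (simp add: nextC_table(3))
    also have "\<dots> = ?I u * (\<Sum>\<nu>\<leftarrow>val (familiesC ?T' a r (r - u)).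
       family_weight a \<nu> * Phi d (drop_zero (\<lambda>q. 0 + next_count a \<nu> q)))"
      by (rule sum_list_const_mult)
    also have "(\<Sum>\<nu>\<leftarrow>val (familiesC ?T' a r (r - u)).
       family_weight a \<nu> * Phi d (drop_zero (\<lambda>q. 0 + next_count a \<nu> q))) =
      orbit_sum (Phi d) a ?L (r - u) (\<lambda>_. 0)"
    proof (rule sum_familiesC[OF pos_a])
      fix b s h assume "((b, s), h) \<in> set ?T'"
      then have "(b, s) \<in> set (map fst ?T')" by force
      then have "(b, s) \<in> set (table_keys d n)" using removeC_keys unfolding is_table_def by metis
      then show "b > 0" by (simp add: set_table_keys)
    qed simp
    finally show "(\<Sum>\<nu>\<leftarrow>val (familiesC ?T' a r (r - u)).
       ?I u * family_weight a \<nu> * Phi d (state_of (val (nextC a \<nu>)))) =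
       ?I u * orbit_sum (Phi d) a ?L (r - u) (\<lambda>_. 0)" .
  qed
  also have "\<dots> = Phi d (state_of T)"
  proof -
    obtain V \<sigma> \<rho> where R: "realization d (state_of T) (V :: nat set) \<sigma> \<rho>"
      using realization_exists[OF normalized_state_of[OF T]] .
    show ?thesis
      by (rule Phi_recurrence[OF R H, symmetric])
        (simp only: count_list_replicate_concat[OF dis] state_of_removeC)
  qed
  finally show ?thesis .
qed

end

lemma Phi_zero:
  assumes "\<And>p. H p = 0"
  shows "Phi d H = 1"
proof -
  have "realization d H ({} :: nat set) id (\<lambda>_. 0)"
    using assms by (simp add: realization_def)
  moreover have "fixed_graphs ({} :: nat set) id (\<lambda>_. 0) = {{}}"
    by (auto simp: fixed_graphs_def all_pairs_def)
  ultimately show ?thesis using Phi_eq by fastforce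
qed

section \<open>Correctness of the memoized evaluation\<close>

definition valid_cache :: "nat \<Rightarrow> nat \<Rightarrow> cache \<Rightarrow> bool" where
  "valid_cache d n C \<longleftrightarrow> distinct (map fst C) \<and>
     (\<forall>(T, v)\<in>set C. is_table d n T \<and> state_size (state_of T) \<le> n \<and> v = Phi d (state_of T))"

text \<open>The bound on the sizes of new keys is what preserves distinctness: recursive calls
  concern smaller states only, so they cannot insert the key on whose behalf they are made.\<close>

definition cache_step :: "nat \<Rightarrow> nat \<Rightarrow> nat \<Rightarrow> cache \<Rightarrow> cache \<Rightarrow> bool" where
  "cache_step d n m C C' \<longleftrightarrow> valid_cache d n C' \<and> length C \<le> length C' \<and>
     (\<forall>(T, v)\<in>set C'. T \<in> fst ` set C \<or> state_size (state_of T) \<le> m)"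

lemma cache_step_refl: "valid_cache d n C \<Longrightarrow> cache_step d n m C C"
  by (force simp: cache_step_def)

lemma cache_step_trans:
  "cache_step d n m C C' \<Longrightarrow> cache_step d n m C' C'' \<Longrightarrow> cache_step d n m C C''"
  unfolding cache_step_def by (fastforce simp: image_iff)

lemma cache_step_mono: "cache_step d n m C C' \<Longrightarrow> m \<le> m' \<Longrightarrow> cache_step d n m' C C'"
  unfolding cache_step_def by fastforce

lemma cache_step_insert:
  assumes "cache_step d n m C C'" "T \<notin> fst ` set C'" "is_table d n T"
    "state_size (state_of T) \<le> n" "state_size (state_of T) \<le> m"
  shows "cache_step d n m C ((T, Phi d (state_of T)) # C')"
  using assms by (simp add: cache_step_def valid_cache_def)

lemma val_lookupC: "val (lookupC C T) = map_of C T"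
  by (induction C) (auto simp: case_prod_beta')

definition term_step :: "nat \<Rightarrow> nat \<times> table \<Rightarrow> nat \<times> cache \<Rightarrow> (nat \<times> cache) cost" where
  "term_step l = (\<lambda>(c, T') (acc, C). do {
                 (v, C') \<leftarrow> phiC l T' C;
                 x \<leftarrow> mulC c v;
                 acc' \<leftarrow> addC acc x;
                 ret (acc', C') })"

lemma phiC_Suc:
  "phiC (Suc l) T C = do {
     inspect (Suc l);
     known \<leftarrow> lookupC C T;
     (case known of
        Some v \<Rightarrow> ret (v, C)
      | None \<Rightarrow> do {
          p \<leftarrow> pickC T;
          (case p of
             None \<Rightarrow> ret (1, (T, 1) # C)
           | Some (a, r) \<Rightarrow> do {
               ts \<leftarrow> termsC T a r;
               (v, C') \<leftarrow> foldC (term_step l) ts (0, C);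
               ret (v, (T, v) # C') }) }) }"
  unfolding term_step_def by simp

declare phiC.simps(2) [simp del]

lemma val_term_step:
  "val (term_step l (c, T') (acc, C)) =
     (acc + c * fst (val (phiC l T' C)), snd (val (phiC l T' C)))"
  by (simp add: term_step_def case_prod_beta')

lemma fold_term_step:
  assumes "\<And>c T' C. (c, T') \<in> set ts \<Longrightarrow> valid_cache d n C \<Longrightarrow>
      fst (val (phiC l T' C)) = Phi d (state_of T') \<and> cache_step d n m C (snd (val (phiC l T' C)))"
    and "valid_cache d n C"
  shows "fst (fold (\<lambda>x s. val (term_step l x s)) ts (acc, C)) =
      acc + (\<Sum>(c, T')\<leftarrow>ts. c * Phi d (state_of T')) \<and>
    cache_step d n m C (snd (fold (\<lambda>x s. val (term_step l x s)) ts (acc, C)))"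
  using assms
proof (induction ts arbitrary: acc C)
  case Nil
  then show ?case by (simp add: cache_step_refl)
next
  case (Cons x ts)
  obtain c T' where x: "x = (c, T')" by (cases x)
  have 1: "fst (val (phiC l T' C)) = Phi d (state_of T')" "cache_step d n m C (snd (val (phiC l T' C)))"
    using Cons.prems x by auto
  then have v: "valid_cache d n (snd (val (phiC l T' C)))" by (simp add: cache_step_def)
  have IH: "fst (fold (\<lambda>x s. val (term_step l x s)) ts (acc + c * Phi d (state_of T'), snd (val (phiC l T' C)))) =
      acc + c * Phi d (state_of T') + (\<Sum>(c, T')\<leftarrow>ts. c * Phi d (state_of T')) \<and>
    cache_step d n m (snd (val (phiC l T' C)))
      (snd (fold (\<lambda>x s. val (term_step l x s)) ts (acc + c * Phi d (state_of T'), snd (val (phiC l T' C)))))"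
  proof (rule Cons.IH[OF _ v])
    fix c T' C assume "(c, T') \<in> set ts" "valid_cache d n C"
    then show "fst (val (phiC l T' C)) = Phi d (state_of T') \<and> cache_step d n m C (snd (val (phiC l T' C)))"
      using Cons.prems(1)[of c T' C] by simp
  qed
  then show ?case using cache_step_trans[OF 1(2)] 1(1) by (simp add: x val_term_step)
qed

theorem phiC_correct:
  assumes "is_table d n T" "state_size (state_of T) < l" "state_size (state_of T) \<le> n" "valid_cache d n C"
  shows "fst (val (phiC l T C)) = Phi d (state_of T) \<and>
    cache_step d n (state_size (state_of T)) C (snd (val (phiC l T C)))"
  using assms
proof (induction l arbitrary: T C)
  case (Suc l)
  let ?H = "state_of T"
  note T = Suc.prems(1)
  show ?case
  proof (cases "map_of C T")
    case (Some v)
    then have "(T, v) \<in> set C" by (rule map_of_SomeD)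
    then have "v = Phi d ?H" using Suc.prems(4) by (auto simp: valid_cache_def)
    then show ?thesis
      using cache_step_refl[OF Suc.prems(4)] Some by (simp add: phiC_Suc val_lookupC)
  next
    case None
    then have notin: "T \<notin> fst ` set C" by (simp add: map_of_eq_None_iff)
    show ?thesis
    proof (cases "val (pickC T)")
      case pick: None
      have "?H p = 0" for p
      proof (cases "map_of T p")
        case (Some h)
        then show ?thesis using val_pickC[OF pick map_of_SomeD[OF Some]] by (simp add: state_of_def)
      qed (simp add: state_of_def)
      then have "Phi d ?H = 1" by (rule Phi_zero)
      moreover have "cache_step d n (state_size ?H) C ((T, Phi d ?H) # C)"
        by (rule cache_step_insert[OF cache_step_refl]) (use Suc.prems notin in auto)
      ultimately show ?thesis using None pick by (simp add: phiC_Suc val_lookupC)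
    next
      case (Some p)
      obtain a r where p: "p = (a, r)" by (cases p)
      obtain h where "((a, r), h) \<in> set T" "h \<noteq> 0" using val_pickC_Some[OF Some] p by blast
      then have H: "?H (a, r) > 0"
        using state_of_in[of T "(a, r)" h] T distinct_table_keys by (simp add: is_table_def)
      let ?ts = "val (termsC T a r)"
      let ?s = "fold (\<lambda>x s. val (term_step l x s)) ?ts (0, C)"
      have tab: "is_table d n T'" "state_size (state_of T') < state_size ?H" if "(c, T') \<in> set ?ts" for c T'
        using termsC_table[OF T H that] by auto
      have "fst ?s = 0 + (\<Sum>(c, T')\<leftarrow>?ts. c * Phi d (state_of T')) \<and> cache_step d n (state_size ?H - 1) C (snd ?s)"
      proof (rule fold_term_step[OF _ Suc.prems(4)])
        fix c T' C' assume c: "(c, T') \<in> set ?ts" and C': "valid_cache d n C'"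
        have "fst (val (phiC l T' C')) = Phi d (state_of T') \<and>
          cache_step d n (state_size (state_of T')) C' (snd (val (phiC l T' C')))"
          by (rule Suc.IH[OF tab(1)[OF c] _ _ C']) (use tab(2)[OF c] Suc.prems in auto)
        then show "fst (val (phiC l T' C')) = Phi d (state_of T') \<and>
          cache_step d n (state_size ?H - 1) C' (snd (val (phiC l T' C')))"
          using tab(2)[OF c] by (auto intro: cache_step_mono)
      qed
      then have s: "fst ?s = Phi d ?H" "cache_step d n (state_size ?H - 1) C (snd ?s)"
        using sum_termsC[OF T H] by auto
      have pos: "state_size ?H > 0" using size_removeC[OF T H] pos_a[OF T H] by simp
      \<comment> \<open>\<open>T\<close> was absent from \<open>C\<close>, and all keys added by the
        loop have smaller size.\<close>
      have "T \<notin> fst ` set (snd ?s)"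
      proof
        assume "T \<in> fst ` set (snd ?s)"
        then obtain v where "(T, v) \<in> set (snd ?s)" by auto
        then have "T \<in> fst ` set C \<or> state_size ?H \<le> state_size ?H - 1"
          using s(2) by (auto simp: cache_step_def)
        then show False using notin pos by auto
      qed
      then have "cache_step d n (state_size ?H) C ((T, Phi d ?H) # snd ?s)"
        by (intro cache_step_insert cache_step_mono[OF s(2)]) (use Suc.prems in auto)
      then show ?thesis
        using None Some p s(1) by (simp add: phiC_Suc val_lookupC case_prod_beta')
    qed
  qed
qed simp

section \<open>Cycle types and Burnside's formula\<close>

definition cycle_count :: "('v \<Rightarrow> 'v) \<Rightarrow> 'v set \<Rightarrow> nat \<Rightarrow> nat" where
  "cycle_count p V a = card {C \<in> orbit p ` V. card C = a}"

text \<open>The permutations of \<open>C\<close> that consist of a single cycle, expressed through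
  one point \<open>v\<close> of it.\<close>

definition full_cycles :: "'v set \<Rightarrow> 'v \<Rightarrow> ('v \<Rightarrow> 'v) set" where
  "full_cycles C v = {c. c permutes C \<and> orbit c v = C}"

lemma finite_full_cycles: "finite C \<Longrightarrow> finite (full_cycles C v)"
  by (rule finite_subset[OF _ finite_permutations[of C]]) (auto simp: full_cycles_def)

context
  fixes V :: "'v set" and v :: 'v
  assumes fin: "finite V" and v: "v \<in> V"
begin

text \<open>The factors move disjoint sets of points, so the composite has the cycle
  \<open>C\<close> together with all cycles of \<open>q\<close>. The converse decomposition
  restricts a permutation to the orbit of \<open>v\<close> and to its complement.\<close>

lemma compose_cycle:
  assumes C: "v \<in> C" "C \<subseteq> V" and c: "c \<in> full_cycles C v" and q: "q permutes (V - C)"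
  shows "x \<in> C \<Longrightarrow> (c \<circ> q) x = c x" and "x \<notin> C \<Longrightarrow> (c \<circ> q) x = q x"
    and "(c \<circ> q) permutes V" and "orbit (c \<circ> q) v = C"
    and "x \<in> C \<Longrightarrow> orbit (c \<circ> q) x = C"
    and "x \<in> V - C \<Longrightarrow> orbit (c \<circ> q) x = orbit q x"
    and "cycle_count (c \<circ> q) V a = cycle_count q (V - C) a + (if a = card C then 1 else 0)"
proof -
  have c': "c permutes C" "orbit c v = C" using c by (auto simp: full_cycles_def)
  show 1: "(c \<circ> q) x = c x" if "x \<in> C" for x
    using permutes_not_in[OF q] that by simp
  show 2: "(c \<circ> q) x = q x" if "x \<notin> C" for x
  proof -
    have "q x \<notin> C"
      using permutes_in_image[OF q, of x] permutes_not_in[OF q, of x] that by (cases "x \<in> V - C") auto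
    then show ?thesis using permutes_not_in[OF c'(1)] by simp
  qed
  show p: "(c \<circ> q) permutes V"
    using permutes_subset[OF q] permutes_subset[OF c'(1) C(2)] by (intro permutes_compose) auto
  have self: "v \<in> orbit c v" using C c' by simp
  show orb: "orbit (c \<circ> q) v = C"
    using orbit_cong[OF self, of "c \<circ> q"] 1 c' by simp
  interpret P: finite_perm V "c \<circ> q" using fin p by unfold_locales
  interpret Q: finite_perm "V - C" q using fin q by unfold_locales auto
  show 5: "orbit (c \<circ> q) x = C" if "x \<in> C" for x
    using P.orbit_eq[of x v] orb that by simp
  show 6: "orbit (c \<circ> q) x = orbit q x" if "x \<in> V - C" for x
  proof (rule orbit_cong[OF Q.self_orbit])
    fix s assume "s \<in> orbit q x"
    then have "s \<notin> C" using permutes_orbit_subset[OF q that] by blast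
    then show "(c \<circ> q) s = q s" by (rule 2)
  qed
  have img: "orbit (c \<circ> q) ` V = insert C (orbit q ` (V - C))"
  proof -
    have "orbit (c \<circ> q) ` V = orbit (c \<circ> q) ` C \<union> orbit (c \<circ> q) ` (V - C)"
      using C by (simp add: image_Un[symmetric] Un_absorb1)
    also have "orbit (c \<circ> q) ` C = {C}" using 5 C by auto
    also have "orbit (c \<circ> q) ` (V - C) = orbit q ` (V - C)" using 6 by (intro image_cong) auto
    finally show ?thesis by (simp only: insert_is_Un[of C "orbit q ` (V - C)"])
  qed
  have notin: "C \<notin> orbit q ` (V - C)"
  proof
    assume "C \<in> orbit q ` (V - C)"
    then have "C \<subseteq> V - C" by (rule Q.orbit_subset)
    then show False using C by blast
  qed
  have eq: "{D \<in> orbit (c \<circ> q) ` V. card D = a} =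
    (if a = card C then insert C {D \<in> orbit q ` (V - C). card D = a} else {D \<in> orbit q ` (V - C). card D = a})"
    unfolding img by auto
  have "finite {D \<in> orbit q ` (V - C). card D = a}" "C \<notin> {D \<in> orbit q ` (V - C). card D = a}"
    using fin notin by auto
  then show "cycle_count (c \<circ> q) V a = cycle_count q (V - C) a + (if a = card C then 1 else 0)"
    unfolding cycle_count_def eq by (cases "a = card C") (simp_all del: mem_Collect_eq)
qed

lemma decompose_cycle:
  assumes p: "p permutes V"
  defines "C \<equiv> orbit p v"
  shows "v \<in> C" "C \<subseteq> V" "perm_restrict p C \<in> full_cycles C v" "perm_restrict p (V - C) permutes (V - C)"
    "perm_restrict p C \<circ> perm_restrict p (V - C) = p"
proof -
  interpret P: finite_perm V p using fin p by unfold_locales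
  have CV: "C \<in> orbit p ` V" using v by (simp add: C_def)
  show vC: "v \<in> C" using P.self_orbit by (simp add: C_def)
  show sub: "C \<subseteq> V" using P.orbit_subset[OF CV] .
  have bij: "bij_betw (perm_restrict p C) C C"
  proof -
    have "inj_on (perm_restrict p C) C"
      using permutes_inj[OF p] by (auto simp: inj_on_def perm_restrict_def inj_def)
    moreover have "perm_restrict p C ` C = C"
      using P.image_orbit[OF CV] by (simp add: perm_restrict_def)
    ultimately show ?thesis by (simp add: bij_betw_def)
  qed
  have pC: "perm_restrict p C permutes C"
    by (rule bij_imp_permutes[OF bij]) (simp add: perm_restrict_def)
  moreover have "orbit (perm_restrict p C) v = orbit p v"
    by (rule orbit_cong[OF P.self_orbit]) (simp add: perm_restrict_def C_def)
  ultimately show "perm_restrict p C \<in> full_cycles C v" by (simp add: full_cycles_def C_def)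
  show pD: "perm_restrict p (V - C) permutes (V - C)"
    unfolding C_def by (rule perm_restrict_diff_cyclic[OF p cyclic_on_orbit[OF p fin]])
  have "perm_restrict p C \<circ> perm_restrict p (V - C) = perm_restrict p (C \<union> (V - C))"
    by (rule perm_restrict_union[OF pC pD]) auto
  also have "C \<union> (V - C) = V" using sub by auto
  finally show "perm_restrict p C \<circ> perm_restrict p (V - C) = p" by (simp only: perm_restrict_id[OF p])
qed

text \<open>Permutations are sorted by the cycle \<open>C\<close> through \<open>v\<close>. One
  bijection, set up for an arbitrary condition on cycle counts, gives both statements: the first
  prescribes the counts, the second imposes no condition and yields a recursion for the factorial
  from which the number of full cycles can be read off.\<close>

lemma card_permutes_by_cycle:
  shows "card {p. p permutes V \<and> (\<forall>a. cycle_count p V a = m a)} =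
    (\<Sum>C | v \<in> C \<and> C \<subseteq> V. card (full_cycles C v) *
       card {q. q permutes (V - C) \<and> (\<forall>a. cycle_count q (V - C) a + (if a = card C then 1 else 0) = m a)})"
    and "fact (card V) = (\<Sum>C | v \<in> C \<and> C \<subseteq> V. card (full_cycles C v) * fact (card (V - C)))"
proof -
  have *: "card {p. p permutes V \<and> P (cycle_count p V)} = (\<Sum>C | v \<in> C \<and> C \<subseteq> V. card (full_cycles C v) *
       card {q. q permutes (V - C) \<and> P (\<lambda>a. cycle_count q (V - C) a + (if a = card C then 1 else 0))})" for P
  proof -
    let ?D = "SIGMA C : {C. v \<in> C \<and> C \<subseteq> V}. full_cycles C v \<times>
      {q. q permutes (V - C) \<and> P (\<lambda>a. cycle_count q (V - C) a + (if a = card C then 1 else 0))}"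
    let ?S = "{p. p permutes V \<and> P (cycle_count p V)}"
    have "bij_betw (\<lambda>(C, c, q). c \<circ> q) ?D ?S"
    proof (rule bij_betw_byWitness[where f' =
          "\<lambda>p. (orbit p v, perm_restrict p (orbit p v), perm_restrict p (V - orbit p v))"])
      show "\<forall>x\<in>?D. (\<lambda>p. (orbit p v, perm_restrict p (orbit p v), perm_restrict p (V - orbit p v)))
          (case x of (C, c, q) \<Rightarrow> c \<circ> q) = x"
      proof
        fix x assume "x \<in> ?D"
        then obtain C c q where x: "x = (C, c, q)" and C: "v \<in> C" "C \<subseteq> V" and c: "c \<in> full_cycles C v"
          and q: "q permutes (V - C)" by auto
        note cc = compose_cycle[OF C c q]
        have cp: "c permutes C" using c by (simp add: full_cycles_def)
        have "perm_restrict (c \<circ> q) C = c"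
        proof
          fix x show "perm_restrict (c \<circ> q) C x = c x"
            unfolding perm_restrict_def using cc(1)[of x] permutes_not_in[OF cp, of x] by auto
        qed
        moreover have "perm_restrict (c \<circ> q) (V - C) = q"
        proof
          fix x show "perm_restrict (c \<circ> q) (V - C) x = q x"
            unfolding perm_restrict_def using cc(2)[of x] permutes_not_in[OF q, of x]
            by auto
        qed
        ultimately show "(\<lambda>p. (orbit p v, perm_restrict p (orbit p v), perm_restrict p (V - orbit p v)))
          (case x of (C, c, q) \<Rightarrow> c \<circ> q) = x"
          unfolding x by (simp only: prod.case cc(4))
      qed
      show "\<forall>p\<in>?S. (case (orbit p v, perm_restrict p (orbit p v), perm_restrict p (V - orbit p v)) of
          (C, c, q) \<Rightarrow> c \<circ> q) = p"
        using decompose_cycle(5) by simp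
      show "(\<lambda>(C, c, q). c \<circ> q) ` ?D \<subseteq> ?S"
      proof (rule image_subsetI)
        fix x assume "x \<in> ?D"
        then obtain C c q where x: "x = (C, c, q)" and C: "v \<in> C" "C \<subseteq> V" and c: "c \<in> full_cycles C v"
          and q: "q permutes (V - C)" and P: "P (\<lambda>a. cycle_count q (V - C) a + (if a = card C then 1 else 0))" by auto
        note cc = compose_cycle[OF C c q]
        have "cycle_count (c \<circ> q) V = (\<lambda>a. cycle_count q (V - C) a + (if a = card C then 1 else 0))"
          using cc(7) by blast
        then show "(case x of (C, c, q) \<Rightarrow> c \<circ> q) \<in> ?S" unfolding x using cc(3) P by simp
      qed
      show "(\<lambda>p. (orbit p v, perm_restrict p (orbit p v), perm_restrict p (V - orbit p v))) ` ?S \<subseteq> ?D"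
      proof (rule image_subsetI)
        fix p assume "p \<in> ?S"
        then have p: "p permutes V" and P: "P (cycle_count p V)" by auto
        note dc = decompose_cycle[OF p]
        note cc = compose_cycle(7)[OF dc(1-4), unfolded dc(5)]
        have "cycle_count p V = (\<lambda>a. cycle_count (perm_restrict p (V - orbit p v)) (V - orbit p v) a
          + (if a = card (orbit p v) then 1 else 0))"
          using cc by blast
        then show "(orbit p v, perm_restrict p (orbit p v), perm_restrict p (V - orbit p v)) \<in> ?D"
          using dc P by simp
      qed
    qed
    then have "card ?S = card ?D" by (rule bij_betw_same_card[symmetric])
    also have "\<dots> = (\<Sum>C | v \<in> C \<and> C \<subseteq> V. card (full_cycles C v \<times>
      {q. q permutes (V - C) \<and> P (\<lambda>a. cycle_count q (V - C) a + (if a = card C then 1 else 0))}))"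
    proof (rule card_SigmaI)
      show "finite {C. v \<in> C \<and> C \<subseteq> V}" using fin by simp
      show "\<forall>C\<in>{C. v \<in> C \<and> C \<subseteq> V}. finite (full_cycles C v \<times>
        {q. q permutes (V - C) \<and> P (\<lambda>a. cycle_count q (V - C) a + (if a = card C then 1 else 0))})"
      proof
        fix C assume "C \<in> {C. v \<in> C \<and> C \<subseteq> V}"
        then have "finite C" using fin finite_subset by blast
        moreover have "finite {q. q permutes (V - C)}" using fin by (intro finite_permutations) simp
        ultimately show "finite (full_cycles C v \<times>
          {q. q permutes (V - C) \<and> P (\<lambda>a. cycle_count q (V - C) a + (if a = card C then 1 else 0))})"
          by (intro finite_cartesian_product finite_full_cycles) (auto elim: rev_finite_subset)
      qed
    qed
    finally show ?thesis by (simp add: card_cartesian_product)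
  qed
  show "card {p. p permutes V \<and> (\<forall>a. cycle_count p V a = m a)} =
    (\<Sum>C | v \<in> C \<and> C \<subseteq> V. card (full_cycles C v) *
       card {q. q permutes (V - C) \<and> (\<forall>a. cycle_count q (V - C) a + (if a = card C then 1 else 0) = m a)})"
    by (rule *)
  show "fact (card V) = (\<Sum>C | v \<in> C \<and> C \<subseteq> V. card (full_cycles C v) * fact (card (V - C)))"
    using *[of "\<lambda>_. True"] fin by (simp add: card_permutations)
qed

lemma sum_containing:
  fixes g :: "nat \<Rightarrow> nat"
  shows "(\<Sum>C | v \<in> C \<and> C \<subseteq> V. g (card C)) = (\<Sum>k<card V. (card V - 1 choose k) * g (Suc k))"
proof -
  have eq: "{C. v \<in> C \<and> C \<subseteq> V} = insert v ` Pow (V - {v})"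
  proof (intro equalityI subsetI)
    fix C assume "C \<in> {C. v \<in> C \<and> C \<subseteq> V}"
    then have "C = insert v (C - {v})" "C - {v} \<in> Pow (V - {v})" by auto
    then show "C \<in> insert v ` Pow (V - {v})" by (rule image_eqI)
  qed (use v in auto)
  have inj: "inj_on (insert v) (Pow (V - {v}))" by (auto simp: inj_on_def)
  have "(\<Sum>C | v \<in> C \<and> C \<subseteq> V. g (card C)) = (\<Sum>Q\<in>Pow (V - {v}). g (card (insert v Q)))"
    unfolding eq sum.reindex[OF inj] comp_def ..
  also have "\<dots> = (\<Sum>Q\<in>Pow (V - {v}). g (Suc (card Q)))"
  proof (rule sum.cong[OF refl])
    fix Q assume "Q \<in> Pow (V - {v})"
    then have "finite Q" "v \<notin> Q" using fin finite_subset by auto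
    then show "g (card (insert v Q)) = g (Suc (card Q))" by simp
  qed
  also have "\<dots> = (\<Sum>k\<le>card V - 1. (card V - 1 choose k) * g (Suc k))"
    using sum_Pow_card[of "V - {v}" "\<lambda>k. g (Suc k)"] fin v by simp
  also have "{..card V - 1} = {..<card V}"
  proof -
    have "card V > 0" using v fin by (auto simp: card_gt_0_iff)
    then show ?thesis by (metis Suc_diff_1 lessThan_Suc_atMost)
  qed
  finally show ?thesis .
qed

end

text \<open>In the recursion for the factorial all terms with \<open>C\<close> different from
  \<open>V\<close> are known by induction, so the remaining one is determined. If it has the
  expected value, each possible length of the cycle through \<open>v\<close> contributes
  \<open>fact (card V - 1)\<close>, and there are \<open>card V\<close> lengths.\<close>

lemma card_full_cycles:
  assumes "finite V" "v \<in> V"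
  shows "card (full_cycles V v) = fact (card V - 1)"
  using assms
proof (induction "card V" arbitrary: V rule: less_induct)
  case less
  let ?A = "{C. v \<in> C \<and> C \<subseteq> V}"
  have pos: "card V > 0" using less.prems by (auto simp: card_gt_0_iff)
  have finA: "finite ?A" "V \<in> ?A" using less.prems by auto
  have "(\<Sum>C\<in>?A - {V}. card (full_cycles C v) * fact (card (V - C))) =
    (\<Sum>C\<in>?A - {V}. fact (card C - 1) * fact (card V - card C))"
  proof (rule sum.cong[OF refl])
    fix C assume C: "C \<in> ?A - {V}"
    then have "finite C" "card C < card V"
      using less.prems finite_subset psubset_card_mono[of V C] by auto
    then have "card (full_cycles C v) = fact (card C - 1)" using less.hyps C by auto
    then show "card (full_cycles C v) * fact (card (V - C)) = fact (card C - 1) * fact (card V - card C)"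
      using C \<open>finite C\<close> by (simp add: card_Diff_subset)
  qed
  moreover have "fact (card V) = card (full_cycles V v) * fact (card (V - V)) +
      (\<Sum>C\<in>?A - {V}. card (full_cycles C v) * fact (card (V - C)))"
    using card_permutes_by_cycle(2)[OF less.prems] sum.remove[OF finA, of "\<lambda>C. card (full_cycles C v) * fact (card (V - C))"] by simp
  moreover have "(\<Sum>C\<in>?A. fact (card C - 1) * fact (card V - card C)) =
      fact (card V - 1) * fact (card V - card V) + (\<Sum>C\<in>?A - {V}. fact (card C - 1) * fact (card V - card C) :: nat)"
    by (rule sum.remove[OF finA])
  moreover have "(\<Sum>C\<in>?A. fact (card C - 1) * fact (card V - card C)) = (fact (card V) :: nat)"
  proof -
    have "(\<Sum>C\<in>?A. fact (card C - 1) * fact (card V - card C)) =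
      (\<Sum>k<card V. (card V - 1 choose k) * (fact k * fact (card V - Suc k)) :: nat)"
      using sum_containing[OF less.prems, of "\<lambda>i. fact (i - 1) * fact (card V - i)"] by simp
    also have "\<dots> = (\<Sum>k<card V. fact (card V - 1))"
    proof (rule sum.cong[OF refl])
      fix k assume "k \<in> {..<card V}"
      then have "k \<le> card V - 1" by auto
      then show "(card V - 1 choose k) * (fact k * fact (card V - Suc k)) = (fact (card V - 1) :: nat)"
        using binomial_fact_lemma[of k "card V - 1"] by (simp add: algebra_simps)
    qed
    also have "\<dots> = card V * fact (card V - 1)" by simp
    also have "\<dots> = fact (card V)" using pos by (metis fact_num_eq_if of_nat_id less_not_refl)
    finally show ?thesis .
  qed
  ultimately show ?case by simp
qed

text \<open>This is the number \<open>z\<^sub>\<lambda>\<close>. The upper limit \<open>K\<close> is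
  separate from the number of points, so that an induction can shrink the set while the range of the
  product stays fixed.\<close>

definition cycle_weight :: "nat \<Rightarrow> (nat \<Rightarrow> nat) \<Rightarrow> nat" where
  "cycle_weight K m = (\<Prod>a=1..K. a ^ m a * fact (m a))"

text \<open>Removing the cycle through \<open>v\<close>, of length \<open>k\<close> say, divides the
  weight by \<open>k * m k\<close>. All cycles of a given length together contribute
  \<open>fact (card V - 1) * (k * m k)\<close>, and the numbers \<open>k * m k\<close> add up to
  \<open>card V\<close>.\<close>

theorem card_cycle_type:
  assumes "finite V" "\<And>a. a \<notin> {1..K} \<Longrightarrow> m a = 0" "(\<Sum>a=1..K. a * m a) = card V"
  shows "card {p. p permutes V \<and> (\<forall>a. cycle_count p V a = m a)} * cycle_weight K m = fact (card V)"
  using assms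
proof (induction "card V" arbitrary: V m rule: less_induct)
  case less
  show ?case
  proof (cases "V = {}")
    case True
    then have "\<forall>a\<in>{1..K}. a * m a = 0" using less.prems(3) by simp
    then have m: "m a = 0" for a using less.prems(2)[of a] by (cases "a \<in> {1..K}") auto
    have "{p. p permutes V \<and> (\<forall>a. cycle_count p V a = m a)} = {id}"
      using True m by (auto simp: cycle_count_def permutes_empty)
    then show ?thesis using True m by (simp add: cycle_weight_def)
  next
    case False
    then obtain v where v: "v \<in> V" by blast
    note fin = less.prems(1)
    let ?N = "\<lambda>C. card {q. q permutes (V - C) \<and> (\<forall>a. cycle_count q (V - C) a + (if a = card C then 1 else 0) = m a)}"
    let ?n = "card V"
    have n: "?n > 0" using v fin by (auto simp: card_gt_0_iff)
    have one: "card (full_cycles C v) * ?N C * cycle_weight K m =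
        fact (card C - 1) * fact (?n - card C) * (card C * m (card C))" if C: "v \<in> C" "C \<subseteq> V" for C
    proof -
      let ?a = "card C"
      have finC: "finite C" using C fin finite_subset by blast
      have pos: "?a > 0" using C finC by (auto simp: card_gt_0_iff)
      have le: "?a \<le> ?n" using C fin by (simp add: card_mono)
      have cf: "card (full_cycles C v) = fact (?a - 1)" by (rule card_full_cycles[OF finC C(1)])
      show ?thesis
      proof (cases "m ?a = 0")
        case True
        have "{q. q permutes (V - C) \<and> (\<forall>a. cycle_count q (V - C) a + (if a = ?a then 1 else 0) = m a)} = {}"
          using True by (auto dest!: spec[of _ ?a])
        then have "?N C = 0" by (simp only: card.empty)
        then show ?thesis using True by simp
      next
        case False
        have aK: "?a \<in> {1..K}"
        proof (rule ccontr)
          assume "?a \<notin> {1..K}"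
          then have "m ?a = 0" by (rule less.prems(2))
          then show False using False by simp
        qed
        define m' where "m' = m(?a := m ?a - 1)"
        have "{q. q permutes (V - C) \<and> (\<forall>a. cycle_count q (V - C) a + (if a = ?a then 1 else 0) = m a)} =
          {q. q permutes (V - C) \<and> (\<forall>a. cycle_count q (V - C) a = m' a)}"
        proof (rule Collect_cong, rule conj_cong[OF refl])
          fix q
          have "cycle_count q (V - C) a + (if a = ?a then 1 else 0) = m a \<longleftrightarrow> cycle_count q (V - C) a = m' a" for a
            using False by (cases "a = ?a") (auto simp: m'_def)
          then show "(\<forall>a. cycle_count q (V - C) a + (if a = ?a then 1 else 0) = m a) \<longleftrightarrow>
            (\<forall>a. cycle_count q (V - C) a = m' a)" by simp
        qed
        then have N: "?N C = card {q. q permutes (V - C) \<and> (\<forall>a. cycle_count q (V - C) a = m' a)}" by simp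
        have cVC: "card (V - C) = ?n - ?a" using C finC by (simp add: card_Diff_subset)
        obtain k where k: "m ?a = Suc k" using False by (cases "m ?a") auto
        have split: "(\<Sum>a=1..K. f a) = f ?a + (\<Sum>a\<in>{1..K} - {?a}. f a)" for f :: "nat \<Rightarrow> nat"
          using aK by (intro sum.remove) auto
        have "(\<Sum>a\<in>{1..K} - {?a}. a * m' a) = (\<Sum>a\<in>{1..K} - {?a}. a * m a)"
          by (rule sum.cong) (auto simp: m'_def)
        then have s: "(\<Sum>a=1..K. a * m' a) = card (V - C)"
          using split[of "\<lambda>a. a * m a"] split[of "\<lambda>a. a * m' a"] less.prems(3) cVC k
          by (simp add: m'_def)
        have IH: "card {q. q permutes (V - C) \<and> (\<forall>a. cycle_count q (V - C) a = m' a)} * cycle_weight K m' = fact (card (V - C))"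
        proof (rule less.hyps)
          show "card (V - C) < card V" using cVC pos n by simp
          show "m' a = 0" if "a \<notin> {1..K}" for a using less.prems(2)[OF that] by (auto simp: m'_def)
        qed (use s fin in auto)
        have "cycle_weight K m = cycle_weight K m' * (?a * m ?a)"
        proof -
          have psplit: "(\<Prod>a=1..K. f a) = f ?a * (\<Prod>a\<in>{1..K} - {?a}. f a)" for f :: "nat \<Rightarrow> nat"
            using aK by (intro prod.remove) auto
          have "(\<Prod>a\<in>{1..K} - {?a}. a ^ m' a * fact (m' a)) = (\<Prod>a\<in>{1..K} - {?a}. a ^ m a * fact (m a) :: nat)"
            by (rule prod.cong) (auto simp: m'_def)
          then show ?thesis
            unfolding cycle_weight_def psplit[of "\<lambda>a. a ^ m a * fact (m a)"] psplit[of "\<lambda>a. a ^ m' a * fact (m' a)"]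
            by (simp add: m'_def k algebra_simps)
        qed
        then have "card (full_cycles C v) * ?N C * cycle_weight K m =
          fact (?a - 1) * (card {q. q permutes (V - C) \<and> (\<forall>a. cycle_count q (V - C) a = m' a)} * cycle_weight K m') * (?a * m ?a)"
          unfolding N cf by simp
        then show ?thesis unfolding IH cVC .
      qed
    qed
    have "card {p. p permutes V \<and> (\<forall>a. cycle_count p V a = m a)} * cycle_weight K m =
      (\<Sum>C | v \<in> C \<and> C \<subseteq> V. card (full_cycles C v) * ?N C * cycle_weight K m)"
      unfolding card_permutes_by_cycle(1)[OF fin v] by (rule sum_distrib_right)
    also have "\<dots> = (\<Sum>C | v \<in> C \<and> C \<subseteq> V. fact (card C - 1) * fact (?n - card C) * (card C * m (card C)))"
      by (rule sum.cong[OF refl]) (use one in auto)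
    also have "\<dots> = (\<Sum>k<?n. (?n - 1 choose k) * (fact k * fact (?n - Suc k) * (Suc k * m (Suc k))))"
      using sum_containing[OF fin v, of "\<lambda>i. fact (i - 1) * fact (?n - i) * (i * m i)"] by simp
    also have "\<dots> = (\<Sum>k<?n. fact (?n - 1) * (Suc k * m (Suc k)))"
    proof (rule sum.cong[OF refl])
      fix k assume "k \<in> {..<?n}"
      then have "k \<le> ?n - 1" by auto
      then have "(?n - 1 choose k) * (fact k * fact (?n - Suc k)) = (fact (?n - 1) :: nat)"
        using binomial_fact_lemma[of k "?n - 1"] by (simp add: algebra_simps)
      then show "(?n - 1 choose k) * (fact k * fact (?n - Suc k) * (Suc k * m (Suc k))) = fact (?n - 1) * (Suc k * m (Suc k))"
        by (metis mult.assoc)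
    qed
    also have "\<dots> = fact (?n - 1) * (\<Sum>a\<in>{1..?n}. a * m a)"
    proof -
      have "(\<Sum>k<?n. Suc k * m (Suc k)) = (\<Sum>a\<in>{1..?n}. a * m a)"
        by (rule sum.reindex_bij_witness[of _ "\<lambda>a. a - 1" Suc]) auto
      then show ?thesis by (simp add: sum_distrib_left[symmetric])
    qed
    also have "(\<Sum>a\<in>{1..?n}. a * m a) = (\<Sum>a=1..K. a * m a)"
    proof (rule sum.mono_neutral_cong)
      show "a * m a = 0" if a: "a \<in> {1..K} - {1..?n}" for a
      proof (rule ccontr)
        assume nz: "a * m a \<noteq> 0"
        have "a * m a \<le> (\<Sum>a=1..K. a * m a)" using a by (intro member_le_sum) auto
        then have le: "a * m a \<le> ?n" using less.prems(3) by simp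
        have "a \<le> a * m a" using nz by simp
        from le_trans[OF this le] show False using a by auto
      qed
      show "a * m a = 0" if a: "a \<in> {1..?n} - {1..K}" for a
        using less.prems(2)[of a] a by auto
    qed auto
    also have "fact (?n - 1) * \<dots> = fact ?n"
      unfolding less.prems(3) using n by (metis fact_num_eq_if of_nat_id less_not_refl mult.commute)
    finally show ?thesis .
  qed
qed

section \<open>Burnside's lemma for regular graphs\<close>

lemma degree_in_image:
  assumes "inj p"
  shows "degree_in ((`) p ` E) (p v) = degree_in E v"
proof -
  have "{e \<in> (`) p ` E. p v \<in> e} = (`) p ` {e \<in> E. v \<in> e}"
    using assms by (auto simp: inj_def)
  then show ?thesis
    unfolding degree_in_def using assms
    by (simp add: card_image inj_on_def inj_image_eq_iff)
qed

context
  fixes V :: "'v set" and d :: nat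
  assumes fin: "finite V"
begin

abbreviation (input) act :: "('v \<Rightarrow> 'v) \<Rightarrow> 'v set set \<Rightarrow> 'v set set" where
  "act p E \<equiv> (`) p ` E"

lemma act_regular:
  assumes p: "p permutes V" and E: "E \<in> regular_graphs d V"
  shows "act p E \<in> regular_graphs d V"
proof -
  have inj: "inj p" by (rule permutes_inj[OF p])
  have "e \<in> all_pairs V \<Longrightarrow> p ` e \<in> all_pairs V" for e
    using permutes_image[OF p] inj by (auto simp: all_pairs_def card_image inj_on_subset[OF inj])
  moreover have "degree_in (act p E) v = d" if vV: "v \<in> V" for v
  proof -
    obtain w where "w \<in> V" "v = p w" using permutes_image[OF p] vV by blast
    then show ?thesis using degree_in_image[OF inj] E by (simp add: regular_graphs_def)
  qed
  ultimately show ?thesis using E by (auto simp: regular_graphs_def)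
qed

lemma act_comp: "act (p \<circ> q) E = act p (act q E)"
  by (simp add: image_comp comp_def)

lemma act_inv: "p permutes V \<Longrightarrow> act (inv p) (act p E) = E"
  by (simp add: act_comp[symmetric] permutes_inv_o)

text \<open>An isomorphism is a bijection of \<open>V\<close> with arbitrary values elsewhere.
  Replacing these by the identity gives a permutation with the same effect on the edges, all of
  which lie inside \<open>V\<close>.\<close>

lemma graph_iso_permutes:
  assumes "E \<subseteq> all_pairs V"
  shows "graph_iso V E E' \<longleftrightarrow> (\<exists>p. p permutes V \<and> E' = act p E)"
proof
  assume "graph_iso V E E'"
  then obtain p where p: "bij_betw p V V" "E' = (\<lambda>e. p ` e) ` E" by (auto simp: graph_iso_def)
  define p' where "p' x = (if x \<in> V then p x else x)" for x
  have "bij_betw p' V V" using p(1) by (simp add: p'_def cong: bij_betw_cong)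
  then have "p' permutes V" by (rule bij_imp_permutes) (simp add: p'_def)
  moreover have "E' = act p' E"
    unfolding p(2)
  proof (rule image_cong[OF refl])
    fix e assume "e \<in> E"
    then have "e \<subseteq> V" using assms by (auto simp: all_pairs_def)
    then show "p ` e = p' ` e" by (auto simp: p'_def)
  qed
  ultimately show "\<exists>p. p permutes V \<and> E' = act p E" by blast
next
  assume "\<exists>p. p permutes V \<and> E' = act p E"
  then show "graph_iso V E E'" using permutes_imp_bij unfolding graph_iso_def by blast
qed

text \<open>Fixed pairs of a permutation and a graph are counted twice. If \<open>q\<close> carries
  \<open>E0\<close> to \<open>E\<close>, composition with \<open>q\<close> matches the permutations
  fixing \<open>E\<close> with those carrying \<open>E0\<close> to \<open>E\<close>. For
  \<open>E\<close> running through the class of \<open>E0\<close> the latter partition all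
  permutations, so every class contributes \<open>fact (card V)\<close>.\<close>

theorem burnside_graphs:
  defines "X \<equiv> regular_graphs d V"
  shows "(\<Sum>p | p permutes V. card (fixed_graphs V p (\<lambda>_. d))) =
    card (X // {(E, E'). E \<in> X \<and> E' \<in> X \<and> graph_iso V E E'}) * fact (card V)"
proof -
  let ?G = "{p. p permutes V}"
  let ?R = "{(E, E'). E \<in> X \<and> E' \<in> X \<and> graph_iso V E E'}"
  have XA: "E \<subseteq> all_pairs V" if "E \<in> X" for E using that by (simp add: X_def regular_graphs_def)
  have finX: "finite X"
    by (rule finite_subset[of _ "Pow (all_pairs V)"]) (use XA fin in auto)
  have finG: "finite ?G" using finite_permutations[OF fin] .
  have R: "(E, E') \<in> ?R \<longleftrightarrow> E \<in> X \<and> (\<exists>p. p permutes V \<and> E' = act p E)" for E E'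
    using graph_iso_permutes[OF XA] act_regular unfolding X_def by blast
  have eqv: "equiv X ?R"
  proof (rule equivI)
    show "?R \<subseteq> X \<times> X" by auto
    show "refl_on X ?R"
    proof (rule refl_onI)
      fix E assume "E \<in> X"
      moreover have "E = act id E" by simp
      ultimately show "(E, E) \<in> ?R" unfolding R using permutes_id by blast
    qed
    show "sym ?R"
    proof (rule symI)
      fix E E' assume "(E, E') \<in> ?R"
      then obtain p where p: "E \<in> X" "p permutes V" "E' = act p E" unfolding R by blast
      then have "E' \<in> X" using act_regular unfolding X_def by blast
      moreover have "E = act (inv p) E'" using act_inv[OF p(2)] p(3) by simp
      ultimately show "(E', E) \<in> ?R" unfolding R using permutes_inv[OF p(2)] by blast
    qed
    show "trans ?R"
    proof (rule transI)
      fix E E' E'' assume "(E, E') \<in> ?R" "(E', E'') \<in> ?R"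
      then obtain p q where pq: "E \<in> X" "p permutes V" "q permutes V" "E'' = act q (act p E)"
        unfolding R by blast
      have "E'' = act (q \<circ> p) E" unfolding pq(4) act_comp ..
      moreover have "(q \<circ> p) permutes V" using pq by (intro permutes_compose)
      ultimately show "(E, E'') \<in> ?R" unfolding R using pq(1) by blast
    qed
  qed
  have cls: "(\<Sum>E\<in>Q. card {p \<in> ?G. act p E = E}) = fact (card V)" if Q: "Q \<in> X // ?R" for Q
  proof -
    obtain E0 where E0: "E0 \<in> X" "Q = ?R `` {E0}" using Q by (rule quotientE)
    have Qiff: "E \<in> Q \<longleftrightarrow> (\<exists>p. p permutes V \<and> E = act p E0)" for E
    proof -
      have "E \<in> Q \<longleftrightarrow> (E0, E) \<in> ?R" unfolding E0(2) by (rule Image_singleton_iff)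
      then show ?thesis unfolding R using E0(1) by blast
    qed
    have finQ: "finite Q" by (rule finite_subset[OF _ finX]) (use E0 in auto)
    have "card {p \<in> ?G. act p E = E} = card {p \<in> ?G. act p E0 = E}" if EQ: "E \<in> Q" for E
    proof -
      obtain q where q: "q permutes V" "E = act q E0" using iffD1[OF Qiff EQ] by blast
      have "bij_betw (\<lambda>p. p \<circ> q) {p \<in> ?G. act p E = E} {p \<in> ?G. act p E0 = E}"
      proof (rule bij_betw_byWitness[where f' = "\<lambda>p. p \<circ> inv q"])
        show "\<forall>p\<in>{p \<in> ?G. act p E = E}. p \<circ> q \<circ> inv q = p"
          using permutes_inv_o[OF q(1)] by (simp add: comp_assoc)
        show "\<forall>p\<in>{p \<in> ?G. act p E0 = E}. p \<circ> inv q \<circ> q = p"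
          using permutes_inv_o[OF q(1)] by (simp add: comp_assoc)
        show "(\<lambda>p. p \<circ> q) ` {p \<in> ?G. act p E = E} \<subseteq> {p \<in> ?G. act p E0 = E}"
        proof (rule image_subsetI)
          fix p assume "p \<in> {p \<in> ?G. act p E = E}"
          then show "p \<circ> q \<in> {p \<in> ?G. act p E0 = E}"
            using q permutes_compose[OF q(1)] act_comp[of p q E0] by simp
        qed
        show "(\<lambda>p. p \<circ> inv q) ` {p \<in> ?G. act p E0 = E} \<subseteq> {p \<in> ?G. act p E = E}"
        proof (rule image_subsetI)
          fix p assume p: "p \<in> {p \<in> ?G. act p E0 = E}"
          have "act (inv q) E = E0" using act_inv[OF q(1)] q(2) by simp
          then have "act (p \<circ> inv q) E = E" using p act_comp[of p "inv q" E] by simp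
          then show "p \<circ> inv q \<in> {p \<in> ?G. act p E = E}"
            using p permutes_compose[OF permutes_inv[OF q(1)]] by simp
        qed
      qed
      then show ?thesis by (rule bij_betw_same_card)
    qed
    then have "(\<Sum>E\<in>Q. card {p \<in> ?G. act p E = E}) = (\<Sum>E\<in>Q. card {p \<in> ?G. act p E0 = E})"
      by (rule sum.cong[OF refl])
    also have "\<dots> = (\<Sum>E\<in>Q. \<Sum>p\<in>{p \<in> ?G. act p E0 = E}. 1)" by simp
    also have "\<dots> = (\<Sum>p\<in>?G. 1)"
    proof (rule sum.group[OF finG finQ], rule image_subsetI)
      fix p assume "p \<in> ?G"
      then show "act p E0 \<in> Q" by (intro iffD2[OF Qiff] exI[of _ p]) simp
    qed
    also have "\<dots> = fact (card V)" using card_permutations[OF refl fin] by simp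
    finally show ?thesis .
  qed
  have "(\<Sum>p\<in>?G. card (fixed_graphs V p (\<lambda>_. d))) = (\<Sum>p\<in>?G. card {E \<in> X. act p E = E})"
  proof (rule sum.cong[OF refl])
    fix p
    have "fixed_graphs V p (\<lambda>_. d) = {E \<in> X. act p E = E}"
      by (auto simp: fixed_graphs_def X_def regular_graphs_def)
    then show "card (fixed_graphs V p (\<lambda>_. d)) = card {E \<in> X. act p E = E}" by simp
  qed
  also have "\<dots> = (\<Sum>E\<in>X. card {p \<in> ?G. act p E = E})"
    by (rule sum_multicount_gen[OF finG finX]) auto
  also have "\<dots> = (\<Sum>Q\<in>X // ?R. \<Sum>E\<in>Q. card {p \<in> ?G. act p E = E})"
  proof -
    have "X = \<Union>(X // ?R)" using Union_quotient[OF eqv] by simp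
    then have "(\<Sum>E\<in>X. card {p \<in> ?G. act p E = E}) = (\<Sum>E\<in>\<Union>(X // ?R). card {p \<in> ?G. act p E = E})"
      by simp
    also have "\<dots> = (\<Sum>Q\<in>X // ?R. \<Sum>E\<in>Q. card {p \<in> ?G. act p E = E})"
    proof (rule sum.Union_disjoint[unfolded comp_def])
      show "\<forall>Q\<in>X // ?R. finite Q"
      proof
        fix Q assume "Q \<in> X // ?R"
        then have "Q \<subseteq> X" using Union_upper[of Q "X // ?R"] Union_quotient[OF eqv] by simp
        then show "finite Q" using finX by (rule finite_subset)
      qed
      show "\<forall>A\<in>X // ?R. \<forall>B\<in>X // ?R. A \<noteq> B \<longrightarrow> A \<inter> B = {}"
      proof (intro ballI impI)
        fix A B assume "A \<in> X // ?R" "B \<in> X // ?R" "A \<noteq> B"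
        then show "A \<inter> B = {}" using quotient_disj[OF eqv, of A B] by simp
      qed
    qed
    finally show ?thesis .
  qed
  also have "\<dots> = (\<Sum>Q\<in>X // ?R. fact (card V))" by (rule sum.cong[OF refl cls])
  also have "\<dots> = card (X // ?R) * fact (card V)" by simp
  finally show ?thesis .
qed

end

section \<open>Partitions as cycle types, and the sum over all partitions\<close>

lemma val_partitionsC_Cons:
  "val (partitionsC (a # as) B) = concat (map (\<lambda>m. map (\<lambda>\<mu>. (a, m) # \<mu>) (val (partitionsC as (B - a * m))))
     [0..<Suc (B div a)])"
proof -
  have "val (partitionsC (a # as) B) = fold (\<lambda>m acc. acc @ map (\<lambda>\<mu>. (a, m) # \<mu>) (val (partitionsC as (B - a * m))))
     [0..<Suc (B div a)] []"
    by (simp del: upt_Suc)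
  then show ?thesis by (simp only: fold_append_concat append_Nil)
qed

declare partitionsC.simps(2) [simp del]

lemma set_partitionsC:
  assumes "\<And>a. a \<in> set as \<Longrightarrow> a > 0"
  shows "\<mu> \<in> set (val (partitionsC as B)) \<longleftrightarrow> map fst \<mu> = as \<and> (\<Sum>(a, m)\<leftarrow>\<mu>. a * m) = B"
  using assms
proof (induction as arbitrary: B \<mu>)
  case Nil
  show ?case by auto
next
  case (Cons a as)
  have a: "a > 0" using Cons.prems by simp
  have IH: "\<mu> \<in> set (val (partitionsC as B)) \<longleftrightarrow> map fst \<mu> = as \<and> (\<Sum>(a, m)\<leftarrow>\<mu>. a * m) = B" for \<mu> B
    using Cons.IH Cons.prems by simp
  have "\<mu> \<in> set (val (partitionsC (a # as) B)) \<longleftrightarrow>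
    (\<exists>m\<le>B div a. \<exists>\<mu>'. \<mu> = (a, m) # \<mu>' \<and> map fst \<mu>' = as \<and> (\<Sum>(a, m)\<leftarrow>\<mu>'. a * m) = B - a * m)"
  proof -
    have cu: "\<mu> \<in> set (concat (map g [0..<Suc k])) \<longleftrightarrow> (\<exists>m\<le>k. \<mu> \<in> set (g m))"
      for g :: "nat \<Rightarrow> (nat \<times> nat) list list" and k
      by (auto simp: less_Suc_eq_le simp del: upt_Suc)
    show ?thesis unfolding val_partitionsC_Cons cu by (auto simp add: image_iff Bex_def IH)
  qed
  also have "\<dots> \<longleftrightarrow> map fst \<mu> = a # as \<and> (\<Sum>(a, m)\<leftarrow>\<mu>. a * m) = B"
  proof
    assume "\<exists>m\<le>B div a. \<exists>\<mu>'. \<mu> = (a, m) # \<mu>' \<and> map fst \<mu>' = as \<and> (\<Sum>(a, m)\<leftarrow>\<mu>'. a * m) = B - a * m"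
    then obtain m \<mu>' where m: "m \<le> B div a" "\<mu> = (a, m) # \<mu>'" "map fst \<mu>' = as" "(\<Sum>(a, m)\<leftarrow>\<mu>'. a * m) = B - a * m"
      by blast
    have "a * m \<le> B" using m(1) a by (simp add: less_eq_div_iff_mult_less_eq mult.commute)
    then show "map fst \<mu> = a # as \<and> (\<Sum>(a, m)\<leftarrow>\<mu>. a * m) = B" using m by simp
  next
    assume *: "map fst \<mu> = a # as \<and> (\<Sum>(a, m)\<leftarrow>\<mu>. a * m) = B"
    then obtain m \<mu>' where \<mu>: "\<mu> = (a, m) # \<mu>'" "map fst \<mu>' = as" by (cases \<mu>) auto
    then have "a * m + (\<Sum>(a, m)\<leftarrow>\<mu>'. a * m) = B" using * by simp
    moreover from this have "m \<le> B div a"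
      using a by (simp add: less_eq_div_iff_mult_less_eq mult.commute)
    ultimately show "\<exists>m\<le>B div a. \<exists>\<mu>'. \<mu> = (a, m) # \<mu>' \<and> map fst \<mu>' = as \<and> (\<Sum>(a, m)\<leftarrow>\<mu>'. a * m) = B - a * m"
      using \<mu> by auto
  qed
  finally show ?case .
qed

lemma distinct_concat_upt:
  assumes "\<And>m. distinct (g m)" and "\<And>m m' x. x \<in> set (g m) \<Longrightarrow> x \<in> set (g m') \<Longrightarrow> m = m'"
  shows "distinct (concat (map g [0..<k]))"
proof (induction k)
  case (Suc k)
  have "set (concat (map g [0..<k])) \<inter> set (g k) = {}"
    using assms(2) by fastforce
  then show ?case using Suc assms(1) by simp
qed simp

lemma distinct_partitionsC: "distinct (val (partitionsC as B))"
proof (induction as arbitrary: B)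
  case (Cons a as)
  show ?case unfolding val_partitionsC_Cons
  proof (rule distinct_concat_upt)
    show "distinct (map (\<lambda>\<mu>. (a, m) # \<mu>) (val (partitionsC as (B - a * m))))" for m
      using Cons by (simp add: distinct_map inj_on_def)
  qed auto
qed simp

lemma val_zC: "val (zC \<mu>) = (\<Prod>(a, m)\<leftarrow>\<mu>. a ^ m * fact m)"
proof -
  have "val (zC \<mu>) = fold (\<lambda>x s. s * x) (map (\<lambda>(a, m). a ^ m * fact m) \<mu>) 1"
    unfolding zC_def by (simp add: fold_map comp_def case_prod_beta')
  then show ?thesis by (simp add: fold_times_prod_list')
qed

lemma val_initC:
  "val (initC d \<mu>) = concat (map (\<lambda>(a, m). map (\<lambda>r. ((a, r), if r = d then m else 0)) [1..<Suc d]) \<mu>)"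
proof -
  have "val (initC d \<mu>) = fold (\<lambda>x acc. acc @ (case x of (a, m) \<Rightarrow> map (\<lambda>r. ((a, r), if r = d then m else 0)) [1..<Suc d])) \<mu> []"
    unfolding initC_def by (simp add: case_prod_beta' if_distrib cong: if_cong del: upt_Suc)
  then show ?thesis by (simp only: fold_append_concat append_Nil)
qed

lemma is_table_initC:
  assumes "map fst \<mu> = [1..<Suc n]"
  shows "is_table d n (val (initC d \<mu>))"
proof -
  have "map fst (val (initC d \<mu>)) = concat (map (\<lambda>a. map (Pair a) [1..<Suc d]) (map fst \<mu>))"
    unfolding val_initC by (simp add: map_concat comp_def case_prod_beta' del: upt_Suc)
  then show ?thesis
    unfolding is_table_def table_keys_def assms by (simp add: product_concat_map del: upt_Suc)
qed

lemma state_of_initC: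
  assumes \<mu>: "map fst \<mu> = [1..<Suc n]" and d: "d \<ge> 1"
  shows "state_of (val (initC d \<mu>)) (a, r) = (if r = d then case map_of \<mu> a of None \<Rightarrow> 0 | Some m \<Rightarrow> m else 0)"
proof -
  have T: "is_table d n (val (initC d \<mu>))" by (rule is_table_initC[OF \<mu>])
  have dist: "distinct (map fst (val (initC d \<mu>)))" "distinct (map fst \<mu>)"
    using T distinct_table_keys \<mu> by (simp_all add: is_table_def del: upt_Suc)
  show ?thesis
  proof (cases "a \<in> {1..n} \<and> r \<in> {1..d}")
    case True
    then have "a \<in> fst ` set \<mu>" using \<mu> by (metis atLeastLessThanSuc_atLeastAtMost list.set_map set_upt)
    then obtain m where m: "(a, m) \<in> set \<mu>" by force
    then have "map_of \<mu> a = Some m" using dist(2) by simp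
    moreover have "((a, r), if r = d then m else 0) \<in> set (val (initC d \<mu>))"
    proof -
      have "r \<in> set [1..<Suc d]" using True by (simp del: upt_Suc)
      then have "((a, r), if r = d then m else 0) \<in>
          set (case (a, m) of (a, m) \<Rightarrow> map (\<lambda>r. ((a, r), if r = d then m else 0)) [1..<Suc d])"
        unfolding prod.case set_map by (rule imageI)
      then show ?thesis
        unfolding val_initC set_concat set_map by (rule UnionI[OF imageI[OF imageI[OF m]]])
    qed
    ultimately show ?thesis using state_of_in[OF dist(1)] by simp
  next
    case False
    then have "state_of (val (initC d \<mu>)) (a, r) = 0"
      using state_of_support[OF T, of "(a, r)"] by auto
    moreover have "map_of \<mu> a = None" if "r = d"
    proof -
      have "a \<notin> {1..n}" using False d that by auto
      then have "a \<notin> fst ` set \<mu>" using \<mu> by (metis atLeastLessThanSuc_atLeastAtMost list.set_map set_upt)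
      then show ?thesis by (simp add: map_of_eq_None_iff)
    qed
    ultimately show ?thesis by simp
  qed
qed

text \<open>Lengths that do not occur are listed with multiplicity 0, which is the form in which
  \<open>partitionsC\<close> lists a partition.\<close>

definition cycle_type :: "nat \<Rightarrow> (nat \<Rightarrow> nat) \<Rightarrow> (nat \<times> nat) list" where
  "cycle_type n p = map (\<lambda>a. (a, cycle_count p {1..n} a)) [1..<Suc n]"

lemma realization_permutation:
  fixes n :: nat
  assumes "d \<ge> 1" "p permutes {1..n}"
  shows "realization d (\<lambda>(a, r). if r = d then cycle_count p {1..n} a else 0) {1..n} p (\<lambda>_. d)"
proof -
  interpret finite_perm "{1..n}" p using assms by unfold_locales auto
  have "card {C \<in> orbit p ` {1..n}. card C = a \<and> (\<forall>v\<in>C. d = r)} = (if r = d then cycle_count p {1..n} a else 0)" for a r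
  proof -
    have "{C \<in> orbit p ` {1..n}. card C = a \<and> (\<forall>v\<in>C. d = r)} =
      (if r = d then {C \<in> orbit p ` {1..n}. card C = a} else {})"
      using orbit_ne by auto
    then show ?thesis unfolding cycle_count_def by simp
  qed
  then show ?thesis using assms by (simp add: realization_def)
qed

lemma cycle_type_partition:
  assumes "p permutes {1..n}"
  shows "cycle_type n p \<in> set (val (partitionsC [1..<Suc n] n))"
    and "\<And>a. a \<notin> {1..n} \<Longrightarrow> cycle_count p {1..n} a = 0"
proof -
  interpret finite_perm "{1..n}" p using assms by unfold_locales auto
  \<comment> \<open>Giving all points degree 1 makes the permutation a realization, so
    \<open>realization_size\<close> supplies the identity that the cycle lengths add up to
    \<open>n\<close>.\<close>
  have R: "realization 1 (\<lambda>(a, r). if r = 1 then cycle_count p {1..n} a else 0) {1..n} p (\<lambda>_. 1)"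
    by (rule realization_permutation) (use assms in auto)
  show 0: "cycle_count p {1..n} a = 0" if "a \<notin> {1..n}" for a
  proof -
    have "card C \<in> {1..n}" if "C \<in> orbit p ` {1..n}" for C
      using card_pos[OF that] card_mono[OF fin orbit_subset[OF that]] by simp
    then have "{C \<in> orbit p ` {1..n}. card C = a} = {}" using \<open>a \<notin> _\<close> by auto
    then show ?thesis unfolding cycle_count_def by (simp only: card.empty)
  qed
  have nz: "1 \<le> a \<and> a \<le> n" if "cycle_count p {1..n} a \<noteq> 0" for a
    using 0[of a] that by (cases "a \<in> {1..n}") auto
  have "n = card {1..n}" by simp
  also have "\<dots> = state_size (\<lambda>(a, r). if r = 1 then cycle_count p {1..n} a else 0)"
    by (rule realization_size[OF R, symmetric])
  also have "\<dots> = (\<Sum>q\<in>{1..n} \<times> {1 :: nat}. fst q * (case q of (a, r) \<Rightarrow> if r = 1 then cycle_count p {1..n} a else 0))"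
  proof (rule state_size_keys[where H = "\<lambda>(a, r). if r = 1 then cycle_count p {1..n} a else 0"])
    show "{q. (case q of (a, r) \<Rightarrow> if r = 1 then cycle_count p {1..n} a else 0) \<noteq> 0} \<subseteq> {1..n} \<times> {1}"
    proof
      fix q assume q: "q \<in> {q. (case q of (a, r) \<Rightarrow> if r = 1 then cycle_count p {1..n} a else 0) \<noteq> 0}"
      obtain a r where ar: "q = (a, r)" by (cases q)
      have "r = 1" "cycle_count p {1..n} a \<noteq> 0" using q ar by (auto split: if_splits)
      then show "q \<in> {1..n} \<times> {1}" using nz[of a] ar by simp
    qed
  qed simp
  also have "\<dots> = (\<Sum>a\<in>{1..n}. a * cycle_count p {1..n} a)"
    by (rule sum.reindex_bij_witness[of _ "\<lambda>a. (a, 1)" fst]) auto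
  also have "\<dots> = (\<Sum>(a, m)\<leftarrow>cycle_type n p. a * m)"
    unfolding cycle_type_def
    by (simp add: comp_def interv_sum_list_conv_sum_set_nat atLeastLessThanSuc_atLeastAtMost del: upt_Suc)
  finally show "cycle_type n p \<in> set (val (partitionsC [1..<Suc n] n))"
    by (subst set_partitionsC) (auto simp: cycle_type_def comp_def simp del: upt_Suc)
qed

lemma card_partition_class:
  assumes \<mu>: "\<mu> \<in> set (val (partitionsC [1..<Suc n] n))"
  shows "card {p. p permutes {1..n} \<and> cycle_type n p = \<mu>} = fact n div val (zC \<mu>)"
proof -
  have \<mu>': "map fst \<mu> = [1..<Suc n]" "(\<Sum>(a, m)\<leftarrow>\<mu>. a * m) = n"
    using \<mu> by (subst (asm) set_partitionsC; auto simp del: upt_Suc)+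
  define m where "m a = (case map_of \<mu> a of None \<Rightarrow> 0 | Some m \<Rightarrow> m)" for a
  have dist: "distinct (map fst \<mu>)" unfolding \<mu>'(1) by simp
  have \<mu>m: "\<mu> = map (\<lambda>a. (a, m a)) [1..<Suc n]"
  proof -
    have "map (\<lambda>a. (a, m a)) (map fst \<mu>) = map (\<lambda>e. e) \<mu>"
      unfolding map_map by (rule map_cong[OF refl]) (use dist in \<open>auto simp: m_def\<close>)
    then show ?thesis unfolding \<mu>'(1) by simp
  qed
  have m0: "m a = 0" if "a \<notin> {1..n}" for a
  proof -
    have "a \<notin> fst ` set \<mu>" using that \<mu>' by (metis atLeastLessThanSuc_atLeastAtMost list.set_map set_upt)
    then show ?thesis by (simp add: m_def map_of_eq_None_iff[THEN iffD2])
  qed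
  have s: "(\<Sum>a=1..n. a * m a) = card {1..n}"
    using \<mu>'(2) by (subst (asm) \<mu>m)
      (simp add: comp_def interv_sum_list_conv_sum_set_nat atLeastLessThanSuc_atLeastAtMost del: upt_Suc)
  have z: "val (zC \<mu>) = cycle_weight n m"
    unfolding val_zC by (subst \<mu>m)
      (simp add: comp_def cycle_weight_def prod.distinct_set_conv_list[symmetric] atLeastLessThanSuc_atLeastAtMost del: upt_Suc)
  have eq: "{p. p permutes {1..n} \<and> cycle_type n p = \<mu>} =
    {p. p permutes {1..n} \<and> (\<forall>a. cycle_count p {1..n} a = m a)}"
  proof (rule Collect_cong, rule conj_cong[OF refl])
    fix p assume p: "p permutes {1..n}"
    have "cycle_type n p = \<mu> \<longleftrightarrow> (\<forall>a\<in>{1..n}. cycle_count p {1..n} a = m a)"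
      unfolding cycle_type_def by (subst \<mu>m) (auto simp: atLeastLessThanSuc_atLeastAtMost simp del: upt_Suc)
    also have "\<dots> \<longleftrightarrow> (\<forall>a. cycle_count p {1..n} a = m a)"
      using m0 cycle_type_partition(2)[OF p] by metis
    finally show "cycle_type n p = \<mu> \<longleftrightarrow> (\<forall>a. cycle_count p {1..n} a = m a)" .
  qed
  have "card {p. p permutes {1..n} \<and> cycle_type n p = \<mu>} * val (zC \<mu>) = fact n"
    unfolding eq z using card_cycle_type[OF _ m0 s] by simp
  moreover from this have "val (zC \<mu>) \<noteq> 0"
    by (intro notI) (simp only: mult_0_right fact_nonzero[symmetric])
  ultimately show ?thesis
    by (metis nonzero_mult_div_cancel_right)
qed

lemma card_fixed_graphs_type:
  assumes d: "d \<ge> 1" and p: "p permutes {1..n}"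
  shows "card (fixed_graphs {1..n} p (\<lambda>_. d)) = Phi d (state_of (val (initC d (cycle_type n p))))"
proof -
  have m: "map fst (cycle_type n p) = [1..<Suc n]" by (simp add: cycle_type_def comp_def del: upt_Suc)
  have "state_of (val (initC d (cycle_type n p))) = (\<lambda>(a, r). if r = d then cycle_count p {1..n} a else 0)"
  proof
    fix q :: "nat \<times> nat"
    obtain a r where q: "q = (a, r)" by (cases q)
    have "(case map_of (cycle_type n p) a of None \<Rightarrow> 0 | Some m \<Rightarrow> m) = cycle_count p {1..n} a"
    proof (cases "a \<in> {1..n}")
      case True
      then show ?thesis
        by (simp add: cycle_type_def map_of_map_restrict restrict_map_def atLeastLessThanSuc_atLeastAtMost del: upt_Suc)
    next
      case False
      then show ?thesis
        using cycle_type_partition(2)[OF p False]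
        by (auto simp add: cycle_type_def map_of_map_restrict restrict_map_def simp del: upt_Suc)
    qed
    then show "state_of (val (initC d (cycle_type n p))) q = (case q of (a, r) \<Rightarrow> if r = d then cycle_count p {1..n} a else 0)"
      using state_of_initC[OF m d] q by simp
  qed
  then show ?thesis using Phi_eq[OF realization_permutation[OF d p]] by simp
qed

lemma size_initC:
  assumes d: "d \<ge> 1" and \<mu>: "\<mu> \<in> set (val (partitionsC [1..<Suc n] n))"
  shows "is_table d n (val (initC d \<mu>))" "state_size (state_of (val (initC d \<mu>))) = n"
proof -
  have \<mu>': "map fst \<mu> = [1..<Suc n]" "(\<Sum>(a, m)\<leftarrow>\<mu>. a * m) = n"
    using \<mu> by (subst (asm) set_partitionsC; auto simp del: upt_Suc)+
  show T: "is_table d n (val (initC d \<mu>))" by (rule is_table_initC[OF \<mu>'(1)])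
  have "state_size (state_of (val (initC d \<mu>))) =
    (\<Sum>(a, m)\<leftarrow>\<mu>. \<Sum>r\<leftarrow>[1..<Suc d]. a * (if r = d then m else 0))"
    by (subst state_size_table[OF T])
      (simp add: val_initC sum_list_concat_map comp_def case_prod_beta' del: upt_Suc)
  also have "\<dots> = (\<Sum>(a, m)\<leftarrow>\<mu>. a * m)"
  proof -
    have "(\<Sum>r\<leftarrow>[1..<Suc d]. a * (if r = d then m else 0)) = a * m" for a m :: nat
      using d by (simp add: interv_sum_list_conv_sum_set_nat sum.delta if_distrib cong: if_cong del: upt_Suc)
    then show ?thesis by (simp del: upt_Suc)
  qed
  finally show "state_size (state_of (val (initC d \<mu>))) = n" using \<mu>'(2) by simp
qed

definition partition_step :: "nat \<Rightarrow> nat \<Rightarrow> nat \<Rightarrow> (nat \<times> nat) list \<Rightarrow> nat \<times> cache \<Rightarrow> (nat \<times> cache) cost" where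
  "partition_step d nf l = (\<lambda>\<mu> (acc, C). do {
       z \<leftarrow> zC \<mu>;
       q \<leftarrow> divC nf z;
       H \<leftarrow> initC d \<mu>;
       (v, C') \<leftarrow> phiC l H C;
       x \<leftarrow> mulC q v;
       acc' \<leftarrow> addC acc x;
       ret (acc', C') })"

lemma regular_countC_alt:
  "regular_countC d n = do {
     as \<leftarrow> countC 1 n;
     \<mu>s \<leftarrow> partitionsC as n;
     nf \<leftarrow> factC n;
     l \<leftarrow> addC n 1;
     (S, C) \<leftarrow> foldC (partition_step d nf l) \<mu>s (0, []);
     U \<leftarrow> divC S nf;
     ret (U, C) }"
  unfolding regular_countC_def partition_step_def ..

lemma val_partition_step:
  "val (partition_step d nf l \<mu> (acc, C)) = (acc + nf div val (zC \<mu>) * fst (val (phiC l (val (initC d \<mu>)) C)),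
     snd (val (phiC l (val (initC d \<mu>)) C)))"
  by (simp add: partition_step_def case_prod_beta')

lemma fold_partition_step:
  assumes "set \<mu>s \<subseteq> set (val (partitionsC [1..<Suc n] n))" "d \<ge> 1" "valid_cache d n C"
  shows "fst (fold (\<lambda>x s. val (partition_step d nf (Suc n) x s)) \<mu>s (acc, C)) =
      acc + (\<Sum>\<mu>\<leftarrow>\<mu>s. nf div val (zC \<mu>) * Phi d (state_of (val (initC d \<mu>)))) \<and>
    cache_step d n n C (snd (fold (\<lambda>x s. val (partition_step d nf (Suc n) x s)) \<mu>s (acc, C)))"
  using assms
proof (induction \<mu>s arbitrary: acc C)
  case Nil
  then show ?case by (simp add: cache_step_refl)
next
  case (Cons \<mu> \<mu>s)
  have \<mu>: "\<mu> \<in> set (val (partitionsC [1..<Suc n] n))" using Cons.prems(1) by simp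
  let ?T = "val (initC d \<mu>)"
  note sz = size_initC[OF Cons.prems(2) \<mu>]
  \<comment> \<open>Initial states have size exactly \<open>n\<close>, so the depth
    \<open>Suc n\<close> is just enough.\<close>
  have 1: "fst (val (phiC (Suc n) ?T C)) = Phi d (state_of ?T)" "cache_step d n n C (snd (val (phiC (Suc n) ?T C)))"
    using phiC_correct[OF sz(1) _ _ Cons.prems(3), of "Suc n"] sz(2) by auto
  then have v: "valid_cache d n (snd (val (phiC (Suc n) ?T C)))" by (simp add: cache_step_def)
  have sub: "set \<mu>s \<subseteq> set (val (partitionsC [1..<Suc n] n))" using Cons.prems(1) by simp
  note IH = Cons.IH[OF sub Cons.prems(2) v, of "acc + nf div val (zC \<mu>) * Phi d (state_of ?T)"]
  then show ?case
    using cache_step_trans[OF 1(2)] 1(1) by (simp add: val_partition_step del: upt_Suc)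
qed

text \<open>The coefficient of a partition is the number of permutations of that cycle type. So the
  sum over partitions unfolds into the sum of the numbers of fixed graphs over all permutations,
  where Burnside's lemma applies and the final division is exact.\<close>

theorem regular_countC_correct:
  assumes d: "d \<ge> 1"
  shows "fst (val (regular_countC d n)) = num_regular d n"
    and "valid_cache d n (snd (val (regular_countC d n)))"
proof -
  let ?P = "val (partitionsC [1..<Suc n] n)"
  let ?V = "{1..n}"
  let ?s = "fold (\<lambda>x s. val (partition_step d (fact n) (Suc n) x s)) ?P (0, [])"
  have v0: "valid_cache d n []" by (simp add: valid_cache_def)
  note f = fold_partition_step[OF order_refl d v0, of "fact n" 0]
  have val: "val (regular_countC d n) = (fst ?s div fact n, snd ?s)"
    unfolding regular_countC_alt by (simp add: case_prod_beta' del: upt_Suc)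
  show "valid_cache d n (snd (val (regular_countC d n)))"
    unfolding val using f by (simp add: cache_step_def del: upt_Suc)
  have finG: "finite {p. p permutes ?V}" by (rule finite_permutations) simp
  have "fst ?s = (\<Sum>\<mu>\<leftarrow>?P. fact n div val (zC \<mu>) * Phi d (state_of (val (initC d \<mu>))))"
    using f by simp
  also have "\<dots> = (\<Sum>\<mu>\<in>set ?P. fact n div val (zC \<mu>) * Phi d (state_of (val (initC d \<mu>))))"
    by (rule sum_list_distinct_conv_sum_set[OF distinct_partitionsC])
  also have "\<dots> = (\<Sum>\<mu>\<in>set ?P. \<Sum>p\<in>{p \<in> {p. p permutes ?V}. cycle_type n p = \<mu>}.
      Phi d (state_of (val (initC d (cycle_type n p)))))"
  proof (rule sum.cong[OF refl])
    fix \<mu> assume \<mu>: "\<mu> \<in> set ?P"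
    have "(\<Sum>p\<in>{p \<in> {p. p permutes ?V}. cycle_type n p = \<mu>}.
      Phi d (state_of (val (initC d (cycle_type n p))))) =
      (\<Sum>p\<in>{p \<in> {p. p permutes ?V}. cycle_type n p = \<mu>}. Phi d (state_of (val (initC d \<mu>))))"
      by (rule sum.cong) auto
    also have "\<dots> = fact n div val (zC \<mu>) * Phi d (state_of (val (initC d \<mu>)))"
      using card_partition_class[OF \<mu>] by (simp del: upt_Suc)
    finally show "fact n div val (zC \<mu>) * Phi d (state_of (val (initC d \<mu>))) =
      (\<Sum>p\<in>{p \<in> {p. p permutes ?V}. cycle_type n p = \<mu>}.
      Phi d (state_of (val (initC d (cycle_type n p)))))" by (rule sym)
  qed
  also have "\<dots> = (\<Sum>p | p permutes ?V. Phi d (state_of (val (initC d (cycle_type n p)))))"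
  proof (rule sum.group[OF finG finite_set], rule image_subsetI)
    fix p assume "p \<in> {p. p permutes ?V}"
    then show "cycle_type n p \<in> set ?P" using cycle_type_partition(1) by blast
  qed
  also have "\<dots> = (\<Sum>p | p permutes ?V. card (fixed_graphs ?V p (\<lambda>_. d)))"
    by (rule sum.cong[OF refl]) (use card_fixed_graphs_type[OF d] in auto)
  also have "\<dots> = num_regular d n * fact n"
    unfolding num_regular_def using burnside_graphs[of ?V d] by simp
  finally show "fst (val (regular_countC d n)) = num_regular d n"
    unfolding val by simp
qed

section \<open>The number of states\<close>

text \<open>For positive weights this is the number of vectors of naturals whose weighted sum is at
  most \<open>B\<close>. It serves alike for states, for partitions and for the choices of values
  below a given state.\<close>

primrec num_le :: "nat list \<Rightarrow> nat \<Rightarrow> nat" where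
  "num_le [] B = 1"
| "num_le (w # ws) B = (\<Sum>k\<le>B div w. num_le ws (B - k * w))"

lemma num_le_pos: "num_le ws B \<ge> 1"
proof (induction ws arbitrary: B)
  case (Cons w ws)
  have "num_le ws (B - 0 * w) \<le> num_le (w # ws) B"
    unfolding num_le.simps by (rule member_le_sum) auto
  then show ?case using Cons[of B] by simp
qed simp

lemma num_le_mono: "B \<le> B' \<Longrightarrow> num_le ws B \<le> num_le ws B'"
proof (induction ws arbitrary: B B')
  case (Cons w ws)
  have "num_le (w # ws) B \<le> (\<Sum>k\<le>B div w. num_le ws (B' - k * w))"
    unfolding num_le.simps by (rule sum_mono) (use Cons in auto)
  also have "\<dots> \<le> num_le (w # ws) B'"
    unfolding num_le.simps by (rule sum_mono2) (use Cons.prems in \<open>auto intro: order_trans div_le_mono\<close>)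
  finally show ?case .
qed simp

text \<open>Every counted vector has weight at most \<open>B\<close>, and its power of
  \<open>x\<close> is therefore at least \<open>x ^ B\<close>. So the count times
  \<open>x ^ B\<close> is at most the generating function of all vectors at \<open>x\<close>, a
  product of geometric series.\<close>

lemma num_le_bound:
  fixes x :: real
  assumes x: "0 < x" "x < 1" and "\<And>w. w \<in> set ws \<Longrightarrow> w > 0"
  shows "num_le ws B * x ^ B \<le> (\<Prod>w\<leftarrow>ws. 1 / (1 - x ^ w))"
  using assms(3)
proof (induction ws arbitrary: B)
  case Nil
  show ?case using x by (simp add: power_le_one)
next
  case (Cons w ws)
  let ?P = "\<Prod>w\<leftarrow>ws. 1 / (1 - x ^ w)"
  have w: "w > 0" using Cons.prems by simp
  have xw: "x ^ w < 1" using x w by (simp add: power_less_one_iff)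
  have P: "?P \<ge> 0"
    using Cons.prems x by (intro prod_list_nonneg) (auto simp: power_le_one)
  have "num_le (w # ws) B * x ^ B = (\<Sum>k\<le>B div w. num_le ws (B - k * w) * x ^ (B - k * w) * (x ^ w) ^ k)"
    unfolding num_le.simps of_nat_sum sum_distrib_right
  proof (rule sum.cong[OF refl])
    fix k assume "k \<in> {..B div w}"
    then have "k * w \<le> B" using w by (simp add: less_eq_div_iff_mult_less_eq)
    then have "x ^ B = x ^ (B - k * w) * (x ^ w) ^ k"
      by (simp add: power_mult[symmetric] power_add[symmetric] mult.commute)
    then show "num_le ws (B - k * w) * x ^ B = num_le ws (B - k * w) * x ^ (B - k * w) * (x ^ w) ^ k"
      by simp
  qed
  also have "\<dots> \<le> (\<Sum>k\<le>B div w. ?P * (x ^ w) ^ k)"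
    by (intro sum_mono mult_right_mono Cons.IH) (use Cons.prems x in auto)
  also have "\<dots> = ?P * (\<Sum>k\<le>B div w. (x ^ w) ^ k)" by (simp add: sum_distrib_left)
  also have "\<dots> \<le> ?P * (1 / (1 - x ^ w))"
  proof (rule mult_left_mono[OF _ P])
    have "(\<Sum>k\<le>B div w. (x ^ w) ^ k) = (1 - (x ^ w) ^ Suc (B div w)) / (1 - x ^ w)"
      using xw by (subst sum_gp0) auto
    also have "\<dots> \<le> 1 / (1 - x ^ w)"
      using xw x by (intro divide_right_mono) auto
    finally show "(\<Sum>k\<le>B div w. (x ^ w) ^ k) \<le> 1 / (1 - x ^ w)" .
  qed
  finally show ?case by (simp add: mult.commute)
qed

section \<open>The generating function of the states\<close>

abbreviation geometric_fps :: "nat \<Rightarrow> real fps" where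
  "geometric_fps w \<equiv> inverse (1 - fps_X ^ w)"

lemma geometric_fps_nth:
  assumes "w > 0"
  shows "fps_nth (geometric_fps w) i = (if w dvd i then 1 else 0)"
proof -
  let ?G = "Abs_fps (\<lambda>i. if w dvd i then 1 else 0) :: real fps"
  have "(1 - fps_X ^ w) * ?G = 1"
  proof (rule fps_ext)
    fix i
    have "fps_nth ((1 - fps_X ^ w) * ?G) i = fps_nth ?G i - fps_nth (fps_X ^ w * ?G) i"
      by (simp add: left_diff_distrib)
    also have "\<dots> = fps_nth 1 i"
    proof (cases "i < w")
      case True
      then show ?thesis using assms by (auto simp: fps_X_power_mult_nth dest: dvd_imp_le)
    next
      case False
      then show ?thesis using assms by (auto simp: fps_X_power_mult_nth dvd_minus_self)
    qed
    finally show "fps_nth ((1 - fps_X ^ w) * ?G) i = fps_nth 1 i" .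
  qed
  then have "geometric_fps w = ?G" by (rule fps_inverse_unique)
  then show ?thesis by simp
qed

text \<open>Multiplication by the series with all coefficients 1 forms partial sums. The count up to
  \<open>B\<close> thus becomes a single coefficient of a product, and the induction over the
  weights peels off one factor at a time.\<close>

lemma num_le_fps:
  assumes "\<And>w. w \<in> set ws \<Longrightarrow> w > 0"
  shows "real (num_le ws B) = (\<Sum>m=0..B. fps_nth (\<Prod>w\<leftarrow>ws. geometric_fps w) m)"
proof -
  let ?S = "Abs_fps (\<lambda>_. 1) :: real fps"
  have "real (num_le ws B) = fps_nth ((\<Prod>w\<leftarrow>ws. geometric_fps w) * ?S) B"
    using assms
  proof (induction ws arbitrary: B)
    case (Cons w ws)
    let ?F = "(\<Prod>w\<leftarrow>ws. geometric_fps w) * ?S"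
    have w: "w > 0" using Cons.prems by simp
    have "fps_nth ((\<Prod>w\<leftarrow>w # ws. geometric_fps w) * ?S) B = fps_nth (geometric_fps w * ?F) B"
      by (simp add: mult.assoc)
    also have "\<dots> = (\<Sum>i=0..B. (if w dvd i then fps_nth ?F (B - i) else 0))"
      unfolding fps_mult_nth[of "geometric_fps w"] geometric_fps_nth[OF w] by (rule sum.cong) auto
    also have "\<dots> = (\<Sum>i\<in>{i\<in>{0..B}. w dvd i}. fps_nth ?F (B - i))"
      by (rule sum.inter_filter[symmetric]) simp
    also have "\<dots> = (\<Sum>k\<le>B div w. fps_nth ?F (B - k * w))"
      by (rule sum.reindex_bij_witness[of _ "\<lambda>k. k * w" "\<lambda>i. i div w"])
        (use w in \<open>auto simp: less_eq_div_iff_mult_less_eq\<close>)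
    also have "\<dots> = real (num_le (w # ws) B)"
      using Cons by simp
    finally show ?case by simp
  qed simp
  then show ?thesis by (simp add: fps_mult_nth)
qed

lemma card_vectors:
  assumes "distinct ks" "\<And>p. p \<in> set ks \<Longrightarrow> fst p > 0"
  shows "finite {H :: state. (\<forall>p. p \<notin> set ks \<longrightarrow> H p = 0) \<and> (\<Sum>p\<leftarrow>ks. fst p * H p) \<le> B} \<and>
    card {H :: state. (\<forall>p. p \<notin> set ks \<longrightarrow> H p = 0) \<and> (\<Sum>p\<leftarrow>ks. fst p * H p) \<le> B} = num_le (map fst ks) B"
  using assms
proof (induction ks arbitrary: B)
  case Nil
  have "{H :: state. (\<forall>p. p \<notin> set [] \<longrightarrow> H p = 0) \<and> (\<Sum>p\<leftarrow>[]. fst p * H p) \<le> B} = {\<lambda>_. 0}"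
    by auto
  then show ?case by simp
next
  case (Cons p ks)
  let ?A = "\<lambda>ks B. {H :: state. (\<forall>p. p \<notin> set ks \<longrightarrow> H p = 0) \<and> (\<Sum>p\<leftarrow>ks. fst p * H p) \<le> B}"
  let ?w = "fst p"
  have w: "?w > 0" and p: "p \<notin> set ks" using Cons.prems by auto
  have IH: "finite (?A ks B')" "card (?A ks B') = num_le (map fst ks) B'" for B'
    using Cons.IH[of B'] Cons.prems by auto
  have same: "(\<Sum>q\<leftarrow>ks. fst q * (H(p := k)) q) = (\<Sum>q\<leftarrow>ks. fst q * H q)" for H :: state and k
    by (rule arg_cong[where f = sum_list], rule map_cong[OF refl]) (use p in auto)
  have eq: "?A (p # ks) B = (\<Union>k\<in>{..B div ?w}. (\<lambda>H. H(p := k)) ` ?A ks (B - k * ?w))"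
  proof (intro equalityI subsetI)
    fix H assume H: "H \<in> ?A (p # ks) B"
    then have le: "?w * H p + (\<Sum>q\<leftarrow>ks. fst q * H q) \<le> B" by simp
    then have "H p \<le> B div ?w" using w by (simp add: less_eq_div_iff_mult_less_eq mult.commute)
    moreover have "H(p := 0) \<in> ?A ks (B - H p * ?w)"
      using H le by (auto simp: same mult.commute simp del: fun_upd_apply) (auto simp: fun_upd_def)
    moreover have "H = (H(p := 0))(p := H p)" by simp
    ultimately show "H \<in> (\<Union>k\<in>{..B div ?w}. (\<lambda>H. H(p := k)) ` ?A ks (B - k * ?w))" by blast
  next
    fix H assume "H \<in> (\<Union>k\<in>{..B div ?w}. (\<lambda>H. H(p := k)) ` ?A ks (B - k * ?w))"
    then obtain k H' where k: "k \<le> B div ?w" "H' \<in> ?A ks (B - k * ?w)" "H = H'(p := k)" by blast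
    then have "k * ?w \<le> B" using w by (simp add: less_eq_div_iff_mult_less_eq)
    moreover have "(\<Sum>q\<leftarrow>ks. fst q * H q) = (\<Sum>q\<leftarrow>ks. fst q * H' q)" unfolding k(3) by (rule same)
    ultimately show "H \<in> ?A (p # ks) B" using k by (auto simp: mult.commute)
  qed
  have inj: "inj_on (\<lambda>H. H(p := k)) (?A ks B')" for k B'
  proof (rule inj_onI)
    fix H H' :: state assume *: "H \<in> ?A ks B'" "H' \<in> ?A ks B'" "H(p := k) = H'(p := k)"
    show "H = H'"
    proof
      fix q show "H q = H' q"
      proof (cases "q = p")
        case True
        then show ?thesis using CollectD[OF *(1)] CollectD[OF *(2)] p by metis
      next
        case False
        then show ?thesis using fun_cong[OF *(3), of q] by (metis fun_upd_other)
      qed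
    qed
  qed
  have "card (?A (p # ks) B) = (\<Sum>k\<le>B div ?w. card ((\<lambda>H. H(p := k)) ` ?A ks (B - k * ?w)))"
    unfolding eq
  proof (rule card_UN_disjoint)
    show "\<forall>i\<in>{..B div ?w}. \<forall>j\<in>{..B div ?w}. i \<noteq> j \<longrightarrow>
        (\<lambda>H. H(p := i)) ` ?A ks (B - i * ?w) \<inter> (\<lambda>H. H(p := j)) ` ?A ks (B - j * ?w) = {}"
    proof (intro ballI impI equals0I)
      fix i j H assume "i \<noteq> j" "H \<in> (\<lambda>H. H(p := i)) ` ?A ks (B - i * ?w) \<inter> (\<lambda>H. H(p := j)) ` ?A ks (B - j * ?w)"
      then obtain H1 H2 where "H = H1(p := i)" "H = H2(p := j)" by (elim IntE imageE)
      then have "H p = i" "H p = j" by (metis fun_upd_same)+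
      then show False using \<open>i \<noteq> j\<close> by simp
    qed
  qed (use IH in auto)
  also have "\<dots> = num_le (map fst (p # ks)) B"
    unfolding card_image[OF inj] IH(2) by simp
  finally have "card (?A (p # ks) B) = num_le (map fst (p # ks)) B" .
  moreover have "finite (?A (p # ks) B)" unfolding eq using IH(1) by (intro finite_UN_I) auto
  ultimately show ?case by blast
qed

text \<open>A nonzero entry at \<open>(a, r)\<close> alone contributes at least \<open>a\<close> to
  the size, so states of size at most \<open>n\<close> live on the finitely many keys with cycle
  length up to \<open>n\<close>.\<close>

lemma states_eq:
  "states d n = {H. (\<forall>p. p \<notin> set (table_keys d n) \<longrightarrow> H p = 0) \<and> (\<Sum>p\<leftarrow>table_keys d n. fst p * H p) \<le> n}"
proof (intro equalityI subsetI)
  fix H assume "H \<in> states d n"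
  then have H: "normalized d H" "state_size H \<le> n" by (auto simp: states_def)
  have fin: "finite {p. H p \<noteq> 0}" using H by (simp add: normalized_def)
  have sub: "{p. H p \<noteq> 0} \<subseteq> set (table_keys d n)"
  proof
    fix p assume p: "p \<in> {p. H p \<noteq> 0}"
    obtain a r where ar: "p = (a, r)" by (cases p)
    have "1 \<le> a" "1 \<le> r" "r \<le> d" using H p ar by (auto simp: normalized_def)
    moreover have "a \<le> n"
    proof -
      have "fst p * H p \<le> (\<Sum>p\<in>{p. H p \<noteq> 0}. fst p * H p)"
        using fin p by (intro member_le_sum) auto
      also have "\<dots> = state_size H" by (rule state_size_keys[symmetric]) (use fin in auto)
      finally have "fst p * H p \<le> n" using H by simp
      moreover have "a \<le> fst p * H p" using p ar by simp
      ultimately show ?thesis by (rule order_trans[rotated])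
    qed
    ultimately show "p \<in> set (table_keys d n)" using ar by (simp add: set_table_keys)
  qed
  have "(\<Sum>p\<leftarrow>table_keys d n. fst p * H p) = state_size H"
    unfolding sum_list_distinct_conv_sum_set[OF distinct_table_keys]
    by (rule state_size_keys[OF _ sub, symmetric]) simp
  then show "H \<in> {H. (\<forall>p. p \<notin> set (table_keys d n) \<longrightarrow> H p = 0) \<and> (\<Sum>p\<leftarrow>table_keys d n. fst p * H p) \<le> n}"
    using H sub by auto
next
  fix H :: state assume H: "H \<in> {H. (\<forall>p. p \<notin> set (table_keys d n) \<longrightarrow> H p = 0) \<and> (\<Sum>p\<leftarrow>table_keys d n. fst p * H p) \<le> n}"
  from CollectD[OF this] have all: "\<forall>p. p \<notin> set (table_keys d n) \<longrightarrow> H p = 0" by (rule conjunct1)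
  have sub: "{p. H p \<noteq> 0} \<subseteq> set (table_keys d n)"
  proof (rule subsetI, rule ccontr)
    fix p assume "p \<in> {p. H p \<noteq> 0}" "p \<notin> set (table_keys d n)"
    then show False using spec[OF all, of p] by simp
  qed
  from sub have fin: "finite {p. H p \<noteq> 0}" by (rule finite_subset) simp
  have "(\<Sum>p\<leftarrow>table_keys d n. fst p * H p) = state_size H"
    unfolding sum_list_distinct_conv_sum_set[OF distinct_table_keys]
    by (rule state_size_keys[OF _ sub, symmetric]) simp
  moreover have "normalized d H"
    using fin sub by (auto simp: normalized_def set_table_keys)
  ultimately show "H \<in> states d n" using H by (simp add: states_def)
qed

lemma card_states: "finite (states d n)" "card (states d n) = num_le (map fst (table_keys d n)) n"
  unfolding states_eq
  using card_vectors[OF distinct_table_keys, of d n n] by (auto simp: set_table_keys)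

lemma fst_table_keys: "w \<in> set (map fst (table_keys d n)) \<Longrightarrow> w > 0"
  by (auto simp: set_table_keys split: if_splits)

lemma prod_table_keys:
  fixes f :: "nat \<Rightarrow> 'a :: comm_monoid_mult"
  shows "(\<Prod>w\<leftarrow>map fst (table_keys d n). f w) = (\<Prod>a<n. f (Suc a) ^ d)"
proof -
  have *: "(\<Prod>p\<leftarrow>List.product as bs. f (fst p)) = (\<Prod>a\<leftarrow>as. f a ^ length bs)" for as bs :: "nat list"
  proof (induction as)
    case (Cons a as)
    have "(\<Prod>b\<leftarrow>bs. f a) = f a ^ length bs" by (induction bs) auto
    then show ?case using Cons by (simp add: comp_def)
  qed simp
  have "(\<Prod>w\<leftarrow>map fst (table_keys d n). f w) = (\<Prod>a\<leftarrow>[1..<Suc n]. f a ^ d)"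
    unfolding table_keys_def map_map comp_def * by (simp del: upt_Suc)
  also have "\<dots> = (\<Prod>a\<in>{1..<Suc n}. f a ^ d)"
    by (subst prod.distinct_set_conv_list[symmetric]) (auto simp del: upt_Suc)
  also have "\<dots> = (\<Prod>a<n. f (Suc a) ^ d)"
    by (rule prod.reindex_bij_witness[of _ Suc "\<lambda>a. a - 1"]) auto
  finally show ?thesis .
qed

text \<open>A factor in powers of \<open>fps_X ^ w\<close> leaves coefficients below
  \<open>w\<close> untouched. Hence each coefficient of the partial products is eventually
  constant.\<close>

lemma geometric_power_nth:
  assumes "w > 0" "i < w"
  shows "fps_nth (geometric_fps w ^ d) i = (if i = 0 then 1 else 0)"
  using assms(2)
proof (induction d arbitrary: i)
  case (Suc d)
  have "fps_nth (geometric_fps w ^ Suc d) i = (\<Sum>j=0..i. fps_nth (geometric_fps w) j * fps_nth (geometric_fps w ^ d) (i - j))"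
    by (simp add: fps_mult_nth)
  also have "\<dots> = (\<Sum>j=0..i. if j = 0 then fps_nth (geometric_fps w ^ d) i else 0)"
    using assms(1) Suc.prems by (intro sum.cong refl) (auto simp: geometric_fps_nth dest: dvd_imp_le)
  also have "\<dots> = fps_nth (geometric_fps w ^ d) i" by (simp add: sum.delta)
  finally show ?case using Suc by simp
qed (simp add: fps_one_nth)

text \<open>Formal power series converge when every coefficient becomes constant, so the limit
  \<open>p\<close> can be written down from the stable coefficients. \<open>has_prod\<close> also
  asks for a nonzero limit, which the constant term 1 provides.\<close>

lemma prodinf_geometric_nth:
  assumes "m \<le> n"
  shows "fps_nth (\<Prod>a. inverse ((1 - fps_X ^ Suc a) ^ d) :: real fps) m =
    fps_nth (\<Prod>a<n. geometric_fps (Suc a) ^ d) m"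
proof -
  let ?f = "\<lambda>a. inverse ((1 - fps_X ^ Suc a) ^ d) :: real fps"
  let ?P = "\<lambda>n. \<Prod>a<n. geometric_fps (Suc a) ^ d"
  have f: "?f a = geometric_fps (Suc a) ^ d" for a by (rule fps_inverse_power)
  have step: "fps_nth (?P (Suc N)) m = fps_nth (?P N) m" if "m \<le> N" for N m
  proof -
    have "fps_nth (?P (Suc N)) m = fps_nth (geometric_fps (Suc N) ^ d * ?P N) m"
      by (simp only: prod.lessThan_Suc mult.commute)
    also have "\<dots> = (\<Sum>j=0..m. fps_nth (geometric_fps (Suc N) ^ d) j * fps_nth (?P N) (m - j))"
      by (rule fps_mult_nth)
    also have "\<dots> = (\<Sum>j=0..m. if j = 0 then fps_nth (?P N) m else 0)"
      by (rule sum.cong[OF refl]) (use that in \<open>auto simp: geometric_power_nth simp del: power_Suc\<close>)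
    also have "\<dots> = fps_nth (?P N) m" by (simp add: sum.delta)
    finally show ?thesis .
  qed
  have stable: "fps_nth (?P N) m = fps_nth (?P m) m" if "m \<le> N" for N m
    using that by (induction N rule: dec_induct) (use step in auto)
  define p where "p = Abs_fps (\<lambda>m. fps_nth (?P m) m)"
  \<comment> \<open>\<open>raw_has_prod\<close> has a start index, here 0; hence the form
    \<open>a + 0\<close>.\<close>
  have "(\<lambda>N. \<Prod>a\<le>N. ?f (a + 0)) \<longlonglongrightarrow> p"
  proof (rule tendsto_fpsI)
    fix m
    show "\<forall>\<^sub>F N in sequentially. fps_nth (\<Prod>a\<le>N. ?f (a + 0)) m = fps_nth p m"
    proof (rule eventually_sequentiallyI[of m])
      fix N assume "m \<le> N"
      then have "m \<le> Suc N" by simp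
      have "(\<Prod>a\<le>N. ?f (a + 0)) = ?P (Suc N)" unfolding f lessThan_Suc_atMost by simp
      then show "fps_nth (\<Prod>a\<le>N. ?f (a + 0)) m = fps_nth p m"
        using stable[OF \<open>m \<le> Suc N\<close>] by (simp add: p_def del: prod.lessThan_Suc)
    qed
  qed
  moreover have "fps_nth p 0 = 1" by (simp add: p_def)
  then have "p \<noteq> 0" by auto
  ultimately have "?f has_prod p" by (simp add: has_prod_def raw_has_prod_def)
  then have "prodinf ?f = p" by (rule has_prod_unique[symmetric])
  then show ?thesis using stable[OF assms] by (simp add: p_def)
qed

theorem card_states_fps:
  "real (card (states d n)) =
    (\<Sum>m=0..n. fps_nth (\<Prod>a. inverse ((1 - fps_X ^ Suc a) ^ d) :: real fps) m)"
proof -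
  have "real (card (states d n)) = (\<Sum>m=0..n. fps_nth (\<Prod>w\<leftarrow>map fst (table_keys d n). geometric_fps w) m)"
    unfolding card_states by (rule num_le_fps[OF fst_table_keys])
  also have "\<dots> = (\<Sum>m=0..n. fps_nth (\<Prod>a. inverse ((1 - fps_X ^ Suc a) ^ d) :: real fps) m)"
    unfolding prod_table_keys by (rule sum.cong[OF refl]) (simp add: prodinf_geometric_nth del: power_Suc)
  finally show ?thesis .
qed

section \<open>The exponential bound for the number of states\<close>

lemma inverse_squares_sums': "(\<lambda>k. 1 / real k ^ 2) sums (pi\<^sup>2 / 6)"
  by (rule sums_Suc_imp) (use inverse_squares_sums in \<open>simp_all add: add.commute\<close>)

text \<open>Expanding the logarithm and summing over \<open>a\<close> first leaves
  \<open>\<Sum>\<^sub>k 1 / (k (e\<^sup>k\<^sup>t - 1)) \<le> \<Sum>\<^sub>k 1 / (k\<^sup>2 t)\<close>.\<close>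

lemma prod_geometric_le:
  fixes t :: real
  assumes t: "t > 0"
  shows "(\<Prod>a<n. 1 / (1 - exp (- t) ^ Suc a)) \<le> exp (pi\<^sup>2 / (6 * t))"
proof -
  let ?y = "\<lambda>a. exp (- t) ^ Suc a"
  have y: "0 < ?y a" "?y a < 1" for a
    using t by (simp, simp only: power_less_one_iff exp_ge_zero, simp)
  \<comment> \<open>The term at \<open>k = 0\<close> is 0 because division by 0 gives 0, so this
    series and that of the inverse squares can both be indexed from 0 and compared term by
    term.\<close>
  have s1: "(\<lambda>k. ?y a ^ k / real k) sums (- ln (1 - ?y a))" for a
  proof -
    have "(\<lambda>k. - ((- (- ?y a)) ^ k) / real k) sums ln (1 + (- ?y a))"
      by (rule ln_series') (use y[of a] in auto)
    from sums_minus[OF this] show ?thesis by simp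
  qed
  have s2: "(\<lambda>k. \<Sum>a<n. ?y a ^ k / real k) sums (\<Sum>a<n. - ln (1 - ?y a))"
    by (rule sums_sum) (rule s1)
  have s3: "(\<lambda>k. (1 / t) * (1 / real k ^ 2)) sums ((1 / t) * (pi\<^sup>2 / 6))"
    by (rule sums_mult[OF inverse_squares_sums'])
  have s4: "(\<Sum>a<n. ?y a ^ k / real k) \<le> (1 / t) * (1 / real k ^ 2)" for k
  proof (cases "k = 0")
    case False
    define q where "q = exp (- (t * k))"
    have kt: "t * k > 0" using t False by simp
    have q: "0 < q" "q < 1" using kt by (simp_all add: q_def)
    have yq: "?y a ^ k = q * q ^ a" for a
    proof -
      have "?y a ^ k = (exp (- t) ^ k) ^ Suc a" by (simp only: power_mult[symmetric] mult.commute)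
      also have "exp (- t) ^ k = q" by (simp add: q_def exp_of_nat_mult[symmetric] mult.commute)
      finally show ?thesis by simp
    qed
    have "(\<Sum>a<n. ?y a ^ k) = q * ((1 - q ^ n) / (1 - q))"
      unfolding yq sum_distrib_left[symmetric] using q by (subst sum_gp_strict) auto
    also have "\<dots> \<le> q * (1 / (1 - q))"
      using q by (intro mult_left_mono divide_right_mono) auto
    also have "\<dots> \<le> 1 / (t * k)"
    proof -
      have "1 + t * k \<le> exp (t * k)" by (rule exp_ge_add_one_self)
      then have "q * (1 + t * k) \<le> q * exp (t * k)" using q by (intro mult_left_mono) auto
      also have "q * exp (t * k) = 1" by (simp add: q_def exp_minus)
      finally have "q * (t * k) \<le> 1 - q" by (simp add: algebra_simps)
      then show ?thesis using q kt by (simp add: field_simps)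
    qed
    finally have "(\<Sum>a<n. ?y a ^ k) / real k \<le> 1 / (t * k) / real k"
      by (rule divide_right_mono) simp
    then show ?thesis by (simp add: sum_divide_distrib power2_eq_square mult.assoc)
  qed simp
  have le: "(\<Sum>a<n. - ln (1 - ?y a)) \<le> (1 / t) * (pi\<^sup>2 / 6)"
    by (rule sums_le[OF s4 s2 s3])
  have "(\<Prod>a<n. 1 / (1 - ?y a)) = exp (\<Sum>a<n. - ln (1 - ?y a))"
    unfolding exp_sum[OF finite_lessThan]
    by (rule prod.cong[OF refl]) (use y in \<open>simp add: exp_minus inverse_eq_divide\<close>)
  also have "\<dots> \<le> exp ((1 / t) * (pi\<^sup>2 / 6))" using le by simp
  finally show ?thesis by (simp add: mult.commute)
qed

theorem card_states_le:
  assumes d: "d \<ge> 1" and n: "n \<ge> 1"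
  shows "real (card (states d n)) \<le> exp (pi * sqrt (2 * real d * real n / 3))"
proof -
  \<comment> \<open>This \<open>t\<close> minimizes \<open>d * pi\<^sup>2 / (6 * t) + n * t\<close>.
    At the minimum both summands equal \<open>pi * sqrt (d * n / 6)\<close>, and their sum is the
    exponent claimed.\<close>
  define t where "t = pi * sqrt (real d / (6 * real n))"
  have t: "t > 0" using d n by (simp add: t_def)
  let ?x = "exp (- t)"
  have "real (card (states d n)) * ?x ^ n \<le> (\<Prod>w\<leftarrow>map fst (table_keys d n). 1 / (1 - ?x ^ w))"
    unfolding card_states by (rule num_le_bound[OF _ _ fst_table_keys]) (use t in auto)
  also have "\<dots> = (\<Prod>a<n. 1 / (1 - ?x ^ Suc a)) ^ d"
    unfolding prod_table_keys by (rule prod_power_distrib[symmetric])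
  also have "\<dots> \<le> exp (pi\<^sup>2 / (6 * t)) ^ d"
  proof (rule power_mono[OF prod_geometric_le[OF t]])
    have "?x ^ Suc a < 1" for a using t by (simp only: power_less_one_iff exp_ge_zero) simp
    then show "0 \<le> (\<Prod>a<n. 1 / (1 - ?x ^ Suc a))"
      by (intro prod_nonneg) (simp add: less_imp_le)
  qed
  also have "\<dots> = exp (real d * (pi\<^sup>2 / (6 * t)))" by (rule exp_of_nat_mult[symmetric])
  finally have "real (card (states d n)) * ?x ^ n * exp (real n * t) \<le> exp (real d * (pi\<^sup>2 / (6 * t))) * exp (real n * t)"
    by (rule mult_right_mono) simp
  moreover have "?x ^ n * exp (real n * t) = 1"
    by (simp add: exp_of_nat_mult[symmetric] exp_add[symmetric])
  ultimately have "real (card (states d n)) \<le> exp (real d * (pi\<^sup>2 / (6 * t)) + real n * t)"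
    by (simp add: exp_add mult.assoc)
  also have "real d * (pi\<^sup>2 / (6 * t)) + real n * t = pi * sqrt (2 * real d * real n / 3)"
  proof -
    define s where "s = sqrt (real d / (6 * real n))"
    have ts: "t = pi * s" by (simp add: t_def s_def)
    have s: "s > 0" "s\<^sup>2 = real d / (6 * real n)" using d n by (simp_all add: s_def)
    then have ds: "real d = 6 * real n * s\<^sup>2" using n by (simp add: field_simps)
    have "real d * (pi\<^sup>2 / (6 * t)) = pi * (real n * s)"
      unfolding ts ds using s(1) pi_gt_zero by (simp add: field_simps power2_eq_square)
    moreover have "real n * t = pi * (real n * s)" by (simp add: t_def s_def)
    moreover have "sqrt (2 * real d * real n / 3) = 2 * (real n * s)"
    proof (rule real_sqrt_unique)
      show "(2 * (real n * s))\<^sup>2 = 2 * real d * real n / 3"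
        unfolding ds by (simp add: power2_eq_square)
    qed (use s in simp)
    ultimately show ?thesis by simp
  qed
  finally show ?thesis .
qed

section \<open>Bit operations\<close>

lemma bits_nat_leI: "x < 2 ^ k \<Longrightarrow> bits (x :: nat) \<le> 2 * k + 1"
  using floorlog_leI[of x 2 k] by (simp add: bits_nat_def)

lemma less_two_power_floorlog: "(x :: nat) < 2 ^ floorlog 2 x"
  using floorlog_bounds[of x 2] by (cases "x = 0") auto

lemma bits_nat_le: "bits (x :: nat) \<le> 2 * x + 1"
  by (rule bits_nat_leI) (rule less_exp)

lemma bits_nat_mono: "x \<le> y \<Longrightarrow> bits (x :: nat) \<le> bits y"
  by (simp add: bits_nat_def floorlog_mono)

lemma bits_nat_mult: "bits (x * y :: nat) \<le> bits x + bits y"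
proof -
  have "x * y < 2 ^ floorlog 2 x * 2 ^ floorlog 2 y"
    by (rule mult_strict_mono) (use less_two_power_floorlog in auto)
  then have "x * y < 2 ^ (floorlog 2 x + floorlog 2 y)" by (simp add: power_add)
  from bits_nat_leI[OF this] show ?thesis by (simp add: bits_nat_def)
qed

text \<open>For exponents of at least 1 the sum of two powers of 2 is at most their product. The
  bound is coarser than the maximum plus a constant, but it treats addition like multiplication, so
  that one estimate of loops covers sums and products.\<close>

lemma bits_nat_add: "bits (x + y :: nat) \<le> bits x + bits y"
proof (cases "x = 0 \<or> y = 0")
  case False
  have p: "floorlog 2 u > 0" if "u \<noteq> 0" for u :: nat
    using that floorlog_eq_zero_iff[of 2 u] by auto
  then obtain i j where ij: "floorlog 2 x = Suc i" "floorlog 2 y = Suc j"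
    using False by (metis gr0_implies_Suc)
  have "x + y < 2 ^ Suc i + 2 ^ Suc j"
    using less_two_power_floorlog[of x] less_two_power_floorlog[of y] by (simp only: ij)
  also have "\<dots> \<le> 2 ^ (Suc i + Suc j)"
  proof -
    obtain u v where "(2 :: nat) ^ i = Suc u" "(2 :: nat) ^ j = Suc v"
      by (metis not0_implies_Suc power_not_zero zero_neq_numeral)
    then show ?thesis by (simp add: power_add)
  qed
  finally show ?thesis using bits_nat_leI[of "x + y" "Suc i + Suc j"] by (simp add: bits_nat_def ij)
qed (auto simp: bits_nat_def)

lemma bits_list_le:
  assumes "\<And>x. x \<in> set xs \<Longrightarrow> bits x \<le> K" "length xs \<le> L"
  shows "bits xs \<le> 1 + L * (1 + K)"
proof -
  have "(\<Sum>x\<leftarrow>xs. 1 + bits x) \<le> (\<Sum>x\<leftarrow>xs. 1 + K)"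
    by (rule sum_list_mono) (use assms in auto)
  also have "\<dots> = length xs * (1 + K)" by (simp add: sum_list_triv)
  also have "\<dots> \<le> L * (1 + K)" using assms(2) by (rule mult_le_mono1)
  finally show ?thesis by (simp add: bits_list_def)
qed

lemma bits_pair [simp]: "bits (x, y) = bits x + bits y"
  by (simp add: bits_prod_def)

lemma bits_bool [simp]: "bits (b :: bool) = 1"
  by (simp add: bits_bool_def)

lemma bits_Nil [simp]: "bits ([] :: 'a::encodable list) = 1"
  by (simp add: bits_list_def)

lemma bits_option [simp]: "bits None = 1" "bits (Some x) = 1 + bits x"
  by (simp_all add: bits_option_def)

text \<open>The invariant \<open>I\<close> is indexed by the number of rounds, since accumulators
  grow. The potential \<phi> allows a round to be expensive if it enlarges the cache accordingly.
  The term quadratic in the length pays for \<open>inspect\<close>, which copies the remaining list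
  in every round.\<close>

lemma bit_ops_foldC_potential:
  fixes \<phi> :: "'b::encodable \<Rightarrow> nat"
  assumes "\<And>i x s. x \<in> set xs \<Longrightarrow> i < length xs \<Longrightarrow> I i s \<Longrightarrow>
      bit_ops (f x s) + \<phi> s \<le> F x + \<phi> (val (f x s)) \<and> I (Suc i) (val (f x s))"
    and "\<And>i s. i \<le> length xs \<Longrightarrow> I i s \<Longrightarrow> bits s \<le> S" and "\<And>x. x \<in> set xs \<Longrightarrow> bits x \<le> K" and "I 0 s"
  shows "bit_ops (foldC f xs s) + \<phi> s \<le>
      (\<Sum>x\<leftarrow>xs. F x) + length xs * (3 + 2 * (length xs * (1 + K))) + (1 + 2 * S) + \<phi> (val (foldC f xs s)) \<and>
    I (length xs) (val (foldC f xs s))"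
proof -
  have "bit_ops (foldC f ys s) + \<phi> s \<le>
      (\<Sum>x\<leftarrow>ys. F x) + length ys * (3 + 2 * (length xs * (1 + K))) + (1 + 2 * S) + \<phi> (val (foldC f ys s)) \<and>
      I (length xs) (val (foldC f ys s))"
    if "set ys \<subseteq> set xs" "i + length ys = length xs" "I i s" for ys i s
    using that
  proof (induction ys arbitrary: i s)
    case Nil
    then show ?case using assms(2)[of i s] by simp
  next
    case (Cons y ys)
    have y: "bit_ops (f y s) + \<phi> s \<le> F y + \<phi> (val (f y s))" "I (Suc i) (val (f y s))"
      using assms(1)[of y i s] Cons.prems by auto
    note IH = Cons.IH[OF _ _ y(2)]
    have "bits (y # ys) \<le> 1 + length xs * (1 + K)"
      by (rule bits_list_le) (use Cons.prems assms(3) in auto)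
    then show ?case using y(1) IH Cons.prems by simp
  qed
  from this[of xs 0 s] show ?thesis using assms(4) by simp
qed

lemma bit_ops_foldC:
  assumes "\<And>i x s. x \<in> set xs \<Longrightarrow> i < length xs \<Longrightarrow> I i s \<Longrightarrow> bit_ops (f x s) \<le> F x \<and> I (Suc i) (val (f x s))"
    and "\<And>i s. i \<le> length xs \<Longrightarrow> I i s \<Longrightarrow> bits s \<le> S" and "\<And>x. x \<in> set xs \<Longrightarrow> bits x \<le> K" and "I 0 s"
  shows "bit_ops (foldC f xs s) \<le> (\<Sum>x\<leftarrow>xs. F x) + length xs * (3 + 2 * (length xs * (1 + K))) + (1 + 2 * S) \<and>
    I (length xs) (val (foldC f xs s))"
  using bit_ops_foldC_potential[of xs I f "\<lambda>_. 0" F S K s] assms by simp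

lemma bit_ops_mapC:
  assumes "\<And>x. x \<in> set xs \<Longrightarrow> bit_ops (f x) \<le> F" "\<And>x. x \<in> set xs \<Longrightarrow> bits x \<le> K"
    "\<And>x. x \<in> set xs \<Longrightarrow> bits (val (f x)) \<le> K" "length xs \<le> L"
  shows "bit_ops (mapC f xs) \<le> L * (F + 6 + 4 * (L * (1 + K))) + 3"
proof -
  have "bit_ops (mapC f ys) \<le> length ys * (F + 6 + 4 * (L * (1 + K))) + 3"
    if "set ys \<subseteq> set xs" "length ys \<le> L" for ys
    using that
  proof (induction ys)
    case (Cons y ys)
    have "bits (y # ys) \<le> 1 + L * (1 + K)"
      by (rule bits_list_le) (use Cons.prems assms(2) in auto)
    moreover have "bits (val (f y) # map (\<lambda>x. val (f x)) ys) \<le> 1 + L * (1 + K)"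
      by (rule bits_list_le) (use Cons.prems assms(3) in auto)
    moreover have "bit_ops (f y) \<le> F" using Cons.prems assms(1) by auto
    ultimately show ?case using Cons by simp
  qed simp
  from this[of xs] have "bit_ops (mapC f xs) \<le> length xs * (F + 6 + 4 * (L * (1 + K))) + 3"
    using assms(4) by simp
  also have "\<dots> \<le> L * (F + 6 + 4 * (L * (1 + K))) + 3"
    using assms(4) by (intro add_mono mult_le_mono1) auto
  finally show ?thesis .
qed

section \<open>Estimates by powers of a common base\<close>

locale big_base =
  fixes z :: nat
  assumes z: "z \<ge> 100"
begin

lemma pow_pos: "1 \<le> z ^ i"
  using z by simp

lemma le_pow: "x \<le> z ^ i \<Longrightarrow> i \<le> j \<Longrightarrow> x \<le> z ^ j"
  by (erule order_trans) (rule power_increasing, use z in auto)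

lemma mult_pow: "x \<le> z ^ i \<Longrightarrow> y \<le> z ^ j \<Longrightarrow> i + j \<le> k \<Longrightarrow> x * y \<le> z ^ k"
  using mult_le_mono[of x "z ^ i" y "z ^ j"] le_pow[of "x * y" "i + j" k] by (simp add: power_add)

text \<open>The number 100 is a reserve: it exceeds the constant factors and the number of summands
  in each program, so all of them disappear by raising the exponent by one. The exponents below are
  bookkeeping of this kind and are not optimized.\<close>

lemma absorb: "x \<le> 100 * z ^ i \<Longrightarrow> i < j \<Longrightarrow> x \<le> z ^ j"
proof -
  assume *: "x \<le> 100 * z ^ i" "i < j"
  have "100 * z ^ i \<le> z ^ Suc i" using z by simp
  with *(1) have "x \<le> z ^ Suc i" by (rule order_trans)
  then show "x \<le> z ^ j" by (rule le_pow) (use *(2) in simp)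
qed

lemma bits_small: "x \<le> z \<Longrightarrow> bits (x :: nat) \<le> z ^ 2"
proof -
  assume "x \<le> z"
  then have "bits x \<le> 2 * z + 1" using bits_nat_le[of x] by simp
  then show ?thesis by (intro absorb[of _ 1]) (use z in auto)
qed

text \<open>Multiplication and division are charged the product of the lengths of their operands,
  hence the doubled exponent.\<close>

lemma ops_le:
  assumes "bits x \<le> z ^ k" "bits y \<le> z ^ k" "2 * k < j"
  shows "bit_ops (addC x y) \<le> z ^ j" "bit_ops (subC x y) \<le> z ^ j" "bit_ops (mulC x y) \<le> z ^ j"
    "bit_ops (divC x y) \<le> z ^ j" "bit_ops (modC x y) \<le> z ^ j" "bit_ops (leC x y) \<le> z ^ j"
proof -
  let ?p = "z ^ (2 * k)"
  have p: "z ^ k \<le> ?p" "1 \<le> ?p" using pow_pos le_pow[of "z ^ k" k "2 * k"] by auto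
  have xy: "bits x * bits y \<le> ?p" by (rule mult_pow[OF assms(1,2)]) simp
  have res: "bits (x + y) \<le> 2 * ?p" "bits (x - y) \<le> ?p" "bits (x * y) \<le> 2 * ?p"
    "bits (x div y) \<le> ?p" "bits (x mod y) \<le> ?p"
    using bits_nat_add[of x y] bits_nat_mult[of x y] assms(1,2) p
      bits_nat_mono[of "x - y" x] bits_nat_mono[of "x div y" x] bits_nat_mono[of "x mod y" x]
    by (auto simp: div_le_dividend)
  show "bit_ops (addC x y) \<le> z ^ j" "bit_ops (subC x y) \<le> z ^ j" "bit_ops (mulC x y) \<le> z ^ j"
    "bit_ops (divC x y) \<le> z ^ j" "bit_ops (modC x y) \<le> z ^ j" "bit_ops (leC x y) \<le> z ^ j"
    unfolding addC_def subC_def mulC_def divC_def modC_def leC_def emit_sel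
    by (rule absorb[OF _ assms(3)], use p xy res assms in simp)+
qed

lemma eqC_le:
  assumes "bits u \<le> z ^ k" "bits v \<le> z ^ k" "k < j"
  shows "bit_ops (eqC u v) \<le> z ^ j"
  unfolding eqC_def emit_sel by (rule absorb[OF _ assms(3)]) (use assms pow_pos[of k] in simp)

lemma ret_le: "bits u \<le> z ^ k \<Longrightarrow> k < j \<Longrightarrow> bit_ops (ret u) \<le> z ^ j"
  by (rule absorb[of _ k]) (use pow_pos[of k] in auto)

lemma inspect_le: "bits u \<le> z ^ k \<Longrightarrow> k < j \<Longrightarrow> bit_ops (inspect u) \<le> z ^ j"
  by (rule absorb[of _ k]) (use pow_pos[of k] in auto)

lemma list_le:
  assumes "\<And>x. x \<in> set xs \<Longrightarrow> bits x \<le> z ^ k" "length xs \<le> z ^ l" "l + k < j"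
  shows "bits xs \<le> z ^ j"
proof -
  have "bits xs \<le> 1 + z ^ l * (1 + z ^ k)" by (rule bits_list_le[OF assms(1,2)])
  also have "\<dots> = 1 + z ^ l + z ^ (l + k)" by (simp add: power_add)
  also have "\<dots> \<le> 100 * z ^ (l + k)"
    using pow_pos[of "l + k"] le_pow[of "z ^ l" l "l + k"] by simp
  finally show ?thesis using assms(3) by (rule absorb)
qed

lemma appC_le:
  assumes "bits xs \<le> z ^ k" "bits ys \<le> z ^ k" "k < j"
  shows "bit_ops (appC xs ys) \<le> z ^ j"
proof -
  have "bits (xs @ ys) \<le> bits xs + bits ys" by (simp add: bits_list_def)
  then show ?thesis
    unfolding appC_def emit_sel by (intro absorb[OF _ assms(3)]) (use assms pow_pos[of k] in simp)
qed

text \<open>The condition \<open>l + k < t\<close> says that copying the list costs less than the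
  bound for one application of \<open>f\<close>. What counts is then the number of applications
  times that bound, and \<open>l + t < j\<close> pays for it.\<close>

lemma mapC_le:
  assumes "\<And>x. x \<in> set xs \<Longrightarrow> bit_ops (f x) \<le> z ^ t" "\<And>x. x \<in> set xs \<Longrightarrow> bits x \<le> z ^ k"
    "\<And>x. x \<in> set xs \<Longrightarrow> bits (val (f x)) \<le> z ^ k" "length xs \<le> z ^ l" "l + k < t" "l + t < j"
  shows "bit_ops (mapC f xs) \<le> z ^ j"
proof -
  have "bit_ops (mapC f xs) \<le> z ^ l * (z ^ t + 6 + 4 * (z ^ l * (1 + z ^ k))) + 3"
    by (rule bit_ops_mapC) (use assms in auto)
  also have "\<dots> \<le> z ^ l * (20 * z ^ t) + 3"
  proof (intro add_mono mult_le_mono2 order_refl)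
    have "z ^ l * (1 + z ^ k) = z ^ l + z ^ (l + k)" by (simp add: power_add)
    also have "\<dots> \<le> 2 * z ^ t"
      using le_pow[of "z ^ l" l t] le_pow[of "z ^ (l + k)" "l + k" t] assms(5) by simp
    finally show "z ^ t + 6 + 4 * (z ^ l * (1 + z ^ k)) \<le> 20 * z ^ t" using pow_pos[of t] by linarith
  qed
  also have "\<dots> = 20 * z ^ (l + t) + 3" by (simp add: power_add)
  also have "\<dots> \<le> 100 * z ^ (l + t)" using pow_pos[of "l + t"] by linarith
  finally show ?thesis using assms(6) by (rule absorb)
qed

lemma foldC_le:
  assumes "\<And>i x s. x \<in> set xs \<Longrightarrow> i < length xs \<Longrightarrow> I i s \<Longrightarrow> bit_ops (f x s) \<le> z ^ t \<and> I (Suc i) (val (f x s))"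
    and "\<And>i s. i \<le> length xs \<Longrightarrow> I i s \<Longrightarrow> bits s \<le> z ^ S" and "\<And>x. x \<in> set xs \<Longrightarrow> bits x \<le> z ^ k" and "I 0 s"
    and "length xs \<le> z ^ l" "l + k < t" "l + t < j" "S < j"
  shows "bit_ops (foldC f xs s) \<le> z ^ j" and "I (length xs) (val (foldC f xs s))"
proof -
  have *: "bit_ops (foldC f xs s) \<le> (\<Sum>x\<leftarrow>xs. z ^ t) + length xs * (3 + 2 * (length xs * (1 + z ^ k))) + (1 + 2 * z ^ S) \<and>
    I (length xs) (val (foldC f xs s))"
    by (rule bit_ops_foldC) (use assms in auto)
  then show "I (length xs) (val (foldC f xs s))" by simp
  have "length xs * (1 + z ^ k) \<le> z ^ l * (1 + z ^ k)" using assms(5) by (rule mult_le_mono1)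
  also have "\<dots> = z ^ l + z ^ (l + k)" by (simp add: power_add)
  also have "\<dots> \<le> 2 * z ^ t"
    using le_pow[of "z ^ l" l t] le_pow[of "z ^ (l + k)" "l + k" t] assms(6) by simp
  finally have "3 + 2 * (length xs * (1 + z ^ k)) \<le> 10 * z ^ t" using pow_pos[of t] by linarith
  then have "length xs * (3 + 2 * (length xs * (1 + z ^ k))) \<le> z ^ l * (10 * z ^ t)"
    using assms(5) by (intro mult_le_mono)
  then have 1: "length xs * (3 + 2 * (length xs * (1 + z ^ k))) \<le> 10 * z ^ (l + t)" by (simp add: power_add)
  have "(\<Sum>x\<leftarrow>xs. z ^ t) = length xs * z ^ t" by (simp add: sum_list_triv)
  also have "\<dots> \<le> z ^ (l + t)" by (rule mult_pow[OF assms(5), of _ t]) auto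
  finally have 2: "(\<Sum>x\<leftarrow>xs. z ^ t) \<le> z ^ (l + t)" .
  let ?m = "max (l + t) S"
  have "z ^ (l + t) \<le> z ^ ?m" "z ^ S \<le> z ^ ?m" "1 \<le> z ^ ?m"
    using le_pow[of "z ^ (l + t)" "l + t" ?m] le_pow[of "z ^ S" S ?m] pow_pos by auto
  then have "bit_ops (foldC f xs s) \<le> 100 * z ^ ?m" using * 1 2 by linarith
  then show "bit_ops (foldC f xs s) \<le> z ^ j" by (rule absorb) (use assms in simp)
qed

lemma countC_le:
  assumes "i + m \<le> z"
  shows "bit_ops (countC i m) \<le> z ^ 8"
proof -
  have "bit_ops (countC' m i) \<le> m * z ^ 6 + z"
    using assms
  proof (induction m arbitrary: i)
    case 0
    then show ?case using z by simp
  next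
    case (Suc m)
    have IH: "bit_ops (countC' m (Suc i)) \<le> m * z ^ 6 + z" by (rule Suc.IH) (use Suc.prems in simp)
    have 1: "bits (Suc m) \<le> z ^ 2" "bits i \<le> z ^ 2" "bits (1 :: nat) \<le> z ^ 2"
      using Suc.prems z by (auto intro!: bits_small)
    have 2: "bits (i # [Suc i..<Suc i + m]) \<le> z ^ 4"
      by (rule list_le[of _ 2 1]) (use Suc.prems in \<open>auto intro!: bits_small\<close>)
    have a: "bit_ops (addC i 1) \<le> z ^ 5" by (rule ops_le(1)[OF 1(2,3)]) simp
    have "bit_ops (countC' (Suc m) i) = 1 + 2 * bits (Suc m) + bit_ops (addC i 1) + bit_ops (countC' m (Suc i))
       + (1 + 2 * bits (i # [Suc i..<Suc i + m]))"
      by (simp add: val_countC')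
    also have "\<dots> \<le> Suc m * z ^ 6 + z"
    proof -
      have "1 + 2 * bits (Suc m) + bit_ops (addC i 1) + (1 + 2 * bits (i # [Suc i..<Suc i + m])) \<le> z ^ 6"
        by (rule absorb[of _ 5])
          (use 1 2 a pow_pos[of 5] le_pow[OF 1(1), of 5] le_pow[OF 2, of 5] in linarith, simp)
      then show ?thesis using IH by simp
    qed
    finally show ?case .
  qed
  also have "\<dots> \<le> z ^ 8"
  proof (rule absorb[of _ 7])
    have "m * z ^ 6 \<le> z ^ 7" by (rule mult_pow[of _ 1 _ 6]) (use assms in auto)
    moreover have "z \<le> z ^ 7" by (rule le_pow[of _ 1]) auto
    ultimately show "m * z ^ 6 + z \<le> 100 * z ^ 7" by linarith
  qed simp
  finally show ?thesis by (simp add: countC_def)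
qed

lemma uptoC_le:
  assumes "m < z"
  shows "bit_ops (uptoC m) \<le> z ^ 9"
proof -
  have "bit_ops (addC m 1) \<le> z ^ 8" by (rule ops_le[of _ 2]) (use assms z in \<open>auto intro!: bits_small\<close>)
  moreover have "bit_ops (countC 0 (m + 1)) \<le> z ^ 8" by (rule countC_le) (use assms in simp)
  ultimately show ?thesis by (intro absorb[of _ 8]) (simp_all add: uptoC_def)
qed

text \<open>One estimate for sums, products and powers: adding or multiplying by \<open>y x\<close>
  lengthens the accumulator by at most the length of \<open>y x\<close>, so its length grows
  linearly with the number of rounds. For powers \<open>y\<close> is constant and the list merely
  counts.\<close>

lemma accumulate_le:
  assumes "\<And>x. x \<in> set xs \<Longrightarrow> bits x \<le> z ^ k" "\<And>x. x \<in> set xs \<Longrightarrow> bits (y x) \<le> z ^ k"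
    "length xs \<le> z ^ l" "2 * (l + k + 1) + l + 1 < j"
    and f: "\<And>x s. x \<in> set xs \<Longrightarrow> f x s = addC (y x) s \<or> f x s = mulC (y x) s"
    and s: "bits s \<le> 3"
  shows "bit_ops (foldC f xs s) \<le> z ^ j" and "bits (val (foldC f xs s)) \<le> z ^ (l + k + 1)"
proof -
  let ?I = "\<lambda>i s. bits s \<le> 3 + i * z ^ k"
  have S: "bits s \<le> z ^ (l + k + 1)" if "i \<le> length xs" "?I i s" for i and s :: nat
  proof -
    have "i * z ^ k \<le> z ^ (l + k)" by (rule mult_pow[of _ l _ k]) (use that(1) assms(3) in auto)
    then have "bits s \<le> 100 * z ^ (l + k)" using that(2) pow_pos[of "l + k"] by linarith
    then show ?thesis by (rule absorb) simp
  qed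
  have step: "bit_ops (f x s) \<le> z ^ (2 * (l + k + 1) + 1) \<and> ?I (Suc i) (val (f x s))"
    if "x \<in> set xs" "i < length xs" "?I i s" for i x s
  proof -
    have x: "bits (y x) \<le> z ^ (l + k + 1)" using assms(2)[OF that(1)] by (rule le_pow) simp
    have s: "bits s \<le> z ^ (l + k + 1)" using S[of i s] that by simp
    have "bits (y x + s) \<le> 3 + Suc i * z ^ k" "bits (y x * s) \<le> 3 + Suc i * z ^ k"
      using bits_nat_add[of "y x" s] bits_nat_mult[of "y x" s] assms(2)[OF that(1)] that(3) by auto
    then show ?thesis
      using ops_le(1,3)[OF x s, of "2 * (l + k + 1) + 1"] f[OF that(1), of s] by auto
  qed
  note fold = foldC_le[where I = ?I and S = "l + k + 1" and t = "2 * (l + k + 1) + 1" and k = k,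
      OF step S assms(1) _ assms(3)]
  show "bit_ops (foldC f xs s) \<le> z ^ j"
    by (rule fold(1)) (use s assms(4) in auto)
  have "?I (length xs) (val (foldC f xs s))"
    by (rule fold(2)[where j = j]) (use s assms(4) in auto)
  then show "bits (val (foldC f xs s)) \<le> z ^ (l + k + 1)" by (rule S[OF order_refl])
qed

lemma bits_one: "bits (1 :: nat) \<le> 3" "bits (0 :: nat) \<le> 3"
  using bits_nat_le[of 1] bits_nat_le[of 0] by auto

lemma prodC_le:
  assumes "\<And>x. x \<in> set xs \<Longrightarrow> bits x \<le> z ^ k" "length xs \<le> z ^ l" "3 * l + 2 * k + 3 < j"
  shows "bit_ops (prodC xs) \<le> z ^ j" "bits (prod_list xs) \<le> z ^ (l + k + 1)"
    "bit_ops (sumC xs) \<le> z ^ j" "bits (sum_list xs) \<le> z ^ (l + k + 1)"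
proof -
  note p = accumulate_le[of xs k "\<lambda>x. x" l j mulC 1, OF assms(1) assms(1) assms(2)]
  note q = accumulate_le[of xs k "\<lambda>x. x" l j addC 0, OF assms(1) assms(1) assms(2)]
  show "bit_ops (prodC xs) \<le> z ^ j"
    unfolding prodC_def by (rule p(1)) (use assms(3) bits_one in auto)
  show "bit_ops (sumC xs) \<le> z ^ j"
    unfolding sumC_def by (rule q(1)) (use assms(3) bits_one in auto)
  have "bits (val (prodC xs)) \<le> z ^ (l + k + 1)"
    unfolding prodC_def by (rule p(2)) (use assms(3) bits_one in auto)
  moreover have "bits (val (sumC xs)) \<le> z ^ (l + k + 1)"
    unfolding sumC_def by (rule q(2)) (use assms(3) bits_one in auto)
  ultimately show "bits (prod_list xs) \<le> z ^ (l + k + 1)" "bits (sum_list xs) \<le> z ^ (l + k + 1)"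
    by (simp_all only: val_prodC val_sumC)
qed

lemma factC_le:
  assumes "m < z"
  shows "bit_ops (factC m) \<le> z ^ 13" "bits (fact m :: nat) \<le> z ^ 4"
proof -
  have el: "bits x \<le> z ^ 2" if "x \<in> set [1..<1 + m]" for x
    using that assms by (intro bits_small) auto
  have len: "length [1..<1 + m] \<le> z ^ 1" using assms by simp
  have "bit_ops (prodC [1..<1 + m]) \<le> z ^ 12" by (rule prodC_le(1)[OF el len]) simp_all
  moreover have "bit_ops (countC 1 m) \<le> z ^ 12"
    by (rule le_pow[OF countC_le]) (use assms in auto)
  ultimately show "bit_ops (factC m) \<le> z ^ 13"
    by (intro absorb[of _ 12]) (simp_all add: factC_def del: upt_Suc)
  have eq: "prod_list [1..<1 + m] = fact m" using val_factC[of m] by (simp add: factC_def del: upt_Suc val_factC)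
  have "bits (prod_list [1..<1 + m]) \<le> z ^ (1 + 2 + 1)" by (rule prodC_le(2)[OF el len, of 13]) simp_all
  then show "bits (fact m :: nat) \<le> z ^ 4" unfolding eq by (rule le_pow) simp
qed

lemma powC_le:
  assumes "bits x \<le> z ^ k" "e < z" "k \<ge> 2" "2 * k + 10 < j"
  shows "bit_ops (powC x e) \<le> z ^ j" "bits (x ^ e) \<le> z ^ (k + 2)"
proof -
  have el: "bits i \<le> z ^ k" if "i \<in> set [1..<1 + e]" for i
    using that assms(2) by (intro le_pow[OF bits_small assms(3)]) auto
  have len: "length [1..<1 + e] \<le> z ^ 1" using assms by simp
  note acc = accumulate_le[of "[1..<1 + e]" k "\<lambda>_. x" 1 "2 * k + 9" "\<lambda>_. mulC x" 1, OF el assms(1) len]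
  have "bit_ops (foldC (\<lambda>_. mulC x) [1..<1 + e] 1) \<le> z ^ (2 * k + 9)"
    by (rule acc(1)) (use bits_one in auto)
  moreover have "bit_ops (countC 1 e) \<le> z ^ (2 * k + 9)"
    by (rule le_pow[OF countC_le]) (use assms in auto)
  ultimately show "bit_ops (powC x e) \<le> z ^ j"
    by (intro absorb[of _ "2 * k + 9"]) (use assms in \<open>simp_all add: powC_def del: upt_Suc\<close>)
  have "bits (val (foldC (\<lambda>_. mulC x) [1..<1 + e] 1)) \<le> z ^ (1 + k + 1)"
    by (rule acc(2)) (use bits_one in auto)
  moreover have "val (foldC (\<lambda>_. mulC x) [1..<1 + e] 1) = x ^ e"
    using val_powC[of x e] by (simp add: powC_def del: upt_Suc val_powC)
  ultimately show "bits (x ^ e) \<le> z ^ (k + 2)" by (simp add: add.commute)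
qed

lemma binomC_le:
  assumes "m < z" "k < z"
  shows "bit_ops (binomC m k) \<le> z ^ 14" "bits (m choose k) \<le> z ^ 2"
proof -
  have mk: "bits m \<le> z ^ 2" "bits k \<le> z ^ 2" using assms by (auto intro: bits_small)
  have f: "bit_ops (factC i) \<le> z ^ 13" "bits (fact i :: nat) \<le> z ^ 4" if "i < z" for i
    using factC_le[OF that] by auto
  have q: "bits (fact k * fact (m - k) :: nat) \<le> z ^ 5"
    by (rule absorb[of _ 4])
      (use bits_nat_mult[of "fact k" "fact (m - k)"] f(2)[OF assms(2)] f(2)[OF less_imp_diff_less[OF assms(1), of k]] in auto)
  have "bit_ops (leC k m) \<le> z ^ 13" "bit_ops (subC m k) \<le> z ^ 13"
    by (rule ops_le[OF mk(2,1)], simp) (rule ops_le[OF mk], simp)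
  moreover have "bit_ops (mulC (fact k) (fact (m - k))) \<le> z ^ 13"
    by (rule ops_le[of _ 4]) (use f assms in auto)
  moreover have "bit_ops (divC (fact m) (fact k * fact (m - k))) \<le> z ^ 13"
    by (rule ops_le[of _ 5]) (use le_pow[OF f(2), of m 5] q assms in auto)
  ultimately show "bit_ops (binomC m k) \<le> z ^ 14"
    using f(1)[of m] f(1)[of k] f(1)[OF less_imp_diff_less[OF assms(1), of k]] assms bits_one pow_pos[of 13] le_pow[of z 1 13] z
    by (intro absorb[of _ 13]) (auto simp add: binomC_def)
  \<comment> \<open>Through \<open>2 ^ m\<close> the length is linear in \<open>m\<close>; the
    estimate for factorials would only give \<open>z ^ 4\<close>.\<close>
  have "m choose k \<le> 2 ^ m" by (rule binomial_le_pow2)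
  also have "\<dots> < 2 ^ Suc m" by simp
  finally have "bits (m choose k) \<le> 2 * Suc m + 1" by (rule bits_nat_leI)
  then show "bits (m choose k) \<le> z ^ 2" by (intro absorb[of _ 1]) (use assms z in auto)
qed

lemma gcd_le_base: "a \<le> z \<Longrightarrow> b \<le> z \<Longrightarrow> gcd a b \<le> z" for a b :: nat
  by (metis gcd_le1_nat gcd_0_left_nat le_trans)

text \<open>The second argument decreases in every round, so \<open>y + 1\<close> bounds the number
  of rounds; a linear count is affordable since \<open>y\<close> is at most
  \<open>z\<close>.\<close>

lemma gcdC_le:
  assumes "x \<le> z" "y \<le> z"
  shows "bit_ops (gcdC x y) \<le> z ^ 8"
proof -
  have "bit_ops (gcdC x y) \<le> (y + 1) * z ^ 6"
    using assms
  proof (induction y arbitrary: x rule: less_induct)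
    case (less y)
    have b: "bits x \<le> z ^ 2" "bits y \<le> z ^ 2" "bits (0 :: nat) \<le> z ^ 2"
      using less.prems by (auto intro!: bits_small)
    have e: "bit_ops (eqC y 0) \<le> z ^ 5" by (rule eqC_le[OF b(2,3)]) simp
    have m: "bit_ops (modC x y) \<le> z ^ 5" by (rule ops_le[OF b(1,2)]) simp
    have r: "bit_ops (ret x) \<le> z ^ 5" by (rule ret_le[OF b(1)]) simp
    have two: "2 * z ^ 5 \<le> z ^ 6" by (rule absorb[of _ 5]) auto
    show ?case
    proof (cases "y = 0")
      case True
      have "bit_ops (gcdC x y) = bit_ops (eqC y 0) + bit_ops (ret x)"
        by (subst gcdC.simps) (simp add: True)
      also have "\<dots> \<le> (y + 1) * z ^ 6" using e r two by (simp add: True del: ret_sel)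
      finally show ?thesis .
    next
      case False
      have IH: "bit_ops (gcdC y (x mod y)) \<le> (x mod y + 1) * z ^ 6"
      proof (rule less.IH)
        show lt: "x mod y < y" using False by simp
        show "x mod y \<le> z" using lt less.prems(2) by linarith
      qed (rule less.prems(2))
      have "x mod y + 1 \<le> y" using False by (simp add: Suc_leI)
      then have "(x mod y + 1) * z ^ 6 \<le> y * z ^ 6" by (rule mult_le_mono1)
      moreover have "bit_ops (gcdC x y) = bit_ops (eqC y 0) + (bit_ops (modC x y) + bit_ops (gcdC y (x mod y)))"
        by (subst gcdC.simps) (simp add: False)
      ultimately show ?thesis using IH e m two by simp
    qed
  qed
  also have "\<dots> \<le> z ^ 8"
  proof (rule absorb[of _ 7])
    have "y * z ^ 6 \<le> z ^ 7" by (rule mult_pow[of _ 1 _ 6]) (use assms in auto)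
    moreover have "z ^ 6 \<le> z ^ 7" by (rule le_pow[of _ 6]) auto
    ultimately show "(y + 1) * z ^ 6 \<le> 100 * z ^ 7" unfolding distrib_right by linarith
  qed simp
  finally show ?thesis .
qed

lemma alphaC_le:
  assumes "a \<le> z" "b \<le> z"
  shows "bit_ops (alphaC a b) \<le> z ^ 9" "bit_ops (betaC a b) \<le> z ^ 9"
proof -
  have b: "bits a \<le> z ^ 2" "bits b \<le> z ^ 2" "bits (gcd a b) \<le> z ^ 2"
    using assms by (auto intro!: bits_small gcd_le_base)
  have "bit_ops (divC b (gcd a b)) \<le> z ^ 8" "bit_ops (divC a (gcd a b)) \<le> z ^ 8"
    by (rule ops_le[OF b(2,3)], simp) (rule ops_le[OF b(1,3)], simp)
  then show "bit_ops (alphaC a b) \<le> z ^ 9" "bit_ops (betaC a b) \<le> z ^ 9"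
    using gcdC_le[OF assms] by (auto intro!: absorb[of _ 8] simp: alphaC_def betaC_def)
qed

lemma minC_le:
  assumes "x \<le> z" "y \<le> z"
  shows "bit_ops (minC x y) \<le> z ^ 6"
proof -
  have b: "bits x \<le> z ^ 2" "bits y \<le> z ^ 2" using assms by (auto intro!: bits_small)
  have "bit_ops (leC x y) \<le> z ^ 5" by (rule ops_le[OF b]) simp
  moreover have "bit_ops (ret x) \<le> z ^ 5" "bit_ops (ret y) \<le> z ^ 5"
    by (rule ret_le[OF b(1)], simp) (rule ret_le[OF b(2)], simp)
  ultimately show ?thesis by (intro absorb[of _ 5]) (auto simp: minC_def simp del: ret_sel(2))
qed

lemma maxkC_le:
  assumes "a \<le> z" "b \<le> z" "r \<le> z" "s \<le> z"
  shows "bit_ops (maxkC a r b s) \<le> z ^ 10"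
proof -
  let ?\<alpha> = "b div gcd a b" and ?\<beta> = "a div gcd a b"
  have le: "?\<alpha> \<le> z" "?\<beta> \<le> z" "r div ?\<alpha> \<le> z" "s div ?\<beta> \<le> z" "gcd a b \<le> z"
    using assms gcd_le_base by (auto intro: le_trans[OF div_le_dividend])
  have "bit_ops (divC r ?\<alpha>) \<le> z ^ 9" "bit_ops (divC s ?\<beta>) \<le> z ^ 9"
    by (rule ops_le[of _ 2]; use assms le in \<open>auto intro!: bits_small\<close>)+
  moreover have "bit_ops (minC (r div ?\<alpha>) (s div ?\<beta>)) \<le> z ^ 9"
    "bit_ops (minC (gcd a b) (min (r div ?\<alpha>) (s div ?\<beta>))) \<le> z ^ 9"
    using le by (auto intro!: le_pow[OF minC_le])
  ultimately show ?thesis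
    using alphaC_le[OF assms(1,2)] le_pow[OF gcdC_le[OF assms(1,2)], of 9]
    by (intro absorb[of _ 9]) (simp_all add: maxkC_def)
qed

lemma innerC_le:
  assumes "a < z" "u < z"
  shows "bit_ops (innerC a u) \<le> z ^ 15" "bits (val (innerC a u)) \<le> z ^ 2"
proof -
  have le: "a - 1 < z" "(a - 1) div 2 < z" "u div 2 < z" "a mod 2 < z" "u mod 2 < z" "2 \<le> z" "1 \<le> z"
    "(a mod 2) * (u mod 2) \<le> z"
    using assms z by (auto simp: mod_2_eq_odd)
  have "bit_ops (subC a 1) \<le> z ^ 14" "bit_ops (divC (a - 1) 2) \<le> z ^ 14" "bit_ops (divC u 2) \<le> z ^ 14"
    "bit_ops (modC a 2) \<le> z ^ 14" "bit_ops (modC u 2) \<le> z ^ 14" "bit_ops (mulC (a mod 2) (u mod 2)) \<le> z ^ 14"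
    by (rule ops_le[of _ 2]; use assms le in \<open>auto intro!: bits_small\<close>)+
  moreover have "bit_ops (eqC ((a mod 2) * (u mod 2)) 1) \<le> z ^ 14"
    by (rule eqC_le[of _ 2]) (use le in \<open>auto intro!: bits_small\<close>)
  moreover have "bit_ops (ret (0 :: nat)) \<le> z ^ 14"
    by (rule ret_le[of _ 2]) (auto intro!: bits_small)
  moreover have "bit_ops (binomC ((a - 1) div 2) (u div 2)) \<le> z ^ 14"
    by (rule binomC_le) (use le in auto)
  ultimately show "bit_ops (innerC a u) \<le> z ^ 15"
    by (intro absorb[of _ 14]) (auto simp: innerC_def simp del: ret_sel(2))
  show "bits (val (innerC a u)) \<le> z ^ 2"
    using binomC_le(2)[OF le(2,3)] by (auto intro: bits_small)
qed

end

section \<open>Number and cost of the enumerated families\<close>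

lemma length_splitsC: "length (val (splitsC ks \<alpha> h B)) \<le> (h + 1) ^ length ks"
proof (induction ks arbitrary: h B)
  case Nil
  show ?case by simp
next
  case (Cons k ks)
  have "length (val (splitsC (k # ks) \<alpha> h B)) \<le> (\<Sum>j\<leftarrow>[0..<Suc h]. (h + 1) ^ length ks)"
    unfolding val_splitsC_Cons length_concat map_map
  proof (rule sum_list_mono)
    fix j assume "j \<in> set [0..<Suc h]"
    have "length (val (splitsC ks \<alpha> (h - j) (B - k * \<alpha> * j))) \<le> (h - j + 1) ^ length ks" by (rule Cons.IH)
    also have "\<dots> \<le> (h + 1) ^ length ks" by (rule power_mono) auto
    finally show "(length \<circ> (\<lambda>j. if k * \<alpha> * j \<le> B then map (\<lambda>(f, B''). ((k, j) # f, B''))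
        (val (splitsC ks \<alpha> (h - j) (B - k * \<alpha> * j))) else [])) j \<le> (h + 1) ^ length ks"
      by simp
  qed
  also have "\<dots> = (h + 1) ^ length (k # ks)" by (simp add: sum_list_triv del: upt_Suc)
  finally show ?case .
qed

text \<open>The exponent is used as \<open>d + 1\<close>: the index \<open>k\<close> runs from 0 to
  \<open>max_mult a r b s\<close>, which is at most \<open>r\<close> and hence at most
  \<open>d\<close>.\<close>

definition family_bound :: "nat \<Rightarrow> table \<Rightarrow> nat" where
  "family_bound m T = (\<Prod>e\<leftarrow>T. (snd e + 1) ^ m)"

lemma family_bound_pos: "1 \<le> family_bound m T"
  by (induction T) (auto simp: family_bound_def)

lemma max_mult_le: "max_mult a r b s \<le> r"
  by (simp add: max_mult_def le_trans[OF min.cobounded2 le_trans[OF min.cobounded1 div_le_dividend]])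

lemma length_familiesC:
  assumes "r \<le> d"
  shows "length (val (familiesC T a r B)) \<le> family_bound (Suc d) T"
proof (induction T arbitrary: B)
  case Nil
  show ?case by (simp add: family_bound_def)
next
  case (Cons e T)
  obtain b s h where e: "e = ((b, s), h)" by (metis prod.exhaust)
  let ?sp = "val (splitsC [0..<Suc (max_mult a r b s)] (b div gcd a b) h B)"
  have "length (val (familiesC (e # T) a r B)) \<le> (\<Sum>p\<leftarrow>?sp. family_bound (Suc d) T)"
    unfolding e val_familiesC_Cons length_concat map_map
    by (rule sum_list_mono) (use Cons in \<open>simp add: case_prod_beta'\<close>)
  also have "\<dots> = length ?sp * family_bound (Suc d) T" by (simp add: sum_list_triv)
  also have "length ?sp \<le> (h + 1) ^ Suc d"
  proof -
    have "length ?sp \<le> (h + 1) ^ Suc (max_mult a r b s)"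
      using length_splitsC[of "[0..<Suc (max_mult a r b s)]" _ h B] by (simp del: upt_Suc)
    also have "\<dots> \<le> (h + 1) ^ Suc d"
      by (rule power_increasing) (use max_mult_le[of a r b s] assms in auto)
    finally show ?thesis .
  qed
  finally show ?case by (simp add: family_bound_def e)
qed

context big_base
begin

lemma bits_pair_small: "x \<le> z \<Longrightarrow> y \<le> z \<Longrightarrow> bits (x :: nat, y :: nat) \<le> z ^ 3"
  by (rule absorb[of _ 2]) (use bits_small[of x] bits_small[of y] in auto)

lemma member_le_sum_list_nat: "x \<in> set xs \<Longrightarrow> x \<le> sum_list (xs :: nat list)"
  by (induction xs) auto

lemma splitsC_elem_le:
  assumes "(f, B') \<in> set (val (splitsC ks \<alpha> h B))" "\<And>k. k \<in> set ks \<Longrightarrow> k \<le> z" "length ks \<le> z" "h \<le> z" "B \<le> z"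
  shows "bits f \<le> z ^ 5" "bits (f, B') \<le> z ^ 6" "B' \<le> B" "length f = length ks"
    "\<And>k j. (k, j) \<in> set f \<Longrightarrow> k \<le> z \<and> j \<le> z"
proof -
  note el = splitsC_elem[OF assms(1)]
  show len: "length f = length ks" using el by (metis length_map)
  show kj: "k \<le> z \<and> j \<le> z" if "(k, j) \<in> set f" for k j
  proof -
    have "k \<in> set (map fst f)" "j \<in> set (map snd f)" using that by force+
    then show ?thesis using el assms(2,4) member_le_sum_list_nat[of j "map snd f"] by auto
  qed
  have "bits x \<le> z ^ 3" if "x \<in> set f" for x
  proof -
    obtain k j where "x = (k, j)" by (cases x)
    then show ?thesis using kj that bits_pair_small by blast
  qed
  then show f: "bits f \<le> z ^ 5" by (rule list_le[of _ _ 1]) (use len assms(3) in auto)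
  show B': "B' \<le> B" using el by linarith
  have "bits B' \<le> z ^ 2" using B' assms(5) by (intro bits_small) simp
  then show "bits (f, B') \<le> z ^ 6"
    by (intro absorb[of _ 5]) (use f le_pow[of "bits B'" 2 5] in auto)
qed

text \<open>Each further \<open>k\<close> adds 4 to the exponent, for the loop over up to
  \<open>z\<close> values of \<open>j\<close> and for collecting the partial solutions. As at most
  \<open>d + 1\<close> values of \<open>k\<close> occur, an exponent linear in the length of
  \<open>ks\<close> is affordable.\<close>

lemma splitsC_le:
  assumes "\<And>k. k \<in> set ks \<Longrightarrow> k \<le> z" "length ks \<le> z" "\<alpha> \<le> z" "h < z" "B \<le> z"
  shows "bit_ops (splitsC ks \<alpha> h B) \<le> z ^ (4 * length ks + 20)"
  using assms
proof (induction ks arbitrary: h B)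
  case Nil
  have b: "bits h \<le> z ^ 2" "bits B \<le> z ^ 2" using Nil by (auto intro!: bits_small)
  have "bit_ops (eqC h 0) \<le> z ^ 19" by (rule eqC_le[of _ 2]) (use b in \<open>auto intro!: bits_small\<close>)
  moreover have "bits [([] :: (nat \<times> nat) list, B)] \<le> z ^ 18"
    using b(2) le_pow[OF b(2), of 17] pow_pos[of 17]
    by (intro absorb[of _ 17]) (auto simp: bits_list_def)
  then have "bit_ops (ret [([] :: (nat \<times> nat) list, B)]) \<le> z ^ 19" by (rule ret_le) simp
  moreover have "bit_ops (ret ([] :: ((nat \<times> nat) list \<times> nat) list)) \<le> z ^ 19"
    by (rule ret_le[of _ 0]) auto
  ultimately show ?case by (intro absorb[of _ 19]) (auto simp del: ret_sel(2))
next
  case (Cons k ks)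
  let ?q = "length ks"
  have k: "k \<le> z" "\<alpha> \<le> z" "h < z" "B \<le> z" "?q \<le> z" "\<And>k. k \<in> set ks \<Longrightarrow> k \<le> z" using Cons.prems by auto
  have IH: "bit_ops (splitsC ks \<alpha> (h - j) (B - x)) \<le> z ^ (4 * ?q + 20)" for j x
    by (rule Cons.IH) (use k in auto)
  let ?sp = "\<lambda>j. val (splitsC ks \<alpha> (h - j) (B - k * \<alpha> * j))"
  have spl: "length (?sp j) \<le> z ^ ?q" for j
  proof -
    have "length (?sp j) \<le> (h - j + 1) ^ ?q" by (rule length_splitsC)
    also have "\<dots> \<le> z ^ ?q" by (rule power_mono) (use k in auto)
    finally show ?thesis .
  qed
  have spe: "bits (f, B') \<le> z ^ 6" "bits ((k, j) # f, B') \<le> z ^ 6"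
    if "(f, B') \<in> set (?sp j)" "j \<le> h" for f B' j
  proof -
    note e = splitsC_elem_le[OF that(1) k(6) k(5)]
    show "bits (f, B') \<le> z ^ 6" by (rule e(2)) (use k in auto)
    have "bits f \<le> z ^ 5" by (rule e(1)) (use k in auto)
    moreover have "bits (k, j) \<le> z ^ 3" by (rule bits_pair_small) (use k that in auto)
    moreover have "B' \<le> B - k * \<alpha> * j" by (rule e(3)) (use k in auto)
    then have "bits B' \<le> z ^ 2" using k by (intro bits_small) simp
    ultimately show "bits ((k, j) # f, B') \<le> z ^ 6"
      using le_pow[of "bits (k, j)" 3 5] le_pow[of "bits B'" 2 5] pow_pos[of 5]
      by (intro absorb[of _ 5]) (auto simp: bits_list_def)
  qed
  let ?f = "\<lambda>j acc. do {
       w \<leftarrow> mulC k \<alpha>;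
       x \<leftarrow> mulC w j;
       c \<leftarrow> leC x B;
       if c then do {
         h' \<leftarrow> subC h j;
         B' \<leftarrow> subC B x;
         sols \<leftarrow> splitsC ks \<alpha> h' B';
         ext \<leftarrow> mapC (\<lambda>(f, B''). ret ((k, j) # f, B'')) sols;
         appC acc ext }
       else ret acc }"
  let ?I = "\<lambda>i acc. length acc \<le> i * z ^ ?q \<and> (\<forall>x\<in>set acc. bits x \<le> z ^ 6)"
  have S: "bits acc \<le> z ^ (?q + 8)" if "i \<le> length [0..<Suc h]" "?I i acc" for i and acc :: "((nat \<times> nat) list \<times> nat) list"
  proof (rule list_le)
    show "bits x \<le> z ^ 6" if "x \<in> set acc" for x using that \<open>?I i acc\<close> by blast
    have "i * z ^ ?q \<le> z ^ (?q + 1)" by (rule mult_pow[of _ 1]) (use that k in auto)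
    then show "length acc \<le> z ^ (?q + 1)" using that by linarith
  qed simp
  let ?t = "4 * ?q + 21"
  have step: "bit_ops (?f j acc) \<le> z ^ ?t \<and> ?I (Suc i) (val (?f j acc))"
    if j: "j \<in> set [0..<Suc h]" and i: "i < length [0..<Suc h]" and I: "?I i acc" for i j acc
  proof
    have jh: "j \<le> h" "j \<le> z" using j k by auto
    have bk: "bits k \<le> z ^ 2" "bits \<alpha> \<le> z ^ 2" "bits j \<le> z ^ 2" "bits h \<le> z ^ 2" "bits B \<le> z ^ 2"
      using k jh by (auto intro!: bits_small)
    have bw: "bits (k * \<alpha>) \<le> z ^ 3"
      using bits_nat_mult[of k \<alpha>] bk by (intro absorb[of _ 2]) auto
    have bx: "bits (k * \<alpha> * j) \<le> z ^ 4"
      using bits_nat_mult[of "k * \<alpha>" j] bw le_pow[OF bk(3), of 3] by (intro absorb[of _ 3]) auto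
    have o1: "bit_ops (mulC k \<alpha>) \<le> z ^ (4 * ?q + 20)" by (rule ops_le[OF bk(1,2)]) simp
    have o2: "bit_ops (mulC (k * \<alpha>) j) \<le> z ^ (4 * ?q + 20)"
      by (rule ops_le[OF bw le_pow[OF bk(3)]]) auto
    have o3: "bit_ops (leC (k * \<alpha> * j) B) \<le> z ^ (4 * ?q + 20)"
      by (rule ops_le[OF bx le_pow[OF bk(5)]]) auto
    have o4: "bit_ops (subC h j) \<le> z ^ (4 * ?q + 20)" by (rule ops_le[OF bk(4,3)]) simp
    have o5: "bit_ops (subC B (k * \<alpha> * j)) \<le> z ^ (4 * ?q + 20)"
      by (rule ops_le[OF le_pow[OF bk(5)] bx]) auto
    let ?ext = "mapC (\<lambda>(f, B''). ret ((k, j) # f, B'')) (?sp j)"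
    have "bit_ops ?ext \<le> z ^ (2 * ?q + 8)"
    proof (rule mapC_le[where t = "?q + 7" and k = 6 and l = ?q])
      fix p assume p: "p \<in> set (?sp j)"
      obtain f B' where fB: "p = (f, B')" by (cases p)
      note e = spe[OF p[unfolded fB] jh(1)]
      show "bits p \<le> z ^ 6" using e fB by simp
      show "bits (val (case p of (f, B'') \<Rightarrow> ret ((k, j) # f, B''))) \<le> z ^ 6" using e fB by simp
      have "bit_ops (ret ((k, j) # f, B')) \<le> z ^ (?q + 7)" by (rule ret_le[OF e(2)]) simp
      then show "bit_ops (case p of (f, B'') \<Rightarrow> ret ((k, j) # f, B'')) \<le> z ^ (?q + 7)" using fB by simp
    qed (use spl in auto)
    then have o6: "bit_ops ?ext \<le> z ^ (4 * ?q + 20)" by (rule le_pow) simp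
    have ve: "bits x \<le> z ^ 6" if "x \<in> set (val ?ext)" for x using that spe(2)[of _ _ j] jh by auto
    have bacc: "bits acc \<le> z ^ (?q + 8)" using S[of i acc] i I by simp
    have bext: "bits (val ?ext) \<le> z ^ (?q + 8)"
      by (rule list_le[of _ 6 ?q]) (use ve spl in auto)
    have o7: "bit_ops (appC acc (val ?ext)) \<le> z ^ (4 * ?q + 20)" by (rule appC_le[OF bacc bext]) simp
    have o8: "bit_ops (ret acc) \<le> z ^ (4 * ?q + 20)" by (rule ret_le[OF bacc]) simp
    show "bit_ops (?f j acc) \<le> z ^ ?t"
      using o1 o2 o3 o4 o5 o6 o7 o8 IH[of j "k * \<alpha> * j"]
      by (intro absorb[of _ "4 * ?q + 20"]) (auto simp del: ret_sel(2) val_mapC simp: mult.assoc)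
    show "?I (Suc i) (val (?f j acc))"
    proof -
      have "val (?f j acc) = (if k * \<alpha> * j \<le> B then acc @ val ?ext else acc)" by simp
      moreover have "length (val ?ext) \<le> z ^ ?q" using spl by simp
      ultimately show ?thesis using I ve by (auto simp del: val_mapC)
    qed
  qed
  have fold: "bit_ops (foldC ?f [0..<Suc h] []) \<le> z ^ (4 * ?q + 23)"
  proof (rule foldC_le(1)[where I = ?I and t = ?t and S = "?q + 8" and k = 2 and l = 1, OF step S])
    show "bits x \<le> z ^ 2" if "x \<in> set [0..<Suc h]" for x using that k by (intro bits_small) auto
  qed (use k in auto)
  have "bits (k # ks) \<le> z ^ 4" by (rule list_le[of _ 2 1]) (use Cons.prems in \<open>auto intro!: bits_small\<close>)
  then have "bit_ops (inspect (k # ks)) \<le> z ^ (4 * ?q + 23)" by (rule inspect_le) simp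
  moreover have "bit_ops (uptoC h) \<le> z ^ (4 * ?q + 23)" by (rule le_pow[OF uptoC_le]) (use k in auto)
  moreover have "bit_ops (splitsC (k # ks) \<alpha> h B) = bit_ops (inspect (k # ks)) + (bit_ops (uptoC h) +
      bit_ops (foldC ?f [0..<Suc h] []))"
    unfolding splitsC.simps by (simp only: bind_cost_sel val_uptoC)
  ultimately show ?case using fold by (intro absorb[of _ "4 * ?q + 23"]) auto
qed

text \<open>In contrast to \<open>is_table\<close> this property passes to the tail of the list, as
  the induction over the entries in \<open>familiesC_le\<close> requires.\<close>

definition small_table :: "table \<Rightarrow> bool" where
  "small_table T \<longleftrightarrow> length T \<le> z ^ 2 \<and> (\<forall>((b, s), h)\<in>set T. b < z \<and> s < z \<and> h < z)"

lemma small_table_bits: "small_table T \<Longrightarrow> bits T \<le> z ^ 6"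
proof (rule list_le[of _ 3 2])
  fix e assume T: "small_table T" and e: "e \<in> set T"
  obtain b s h where "e = ((b, s), h)" by (metis prod.exhaust)
  then have "b \<le> z" "s \<le> z" "h \<le> z" "e = ((b, s), h)" using T e by (auto simp: small_table_def)
  then show "bits e \<le> z ^ 3"
    using bits_small[of b] bits_small[of s] bits_small[of h] by (intro absorb[of _ 2]) auto
qed (auto simp: small_table_def)

lemma familiesC_entry:
  assumes T: "small_table T" and r: "r \<le> d" "d + 1 < z" and \<nu>: "\<nu> \<in> set (val (familiesC T a r B))" and e: "((b, s), f) \<in> set \<nu>"
  shows "b < z" "s < z" "\<And>k j. (k, j) \<in> set f \<Longrightarrow> k < z \<and> j < z" "length f < z" "sum_list (map snd f) < z"
    "bits f \<le> z ^ 5" "bits ((b, s), f) \<le> z ^ 6"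
proof -
  note el = familiesC_elem[OF \<nu>]
  obtain i where i: "i < length \<nu>" "\<nu> ! i = ((b, s), f)" using e by (metis in_set_conv_nth)
  have len: "length \<nu> = length T" using el by (metis length_map)
  obtain h where h: "T ! i = ((b, s), h)"
  proof -
    have m: "map fst \<nu> = map fst T" using el by blast
    have "fst (T ! i) = (b, s)" using arg_cong[OF m, of "\<lambda>l. l ! i"] i len by simp
    then show ?thesis using that by (cases "T ! i") auto
  qed
  have "T ! i \<in> set T" using i len by simp
  then show b: "b < z" "s < z" using T h by (auto simp: small_table_def)
  have hz: "h < z" using T h \<open>T ! i \<in> set T\<close> by (auto simp: small_table_def)
  have f: "map fst f = [0..<Suc (max_mult a r b s)]" "sum_list (map snd f) = h"
    using el i len h by (auto simp: list_all2_conv_all_nth simp del: upt_Suc)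
  show "sum_list (map snd f) < z" using f hz by simp
  have "length f = Suc (max_mult a r b s)" using f(1) by (metis length_map length_upt minus_nat.diff_0)
  then show lf: "length f < z" using max_mult_le[of a r b s] r by simp
  show kj: "k < z \<and> j < z" if "(k, j) \<in> set f" for k j
  proof -
    have "k \<in> set (map fst f)" "j \<in> set (map snd f)" using that by force+
    then show ?thesis
      using f hz max_mult_le[of a r b s] r member_le_sum_list_nat[of j "map snd f"] by (auto simp del: upt_Suc)
  qed
  have "bits x \<le> z ^ 3" if "x \<in> set f" for x
  proof -
    obtain k j where "x = (k, j)" by (cases x)
    then show ?thesis using kj[of k j] that bits_pair_small[of k j] by simp
  qed
  then show bf: "bits f \<le> z ^ 5" by (rule list_le[of _ _ 1]) (use lf in auto)
  have "bits (b, s) \<le> z ^ 3" by (rule bits_pair_small) (use b in auto)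
  then show "bits ((b, s), f) \<le> z ^ 6"
    by (intro absorb[of _ 5]) (use bf le_pow[of "bits (b, s)" 3 5] in auto)
qed

lemma familiesC_bits:
  assumes T: "small_table T" and r: "r \<le> d" "d + 1 < z" and \<nu>: "\<nu> \<in> set (val (familiesC T a r B))"
  shows "bits \<nu> \<le> z ^ 9" "length \<nu> \<le> z ^ 2"
proof -
  show len: "length \<nu> \<le> z ^ 2"
    using familiesC_elem[OF \<nu>] T unfolding small_table_def by (metis length_map)
  show "bits \<nu> \<le> z ^ 9"
  proof (rule list_le[OF _ len])
    fix e assume e: "e \<in> set \<nu>"
    obtain b s f where "e = ((b, s), f)" by (metis prod.exhaust)
    then show "bits e \<le> z ^ 6" using familiesC_entry(7)[OF T r \<nu>] e by blast
  qed simp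
qed

text \<open>Raising the exponent of \<open>z\<close> for every entry would end at an exponent of
  order \<open>n * d\<close>. The bound is therefore linear in the length of the table and in
  \<open>family_bound\<close>, which is multiplicative: the \<open>(h + 1) ^ Suc d\<close> choices
  for the first entry multiply the bound for the tail into the one for the whole table, and the
  overhead of the first entry is worth one more unit of length.\<close>

lemma familiesC_le:
  assumes "small_table T" "a \<le> z" "r \<le> d" "d + 1 < z" "B \<le> r" "family_bound (Suc d) T \<le> z ^ (d + 1)"
  shows "bit_ops (familiesC T a r B) \<le> (length T + 1) * (family_bound (Suc d) T * z ^ (4 * d + 30))"
  using assms
proof (induction T arbitrary: B)
  case Nil
  have b: "bits B \<le> z ^ 2" using Nil by (intro bits_small) simp
  have "bit_ops (eqC B 0) \<le> z ^ (4 * d + 29)" by (rule eqC_le[of _ 2]) (use b in \<open>auto intro!: bits_small\<close>)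
  moreover have "bits [[] :: family] \<le> z ^ 1" "bits ([] :: family list) \<le> z ^ 1"
    using z by (auto simp: bits_list_def)
  then have "bit_ops (ret [[] :: family]) \<le> z ^ (4 * d + 29)" "bit_ops (ret ([] :: family list)) \<le> z ^ (4 * d + 29)"
    by (auto intro!: ret_le[of _ 1] simp del: ret_sel(2))
  ultimately have "bit_ops (familiesC [] a r B) \<le> z ^ (4 * d + 30)"
    by (intro absorb[of _ "4 * d + 29"]) (auto simp del: ret_sel(2))
  then show ?case by (simp add: family_bound_def)
next
  case (Cons e T)
  obtain b s h where e: "e = ((b, s), h)" by (metis prod.exhaust)
  have bsh: "b < z" "s < z" "h < z" and T: "small_table T"
    using Cons.prems(1) e by (auto simp: small_table_def)
  have r: "r \<le> d" "d + 1 < z" "r \<le> z" and B: "B \<le> r" "B \<le> z" using Cons.prems by auto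
  let ?u = "(h + 1) ^ Suc d" and ?W = "family_bound (Suc d) T" and ?P = "z ^ (4 * d + 30)"
  have W: "family_bound (Suc d) (e # T) = ?u * ?W" by (simp add: family_bound_def e)
  have uW: "?u * ?W \<le> z ^ (d + 1)" using Cons.prems(6) W by simp
  have upos: "1 \<le> ?u" by (rule one_le_power) simp
  have Wle: "?W \<le> z ^ (d + 1)"
  proof -
    have "1 * ?W \<le> ?u * ?W" using upos by (rule mult_le_mono1)
    then show ?thesis using uW by linarith
  qed
  have ule: "?u \<le> z ^ (d + 1)"
  proof -
    have "?u * 1 \<le> ?u * ?W" using family_bound_pos by (rule mult_le_mono2)
    then show ?thesis using uW by linarith
  qed
  let ?\<alpha> = "b div gcd a b" and ?K = "max_mult a r b s"
  let ?ks = "[0..<Suc ?K]"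
  have K: "?K \<le> d" using max_mult_le[of a r b s] r by simp
  let ?sp = "val (splitsC ?ks ?\<alpha> h B)"
  have al: "?\<alpha> \<le> z" using bsh by (meson div_le_dividend le_trans less_imp_le)
  have lsp: "length ?sp \<le> ?u"
  proof -
    have "length ?sp \<le> (h + 1) ^ Suc ?K" using length_splitsC[of ?ks ?\<alpha> h B] by (simp del: upt_Suc)
    also have "\<dots> \<le> ?u" by (rule power_increasing) (use K in auto)
    finally show ?thesis .
  qed
  have spe: "bits (f, B') \<le> z ^ 6" "B' \<le> r" if "(f, B') \<in> set ?sp" for f B'
  proof -
    note el = splitsC_elem_le(2,3)[OF that]
    show "bits (f, B') \<le> z ^ 6" by (rule el(1)) (use K r bsh B in auto)
    have "B' \<le> B" by (rule el(2)) (use K r bsh B in auto)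
    then show "B' \<le> r" using B by simp
  qed
  let ?f = "\<lambda>(f, B') acc. do {
         \<nu>s \<leftarrow> familiesC T a r B';
         ext \<leftarrow> mapC (\<lambda>\<nu>. ret (((b, s), f) # \<nu>)) \<nu>s;
         appC acc ext }"
  \<comment> \<open>The cost of the recursive call enters the bound for a round as it stands.
    Rounding it up to a power of \<open>z\<close> here would raise the exponent at every
    entry.\<close>
  let ?C = "(length T + 1) * (?W * ?P)"
  let ?F = "?C + z ^ (4 * d + 26)"
  let ?I = "\<lambda>i (acc :: family list). length acc \<le> i * ?W \<and> (\<forall>x\<in>set acc. bits x \<le> z ^ 9)"
  have S: "bits acc \<le> z ^ (d + 11)" if "i \<le> length ?sp" "?I i acc" for i and acc :: "family list"
  proof (rule list_le)
    show "bits x \<le> z ^ 9" if "x \<in> set acc" for x using that \<open>?I i acc\<close> by blast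
    have "i * ?W \<le> ?u * ?W" using that(1) lsp by (intro mult_le_mono1) simp
    then show "length acc \<le> z ^ (d + 1)" using that uW by linarith
  qed simp
  have lT: "length (e # T) \<le> z ^ 2" using Cons.prems(1) by (simp add: small_table_def)
  have step: "bit_ops (?f p acc) \<le> ?F \<and> ?I (Suc i) (val (?f p acc))"
    if p: "p \<in> set ?sp" and i: "i < length ?sp" and I: "?I i acc" for i p acc
  proof -
    obtain f B' where fB: "p = (f, B')" by (cases p)
    note pe = spe[OF p[unfolded fB]]
    let ?fam = "val (familiesC T a r B')"
    let ?ext = "mapC (\<lambda>\<nu>. ret (((b, s), f) # \<nu>)) ?fam"
    have IH: "bit_ops (familiesC T a r B') \<le> ?C"
      by (rule Cons.IH[OF T Cons.prems(2) r(1,2) pe(2) Wle])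
    have lf: "length ?fam \<le> ?W" by (rule length_familiesC[OF r(1)])
    have be: "bits (((b, s), f) # \<nu>) \<le> z ^ 9" "bits \<nu> \<le> z ^ 9" if "\<nu> \<in> set ?fam" for \<nu>
    proof -
      show "bits \<nu> \<le> z ^ 9" by (rule familiesC_bits(1)[OF T r(1,2) that])
      show "bits (((b, s), f) # \<nu>) \<le> z ^ 9"
      proof (rule list_le[of _ 6 2])
        have "\<nu>' \<in> set (val (familiesC (e # T) a r B))" if "\<nu>' = ((b, s), f) # \<nu>" for \<nu>'
          unfolding e val_familiesC_Cons that using p[unfolded fB] \<open>\<nu> \<in> set ?fam\<close>
          by (auto intro!: bexI[of _ "(f, B')"] simp del: upt_Suc)
        then have mem: "((b, s), f) # \<nu> \<in> set (val (familiesC (e # T) a r B))" by blast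
        show "bits x \<le> z ^ 6" if "x \<in> set (((b, s), f) # \<nu>)" for x
        proof -
          obtain b' s' f' where "x = ((b', s'), f')" by (metis prod.exhaust)
          then show ?thesis using familiesC_entry(7)[OF Cons.prems(1) r(1,2) mem] that by blast
        qed
        show "length (((b, s), f) # \<nu>) \<le> z ^ 2" by (rule familiesC_bits(2)[OF Cons.prems(1) r(1,2) mem])
      qed simp
    qed
    have "bit_ops ?ext \<le> z ^ (2 * d + 13)"
    proof (rule mapC_le[where t = "d + 11" and k = 9 and l = "d + 1"])
      fix \<nu> assume \<nu>: "\<nu> \<in> set ?fam"
      show "bit_ops (ret (((b, s), f) # \<nu>)) \<le> z ^ (d + 11)" by (rule ret_le[OF be(1)[OF \<nu>]]) simp
      show "bits \<nu> \<le> z ^ 9" "bits (val (ret (((b, s), f) # \<nu>))) \<le> z ^ 9" using be[OF \<nu>] by simp_all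
    qed (use lf Wle in auto)
    then have o1: "bit_ops ?ext \<le> z ^ (4 * d + 25)" by (rule le_pow) simp
    have ve: "bits x \<le> z ^ 9" if "x \<in> set (val ?ext)" for x using that be(1) by auto
    have bacc: "bits acc \<le> z ^ (d + 11)" using S[of i acc] i I by simp
    have bext: "bits (val ?ext) \<le> z ^ (d + 11)"
      by (rule list_le[of _ 9 "d + 1"]) (use ve lf Wle in auto)
    have "bit_ops (appC acc (val ?ext)) \<le> z ^ (4 * d + 25)" by (rule appC_le[OF bacc bext]) simp
    then have "bit_ops ?ext + bit_ops (appC acc (val ?ext)) \<le> z ^ (4 * d + 26)"
      using o1 by (intro absorb[of _ "4 * d + 25"]) auto
    then have "bit_ops (?f p acc) \<le> ?F" using IH by (simp add: fB del: val_mapC)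
    moreover have "?I (Suc i) (val (?f p acc))"
    proof -
      have "val (?f p acc) = acc @ val ?ext" by (simp add: fB)
      moreover have "length (val ?ext) \<le> ?W" using lf by simp
      ultimately show ?thesis using I ve by (auto simp del: val_mapC)
    qed
    ultimately show ?thesis by blast
  qed
  have "bit_ops (foldC ?f ?sp []) \<le> (\<Sum>p\<leftarrow>?sp. ?F) + length ?sp * (3 + 2 * (length ?sp * (1 + z ^ 6))) + (1 + 2 * z ^ (d + 11)) \<and>
      ?I (length ?sp) (val (foldC ?f ?sp []))"
    by (rule bit_ops_foldC[where I = ?I, OF step S]) (use spe(1) in auto)
  then have fold: "bit_ops (foldC ?f ?sp []) \<le> length ?sp * ?F + length ?sp * (3 + 2 * (length ?sp * (1 + z ^ 6))) + (1 + 2 * z ^ (d + 11))"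
    by (simp add: sum_list_triv)
  also have "\<dots> \<le> ?u * ?F + ?u * z ^ (4 * d + 26) + z ^ (4 * d + 26)"
  proof (intro add_mono mult_le_mono lsp order_refl)
    have "length ?sp * (1 + z ^ 6) \<le> z ^ (d + 1) * (1 + z ^ 6)" using lsp ule by (intro mult_le_mono1) simp
    also have "\<dots> = z ^ (d + 1) + z ^ (d + 7)"
      unfolding distrib_left mult_1_right power_add[symmetric] by (simp add: add.commute)
    finally have "3 + 2 * (length ?sp * (1 + z ^ 6)) \<le> 100 * z ^ (d + 7)"
      using le_pow[of "z ^ (d + 1)" "d + 1" "d + 7"] pow_pos[of "d + 7"] by simp
    then show "3 + 2 * (length ?sp * (1 + z ^ 6)) \<le> z ^ (4 * d + 26)" by (rule absorb) simp
    show "1 + 2 * z ^ (d + 11) \<le> z ^ (4 * d + 26)" by (rule absorb[of _ "d + 11"]) (use pow_pos[of "d + 11"] in linarith, simp)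
  qed
  finally have fold: "bit_ops (foldC ?f ?sp []) \<le> ?u * ?F + ?u * z ^ (4 * d + 26) + z ^ (4 * d + 26)" .
  have "bit_ops (inspect (e # T)) \<le> z ^ (4 * d + 26)"
    by (rule inspect_le[OF small_table_bits[OF Cons.prems(1)]]) simp
  moreover have "bit_ops (alphaC a b) \<le> z ^ (4 * d + 26)" "bit_ops (maxkC a r b s) \<le> z ^ (4 * d + 26)"
    "bit_ops (uptoC ?K) \<le> z ^ (4 * d + 26)"
    by (rule le_pow[OF alphaC_le(1)], use Cons.prems(2) bsh in auto)
      (rule le_pow[OF maxkC_le], use Cons.prems(2) bsh r in auto, rule le_pow[OF uptoC_le], use K r in auto)
  moreover have "bit_ops (splitsC ?ks ?\<alpha> h B) \<le> z ^ (4 * d + 26)"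
  proof (rule le_pow[OF splitsC_le])
    show "4 * length ?ks + 20 \<le> 4 * d + 26" using K by simp
  qed (use K r bsh B al in auto)
  moreover have "bit_ops (familiesC (e # T) a r B) = bit_ops (inspect (e # T)) + (bit_ops (alphaC a b) + (bit_ops (maxkC a r b s) +
      (bit_ops (uptoC ?K) + (bit_ops (splitsC ?ks ?\<alpha> h B) + bit_ops (foldC ?f ?sp [])))))"
    unfolding e familiesC.simps(2) prod.case
    by (simp only: bind_cost_sel val_uptoC val_maxkC val_alphaC max_mult_def[symmetric])
  ultimately have "bit_ops (familiesC (e # T) a r B) \<le> ?u * ?C + (2 * (?u * z ^ (4 * d + 26)) + 6 * z ^ (4 * d + 26))"
    using fold by (simp add: distrib_left)
  also have "\<dots> \<le> ?u * ?C + ?u * (?W * ?P)"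
  proof (rule add_left_mono)
    have "2 * (?u * z ^ (4 * d + 26)) + 6 * z ^ (4 * d + 26) \<le> ?u * (100 * z ^ (4 * d + 26))"
    proof -
      have "1 * z ^ (4 * d + 26) \<le> ?u * z ^ (4 * d + 26)" using upos by (rule mult_le_mono1)
      then show ?thesis by linarith
    qed
    also have "\<dots> \<le> ?u * (1 * ?P)"
      unfolding mult_1 by (rule mult_le_mono2, rule absorb[of _ "4 * d + 26"], rule order_refl, simp)
    also have "\<dots> \<le> ?u * (?W * ?P)" by (intro mult_le_mono2 mult_le_mono1 family_bound_pos)
    finally show "2 * (?u * z ^ (4 * d + 26)) + 6 * z ^ (4 * d + 26) \<le> ?u * (?W * ?P)" .
  qed
  also have "\<dots> = (length (e # T) + 1) * (family_bound (Suc d) (e # T) * ?P)"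
    unfolding W by (simp add: algebra_simps)
  finally show ?case .
qed

end

section \<open>Families compared with states, and the cost of the terms of one state\<close>

lemma prod_list_power: "(\<Prod>x\<leftarrow>xs. f x ^ m) = (\<Prod>x\<leftarrow>xs. f x :: nat) ^ m"
  by (induction xs) (auto simp: power_mult_distrib)

text \<open>Lowering the entries independently gives distinct vectors of no larger weight. In the
  induction the first entry takes any value \<open>k\<close> up to \<open>h\<close>; the budget left
  over is at least what the other entries use, and monotonicity of \<open>num_le\<close> does the
  rest.\<close>

lemma prod_le_num_le:
  assumes "\<And>e. e \<in> set T \<Longrightarrow> fst (fst e) > 0"
  shows "(\<Prod>e\<leftarrow>T. snd e + 1) \<le> num_le (map (\<lambda>e. fst (fst e)) T) (\<Sum>(p, h)\<leftarrow>T. fst p * h)"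
  using assms
proof (induction T)
  case (Cons e T)
  obtain w s h where e: "e = ((w, s), h)" by (metis prod.exhaust)
  have w: "w > 0" using Cons.prems[of e] e by simp
  let ?ws = "map (\<lambda>e. fst (fst e)) T" and ?R = "\<Sum>(p, h)\<leftarrow>T. fst p * h"
  have "(\<Prod>e\<leftarrow>T. snd e + 1) \<le> num_le ?ws ?R" by (rule Cons.IH) (use Cons.prems in simp)
  then have "(h + 1) * (\<Prod>e\<leftarrow>T. snd e + 1) \<le> (h + 1) * num_le ?ws ?R" by (rule mult_le_mono2)
  then have "(\<Prod>e\<leftarrow>e # T. snd e + 1) \<le> (h + 1) * num_le ?ws ?R" by (simp add: e)
  also have "\<dots> = (\<Sum>k\<le>h. num_le ?ws ?R)" by simp
  also have "\<dots> \<le> (\<Sum>k\<le>h. num_le ?ws (w * h + ?R - k * w))"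
  proof (rule sum_mono)
    fix k assume "k \<in> {..h}"
    then have "k * w \<le> w * h" by (simp add: mult.commute)
    then show "num_le ?ws ?R \<le> num_le ?ws (w * h + ?R - k * w)" by (intro num_le_mono) linarith
  qed
  also have "\<dots> \<le> (\<Sum>k\<le>(w * h + ?R) div w. num_le ?ws (w * h + ?R - k * w))"
    by (rule sum_mono2) (use w in auto)
  finally show ?case by (simp add: e)
qed simp

lemma family_bound_le:
  assumes T: "is_table d n T" and size: "state_size (state_of T) \<le> n"
  shows "family_bound m T \<le> card (states d n) ^ m"
proof -
  have keys: "map fst T = table_keys d n" using T by (simp add: is_table_def)
  have pos: "fst (fst e) > 0" if "e \<in> set T" for e
    by (rule fst_table_keys[of _ d n]) (use that keys in \<open>metis image_eqI list.set_map\<close>)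
  have "(\<Prod>e\<leftarrow>T. snd e + 1) \<le> num_le (map (\<lambda>e. fst (fst e)) T) (\<Sum>(p, h)\<leftarrow>T. fst p * h)"
    by (rule prod_le_num_le[OF pos])
  also have "\<dots> \<le> num_le (map (\<lambda>e. fst (fst e)) T) n"
    using size by (intro num_le_mono) (simp add: state_size_table[OF T])
  also have "map (\<lambda>e. fst (fst e)) T = map fst (table_keys d n)"
    unfolding keys[symmetric] by simp
  finally show ?thesis unfolding family_bound_def prod_list_power card_states(2) by (rule power_mono) simp
qed

locale table_base = big_base +
  fixes d n :: nat
  assumes n_less: "n + d + 1 < z" and states_le: "card (states d n) \<le> z"
begin

lemma entry_le:
  assumes T: "is_table d n T" "state_size (state_of T) \<le> n" and e: "((b, s), h) \<in> set T"
  shows "1 \<le> b" "b \<le> n" "1 \<le> s" "s \<le> d" "h \<le> n"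
proof -
  have "(b, s) \<in> set (map fst T)" using e by force
  then have "(b, s) \<in> set (table_keys d n)" using T(1) unfolding is_table_def by metis
  then show bs: "1 \<le> b" "b \<le> n" "1 \<le> s" "s \<le> d" by (auto simp: set_table_keys)
  have "b * h \<in> set (map (\<lambda>(p, h). fst p * h) T)" using e by force
  then have "b * h \<le> (\<Sum>(p, h)\<leftarrow>T. fst p * h)" by (rule member_le_sum_list_nat)
  then have "b * h \<le> n" using T(2) by (simp add: state_size_table[OF T(1)])
  moreover have "1 * h \<le> b * h" using bs(1) by (rule mult_le_mono1)
  ultimately show "h \<le> n" by linarith
qed

lemma small_table:
  assumes T: "is_table d n T" "state_size (state_of T) \<le> n"
  shows "small_table T" "length T \<le> z ^ 2" "bits T \<le> z ^ 6"
proof -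
  have "length T = n * d" using T(1) length_table_keys unfolding is_table_def by (metis length_map)
  moreover have "n * d \<le> z * z" using n_less by (intro mult_le_mono) auto
  ultimately show l: "length T \<le> z ^ 2" by (simp add: power2_eq_square)
  show "small_table T"
    unfolding small_table_def using l entry_le[OF T] n_less by fastforce
  then show "bits T \<le> z ^ 6" by (rule small_table_bits)
qed

lemma family_bound_le': "is_table d n T \<Longrightarrow> state_size (state_of T) \<le> n \<Longrightarrow> family_bound (Suc d) T \<le> z ^ (d + 1)"
  using family_bound_le[of d n T "Suc d"] power_mono[OF states_le, of "Suc d"] by simp

lemma table_entry_bits:
  assumes "is_table d n T" "state_size (state_of T) \<le> n" "(p, h) \<in> set T"
  shows "bits p \<le> z ^ 3" "bits h \<le> z ^ 2" "bits (p, h) \<le> z ^ 4" "bits (p, h - 1) \<le> z ^ 4"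
proof -
  obtain b s where p: "p = (b, s)" by (cases p)
  note e = entry_le[OF assms(1,2) assms(3)[unfolded p]]
  show p: "bits p \<le> z ^ 3" unfolding p by (rule bits_pair_small) (use e n_less in auto)
  show h: "bits h \<le> z ^ 2" by (rule bits_small) (use e n_less in simp)
  have "bits (h - 1) \<le> z ^ 2" by (rule bits_small) (use e n_less in simp)
  then show "bits (p, h) \<le> z ^ 4" "bits (p, h - 1) \<le> z ^ 4"
    using p h le_pow[of "bits h" 2 3] le_pow[of "bits (h - 1)" 2 3] by (auto intro!: absorb[of _ 3])
qed

lemma removeC_le:
  assumes T: "is_table d n T" "state_size (state_of T) \<le> n" and q: "bits q \<le> z ^ 3"
  shows "bit_ops (removeC q T) \<le> z ^ 10"
  unfolding removeC_def
proof (rule mapC_le[where t = 7 and k = 4 and l = 2])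
  fix e assume e: "e \<in> set T"
  obtain p h where ph: "e = (p, h)" by (cases e)
  note b = table_entry_bits[OF T e[unfolded ph]]
  have "bit_ops (eqC p q) \<le> z ^ 6" by (rule eqC_le[OF b(1) q]) simp
  moreover have "bit_ops (subC h 1) \<le> z ^ 6" by (rule ops_le[OF b(2)]) (auto intro!: bits_small simp: pow_pos z[THEN le_trans[rotated]])
  moreover have "bit_ops (ret (p, h)) \<le> z ^ 6" "bit_ops (ret (p, h - 1)) \<le> z ^ 6"
    by (rule ret_le[OF b(3)], simp) (rule ret_le[OF b(4)], simp)
  ultimately show "bit_ops (case e of (p, h) \<Rightarrow> do {
     c \<leftarrow> eqC p q;
     if c then do { h' \<leftarrow> subC h 1; ret (p, h') } else ret (p, h) }) \<le> z ^ 7"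
    by (intro absorb[of _ 6]) (auto simp: ph simp del: ret_sel(2))
  show "bits e \<le> z ^ 4" using b ph by simp
  show "bits (val (case e of (p, h) \<Rightarrow> do {
     c \<leftarrow> eqC p q;
     if c then do { h' \<leftarrow> subC h 1; ret (p, h') } else ret (p, h) })) \<le> z ^ 4"
    using b(3,4) by (auto simp: ph simp del: bits_pair)
qed (use small_table[OF T] in auto)

lemma pickC_le:
  assumes T: "is_table d n T" "state_size (state_of T) \<le> n"
  shows "bit_ops (pickC T) \<le> z ^ 10"
  unfolding pickC_def
proof (rule foldC_le(1)[where I = "\<lambda>i acc. bits acc \<le> z ^ 4" and t = 7 and k = 4 and l = 2 and S = 4])
  fix i :: nat and e and acc :: "(nat \<times> nat) option"
  assume e: "e \<in> set T" and I: "bits acc \<le> z ^ 4"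
  obtain p h where ph: "e = (p, h)" by (cases e)
  note b = table_entry_bits[OF T e[unfolded ph]]
  have s: "bits (Some p) \<le> z ^ 4" using b(1) pow_pos[of 3] by (intro absorb[of _ 3]) auto
  have "bit_ops (eqC h 0) \<le> z ^ 6" by (rule eqC_le[OF b(2)]) (auto intro!: bits_small)
  moreover have "bit_ops (ret acc) \<le> z ^ 6" "bit_ops (ret (Some p)) \<le> z ^ 6"
    by (rule ret_le[OF I], simp) (rule ret_le[OF s], simp)
  ultimately show "bit_ops ((case e of (p, h) \<Rightarrow> \<lambda>acc. do {
     c \<leftarrow> eqC h 0;
     if c then ret acc else ret (Some p) }) acc) \<le> z ^ 7 \<and>
     bits (val ((case e of (p, h) \<Rightarrow> \<lambda>acc. do {
     c \<leftarrow> eqC h 0;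
     if c then ret acc else ret (Some p) }) acc)) \<le> z ^ 4"
    using I s by (intro conjI, intro absorb[of _ 6]) (auto simp: ph simp del: ret_sel(2) bits_option)
next
  show "bits x \<le> z ^ 4" if "x \<in> set T" for x
    using table_entry_bits(3)[OF T] that by (cases x) blast
qed (use small_table[OF T] pow_pos in auto)

context
  fixes T :: table and a r B :: nat and \<nu> :: family
  assumes T: "is_table d n T" "state_size (state_of T) \<le> n" and a: "0 < a" "a < z" and r: "r \<le> d"
    and \<nu>: "\<nu> \<in> set (val (familiesC T a r B))"
begin

lemma family_entry:
  assumes e: "((b, s), f) \<in> set \<nu>"
  shows "b < z" "s < z" "\<And>k j. (k, j) \<in> set f \<Longrightarrow> k < z \<and> j < z" "length f < z" "sum_list (map snd f) < z"
    "bits f \<le> z ^ 5" "bits ((b, s), f) \<le> z ^ 6"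
proof -
  have "d + 1 < z" using n_less by simp
  note f = familiesC_entry[OF small_table(1)[OF T] r this \<nu> e]
  show "b < z" "s < z" "\<And>k j. (k, j) \<in> set f \<Longrightarrow> k < z \<and> j < z" "length f < z" "sum_list (map snd f) < z"
    "bits f \<le> z ^ 5" "bits ((b, s), f) \<le> z ^ 6" by (fact f)+
qed

lemma family_bits: "bits \<nu> \<le> z ^ 9" "length \<nu> \<le> z ^ 2"
  using familiesC_bits[OF small_table(1)[OF T] r _ \<nu>] n_less by auto

lemma weightC_le: "bit_ops (weightC a \<nu>) \<le> z ^ 25" "bits (val (weightC a \<nu>)) \<le> z ^ 10"
proof -
  let ?f = "\<lambda>((b, s), f) acc. do {
     js \<leftarrow> mapC (\<lambda>(k, j). ret j) f;
     h \<leftarrow> sumC js;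
     hf \<leftarrow> factC h;
     jfs \<leftarrow> mapC factC js;
     den \<leftarrow> prodC jfs;
     q \<leftarrow> divC hf den;
     g \<leftarrow> gcdC a b;
     xs \<leftarrow> mapC (\<lambda>(k, j). do { x \<leftarrow> binomC g k; powC x j }) f;
     x \<leftarrow> prodC xs;
     W \<leftarrow> mulC q x;
     mulC acc W }"
  let ?I = "\<lambda>i acc. bits acc \<le> 3 + i * z ^ 7"
  have S: "bits acc \<le> z ^ 10" if "i \<le> length \<nu>" "?I i acc" for i acc
  proof -
    have "i * z ^ 7 \<le> z ^ 9" by (rule mult_pow[of _ 2 _ 7]) (use that(1) family_bits in auto)
    then show ?thesis using that(2) pow_pos[of 9] by (intro absorb[of _ 9]) linarith+
  qed
  have step: "bit_ops (?f e acc) \<le> z ^ 22 \<and> ?I (Suc i) (val (?f e acc))"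
    if e: "e \<in> set \<nu>" and i: "i < length \<nu>" and I: "?I i acc" for i e acc
  proof -
    obtain b s f where bsf: "e = ((b, s), f)" by (metis prod.exhaust)
    note en = family_entry[OF e[unfolded bsf]]
    have kj: "k < z" "j < z" "bits (k, j) \<le> z ^ 3" if "(k, j) \<in> set f" for k j
      using en(3)[OF that] bits_pair_small[of k j] by auto
    have lf: "length f \<le> z ^ 1" using en(4) by simp
    let ?js = "map snd f" and ?g = "gcd a b"
    have js: "j < z" "bits j \<le> z ^ 2" if "j \<in> set ?js" for j
    proof -
      show "j < z" using that kj(2) by auto
      then show "bits j \<le> z ^ 2" by (intro bits_small) simp
    qed
    have g: "?g < z" using a by (intro le_less_trans[OF gcd_le1_nat]) auto
    let ?h = "sum_list ?js" and ?den = "prod_list (map fact ?js) :: nat"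
    let ?x = "prod_list (map (\<lambda>(k, j). (?g choose k) ^ j) f)"
    have c1: "bit_ops (mapC (case_prod (\<lambda>k. ret)) f) \<le> z ^ 21"
    proof (rule mapC_le[where t = 5 and k = 3 and l = 1])
      fix p assume p: "p \<in> set f"
      obtain k j where [simp]: "p = (k, j)" by (cases p)
      have "bits j \<le> z ^ 2" using kj(2) p by (intro bits_small) force
      then show "bit_ops (case_prod (\<lambda>k. ret) p) \<le> z ^ 5" "bits p \<le> z ^ 3" "bits (val (case_prod (\<lambda>k. ret) p)) \<le> z ^ 3"
        using kj(3) p ret_le[of j 2 5] le_pow[of "bits j" 2 3] by (auto simp del: ret_sel(2) bits_pair)
    qed (use lf in auto)
    have c2: "bit_ops (sumC ?js) \<le> z ^ 21" by (rule prodC_le(3)[of _ 2 1]) (use js lf in auto)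
    have h: "?h < z" by (rule en(5))
    have c3: "bit_ops (factC ?h) \<le> z ^ 21" by (rule le_pow[OF factC_le(1)[OF h]]) simp
    have c4: "bit_ops (mapC factC ?js) \<le> z ^ 21"
    proof (rule mapC_le[where t = 13 and k = 4 and l = 1])
      fix j assume "j \<in> set ?js"
      from js[OF this] show "bit_ops (factC j) \<le> z ^ 13" "bits j \<le> z ^ 4" "bits (val (factC j)) \<le> z ^ 4"
        using factC_le[of j] le_pow[of "bits j" 2 4] by auto
    qed (use lf in auto)
    have fj: "bits x \<le> z ^ 4" if "x \<in> set (map fact ?js)" for x :: nat
      using that factC_le(2) js(1) by auto
    have lj: "length (map fact ?js) \<le> z ^ 1" using lf by simp
    have c5: "bit_ops (prodC (map fact ?js)) \<le> z ^ 21" by (rule prodC_le(1)[OF fj lj]) simp_all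
    have den: "bits ?den \<le> z ^ 6" using prodC_le(2)[OF fj lj, of 20] by simp
    have hf: "bits (fact ?h :: nat) \<le> z ^ 6" by (rule le_pow[OF factC_le(2)[OF h]]) simp
    have c6: "bit_ops (divC (fact ?h) ?den) \<le> z ^ 21" by (rule ops_le[OF hf den]) simp
    have q: "bits (fact ?h div ?den) \<le> z ^ 6"
      by (rule le_trans[OF bits_nat_mono hf]) (rule div_le_dividend)
    have c7: "bit_ops (gcdC a b) \<le> z ^ 21" by (rule le_pow[OF gcdC_le]) (use a en in auto)
    have pw: "bit_ops (binomC ?g k) + bit_ops (powC (?g choose k) j) \<le> z ^ 16" "bits ((?g choose k) ^ j) \<le> z ^ 4"
      if "(k, j) \<in> set f" for k j
    proof -
      note bk = binomC_le[OF g kj(1)[OF that]]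
      note p = powC_le[OF bk(2) kj(2)[OF that], of 15]
      show "bits ((?g choose k) ^ j) \<le> z ^ 4" using p(2) by simp
      show "bit_ops (binomC ?g k) + bit_ops (powC (?g choose k) j) \<le> z ^ 16"
        using p(1) le_pow[OF bk(1), of 15] by (intro absorb[of _ 15]) auto
    qed
    have c8: "bit_ops (mapC (\<lambda>(k, j). do { x \<leftarrow> binomC ?g k; powC x j }) f) \<le> z ^ 21"
    proof (rule mapC_le[where t = 16 and k = 4 and l = 1])
      fix p assume p: "p \<in> set f"
      obtain k j where kp: "p = (k, j)" by (cases p)
      show "bit_ops (case p of (k, j) \<Rightarrow> do { x \<leftarrow> binomC ?g k; powC x j }) \<le> z ^ 16"
        "bits (val (case p of (k, j) \<Rightarrow> do { x \<leftarrow> binomC ?g k; powC x j })) \<le> z ^ 4"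
        using pw[of k j] p kp by auto
      show "bits p \<le> z ^ 4" using kj(3)[of k j] p kp le_pow[of "bits p" 3 4] by simp
    qed (use lf in auto)
    have xs: "bits x \<le> z ^ 4" if "x \<in> set (map (\<lambda>(k, j). (?g choose k) ^ j) f)" for x
      using that pw(2) by auto
    have lx: "length (map (\<lambda>(k, j). (?g choose k) ^ j) f) \<le> z ^ 1" using lf by simp
    have c9: "bit_ops (prodC (map (\<lambda>(k, j). (?g choose k) ^ j) f)) \<le> z ^ 21" by (rule prodC_le(1)[OF xs lx]) simp_all
    have x: "bits ?x \<le> z ^ 6" using prodC_le(2)[OF xs lx, of 20] by simp
    have c10: "bit_ops (mulC (fact ?h div ?den) ?x) \<le> z ^ 21" by (rule ops_le[OF q x]) simp
    have W: "bits (fact ?h div ?den * ?x) \<le> z ^ 7"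
      using bits_nat_mult[of "fact ?h div ?den" ?x] q x by (intro absorb[of _ 6]) auto
    have acc: "bits acc \<le> z ^ 10" using S[of i acc] i I by simp
    have c11: "bit_ops (mulC acc (fact ?h div ?den * ?x)) \<le> z ^ 21"
      by (rule ops_le[OF acc le_pow[OF W]]) simp_all
    have v: "val (mapC (case_prod (\<lambda>k. ret)) f) = ?js" "val (mapC factC ?js) = map fact ?js"
      "val (mapC (\<lambda>(k, j). do { x \<leftarrow> binomC ?g k; powC x j }) f) = map (\<lambda>(k, j). (?g choose k) ^ j) f"
      by (auto simp: case_prod_beta')
    have "bit_ops (?f e acc) \<le> 100 * z ^ 21"
      unfolding bsf prod.case bind_cost_sel
      by (simp only: v val_sumC val_factC val_gcdC val_prodC val_arith)
        (use c1 c2 c3 c4 c5 c6 c7 c8 c9 c10 c11 in linarith)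
    then have "bit_ops (?f e acc) \<le> z ^ 22" by (rule absorb) simp
    moreover have "val (?f e acc) = acc * (fact ?h div ?den * ?x)"
      unfolding bsf prod.case bind_cost_sel by (simp only: v val_sumC val_factC val_gcdC val_prodC val_arith)
    then have "?I (Suc i) (val (?f e acc))"
      using bits_nat_mult[of acc "fact ?h div ?den * ?x"] W I by simp
    ultimately show ?thesis by blast
  qed
  note fold = foldC_le[where I = ?I and t = 22 and S = 10 and k = 6 and l = 2 and j = 25, OF step S]
  have el: "bits e \<le> z ^ 6" if "e \<in> set \<nu>" for e
  proof -
    obtain b s f where bsf: "e = ((b, s), f)" by (metis prod.exhaust)
    then show ?thesis using family_entry(7) that by blast
  qed
  show "bit_ops (weightC a \<nu>) \<le> z ^ 25"
    unfolding weightC_def by (rule fold(1)) (use el family_bits bits_one in auto)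
  have "?I (length \<nu>) (val (weightC a \<nu>))"
    unfolding weightC_def by (rule fold(2)) (use el family_bits bits_one in auto)
  then show "bits (val (weightC a \<nu>)) \<le> z ^ 10" by (rule S[OF order_refl])
qed

end

end

context table_base
begin

text \<open>The value of the accumulator is bounded here, not just its length: a round adds one
  count below \<open>z\<close>, and there are fewer than \<open>z\<close> rounds. Entries of the new
  table thus stay below a fixed power of \<open>z\<close>.\<close>

lemma nextC_inner_le:
  defines "F \<equiv> \<lambda>b' s b t \<beta>. \<lambda>(k, j) acc. do {
         kb \<leftarrow> mulC k \<beta>;
         s' \<leftarrow> addC t kb;
         c \<leftarrow> eqC (b', s) (b, s');
         if c then addC acc j else ret acc }"
  assumes f: "\<And>k j. (k, j) \<in> set f \<Longrightarrow> k < z \<and> j < z" "length f < z"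
    and z: "b < z" "s < z" "b' < z" "t < z" "\<beta> < z" and acc: "acc \<le> z ^ 4"
  shows "bit_ops (foldC (F b' s b t \<beta>) f acc) \<le> z ^ 16"
    and "val (foldC (F b' s b t \<beta>) f acc) \<le> acc + z ^ 2"
proof -
  let ?f = "F b' s b t \<beta>"
  let ?I = "\<lambda>i x. x \<le> acc + i * z"
  have S: "bits x \<le> z ^ 6" if "i \<le> length f" "?I i x" for i x
  proof -
    have "i * z \<le> z ^ 2" by (rule mult_pow[of _ 1 _ 1]) (use that(1) f(2) in auto)
    then have "x \<le> 2 * z ^ 4" using that(2) acc le_pow[of "i * z" 2 4] by simp
    then show ?thesis
      using bits_nat_le[of x] le_pow[of "z ^ 4" 4 5] pow_pos[of 5] by (intro absorb[of _ 5]) linarith+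
  qed
  have step: "bit_ops (?f p x) \<le> z ^ 14 \<and> ?I (Suc i) (val (?f p x))"
    if p: "p \<in> set f" and i: "i < length f" and I: "?I i x" for i p x
  proof -
    obtain k j where kj: "p = (k, j)" by (cases p)
    have lt: "k < z" "j < z" using f(1) p kj by auto
    have bk: "bits k \<le> z ^ 2" "bits j \<le> z ^ 2" "bits \<beta> \<le> z ^ 2" "bits t \<le> z ^ 2" "bits b \<le> z ^ 2"
      using lt z by (auto intro!: bits_small)
    have kb: "bits (k * \<beta>) \<le> z ^ 3" using bits_nat_mult[of k \<beta>] bk by (intro absorb[of _ 2]) auto
    have s': "bits (t + k * \<beta>) \<le> z ^ 4"
      using bits_nat_add[of t "k * \<beta>"] kb le_pow[OF bk(4), of 3] by (intro absorb[of _ 3]) auto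
    have bs: "bits (b', s) \<le> z ^ 5" by (rule le_pow[OF bits_pair_small]) (use z in auto)
    have bs': "bits (b, t + k * \<beta>) \<le> z ^ 5"
      using s' le_pow[OF bk(5), of 4] by (intro absorb[of _ 4]) auto
    have x: "bits x \<le> z ^ 6" using S[of i x] i I by simp
    have "bit_ops (mulC k \<beta>) \<le> z ^ 13" "bit_ops (addC t (k * \<beta>)) \<le> z ^ 13"
      "bit_ops (eqC (b', s) (b, t + k * \<beta>)) \<le> z ^ 13" "bit_ops (addC x j) \<le> z ^ 13" "bit_ops (ret x) \<le> z ^ 13"
      by (rule ops_le[OF bk(1,3)], simp, rule ops_le[OF le_pow[OF bk(4)] kb], simp, simp,
        rule eqC_le[OF bs bs'], simp, rule ops_le[OF x le_pow[OF bk(2)]], simp, simp, rule ret_le[OF x], simp)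
    then have "bit_ops (?f p x) \<le> z ^ 14"
      by (intro absorb[of _ 13]) (auto simp: kj F_def simp del: ret_sel(2) bits_pair prod.inject)
    moreover have "?I (Suc i) (val (?f p x))" using I lt by (auto simp: kj F_def)
    ultimately show ?thesis by blast
  qed
  note fold = foldC_le[where I = ?I and t = 14 and S = 6 and k = 3 and l = 1 and j = 16, OF step S]
  have el: "bits p \<le> z ^ 3" if "p \<in> set f" for p
    using f(1)[of "fst p" "snd p"] bits_pair_small[of "fst p" "snd p"] that by simp
  show "bit_ops (foldC ?f f acc) \<le> z ^ 16" by (rule fold(1)) (use el f in auto)
  have "?I (length f) (val (foldC ?f f acc))" by (rule fold(2)) (use el f in auto)
  moreover have "length f * z \<le> z ^ 2" by (rule mult_pow[of _ 1 _ 1]) (use f(2) in auto)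
  ultimately show "val (foldC ?f f acc) \<le> acc + z ^ 2" by linarith
qed

context
  fixes T :: table and a r B :: nat and \<nu> :: family
  assumes T: "is_table d n T" "state_size (state_of T) \<le> n" and a: "0 < a" "a < z" and r: "r \<le> d"
    and \<nu>: "\<nu> \<in> set (val (familiesC T a r B))"
begin

lemma nextC_le: "bit_ops (nextC a \<nu>) \<le> z ^ 23"
  unfolding nextC_def
proof (rule mapC_le[where t = 20 and k = 6 and l = 2])
  note entry = family_entry[OF T a r \<nu>] and fam = family_bits[OF T a r \<nu>]
  have el: "bits e \<le> z ^ 6" if "e \<in> set \<nu>" for e
    using entry(7)[of "fst (fst e)" "snd (fst e)" "snd e"] that by simp
  fix e assume e: "e \<in> set \<nu>"
  obtain b t f0 where bt: "e = ((b, t), f0)" by (metis prod.exhaust)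
  have b: "b < z" "t < z" using entry[of b t f0] e bt by auto
  let ?\<beta> = "a div gcd a b"
  have be: "?\<beta> < z" using a(2) by (rule le_less_trans[rotated]) (rule div_le_dividend)
  let ?g = "\<lambda>((b', s), f) acc.
       foldC (\<lambda>(k, j) acc. do {
         kb \<leftarrow> mulC k ?\<beta>;
         s' \<leftarrow> addC t kb;
         c \<leftarrow> eqC (b', s) (b, s');
         if c then addC acc j else ret acc }) f acc"
  let ?I = "\<lambda>i x. x \<le> i * z ^ 2"
  have I: "x \<le> z ^ 4" if "i \<le> length \<nu>" "?I i x" for i x
  proof -
    have "i * z ^ 2 \<le> z ^ 4" by (rule mult_pow[of _ 2 _ 2]) (use that(1) fam in auto)
    then show ?thesis using that(2) by simp
  qed
  have S: "bits x \<le> z ^ 5" if "x \<le> z ^ 4" for x :: nat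
    using bits_nat_le[of x] that pow_pos[of 4] by (intro absorb[of _ 4]) linarith+
  have step: "bit_ops (?g e' x) \<le> z ^ 16 \<and> ?I (Suc i) (val (?g e' x))"
    if e': "e' \<in> set \<nu>" and i: "i < length \<nu>" and x: "?I i x" for i e' x
  proof -
    obtain b' s f where bs: "e' = ((b', s), f)" by (metis prod.exhaust)
    note en = entry[OF e'[unfolded bs]]
    have "x \<le> z ^ 4" using I[of i x] i x by simp
    note inner = nextC_inner_le[OF en(3,4) b(1) en(2,1) b(2) be this]
    then show ?thesis using x unfolding bs prod.case by (auto simp del: val_foldC)
  qed
  note fold = foldC_le[where I = ?I and t = 16 and S = 5 and k = 6 and l = 2 and j = 19, OF step S[OF I]]
  have fold1: "bit_ops (foldC ?g \<nu> 0) \<le> z ^ 19" by (rule fold(1)) (use el fam in auto)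
  have fold2: "?I (length \<nu>) (val (foldC ?g \<nu> 0))" by (rule fold(2)) (use el fam in auto)
  have bx: "bits ((b, t), val (foldC ?g \<nu> 0)) \<le> z ^ 6"
    using bits_pair_small[of b t] b le_pow[of "bits (b, t)" 3 5] S[OF I[OF order_refl fold2]]
    by (intro absorb[of _ 5]) (auto simp del: val_foldC)
  have "bit_ops (betaC a b) \<le> z ^ 19" by (rule le_pow[OF alphaC_le(2)]) (use a b in auto)
  moreover have "bit_ops (ret ((b, t), val (foldC ?g \<nu> 0))) \<le> z ^ 19" by (rule ret_le[OF bx]) simp
  ultimately show "bit_ops ((\<lambda>((b, t), _). do {
     \<beta> \<leftarrow> betaC a b;
     x \<leftarrow> foldC (\<lambda>((b', s), f) acc.
       foldC (\<lambda>(k, j) acc. do {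
         kb \<leftarrow> mulC k \<beta>;
         s' \<leftarrow> addC t kb;
         c \<leftarrow> eqC (b', s) (b, s');
         if c then addC acc j else ret acc }) f acc) \<nu> 0;
     ret ((b, t), x) }) e) \<le> z ^ 20"
    using fold1 unfolding bt prod.case bind_cost_sel val_betaC by (intro absorb[of _ 19]) (linarith, simp)
  show "bits e \<le> z ^ 6" by (rule el[OF e])
  show "bits (val ((\<lambda>((b, t), _). do {
     \<beta> \<leftarrow> betaC a b;
     x \<leftarrow> foldC (\<lambda>((b', s), f) acc.
       foldC (\<lambda>(k, j) acc. do {
         kb \<leftarrow> mulC k \<beta>;
         s' \<leftarrow> addC t kb;
         c \<leftarrow> eqC (b', s) (b, s');
         if c then addC acc j else ret acc }) f acc) \<nu> 0;
     ret ((b, t), x) }) e)) \<le> z ^ 6"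
    using bx unfolding bt prod.case bind_cost_sel val_betaC ret_sel(1) .
qed (use family_bits[OF T a r \<nu>] in auto)

end

text \<open>Of the exponent, \<open>4 * d + 30\<close> comes from the unit cost in
  \<open>familiesC_le\<close> and \<open>d + 1\<close> from the bound on the number of families. The
  remainder covers the length of the table, the values of \<open>u\<close> and the copying of the
  collected terms.\<close>

lemma termsC_le:
  assumes T: "is_table d n T" "state_size (state_of T) \<le> n" and H: "state_of T (a, r) > 0"
  shows "bit_ops (termsC T a r) \<le> z ^ (5 * d + 39)" "length (val (termsC T a r)) \<le> z ^ (d + 2)"
    "\<And>x. x \<in> set (val (termsC T a r)) \<Longrightarrow> bits (fst x) \<le> z ^ 11 \<and> bits x \<le> z ^ 12"
proof -
  let ?T' = "val (removeC (a, r) T)"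
  have ar: "(a, r) \<in> {1..n} \<times> {1..d}" using state_of_support[OF T(1)] H by blast
  then have a: "0 < a" "a < z" "a \<le> z" and r: "r \<le> d" "r < z" "r \<le> z" using n_less by auto
  have T': "is_table d n ?T'" "state_size (state_of ?T') \<le> n"
    using removeC_keys[OF T(1) H] size_removeC[OF T(1) H] T(2) by auto
  let ?g = "\<lambda>i \<nu>. do {
         w \<leftarrow> weightC a \<nu>;
         c \<leftarrow> mulC i w;
         H \<leftarrow> nextC a \<nu>;
         ret (c, H) }"
  let ?f = "\<lambda>u acc. do {
       i \<leftarrow> innerC a u;
       B \<leftarrow> subC r u;
       \<nu>s \<leftarrow> familiesC ?T' a r B;
       ext \<leftarrow> mapC (?g i) \<nu>s;
       appC acc ext }"
  let ?P = "\<lambda>x. bits (fst x) \<le> z ^ 11 \<and> bits x \<le> z ^ 12"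
  let ?I = "\<lambda>i acc. length acc \<le> i * z ^ (d + 1) \<and> (\<forall>x\<in>set acc. ?P x)"
  have L: "length acc \<le> z ^ (d + 2)" if "i \<le> length [0..<Suc r]" "?I i acc" for i and acc :: "(nat \<times> table) list"
  proof -
    have "i * z ^ (d + 1) \<le> z ^ (d + 2)" by (rule mult_pow[of _ 1 _ "d + 1"]) (use that(1) r(2) in auto)
    then show ?thesis using that(2) by linarith
  qed
  have S: "bits acc \<le> z ^ (d + 15)" if "i \<le> length [0..<Suc r]" "?I i acc" for i and acc :: "(nat \<times> table) list"
    by (rule list_le[of _ 12 "d + 2"]) (use L[OF that] that(2) in auto)
  have step: "bit_ops (?f u acc) \<le> z ^ (5 * d + 36) \<and> ?I (Suc i) (val (?f u acc))"
    if u: "u \<in> set [0..<Suc r]" and i: "i < length [0..<Suc r]" and I: "?I i acc" for i u acc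
  proof -
    have u: "u < z" using u r by auto
    let ?i = "val (innerC a u)" and ?fam = "val (familiesC ?T' a r (r - u))"
    note inn = innerC_le[OF a(2) u]
    have c1: "bit_ops (innerC a u) \<le> z ^ (5 * d + 35)" by (rule le_pow[OF inn(1)]) simp
    have c2: "bit_ops (subC r u) \<le> z ^ (5 * d + 35)"
      by (rule ops_le[of _ 2]) (use u r in \<open>auto intro!: bits_small\<close>)
    have fb: "family_bound (Suc d) ?T' \<le> z ^ (d + 1)" by (rule family_bound_le'[OF T'])
    have lf: "length ?fam \<le> z ^ (d + 1)" by (rule le_trans[OF length_familiesC[OF r(1)] fb])
    have "bit_ops (familiesC ?T' a r (r - u)) \<le> (length ?T' + 1) * (family_bound (Suc d) ?T' * z ^ (4 * d + 30))"
      by (rule familiesC_le[OF small_table(1)[OF T'] a(3) r(1) _ _ fb]) (use n_less in auto)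
    also have "\<dots> \<le> z ^ (5 * d + 35)"
    proof (rule mult_pow[of _ 3 _ "5 * d + 31"])
      show "length ?T' + 1 \<le> z ^ 3" using small_table(2)[OF T'] pow_pos[of 2] by (intro absorb[of _ 2]) auto
      show "family_bound (Suc d) ?T' * z ^ (4 * d + 30) \<le> z ^ (5 * d + 31)"
        by (rule mult_pow[OF fb, of _ "4 * d + 30"]) auto
    qed simp
    finally have c3: "bit_ops (familiesC ?T' a r (r - u)) \<le> z ^ (5 * d + 35)" .
    have el: "bit_ops (?g ?i \<nu>) \<le> z ^ (d + 26)" "?P (val (?g ?i \<nu>))" if \<nu>: "\<nu> \<in> set ?fam" for \<nu>
    proof -
      note w = weightC_le[OF T' a(1,2) r(1) \<nu>] and nx = nextC_le[OF T' a(1,2) r(1) \<nu>]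
      have iw: "bits (?i * val (weightC a \<nu>)) \<le> z ^ 11"
        using bits_nat_mult[of ?i "val (weightC a \<nu>)"] w(2) le_pow[OF inn(2), of 10] by (intro absorb[of _ 10]) auto
      note nt = nextC_table[OF T(1) H \<nu>]
      have "bits (val (nextC a \<nu>)) \<le> z ^ 6" by (rule small_table(3)[OF nt(2)]) (use nt(4) T(2) in simp)
      then have both: "bits (?i * val (weightC a \<nu>), val (nextC a \<nu>)) \<le> z ^ 12"
        using iw le_pow[of "bits (val (nextC a \<nu>))" 6 11] by (intro absorb[of _ 11]) auto
      then show "?P (val (?g ?i \<nu>))" using iw by simp
      have "bit_ops (mulC ?i (val (weightC a \<nu>))) \<le> z ^ 25" by (rule ops_le[OF le_pow[OF inn(2)] w(2)]) simp_all
      moreover have "bit_ops (ret (?i * val (weightC a \<nu>), val (nextC a \<nu>))) \<le> z ^ 25" by (rule ret_le[OF both]) simp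
      ultimately have "bit_ops (?g ?i \<nu>) \<le> z ^ 26"
        using w(1) le_pow[OF nx, of 25] by (intro absorb[of _ 25]) (simp_all del: ret_sel(2) val_innerC bits_pair)
      then show "bit_ops (?g ?i \<nu>) \<le> z ^ (d + 26)" by (rule le_pow) simp
    qed
    have fb: "bits \<nu> \<le> z ^ 12" if "\<nu> \<in> set ?fam" for \<nu>
      by (rule le_pow[OF family_bits(1)[OF T' a(1,2) r(1) that]]) simp
    let ?ext = "mapC (?g ?i) ?fam"
    have c4: "bit_ops ?ext \<le> z ^ (5 * d + 35)"
      by (rule mapC_le[where t = "d + 26" and k = 12 and l = "d + 1"]) (use el fb lf in blast | simp)+
    have lext: "length (val ?ext) \<le> z ^ (d + 1)" using lf by simp
    have eext: "?P x" if "x \<in> set (val ?ext)" for x using that el(2) by auto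
    have bext: "bits (val ?ext) \<le> z ^ (d + 15)" by (rule list_le[of _ 12 "d + 1"]) (use eext lext in auto)
    have bacc: "bits acc \<le> z ^ (d + 15)" using S[of i acc] i I by simp
    have c5: "bit_ops (appC acc (val ?ext)) \<le> z ^ (5 * d + 35)" by (rule appC_le[OF bacc bext]) simp
    have "bit_ops (?f u acc) \<le> 100 * z ^ (5 * d + 35)"
      unfolding bind_cost_sel val_arith using c1 c2 c3 c4 c5 by linarith
    then have "bit_ops (?f u acc) \<le> z ^ (5 * d + 36)" by (rule absorb) simp
    moreover have "val (?f u acc) = acc @ val ?ext" unfolding bind_cost_sel val_arith val_appC ..
    then have "?I (Suc i) (val (?f u acc))" using I lext eext by (auto simp del: val_mapC)
    ultimately show ?thesis by blast
  qed
  have usb: "bits x \<le> z ^ 2" if "x \<in> set [0..<Suc r]" for x using that r by (intro bits_small) auto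
  note fold = foldC_le[where I = ?I and t = "5 * d + 36" and S = "d + 15" and k = 2 and l = 1 and j = "5 * d + 38", OF step S usb]
  have fold1: "bit_ops (foldC ?f [0..<Suc r] []) \<le> z ^ (5 * d + 38)" by (rule fold(1)) (use r in auto)
  have fold2: "?I (length [0..<Suc r]) (val (foldC ?f [0..<Suc r] []))" by (rule fold(2)) (use r in auto)
  have v: "val (termsC T a r) = val (foldC ?f [0..<Suc r] [])"
    unfolding termsC_def bind_cost_sel val_uptoC ..
  show "length (val (termsC T a r)) \<le> z ^ (d + 2)" unfolding v by (rule L[OF order_refl fold2])
  show "?P x" if "x \<in> set (val (termsC T a r))" for x using fold2 that unfolding v by blast
  have "bit_ops (removeC (a, r) T) \<le> z ^ (5 * d + 38)"
    by (rule le_pow[OF removeC_le[OF T bits_pair_small]]) (use a r in auto)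
  moreover have "bit_ops (uptoC r) \<le> z ^ (5 * d + 38)" by (rule le_pow[OF uptoC_le[OF r(2)]]) simp
  ultimately have "bit_ops (termsC T a r) \<le> 100 * z ^ (5 * d + 38)"
    unfolding termsC_def bind_cost_sel val_uptoC using fold1 by linarith
  then show "bit_ops (termsC T a r) \<le> z ^ (5 * d + 39)" by (rule absorb) simp
qed

end

section \<open>The size of the cache and the amortized cost of the evaluation\<close>

lemma Phi_le:
  assumes "normalized d H"
  shows "Phi d H \<le> 2 ^ (state_size H * state_size H)"
proof -
  obtain V \<sigma> \<rho> where R: "realization d H (V :: nat set) \<sigma> \<rho>" using realization_exists[OF assms] .
  have V: "finite V" "finite (all_pairs V)"
    using R by (auto simp: realization_def all_pairs_def)
  have "Phi d H = card (fixed_graphs V \<sigma> \<rho>)" by (rule Phi_eq[OF R])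
  also have "\<dots> \<le> card (Pow (all_pairs V))"
    by (rule card_mono) (use V in \<open>auto simp: fixed_graphs_def\<close>)
  also have "\<dots> = 2 ^ (card V choose 2)" using V by (simp add: card_Pow card_all_pairs)
  also have "\<dots> \<le> 2 ^ (state_size H * state_size H)"
  proof (rule power_increasing)
    have "card V choose 2 \<le> card V * (card V - 1)" by (simp add: choose_two)
    also have "\<dots> \<le> card V * card V" by (rule mult_le_mono2) simp
    finally show "card V choose 2 \<le> state_size H * state_size H" by (simp add: realization_size[OF R])
  qed simp
  finally show ?thesis .
qed

text \<open>Keys of a valid cache are distinct tables, and a table is determined by its state; so
  the entries inject into the set of states.\<close>

lemma valid_cache_states:
  assumes "valid_cache d n C"
  shows "\<forall>(T, v)\<in>set C. state_of T \<in> states d n \<and> v = Phi d (state_of T)" and "length C \<le> card (states d n)"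
proof -
  show st: "\<forall>(T, v)\<in>set C. state_of T \<in> states d n \<and> v = Phi d (state_of T)"
    using assms normalized_state_of by (auto simp: valid_cache_def states_def)
  let ?K = "set (map fst C)"
  have tab: "is_table d n T" "state_of T \<in> states d n" if "T \<in> ?K" for T
    using assms st that by (auto simp: valid_cache_def)
  have "length C = card ?K" using assms distinct_card[of "map fst C"] by (simp add: valid_cache_def)
  also have "\<dots> = card (state_of ` ?K)"
    by (rule card_image[symmetric]) (use tab is_table_eqI in \<open>blast intro: inj_onI\<close>)
  also have "\<dots> \<le> card (states d n)"
    by (rule card_mono[OF card_states(1)]) (use tab in blast)
  finally show "length C \<le> card (states d n)" .
qed

context table_base
begin

text \<open>A graph counted by \<open>Phi\<close> is a set of pairs among at most \<open>n\<close>
  points, so the value is at most 2 to the power \<open>n * n\<close> and its length is quadratic in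
  \<open>n\<close>.\<close>

lemma Phi_bits:
  assumes "is_table d n T" "state_size (state_of T) \<le> n"
  shows "bits (Phi d (state_of T)) \<le> z ^ 3"
proof -
  have "Phi d (state_of T) \<le> 2 ^ (state_size (state_of T) * state_size (state_of T))"
    by (rule Phi_le[OF normalized_state_of[OF assms(1)]])
  also have "\<dots> \<le> 2 ^ (n * n)" using assms(2) by (intro power_increasing mult_le_mono) auto
  also have "\<dots> < 2 ^ Suc (n * n)" by simp
  finally have "bits (Phi d (state_of T)) \<le> 2 * Suc (n * n) + 1" by (rule bits_nat_leI)
  moreover have "n * n \<le> z ^ 2" unfolding power2_eq_square using n_less by (intro mult_le_mono) auto
  ultimately show ?thesis using pow_pos[of 2] by (intro absorb[of _ 2]) auto
qed

lemma valid_cache_bits: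
  assumes C: "valid_cache d n C"
  shows "length C \<le> z" "\<And>T v. (T, v) \<in> set C \<Longrightarrow> bits T \<le> z ^ 6 \<and> bits v \<le> z ^ 3 \<and> bits (T, v) \<le> z ^ 7" "bits C \<le> z ^ 9"
proof -
  show len: "length C \<le> z" using valid_cache_states(2)[OF C] states_le by simp
  show el: "bits T \<le> z ^ 6 \<and> bits v \<le> z ^ 3 \<and> bits (T, v) \<le> z ^ 7" if "(T, v) \<in> set C" for T v
  proof -
    have T: "is_table d n T" "state_size (state_of T) \<le> n" "v = Phi d (state_of T)"
      using C that by (auto simp: valid_cache_def)
    have "bits T \<le> z ^ 6" "bits v \<le> z ^ 3" using small_table(3)[OF T(1,2)] Phi_bits[OF T(1,2)] T(3) by auto
    then show ?thesis using le_pow[of "bits v" 3 6] by (intro conjI absorb[of "bits (T, v)" 6]) auto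
  qed
  show "bits C \<le> z ^ 9" by (rule list_le[of _ 7 1]) (use el len in auto)
qed

text \<open>Linear search compares at most \<open>z\<close> keys, each of length bounded by a fixed
  power of \<open>z\<close>. The exponent is free of \<open>d\<close>, so repeated visits of cached
  states stay cheap.\<close>

lemma lookupC_le:
  assumes C: "valid_cache d n C" and T: "bits T \<le> z ^ 6"
  shows "bit_ops (lookupC C T) \<le> z ^ 13"
proof -
  note cb = valid_cache_bits[OF C]
  have "bit_ops (lookupC D T) \<le> (length D + 1) * z ^ 11" if "set D \<subseteq> set C" "length D \<le> z" for D
    using that
  proof (induction D)
    case Nil
    have "bit_ops (ret (None :: nat option)) \<le> z ^ 11" by (rule ret_le[of _ 0]) auto
    then show ?case by (simp del: ret_sel(2))
  next
    case (Cons e D)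
    obtain T' v where e: "e = (T', v)" by (cases e)
    have Tv: "bits T' \<le> z ^ 6" "bits v \<le> z ^ 3" using cb(2)[of T' v] Cons.prems e by auto
    have "bits (e # D) \<le> z ^ 9" by (rule list_le[of _ 7 1]) (use Cons.prems cb(2) in auto)
    then have 1: "bit_ops (inspect (e # D)) \<le> z ^ 10" by (rule inspect_le) simp
    have 2: "bit_ops (eqC T' T) \<le> z ^ 10" by (rule eqC_le[OF Tv(1) T]) simp
    have "bits (Some v) \<le> z ^ 4" using Tv pow_pos[of 3] by (intro absorb[of _ 3]) auto
    then have 3: "bit_ops (ret (Some v)) \<le> z ^ 10" by (rule ret_le) simp
    have IH: "bit_ops (lookupC D T) \<le> (length D + 1) * z ^ 11" using Cons by simp
    have "3 * z ^ 10 \<le> z ^ 11" by (rule absorb[of _ 10]) auto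
    moreover have "bit_ops (lookupC (e # D) T) \<le> 3 * z ^ 10 + bit_ops (lookupC D T)"
      using 1 2 3 by (auto simp: e simp del: ret_sel(2) inspect_sel(2))
    ultimately have "bit_ops (lookupC (e # D) T) \<le> z ^ 11 + (length D + 1) * z ^ 11" using IH by linarith
    then show ?case by simp
  qed
  from this[OF order_refl cb(1)] have "bit_ops (lookupC C T) \<le> (length C + 1) * z ^ 11" .
  also have "\<dots> \<le> z ^ 13"
    by (rule mult_pow[of _ 2 _ 11]) (use cb(1) z in \<open>auto intro!: absorb[of _ 1]\<close>)
  finally show ?thesis .
qed

text \<open>The exponent is two above that of \<open>termsC_le\<close>, which leaves room for the
  loop over the terms.\<close>

definition fresh_cost :: nat where
  "fresh_cost = z ^ (5 * d + 41)"

text \<open>Amortized: evaluating a cached state costs at most \<open>z\<^sup>1\<^sup>5\<close>, and each state evaluated for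
  the first time pays \<open>fresh_cost\<close> for its own list of terms.\<close>

theorem phiC_le:
  assumes "is_table d n T" "state_size (state_of T) < l" "state_size (state_of T) \<le> n" "valid_cache d n C" "l < z"
  shows "bit_ops (phiC l T C) + fresh_cost * length C \<le> z ^ 15 + fresh_cost * length (snd (val (phiC l T C)))"
  using assms
proof (induction l arbitrary: T C)
  case (Suc l)
  let ?H = "state_of T"
  note T = Suc.prems(1,3) and C = Suc.prems(4)
  let ?res = "val (phiC (Suc l) T C)"
  \<comment> \<open>Correctness enters the cost estimate: the result is the fixed-point number
    together with a valid cache, and this is what bounds its length.\<close>
  note correct = phiC_correct[OF Suc.prems(1-4)]
  have vres: "valid_cache d n (snd ?res)" using correct by (simp add: cache_step_def)
  have "bits (fst ?res) \<le> z ^ 3" using correct Phi_bits[OF T] by simp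
  then have bres: "bits ?res \<le> z ^ 10"
    using valid_cache_bits(3)[OF vres] le_pow[of "bits (fst ?res)" 3 9] bits_pair[of "fst ?res" "snd ?res"]
    by (intro absorb[of _ 9]) auto
  have res: "bit_ops (ret ?res) \<le> z ^ 13" by (rule ret_le[OF bres]) simp
  have "bits (Suc l) \<le> z ^ 2" by (rule bits_small) (use Suc.prems in simp)
  then have insp: "bit_ops (inspect (Suc l)) \<le> z ^ 13" by (rule inspect_le) simp
  have look: "bit_ops (lookupC C T) \<le> z ^ 13" by (rule lookupC_le[OF C small_table(3)[OF T]])
  have pick: "bit_ops (pickC T) \<le> z ^ 13" by (rule le_pow[OF pickC_le[OF T]]) simp
  have sum: "bit_ops (inspect (Suc l)) + bit_ops (lookupC C T) + bit_ops (pickC T) + bit_ops (ret ?res) \<le> z ^ 15"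
    using insp look pick res by (intro absorb[of _ 13]) linarith+
  show ?case
  proof (cases "map_of C T")
    case (Some v)
    then have r: "?res = (v, C)" by (simp add: phiC_Suc val_lookupC)
    have "bit_ops (phiC (Suc l) T C) = bit_ops (inspect (Suc l)) + (bit_ops (lookupC C T) + bit_ops (ret (v, C)))"
      unfolding phiC_Suc bind_cost_sel val_lookupC by (simp only: Some option.case)
    then show ?thesis using sum unfolding r snd_conv by linarith
  next
    case None
    show ?thesis
    proof (cases "val (pickC T)")
      case pn: None
      have r: "?res = (1, (T, 1) # C)" by (simp add: phiC_Suc val_lookupC None pn)
      have "bit_ops (phiC (Suc l) T C) = bit_ops (inspect (Suc l)) + (bit_ops (lookupC C T) + (bit_ops (pickC T) + bit_ops (ret (1 :: nat, (T, 1) # C))))"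
        unfolding phiC_Suc bind_cost_sel val_lookupC by (simp only: None pn option.case bind_cost_sel)
      then show ?thesis using sum unfolding r by simp
    next
      case (Some p)
      obtain a r where p: "p = (a, r)" by (cases p)
      obtain h where "((a, r), h) \<in> set T" "h \<noteq> 0" using val_pickC_Some[OF Some] p by blast
      then have H: "?H (a, r) > 0"
        using state_of_in[of T "(a, r)" h] T distinct_table_keys by (simp add: is_table_def)
      let ?ts = "val (termsC T a r)"
      note tm = termsC_le[OF T H]
      \<comment> \<open>The growth of the cache is left to the potential. The invariant only keeps
        the cache valid, which bounds its length by the number of states, and limits the length of
        the partial sum.\<close>
      let ?I = "\<lambda>i s. valid_cache d n (snd s) \<and> bits (fst s) \<le> 3 + i * z ^ 12"
      let ?\<phi> = "\<lambda>s :: nat \<times> cache. fresh_cost * length (snd s)"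
      have acc: "bits x \<le> z ^ (d + 15)" if "i \<le> length ?ts" "bits x \<le> 3 + i * z ^ 12" for i and x :: nat
      proof -
        have "i * z ^ 12 \<le> z ^ (d + 14)" by (rule mult_pow[of _ "d + 2" _ 12]) (use that(1) tm(2) in auto)
        then show ?thesis using that(2) pow_pos[of "d + 14"] by (intro absorb[of _ "d + 14"]) linarith+
      qed
      have S: "bits s \<le> z ^ (d + 16)" if "i \<le> length ?ts" "?I i s" for i and s :: "nat \<times> cache"
        using acc[of i "fst s"] valid_cache_bits(3)[of "snd s"] le_pow[of "bits (snd s)" 9 "d + 15"] that bits_pair[of "fst s" "snd s"]
        by (intro absorb[of _ "d + 15"]) auto
      let ?F = "z ^ (2 * d + 32)"
      have step: "bit_ops (term_step l x s) + ?\<phi> s \<le> ?F + ?\<phi> (val (term_step l x s)) \<and> ?I (Suc i) (val (term_step l x s))"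
        if x: "x \<in> set ?ts" and i: "i < length ?ts" and I: "?I i s" for i x s
      proof -
        obtain c T' where x': "x = (c, T')" by (cases x)
        obtain ac D where s: "s = (ac, D)" by (cases s)
        have D: "valid_cache d n D" "bits ac \<le> 3 + i * z ^ 12" using I s by auto
        have T': "is_table d n T'" "state_size (state_of T') < state_size ?H"
          using termsC_table[OF T(1) H] x x' by auto
        have pr: "state_size (state_of T') < l" "state_size (state_of T') \<le> n" "l < z" using T' T Suc.prems by auto
        have IH: "bit_ops (phiC l T' D) + fresh_cost * length D \<le> z ^ 15 + fresh_cost * length (snd (val (phiC l T' D)))"
          by (rule Suc.IH[OF T'(1) pr(1,2) D(1) pr(3)])
        note cor = phiC_correct[OF T'(1) pr(1,2) D(1)]
        let ?v = "Phi d (state_of T')"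
        obtain D' where ph: "val (phiC l T' D) = (?v, D')" using cor by (metis prod.collapse)
        have D': "valid_cache d n D'" using cor ph by (simp add: cache_step_def)
        have c: "bits c \<le> z ^ 11" using tm(3)[OF x] x' by simp
        have v: "bits ?v \<le> z ^ 11" by (rule le_pow[OF Phi_bits[OF T'(1) pr(2)]]) simp
        have cv: "bits (c * ?v) \<le> z ^ 12" using bits_nat_mult[of c ?v] c v by (intro absorb[of _ 11]) auto
        have vt: "val (term_step l x s) = (ac + c * ?v, D')" by (simp add: x' s val_term_step ph)
        have I': "?I (Suc i) (val (term_step l x s))"
          unfolding vt using D' D(2) cv bits_nat_add[of ac "c * ?v"] by simp
        have o1: "bit_ops (mulC c ?v) \<le> z ^ (2 * d + 31)" by (rule ops_le[OF c v]) simp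
        have ac: "bits ac \<le> z ^ (d + 15)" using acc[of i ac] i D(2) by simp
        have o2: "bit_ops (addC ac (c * ?v)) \<le> z ^ (2 * d + 31)" by (rule ops_le[OF ac le_pow[OF cv]]) simp_all
        have "bits (ac + c * ?v, D') \<le> z ^ (d + 16)" using S[of "Suc i", OF _ I'] i vt by simp
        then have o3: "bit_ops (ret (ac + c * ?v, D')) \<le> z ^ (2 * d + 31)" by (rule ret_le) simp
        have o4: "z ^ 15 \<le> z ^ (2 * d + 31)" by (rule le_pow[OF order_refl]) simp
        have "bit_ops (mulC c ?v) + bit_ops (addC ac (c * ?v)) + bit_ops (ret (ac + c * ?v, D')) + z ^ 15 \<le> ?F"
          using o1 o2 o3 o4 by (intro absorb[of _ "2 * d + 31"]) linarith+
        moreover have "bit_ops (term_step l x s) = bit_ops (phiC l T' D) + (bit_ops (mulC c ?v) + (bit_ops (addC ac (c * ?v)) + bit_ops (ret (ac + c * ?v, D'))))"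
          unfolding term_step_def x' s prod.case bind_cost_sel ph val_arith ..
        ultimately have "bit_ops (term_step l x s) + fresh_cost * length D \<le> ?F + fresh_cost * length D'"
          using IH unfolding ph snd_conv by linarith
        then show ?thesis using I' unfolding vt unfolding s by simp
      qed
      let ?N = "length ?ts" and ?fold = "foldC (term_step l) ?ts (0, C)"
      have "bit_ops ?fold + ?\<phi> (0, C) \<le> (\<Sum>x\<leftarrow>?ts. ?F) + ?N * (3 + 2 * (?N * (1 + z ^ 12))) + (1 + 2 * z ^ (d + 16)) + ?\<phi> (val ?fold) \<and> ?I ?N (val ?fold)"
        by (rule bit_ops_foldC_potential[where I = ?I, OF step S]) (use tm(3) C bits_one in auto)
      then have "bit_ops ?fold + ?\<phi> (0, C) \<le> ?N * ?F + ?N * (3 + 2 * (?N * (1 + z ^ 12))) + (1 + 2 * z ^ (d + 16)) + ?\<phi> (val ?fold)"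
        by (simp only: sum_list_triv of_nat_id)
      moreover have "?N * ?F \<le> z ^ (3 * d + 34)" by (rule mult_pow[OF tm(2) order_refl]) simp
      moreover have "?N * (3 + 2 * (?N * (1 + z ^ 12))) \<le> z ^ (3 * d + 34)"
      proof (rule mult_pow[OF tm(2), of _ "d + 16"])
        have "?N * (1 + z ^ 12) \<le> z ^ (d + 15)"
          by (rule mult_pow[OF tm(2), of _ 13]) (use pow_pos[of 12] in \<open>auto intro!: absorb[of _ 12]\<close>)
        then show "3 + 2 * (?N * (1 + z ^ 12)) \<le> z ^ (d + 16)"
          using pow_pos[of "d + 15"] by (intro absorb[of _ "d + 15"]) linarith+
      qed simp
      moreover have "1 + 2 * z ^ (d + 16) \<le> z ^ (3 * d + 34)"
        by (rule absorb[of _ "d + 16"]) (use pow_pos[of "d + 16"] in linarith, simp)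
      moreover have "bit_ops (termsC T a r) + 3 * z ^ (3 * d + 34) \<le> fresh_cost"
        unfolding fresh_cost_def using le_pow[OF tm(1), of "5 * d + 40"] le_pow[of "z ^ (3 * d + 34)" "3 * d + 34" "5 * d + 40"]
        by (intro absorb[of _ "5 * d + 40"]) simp_all
      \<comment> \<open>The potential covers the entries added by the recursive calls. The remaining
        \<open>fresh_cost\<close> is matched by the entry for \<open>T\<close> itself, by which the
        final cache is one longer than that of the loop.\<close>
      ultimately have main: "bit_ops (termsC T a r) + bit_ops ?fold + ?\<phi> (0, C) \<le> fresh_cost + ?\<phi> (val ?fold)"
        by linarith
      obtain v D where vD: "val ?fold = (v, D)" by (cases "val ?fold")
      have r: "?res = (v, (T, v) # D)"
        using vD by (simp add: phiC_Suc val_lookupC None Some p del: val_foldC)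
      have "bit_ops (phiC (Suc l) T C) = bit_ops (inspect (Suc l)) + (bit_ops (lookupC C T) + (bit_ops (pickC T) +
          (bit_ops (termsC T a r) + (bit_ops ?fold + bit_ops (ret (v, (T, v) # D))))))"
        unfolding phiC_Suc bind_cost_sel val_lookupC by (simp only: None Some p option.case prod.case bind_cost_sel vD)
      then show ?thesis using sum main unfolding r vD by simp
    qed
  qed
qed simp

end

section \<open>Cost of the partitions, their weights and their initial states\<close>

lemma length_partitionsC: "length (val (partitionsC as B)) \<le> num_le as B"
proof (induction as arbitrary: B)
  case (Cons a as)
  have "length (val (partitionsC (a # as) B)) \<le> (\<Sum>m\<leftarrow>[0..<Suc (B div a)]. num_le as (B - m * a))"
    unfolding val_partitionsC_Cons length_concat map_map
    by (rule sum_list_mono) (use Cons in \<open>simp add: mult.commute\<close>)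
  also have "\<dots> = num_le (a # as) B"
    unfolding num_le.simps by (rule sum_list_upt)
  finally show ?case .
qed simp

context big_base
begin

lemma partitionsC_elem:
  assumes "\<mu> \<in> set (val (partitionsC as B))" "\<And>a. a \<in> set as \<Longrightarrow> 0 < a \<and> a < z" "length as < z" "B < z"
  shows "bits \<mu> \<le> z ^ 5" "length \<mu> \<le> z" "\<And>a m. (a, m) \<in> set \<mu> \<Longrightarrow> a < z \<and> m < z \<and> bits (a, m) \<le> z ^ 3"
proof -
  have \<mu>: "map fst \<mu> = as" "(\<Sum>(a, m)\<leftarrow>\<mu>. a * m) = B"
    using assms(1) set_partitionsC[of as \<mu> B] assms(2) by auto
  show el: "a < z \<and> m < z \<and> bits (a, m) \<le> z ^ 3" if "(a, m) \<in> set \<mu>" for a m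
  proof -
    have "a \<in> set (map fst \<mu>)" using that by force
    then have a: "0 < a" "a < z" using assms(2) unfolding \<mu>(1) by auto
    have "a * m \<in> set (map (\<lambda>(a, m). a * m) \<mu>)" using that by force
    from member_le_sum_list_nat[OF this] have "a * m \<le> B" unfolding \<mu>(2) .
    moreover have "1 * m \<le> a * m" using a by (intro mult_le_mono1) simp
    ultimately have "m < z" using assms(4) by linarith
    then show ?thesis using a bits_pair_small[of a m] by (simp del: bits_pair)
  qed
  show len: "length \<mu> \<le> z" using \<mu>(1) assms(3) by (metis length_map less_imp_le)
  show "bits \<mu> \<le> z ^ 5" by (rule list_le[of _ 3 1]) (use el len in auto)
qed

text \<open>As for the families, the bound is linear in the count. The counts for the tails, with
  budgets \<open>B - m * a\<close>, add up exactly to \<open>num_le (a # as) B\<close>, so the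
  recursive calls reproduce the bound without raising the exponent.\<close>

lemma partitionsC_le:
  assumes "\<And>a. a \<in> set as \<Longrightarrow> 0 < a \<and> a < z" "length as < z" "B < z" "num_le as B \<le> z"
  shows "bit_ops (partitionsC as B) \<le> (length as + 1) * (num_le as B * z ^ 12)"
  using assms
proof (induction as arbitrary: B)
  case Nil
  have "bit_ops (eqC B 0) \<le> z ^ 11" by (rule eqC_le[of _ 2]) (use Nil in \<open>auto intro!: bits_small\<close>)
  moreover have "bits [[] :: (nat \<times> nat) list] \<le> z ^ 1" "bits ([] :: (nat \<times> nat) list list) \<le> z ^ 1"
    using z by (auto simp: bits_list_def)
  then have "bit_ops (ret [[] :: (nat \<times> nat) list]) \<le> z ^ 11" "bit_ops (ret ([] :: (nat \<times> nat) list list)) \<le> z ^ 11"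
    by (auto intro!: ret_le[of _ 1] simp del: ret_sel(2))
  ultimately have "bit_ops (partitionsC [] B) \<le> z ^ 12"
    by (intro absorb[of _ 11]) (auto simp del: ret_sel(2))
  then show ?case by simp
next
  case (Cons a as)
  let ?N = "Suc (B div a)" and ?W = "num_le (a # as) B"
  have as: "0 < a" "a < z" "\<And>a. a \<in> set as \<Longrightarrow> 0 < a \<and> a < z" "length as < z" "B < z" "?W \<le> z"
    using Cons.prems by auto
  have q: "B div a < z" using as(5) by (rule le_less_trans[rotated]) (rule div_le_dividend)
  have numW: "num_le as (B - a * m) \<le> z" for m
  proof -
    have "num_le as (B - 0 * a) \<le> ?W" unfolding num_le.simps by (rule member_le_sum) auto
    then show ?thesis using num_le_mono[of "B - a * m" B as] as(6) by simp
  qed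
  let ?f = "\<lambda>m acc. do {
       x \<leftarrow> mulC a m;
       B' \<leftarrow> subC B x;
       \<mu>s \<leftarrow> partitionsC as B';
       ext \<leftarrow> mapC (\<lambda>\<mu>. ret ((a, m) # \<mu>)) \<mu>s;
       appC acc ext }"
  let ?F = "\<lambda>m. (length as + 1) * (num_le as (B - m * a) * z ^ 12) + z ^ 11"
  let ?I = "\<lambda>i (acc :: (nat \<times> nat) list list). length acc \<le> i * z \<and> (\<forall>\<mu>\<in>set acc. bits \<mu> \<le> z ^ 6)"
  have S: "bits acc \<le> z ^ 9" if "i \<le> length [0..<?N]" "?I i acc" for i acc
  proof (rule list_le[of _ 6 2])
    have "i * z \<le> z ^ 2" by (rule mult_pow[of _ 1 _ 1]) (use that(1) q in auto)
    then show "length acc \<le> z ^ 2" using that(2) by linarith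
  qed (use that(2) in auto)
  have step: "bit_ops (?f m acc) \<le> ?F m \<and> ?I (Suc i) (val (?f m acc))"
    if m: "m \<in> set [0..<?N]" and i: "i < length [0..<?N]" and I: "?I i acc" for i m acc
  proof -
    let ?\<mu>s = "val (partitionsC as (B - a * m))"
    let ?ext = "mapC (\<lambda>\<mu>. ret ((a, m) # \<mu>)) ?\<mu>s"
    have mz: "m < z" using m q by auto
    have b: "bits a \<le> z ^ 2" "bits m \<le> z ^ 2" "bits B \<le> z ^ 2"
      using as mz by (auto intro!: bits_small)
    have am: "bits (a * m) \<le> z ^ 3" using bits_nat_mult[of a m] b by (intro absorb[of _ 2]) auto
    have Bm: "B - a * m < z" using as(5) by simp
    have o1: "bit_ops (mulC a m) \<le> z ^ 10" by (rule ops_le[OF b(1,2)]) simp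
    have o2: "bit_ops (subC B (a * m)) \<le> z ^ 10" by (rule ops_le[OF le_pow[OF b(3)] am]) simp_all
    have IH: "bit_ops (partitionsC as (B - a * m)) \<le> (length as + 1) * (num_le as (B - a * m) * z ^ 12)"
      by (rule Cons.IH[OF as(3,4) Bm numW])
    have len: "length ?\<mu>s \<le> z" by (rule le_trans[OF length_partitionsC numW])
    have el: "bits \<mu> \<le> z ^ 6 \<and> bits ((a, m) # \<mu>) \<le> z ^ 6" if "\<mu> \<in> set ?\<mu>s" for \<mu>
    proof -
      have 1: "bits \<mu> \<le> z ^ 5" by (rule partitionsC_elem(1)[OF that as(3,4) Bm])
      have 2: "bits (a, m) \<le> z ^ 5" by (rule le_pow[OF bits_pair_small]) (use as mz in auto)
      have "bits ((a, m) # \<mu>) \<le> 1 + bits (a, m) + bits \<mu>" by (simp add: bits_list_def)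
      then have "bits ((a, m) # \<mu>) \<le> 100 * z ^ 5" using 1 2 pow_pos[of 5] by linarith
      then show ?thesis using le_pow[OF 1, of 6] by (auto intro: absorb)
    qed
    have o3: "bit_ops ?ext \<le> z ^ 10"
    proof (rule mapC_le[where t = 8 and k = 6 and l = 1])
      fix \<mu> assume "\<mu> \<in> set ?\<mu>s"
      note el = el[OF this]
      show "bits \<mu> \<le> z ^ 6" "bits (val (ret ((a, m) # \<mu>))) \<le> z ^ 6" using el by auto
      show "bit_ops (ret ((a, m) # \<mu>)) \<le> z ^ 8" by (rule ret_le[OF conjunct2[OF el]]) simp
    qed (use len in auto)
    have lext: "length (val ?ext) \<le> z" using len by simp
    have eext: "bits \<mu> \<le> z ^ 6" if "\<mu> \<in> set (val ?ext)" for \<mu> using that el by auto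
    have bext: "bits (val ?ext) \<le> z ^ 9" by (rule list_le[of _ 6 1]) (use eext lext in auto)
    have bacc: "bits acc \<le> z ^ 9" using S[of i acc] i I by simp
    have o4: "bit_ops (appC acc (val ?ext)) \<le> z ^ 10" by (rule appC_le[OF bacc bext]) simp
    have "bit_ops (mulC a m) + bit_ops (subC B (a * m)) + bit_ops ?ext + bit_ops (appC acc (val ?ext)) \<le> z ^ 11"
      using o1 o2 o3 o4 by (intro absorb[of _ 10]) linarith+
    then have "bit_ops (?f m acc) \<le> ?F m"
      unfolding bind_cost_sel val_arith using IH by (simp only: mult.commute[of m a])
    moreover have "val (?f m acc) = acc @ val ?ext" unfolding bind_cost_sel val_arith val_appC ..
    then have "?I (Suc i) (val (?f m acc))" using I lext eext by (auto simp del: val_mapC)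
    ultimately show ?thesis by blast
  qed
  let ?ms = "[0..<?N]"
  have "bit_ops (foldC ?f ?ms []) \<le> (\<Sum>m\<leftarrow>?ms. ?F m) + length ?ms * (3 + 2 * (length ?ms * (1 + z ^ 2))) + (1 + 2 * z ^ 9) \<and>
      ?I (length ?ms) (val (foldC ?f ?ms []))"
  proof (rule bit_ops_foldC[where I = ?I, OF step S])
    show "bits x \<le> z ^ 2" if "x \<in> set ?ms" for x using that q by (intro bits_small) auto
  qed auto
  moreover have "(\<Sum>m\<leftarrow>?ms. ?F m) = (length as + 1) * (?W * z ^ 12) + ?N * z ^ 11"
    unfolding sum_list_upt sum.distrib num_le.simps sum_distrib_left sum_distrib_right by simp
  moreover have len: "length ?ms = ?N" by simp
  ultimately have fold: "bit_ops (foldC ?f ?ms []) \<le>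
      (length as + 1) * (?W * z ^ 12) + ?N * z ^ 11 + ?N * (3 + 2 * (?N * (1 + z ^ 2))) + (1 + 2 * z ^ 9)"
    by (simp only: len)
  \<comment> \<open>Every value of \<open>m\<close> accounts for at least one vector, so the
    overhead of the rounds can be charged to the vectors counted by \<open>?W\<close>.\<close>
  have NW: "?N \<le> ?W"
  proof -
    have "(\<Sum>k\<le>B div a. 1) \<le> ?W" unfolding num_le.simps by (rule sum_mono) (rule num_le_pos)
    then show ?thesis by simp
  qed
  have "?N * (1 + z ^ 2) \<le> z ^ 4"
    by (rule mult_pow[of _ 1 _ 3]) (use q pow_pos[of 2] in \<open>auto intro!: absorb[of _ 2]\<close>)
  then have "3 + 2 * (?N * (1 + z ^ 2)) \<le> z ^ 11"
    by (intro absorb[of _ 10]) (use le_pow[of "z ^ 4" 4 10] pow_pos[of 10] in simp_all)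
  then have "?N * z ^ 11 + ?N * (3 + 2 * (?N * (1 + z ^ 2))) \<le> ?W * z ^ 11 + ?W * z ^ 11"
    using NW by (intro add_mono mult_le_mono) auto
  moreover have "z ^ 11 \<le> ?W * z ^ 11" using num_le_pos[of "a # as" B] mult_le_mono1[of 1 ?W "z ^ 11"] by simp
  moreover have "1 + 2 * z ^ 9 \<le> z ^ 11" by (rule absorb[of _ 9]) (use pow_pos[of 9] in auto)
  moreover have "bit_ops (inspect (a # as)) \<le> z ^ 11"
  proof (rule inspect_le)
    have "bits x \<le> z ^ 2" if "x \<in> set (a # as)" for x
      using Cons.prems(1)[OF that] by (intro bits_small) simp
    then show "bits (a # as) \<le> z ^ 4" by (rule list_le[of _ 2 1]) (use Cons.prems in auto)
  qed simp
  moreover have "bit_ops (divC B a) \<le> z ^ 11" by (rule ops_le[of _ 2]) (use as in \<open>auto intro!: bits_small\<close>)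
  moreover have "bit_ops (uptoC (B div a)) \<le> z ^ 11" by (rule le_pow[OF uptoC_le[OF q]]) simp
  moreover have "bit_ops (partitionsC (a # as) B) = bit_ops (inspect (a # as)) + (bit_ops (divC B a) + (bit_ops (uptoC (B div a)) + bit_ops (foldC ?f ?ms [])))"
    unfolding partitionsC.simps(2) bind_cost_sel val_arith val_uptoC ..
  ultimately have "bit_ops (partitionsC (a # as) B) \<le> (length as + 1) * (?W * z ^ 12) + 100 * (?W * z ^ 11)"
    using fold by linarith
  also have "100 * (?W * z ^ 11) \<le> ?W * z ^ 12"
  proof -
    have "100 * z ^ 11 \<le> z ^ 12" by (rule absorb[of _ 11]) auto
    from mult_le_mono2[OF this, of ?W] show ?thesis by (simp only: mult.left_commute)
  qed
  finally show ?case by simp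
qed

context
  fixes \<mu> :: "(nat \<times> nat) list"
  assumes len: "length \<mu> \<le> z" and el: "\<And>a m. (a, m) \<in> set \<mu> \<Longrightarrow> a < z \<and> m < z \<and> bits (a, m) \<le> z ^ 3"
begin

lemma zC_le: "bit_ops (zC \<mu>) \<le> z ^ 18" "bits (val (zC \<mu>)) \<le> z ^ 7"
proof -
  let ?f = "\<lambda>(a, m) acc. do {
     x \<leftarrow> powC a m;
     y \<leftarrow> factC m;
     z \<leftarrow> mulC x y;
     mulC acc z }"
  let ?I = "\<lambda>i acc. bits acc \<le> 3 + i * z ^ 5"
  have S: "bits acc \<le> z ^ 7" if "i \<le> length \<mu>" "?I i acc" for i acc
  proof -
    have "i * z ^ 5 \<le> z ^ 6" by (rule mult_pow[of _ 1 _ 5]) (use that(1) len in auto)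
    then show ?thesis using that(2) pow_pos[of 6] by (intro absorb[of _ 6]) linarith+
  qed
  have step: "bit_ops (?f p acc) \<le> z ^ 16 \<and> ?I (Suc i) (val (?f p acc))"
    if p: "p \<in> set \<mu>" and i: "i < length \<mu>" and I: "?I i acc" for i p acc
  proof -
    obtain a m where am: "p = (a, m)" by (cases p)
    have lt: "a < z" "m < z" using el[of a m] p am by auto
    have "bits a \<le> z ^ 2" by (rule bits_small) (use lt in simp)
    note pw = powC_le[OF this lt(2), of 15] and ft = factC_le[OF lt(2)]
    have pb: "bits (a ^ m) \<le> z ^ 4" using pw(2) by simp
    have W: "bits (a ^ m * fact m) \<le> z ^ 5"
      using bits_nat_mult[of "a ^ m" "fact m"] pb ft(2) by (intro absorb[of _ 4]) auto
    have acc: "bits acc \<le> z ^ 7" using S[of i acc] i I by simp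
    have "bit_ops (mulC (a ^ m) (fact m)) \<le> z ^ 15" "bit_ops (mulC acc (a ^ m * fact m)) \<le> z ^ 15"
      by (rule ops_le[OF pb ft(2)], simp, rule ops_le[OF acc le_pow[OF W]], simp, simp)
    then have "bit_ops (?f p acc) \<le> 100 * z ^ 15"
      unfolding am prod.case bind_cost_sel val_arith val_powC val_factC
      using pw(1) le_pow[OF ft(1), of 15] by simp
    then have "bit_ops (?f p acc) \<le> z ^ 16" by (rule absorb) simp
    moreover have "?I (Suc i) (val (?f p acc))"
      using bits_nat_mult[of acc "a ^ m * fact m"] W I by (simp add: am)
    ultimately show ?thesis by blast
  qed
  note fold = foldC_le[where I = ?I and t = 16 and S = 7 and k = 3 and l = 1 and j = 18, OF step S]
  have el': "bits p \<le> z ^ 3" if "p \<in> set \<mu>" for p using el[of "fst p" "snd p"] that by simp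
  show "bit_ops (zC \<mu>) \<le> z ^ 18" unfolding zC_def by (rule fold(1)) (use el' len bits_one in auto)
  have "?I (length \<mu>) (val (zC \<mu>))" unfolding zC_def by (rule fold(2)) (use el' len bits_one in auto)
  then show "bits (val (zC \<mu>)) \<le> z ^ 7" by (rule S[OF order_refl])
qed

lemma initC_le:
  assumes d: "d + 1 \<le> z"
  shows "bit_ops (initC d \<mu>) \<le> z ^ 14"
proof -
  let ?rs = "[1..<1 + d]"
  let ?row = "\<lambda>a m r. do {
         c \<leftarrow> eqC r d;
         if c then ret ((a, r), m) else ret ((a, r), 0) }"
  let ?f = "\<lambda>(a, m) acc. do {
       row \<leftarrow> mapC (?row a m) ?rs;
       appC acc row }"
  let ?I = "\<lambda>i (acc :: table). length acc \<le> i * z \<and> (\<forall>x\<in>set acc. bits x \<le> z ^ 4)"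
  have S: "bits acc \<le> z ^ 7" if "i \<le> length \<mu>" "?I i acc" for i acc
  proof (rule list_le[of _ 4 2])
    have "i * z \<le> z ^ 2" by (rule mult_pow[of _ 1 _ 1]) (use that(1) len in auto)
    then show "length acc \<le> z ^ 2" using that(2) by linarith
  qed (use that(2) in auto)
  have rs: "length ?rs \<le> z ^ 1" "\<And>r. r \<in> set ?rs \<Longrightarrow> r \<le> z" using d by auto
  have step: "bit_ops (?f p acc) \<le> z ^ 11 \<and> ?I (Suc i) (val (?f p acc))"
    if p: "p \<in> set \<mu>" and i: "i < length \<mu>" and I: "?I i acc" for i p acc
  proof -
    obtain a m where am: "p = (a, m)" by (cases p)
    have lt: "a < z" "m < z" using el[of a m] p am by auto
    let ?R = "mapC (?row a m) ?rs"
    have b: "bits ((a, r), m') \<le> z ^ 4" if "r \<le> z" "m' \<le> z" for r m'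
      using bits_pair_small[of a r] lt that le_pow[OF bits_small[of m'], of 3] by (intro absorb[of _ 3]) auto
    have o1: "bit_ops ?R \<le> z ^ 10"
    proof (rule mapC_le[where t = 7 and k = 4 and l = 1])
      fix r assume r: "r \<in> set ?rs"
      have rd: "bits r \<le> z ^ 2" "bits d \<le> z ^ 2" using rs(2)[OF r] d by (auto intro!: bits_small)
      show "bits r \<le> z ^ 4" by (rule le_pow[OF rd(1)]) simp
      have "bit_ops (eqC r d) \<le> z ^ 6" by (rule eqC_le[OF rd]) simp
      moreover have "bit_ops (ret ((a, r), m)) \<le> z ^ 6" "bit_ops (ret ((a, r), 0 :: nat)) \<le> z ^ 6"
        by (rule ret_le[OF b[OF rs(2)[OF r]]], use lt in simp, simp, rule ret_le[OF b[OF rs(2)[OF r]]], simp, simp)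
      ultimately show "bit_ops (?row a m r) \<le> z ^ 7" by (intro absorb[of _ 6]) (auto simp del: ret_sel(2))
      show "bits (val (?row a m r)) \<le> z ^ 4" using b[OF rs(2)[OF r]] lt by (auto simp del: bits_pair)
    qed (use rs in auto)
    have lR: "length (val ?R) \<le> z" using d by simp
    have eR: "bits x \<le> z ^ 4" if x: "x \<in> set (val ?R)" for x
    proof -
      obtain r where r: "r \<in> set ?rs" "x = val (?row a m r)" using x by (auto simp del: val_if bind_cost_sel val_eqC)
      then show ?thesis using b[OF rs(2)[OF r(1)]] lt by (auto simp del: bits_pair)
    qed
    have bR: "bits (val ?R) \<le> z ^ 7" by (rule list_le[of _ 4 1]) (use eR lR in auto)
    have bacc: "bits acc \<le> z ^ 7" using S[of i acc] i I by simp
    have o2: "bit_ops (appC acc (val ?R)) \<le> z ^ 10" by (rule appC_le[OF bacc bR]) simp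
    have "bit_ops (?f p acc) \<le> z ^ 11"
      unfolding am prod.case bind_cost_sel using o1 o2 by (intro absorb[of _ 10]) linarith+
    moreover have "val (?f p acc) = acc @ val ?R" unfolding am prod.case bind_cost_sel val_appC ..
    then have "?I (Suc i) (val (?f p acc))" using I lR eR by (auto simp del: val_mapC)
    ultimately show ?thesis by blast
  qed
  have el': "bits p \<le> z ^ 3" if "p \<in> set \<mu>" for p using el[of "fst p" "snd p"] that by simp
  have "bit_ops (foldC ?f \<mu> []) \<le> z ^ 13"
    by (rule foldC_le(1)[where I = ?I and t = 11 and S = 7 and k = 3 and l = 1, OF step S])
      (use el' len in auto)
  moreover have "bit_ops (countC 1 d) \<le> z ^ 13" by (rule le_pow[OF countC_le]) (use d in auto)
  ultimately show ?thesis unfolding initC_def bind_cost_sel val_countC by (intro absorb[of _ 13]) linarith+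
qed

end

end

text \<open>Partitions of \<open>n\<close> are counted by the states for \<open>d = 1\<close>, and
  those are among the states for every larger \<open>d\<close>. So the number of partitions is
  bounded by \<open>z\<close> as well.\<close>

lemma card_partitions_le:
  assumes "d \<ge> 1"
  shows "num_le [1..<Suc n] n \<le> card (states d n)"
proof -
  have "map fst (List.product xs [1 :: nat]) = xs" for xs :: "nat list" by (induction xs) auto
  then have "map fst (table_keys 1 n) = [1..<Suc n]" by (simp add: table_keys_def)
  then have "num_le [1..<Suc n] n = card (states 1 n)" using card_states(2)[of 1 n] by simp
  also have "\<dots> \<le> card (states d n)"
  proof (rule card_mono[OF card_states(1)], rule subsetI)
    fix H assume "H \<in> states 1 n"
    then have H: "normalized 1 H" "state_size H \<le> n" by (auto simp: states_def)
    from H(1) have "normalized d H" unfolding normalized_def using assms le_trans by blast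
    then show "H \<in> states d n" using H(2) by (simp add: states_def)
  qed
  finally show ?thesis .
qed

section \<open>The total cost\<close>

context table_base
begin

text \<open>The cache starts empty and ends with at most \<open>z\<close> entries, so over the whole
  run the potential amounts to at most \<open>z * fresh_cost\<close>. Each of the at most
  \<open>z\<close> partitions adds only a power of \<open>z\<close> whose exponent does not depend
  on \<open>d\<close>.\<close>

theorem regular_countC_le:
  assumes d: "d \<ge> 1"
  shows "bit_ops (regular_countC d n) \<le> z ^ (5 * d + 43)"
proof -
  let ?as = "[1..<Suc n]"
  let ?P = "val (partitionsC ?as n)"
  have n: "n < z" "Suc n < z" "d + 1 \<le> z" using n_less by auto
  have W: "num_le ?as n \<le> z" by (rule le_trans[OF card_partitions_le[OF d] states_le])
  have as: "0 < a \<and> a < z" if "a \<in> set ?as" for a using that n by auto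
  have las: "length ?as < z" using n by simp
  have pe: "bits \<mu> \<le> z ^ 5" "length \<mu> \<le> z" "\<And>a m. (a, m) \<in> set \<mu> \<Longrightarrow> a < z \<and> m < z \<and> bits (a, m) \<le> z ^ 3"
    if "\<mu> \<in> set ?P" for \<mu>
    by (rule partitionsC_elem[OF that as las n(1)]; assumption)+
  let ?step = "partition_step d (fact n) (Suc n)"
  let ?I = "\<lambda>i (s :: nat \<times> cache). valid_cache d n (snd s) \<and> bits (fst s) \<le> 3 + i * z ^ 6"
  let ?\<phi> = "\<lambda>s :: nat \<times> cache. fresh_cost * length (snd s)"
  have lP: "length ?P \<le> z" by (rule le_trans[OF length_partitionsC W])
  have acc: "bits x \<le> z ^ 8" if "i \<le> length ?P" "bits x \<le> 3 + i * z ^ 6" for i and x :: nat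
  proof -
    have "i * z ^ 6 \<le> z ^ 7" by (rule mult_pow[of _ 1 _ 6]) (use that(1) lP in auto)
    then show ?thesis using that(2) pow_pos[of 7] by (intro absorb[of _ 7]) linarith+
  qed
  have S: "bits s \<le> z ^ 10" if "i \<le> length ?P" "?I i s" for i and s :: "nat \<times> cache"
    using acc[of i "fst s"] valid_cache_bits(3)[of "snd s"] le_pow[of "bits (fst s)" 8 9] that bits_pair[of "fst s" "snd s"]
    by (intro absorb[of _ 9]) auto
  have nf: "bits (fact n :: nat) \<le> z ^ 4" by (rule factC_le(2)[OF n(1)])
  have step: "bit_ops (?step \<mu> s) + ?\<phi> s \<le> z ^ 19 + ?\<phi> (val (?step \<mu> s)) \<and> ?I (Suc i) (val (?step \<mu> s))"
    if \<mu>: "\<mu> \<in> set ?P" and i: "i < length ?P" and I: "?I i s" for i \<mu> s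
  proof -
    obtain ac C where s: "s = (ac, C)" by (cases s)
    have C: "valid_cache d n C" "bits ac \<le> 3 + i * z ^ 6" using I s by auto
    let ?T = "val (initC d \<mu>)" and ?q = "fact n div val (zC \<mu>)"
    note sz = size_initC[OF d \<mu>]
    have sz': "state_size (state_of ?T) < Suc n" "state_size (state_of ?T) \<le> n" using sz(2) by auto
    note cor = phiC_correct[OF sz(1) sz' C(1)] and ph_le = phiC_le[OF sz(1) sz' C(1) n(2)]
    let ?v = "Phi d (state_of ?T)"
    obtain C' where ph: "val (phiC (Suc n) ?T C) = (?v, C')" using cor by (metis prod.collapse)
    have C': "valid_cache d n C'" using cor ph by (simp add: cache_step_def)
    have zc: "bit_ops (zC \<mu>) \<le> z ^ 18" "bits (val (zC \<mu>)) \<le> z ^ 7"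
      by (rule zC_le[OF pe(2)[OF \<mu>] pe(3)[OF \<mu>]]; assumption)+
    have ic: "bit_ops (initC d \<mu>) \<le> z ^ 14" by (rule initC_le[OF pe(2)[OF \<mu>] pe(3)[OF \<mu>] n(3)])
    have q: "bits ?q \<le> z ^ 4" by (rule le_trans[OF bits_nat_mono nf]) (rule div_le_dividend)
    have v: "bits ?v \<le> z ^ 4" by (rule le_pow[OF Phi_bits[OF sz(1) sz'(2)]]) simp
    have qv: "bits (?q * ?v) \<le> z ^ 5" using bits_nat_mult[of ?q ?v] q v by (intro absorb[of _ 4]) auto
    have vt: "val (?step \<mu> s) = (ac + ?q * ?v, C')" by (simp add: s val_partition_step ph)
    have I': "?I (Suc i) (val (?step \<mu> s))"
      unfolding vt using C' C(2) qv bits_nat_add[of ac "?q * ?v"] le_pow[OF qv, of 6] by simp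
    have ac: "bits ac \<le> z ^ 8" using acc[of i ac] i C(2) by simp
    have o1: "bit_ops (divC (fact n) (val (zC \<mu>))) \<le> z ^ 18" by (rule ops_le[OF le_pow[OF nf] zc(2)]) simp_all
    have o2: "bit_ops (mulC ?q ?v) \<le> z ^ 18" by (rule ops_le[OF q v]) simp
    have o3: "bit_ops (addC ac (?q * ?v)) \<le> z ^ 18" by (rule ops_le[OF ac le_pow[OF qv]]) simp_all
    have "bits (ac + ?q * ?v, C') \<le> z ^ 10" using S[of "Suc i", OF _ I'] i vt by simp
    then have o4: "bit_ops (ret (ac + ?q * ?v, C')) \<le> z ^ 18" by (rule ret_le) simp
    have o5: "bit_ops (initC d \<mu>) \<le> z ^ 18" by (rule le_pow[OF ic]) simp
    have o6: "z ^ 15 \<le> z ^ 18" by (rule le_pow[OF order_refl]) simp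
    have "bit_ops (zC \<mu>) + bit_ops (divC (fact n) (val (zC \<mu>))) + bit_ops (initC d \<mu>) + z ^ 15 + bit_ops (mulC ?q ?v) +
        bit_ops (addC ac (?q * ?v)) + bit_ops (ret (ac + ?q * ?v, C')) \<le> z ^ 19"
      using zc(1) o1 o2 o3 o4 o5 o6 by (intro absorb[of _ 18]) linarith+
    moreover have "bit_ops (?step \<mu> s) = bit_ops (zC \<mu>) + (bit_ops (divC (fact n) (val (zC \<mu>))) + (bit_ops (initC d \<mu>) +
        (bit_ops (phiC (Suc n) ?T C) + (bit_ops (mulC ?q ?v) + (bit_ops (addC ac (?q * ?v)) + bit_ops (ret (ac + ?q * ?v, C')))))))"
      unfolding partition_step_def s prod.case bind_cost_sel val_arith ph ..
    ultimately have "bit_ops (?step \<mu> s) + fresh_cost * length C \<le> z ^ 19 + fresh_cost * length C'"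
      using ph_le unfolding ph snd_conv by linarith
    then show ?thesis using I' unfolding vt unfolding s by simp
  qed
  let ?N = "length ?P" and ?fold = "foldC ?step ?P (0, [])"
  have "bit_ops ?fold + ?\<phi> (0, []) \<le> (\<Sum>x\<leftarrow>?P. z ^ 19) + ?N * (3 + 2 * (?N * (1 + z ^ 5))) + (1 + 2 * z ^ 10) + ?\<phi> (val ?fold) \<and> ?I ?N (val ?fold)"
  proof (rule bit_ops_foldC_potential[where I = ?I, OF step S])
    show "?I 0 (0, [])" using bits_one by (simp add: valid_cache_def)
  qed (use pe(1) in auto)
  then have fold: "bit_ops ?fold \<le> ?N * z ^ 19 + ?N * (3 + 2 * (?N * (1 + z ^ 5))) + (1 + 2 * z ^ 10) + fresh_cost * length (snd (val ?fold))"
    and I: "?I ?N (val ?fold)"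
    by (simp_all only: sum_list_triv of_nat_id snd_conv list.size mult_0_right add_0_right)
  let ?e = "5 * d + 42"
  have f1: "?N * z ^ 19 \<le> z ^ ?e" by (rule mult_pow[of _ 1 _ 19]) (use lP in auto)
  have f2: "?N * (3 + 2 * (?N * (1 + z ^ 5))) \<le> z ^ ?e"
  proof (rule mult_pow[of _ 1 _ 8])
    have "?N * (1 + z ^ 5) \<le> z ^ 7"
      by (rule mult_pow[of _ 1 _ 6]) (use lP pow_pos[of 5] in \<open>auto intro!: absorb[of _ 5]\<close>)
    then show "3 + 2 * (?N * (1 + z ^ 5)) \<le> z ^ 8"
      using pow_pos[of 7] by (intro absorb[of _ 7]) linarith+
  qed (use lP in auto)
  have f3: "1 + 2 * z ^ 10 \<le> z ^ ?e" by (rule absorb[of _ 10]) (use pow_pos[of 10] in auto)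
  have f4: "fresh_cost * length (snd (val ?fold)) \<le> z ^ ?e"
    unfolding fresh_cost_def
    by (rule mult_pow[of _ "5 * d + 41" _ 1]) (use valid_cache_bits(1)[OF conjunct1[OF I]] in auto)
  have ca: "val (countC 1 n) = ?as" "val (addC n 1) = Suc n" by simp_all
  have g1: "bit_ops (countC 1 n) \<le> z ^ ?e" by (rule le_pow[OF countC_le]) (use n in auto)
  have "bit_ops (partitionsC ?as n) \<le> (length ?as + 1) * (num_le ?as n * z ^ 12)"
    by (rule partitionsC_le[OF as las n(1) W])
  also have "\<dots> \<le> z ^ ?e"
  proof (rule mult_pow[of _ 1 _ 13])
    show "num_le ?as n * z ^ 12 \<le> z ^ 13" by (rule mult_pow[of _ 1 _ 12]) (use W in auto)
  qed (use n in auto)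
  finally have g2: "bit_ops (partitionsC ?as n) \<le> z ^ ?e" .
  have g3: "bit_ops (factC n) \<le> z ^ ?e" by (rule le_pow[OF factC_le(1)[OF n(1)]]) simp
  have g4: "bit_ops (addC n 1) \<le> z ^ ?e" by (rule ops_le[of _ 2]) (use n in \<open>auto intro!: bits_small\<close>)
  obtain U C where UC: "val ?fold = (U, C)" by (cases "val ?fold")
  have U: "bits U \<le> z ^ 8" and C: "bits C \<le> z ^ 9"
    using acc[OF order_refl, of U] valid_cache_bits(3)[of C] I unfolding UC by auto
  have g5: "bit_ops (divC U (fact n)) \<le> z ^ ?e" by (rule ops_le[OF U le_pow[OF nf]]) simp_all
  have "bits (U div fact n) \<le> z ^ 8" by (rule le_trans[OF bits_nat_mono U]) (rule div_le_dividend)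
  then have "bits (U div fact n, C) \<le> z ^ 10"
    using C le_pow[of "bits (U div fact n)" 8 9] by (intro absorb[of _ 9]) auto
  then have g6: "bit_ops (ret (U div fact n, C)) \<le> z ^ ?e" by (rule ret_le) simp
  have "bit_ops (regular_countC d n) = bit_ops (countC 1 n) + (bit_ops (partitionsC ?as n) + (bit_ops (factC n) +
      (bit_ops (addC n 1) + (bit_ops ?fold + (bit_ops (divC U (fact n)) + bit_ops (ret (U div fact n, C)))))))"
    unfolding regular_countC_alt bind_cost_sel ca val_factC UC prod.case val_arith(4) ..
  then have "bit_ops (regular_countC d n) \<le> 100 * z ^ ?e"
    using fold f1 f2 f3 f4 g1 g2 g3 g4 g5 g6 by linarith
  then show ?thesis by (rule absorb) simp
qed

end

lemma regular_countC_exp: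
  assumes d: "d \<ge> 1"
  obtains c :: real where "\<And>n. n \<ge> 1 \<Longrightarrow> real (bit_ops (regular_countC d n)) \<le> exp (c * sqrt (real n))"
proof
  fix n :: nat assume n: "n \<ge> 1"
  let ?s = "sqrt (real n)" and ?k = "real d + 100" and ?p = "pi * sqrt (2 * real d / 3)"
  \<comment> \<open>The three summands of \<open>?M\<close> dominate the three summands of
    \<open>z\<close>: \<open>n\<close> is at most \<open>exp (2 * ?s)\<close>, the constant
    \<open>?k\<close> at most \<open>exp ?k\<close>, and the number of states at most
    \<open>exp (?p * ?s)\<close>.\<close>
  let ?M = "2 + ?k + ?p"
  \<comment> \<open>The summand \<open>d + 100\<close> yields both \<open>z \<ge> 100\<close> and
    \<open>n + d + 1 < z\<close>.\<close>
  define z where "z = n + (d + 100) + card (states d n)"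
  interpret table_base z d n by unfold_locales (auto simp: z_def)
  have s: "?s \<ge> 1" using n by simp
  have p: "0 \<le> ?p" by simp
  have "real n = ?s ^ 2" by simp
  also have "\<dots> \<le> exp ?s ^ 2" using exp_ge_add_one_self[of ?s] s by (intro power_mono) linarith+
  also have "\<dots> = exp (2 * ?s)" by (simp add: exp_double)
  also have "\<dots> \<le> exp (?M * ?s)" unfolding exp_le_cancel_iff using s p by (intro mult_right_mono) auto
  finally have 1: "real n \<le> exp (?M * ?s)" .
  have "?k \<le> exp ?k" using exp_ge_add_one_self[of ?k] by linarith
  also have "\<dots> \<le> exp (?M * ?s)"
    unfolding exp_le_cancel_iff using mult_mono[of ?k ?M 1 ?s] s p by simp
  finally have 2: "?k \<le> exp (?M * ?s)" .
  have "real (card (states d n)) \<le> exp (pi * sqrt (2 * real d * real n / 3))" by (rule card_states_le[OF d n])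
  also have "pi * sqrt (2 * real d * real n / 3) = ?p * ?s" by (simp add: real_sqrt_mult real_sqrt_divide)
  also have "exp (?p * ?s) \<le> exp (?M * ?s)" unfolding exp_le_cancel_iff using s by (intro mult_right_mono) auto
  finally have 3: "real (card (states d n)) \<le> exp (?M * ?s)" .
  have "real z \<le> 3 * exp (?M * ?s)" using 1 2 3 by (simp add: z_def)
  \<comment> \<open>The factor 3 is absorbed because \<open>?s\<close> is at least 1 and
    \<open>exp (2 * ?s)\<close> is at least \<open>1 + 2 * ?s\<close>.\<close>
  also have "\<dots> \<le> exp (2 * ?s) * exp (?M * ?s)"
    by (rule mult_right_mono) (use exp_ge_add_one_self[of "2 * ?s"] s in linarith, simp)
  also have "\<dots> = exp ((?M + 2) * ?s)" by (simp add: exp_add[symmetric] algebra_simps)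
  finally have z: "real z \<le> exp ((?M + 2) * ?s)" .
  have "real (bit_ops (regular_countC d n)) \<le> real (z ^ (5 * d + 43))"
    using regular_countC_le[OF d] by (rule of_nat_mono)
  also have "\<dots> = real z ^ (5 * d + 43)" by simp
  also have "\<dots> \<le> exp ((?M + 2) * ?s) ^ (5 * d + 43)" using z by (rule power_mono) simp
  also have "\<dots> = exp ((real (5 * d + 43) * (?M + 2)) * ?s)" by (simp only: exp_of_nat_mult[symmetric] mult.assoc)
  finally show "real (bit_ops (regular_countC d n)) \<le> exp ((real (5 * d + 43) * (?M + 2)) * ?s)" .
qed

theorem theorem5p3:
  fixes d :: nat
  assumes "d \<ge> 1"
  shows "(\<forall>n. fst (val (regular_countC d n)) = num_regular d n)
    \<and> (\<exists>c :: real. \<forall>n\<ge>1.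
          real (bit_ops (regular_countC d n)) \<le> exp (c * sqrt (real n))
        \<and> real (storage (regular_countC d n)) \<le> exp (c * sqrt (real n)))
    \<and> (\<forall>n\<ge>1. \<forall>cache. cache = snd (val (regular_countC d n)) \<longrightarrow>
          (\<forall>(T, v) \<in> set cache. state_of T \<in> states d n \<and> v = Phi d (state_of T))
        \<and> length cache \<le> card (states d n)
        \<and> real (card (states d n)) =
            (\<Sum>m=0..n. fps_nth (\<Prod>a. inverse ((1 - fps_X ^ Suc a) ^ d) :: real fps) m)
        \<and> real (card (states d n)) \<le> exp (pi * sqrt (2 * real d * real n / 3)))"
proof (intro conjI allI impI)
  show "fst (val (regular_countC d n)) = num_regular d n" for n
    by (rule regular_countC_correct(1)[OF assms])
  obtain c :: real where c: "\<And>n. n \<ge> 1 \<Longrightarrow> real (bit_ops (regular_countC d n)) \<le> exp (c * sqrt (real n))"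
    using regular_countC_exp[OF assms] by blast
  have "real (storage (regular_countC d n)) \<le> exp (c * sqrt (real n))" if "n \<ge> 1" for n
    using c[OF that] of_nat_mono[OF storage_le_regular_countC[of d n], where 'a = real] by linarith
  then show "\<exists>c :: real. \<forall>n\<ge>1. real (bit_ops (regular_countC d n)) \<le> exp (c * sqrt (real n))
      \<and> real (storage (regular_countC d n)) \<le> exp (c * sqrt (real n))"
    using c by blast
next
  fix n :: nat and cache
  assume n: "n \<ge> 1" and cache: "cache = snd (val (regular_countC d n))"
  have "valid_cache d n cache" unfolding cache by (rule regular_countC_correct(2)[OF assms])
  note vc = valid_cache_states[OF this]
  show "\<forall>(T, v) \<in> set cache. state_of T \<in> states d n \<and> v = Phi d (state_of T)" by (rule vc(1))
  show "length cache \<le> card (states d n)" by (rule vc(2))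
  show "real (card (states d n)) =
      (\<Sum>m=0..n. fps_nth (\<Prod>a. inverse ((1 - fps_X ^ Suc a) ^ d) :: real fps) m)"
    by (rule card_states_fps)
  show "real (card (states d n)) \<le> exp (pi * sqrt (2 * real d * real n / 3))"
    by (rule card_states_le[OF assms n])
qed

end
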